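(* Let $D\subset \mathbb{C}_\tau$ be a domain, let $V\subset\mathbb{R}^n_x$ be a bounded convex domain, and let $V+i\mathbb{R}^n=\{z=x+iy\in\mathbb{C}^n : x\in V\}$ be the associated tube domain. Let $\varphi(\tau,z)$ be a plurisubharmonic function on $D\times (V+i\mathbb{R}^n)$ which is independent of $y=\operatorname{Im}(z)$; write $\varphi(\tau,x)$ for its value at $(\tau, x+iy)$. Then for any point $a\in D$ and any $r>0$ such that $\int_V e^{-\varphi(a,x)}\,d\lambda(x)<+\infty$ and $\Delta(a;r)=\{\tau\in\mathbb{C}: |\tau-a|<r\}\subset D$, there exists a holomorphic function $f$ on $\Delta(a;r)$ with $f(a)=1$ and $$\int_{\Delta(a;r)\times V}|f(\tau)|^2 e^{-\varphi(\tau,x)}\,d\lambda(\tau,x)\le \pi r^2\int_V e^{-\varphi(a,x)}\,d\lambda(x).$$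
   Context: $\lambda$ denotes Lebesgue measure (on $\mathbb{C}\cong\mathbb{R}^2$, on $\mathbb{R}^n$, and on products thereof). Plurisubharmonic functions take values in $\mathbb{R}\cup\{-\infty\}$. *)

theory Defs
  imports "HOL-Analysis.Analysis"
begin

definition cline :: "complex \<times> (complex^'n) \<Rightarrow> complex \<times> (complex^'n) \<Rightarrow> complex \<Rightarrow> complex \<times> (complex^'n)" where
  "cline p w \<zeta> = (fst p + \<zeta> * fst w, \<chi> i. snd p $ i + \<zeta> * snd w $ i)"

definition usc_on :: "'a::topological_space set \<Rightarrow> ('a \<Rightarrow> ereal) \<Rightarrow> bool" where
  "usc_on S u \<longleftrightarrow> (\<forall>x\<in>S. \<forall>c. u x < c \<longrightarrow> (\<forall>\<^sub>F y in at x within S. u y < c))"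

text \<open>Mean value of \<open>u\<close> over the circle \<open>\<theta> \<mapsto> p + e^{i\<theta>} w\<close>, with the usual convention
  for functions bounded above: it is \<open>-\<infinity>\<close> unless \<open>u\<close> is a.e. finite and integrable on the circle.\<close>
definition circle_mean :: "(complex \<times> (complex^'n) \<Rightarrow> ereal) \<Rightarrow> complex \<times> (complex^'n) \<Rightarrow> complex \<times> (complex^'n) \<Rightarrow> ereal" where
  "circle_mean u p w =
    (if (AE \<theta> in lborel. \<theta> \<in> {0..2*pi} \<longrightarrow> u (cline p w (cis \<theta>)) \<noteq> -\<infinity>) \<and>
        set_integrable lborel {0..2*pi} (\<lambda>\<theta>. real_of_ereal (u (cline p w (cis \<theta>))))
     then ereal (1/(2*pi) * (LINT \<theta>:{0..2*pi}|lborel. real_of_ereal (u (cline p w (cis \<theta>)))))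
     else -\<infinity>)"

definition psh_on :: "(complex \<times> (complex^'n)) set \<Rightarrow> (complex \<times> (complex^'n) \<Rightarrow> ereal) \<Rightarrow> bool" where
  "psh_on \<Omega> u \<longleftrightarrow> open \<Omega> \<and> (\<forall>x\<in>\<Omega>. u x \<noteq> \<infinity>) \<and> usc_on \<Omega> u \<and>
     (\<forall>p w. (\<forall>\<zeta>. cmod \<zeta> \<le> 1 \<longrightarrow> cline p w \<zeta> \<in> \<Omega>) \<longrightarrow> u p \<le> circle_mean u p w)"

definition tube :: "(real^'n) set \<Rightarrow> (complex^'n) set" where
  "tube V = {z. (\<chi> i. Re (z $ i)) \<in> V}"

definition cvec :: "real^'n \<Rightarrow> complex^'n" where
  "cvec x = (\<chi> i. complex_of_real (x $ i))"

definition expneg :: "ereal \<Rightarrow> ennreal" where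
  "expneg t = (if t = -\<infinity> then \<infinity> else ennreal (exp (- real_of_ereal t)))"

end

theory Submission
  imports Defs "HOL-Complex_Analysis.Complex_Analysis"
begin

unbundle no fps_syntax

text \<open>For a continuous weight \<open>\<psi>(\<tau>, x)\<close> satisfying the sub-mean value inequality along all continuous
  circles \<open>\<zeta> \<mapsto> (\<tau> + \<rho> \<zeta>, X \<zeta>)\<close>, the function \<open>- log \<integral> e^{-\<psi>(\<tau>, x)} dx\<close> is again subharmonic: integrate out one
  coordinate at a time, transporting the conditional law at the centre of the circle to those on the circle by
  quantile maps whose mean is the identity, and use the inequality of arithmetic and geometric means. So the
  claim for \<open>\<psi>\<close> reduces to the sharp one-dimensional extension theorem on the disc for a continuous
  subharmonic weight, which follows by duality from a weighted d-bar inequality of Donnelly-Fefferman type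
  and mollification. A tube-invariant plurisubharmonic \<open>\<phi>\<close> is approximated by such weights: glue \<open>\<phi>\<close> with a steep
  multiple of the distance to a compact convex subset of \<open>V\<close> and convolve with a radial kernel. The
  extensions for the approximating weights converge along a subsequence by Montel's theorem, and Fatou's lemma
  gives the estimate.\<close>

section \<open>Translations and weak Wirtinger calculus\<close>

text \<open>Weights that depend only on Re z satisfy the sub-mean value inequality along every
  continuous circle of real points, because on the unit circle each continuous real function is a
  uniform limit of real parts of entire functions. Transport needs exactly this freedom: quantile
  maps depend on the point of the circle merely continuously. Integrating one coordinate at a time
  needs rectangular fibres, so the weights live on all of R^n and are integrated over a box; the
  cone makes the part of the box away from a compact subset of V negligible. The sharp constant
  comes from the multiplier c (c |z|^2 - 1 - ln (c |z|^2)) with c = 1 / R^2. Its logarithmic pole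
  produces a point mass at the origin, and its shape turns the remaining terms into a perfect
  square. Duality rests on one formula: if d-bar \<gamma> = z g with \<gamma> of compact support,
  then a holomorphic F has integral of F g equal to - pi F(0) \<gamma>(0). Hence F with F(0) = 1 is
  the Riesz representer of g -> - pi \<gamma>(0), and a bound for that functional is a bound for
  F.\<close>

lemma nn_integral_lborel_shift:
  fixes f :: "'a::euclidean_space \<Rightarrow> ennreal"
  assumes [measurable]: "f \<in> borel_measurable borel"
  shows "(\<integral>\<^sup>+x. f (c + x) \<partial>lborel) = (\<integral>\<^sup>+x. f x \<partial>lborel)"
proof -
  have "(\<integral>\<^sup>+x. f x \<partial>lborel) = (\<integral>\<^sup>+x. f x \<partial>distr lborel borel ((+) c))"
    by (simp add: lborel_distr_plus)
  also have "\<dots> = (\<integral>\<^sup>+x. f (c + x) \<partial>lborel)"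
    by (rule nn_integral_distr) auto
  finally show ?thesis by simp
qed

lemma nn_integral_lborel_reflect:
  fixes f :: "'a::euclidean_space \<Rightarrow> ennreal"
  assumes [measurable]: "f \<in> borel_measurable borel"
  shows "(\<integral>\<^sup>+x. f (c - x) \<partial>lborel) = (\<integral>\<^sup>+x. f x \<partial>lborel)"
proof -
  have "(\<integral>\<^sup>+x. f x \<partial>lborel) = (\<integral>\<^sup>+x. f x \<partial>distr lborel borel (\<lambda>x. c + (-1) *\<^sub>R x))"
    by (subst lborel_affine[of "-1" c]) (auto simp: density_1)
  also have "\<dots> = (\<integral>\<^sup>+x. f (c - x) \<partial>lborel)"
    by (subst nn_integral_distr) auto
  finally show ?thesis by simp
qed

lemma integral_lborel_shift:
  fixes f :: "'a::euclidean_space \<Rightarrow> 'b::{banach, second_countable_topology}"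
  assumes [measurable]: "f \<in> borel_measurable borel"
  shows "(\<integral>x. f (c + x) \<partial>lborel) = (\<integral>x. f x \<partial>lborel)"
proof -
  have "(\<integral>x. f x \<partial>lborel) = (\<integral>x. f x \<partial>distr lborel borel ((+) c))"
    by (simp add: lborel_distr_plus)
  also have "\<dots> = (\<integral>x. f (c + x) \<partial>lborel)"
    by (rule integral_distr) auto
  finally show ?thesis by simp
qed

lemma integral_lborel_reflect:
  fixes f :: "'a::euclidean_space \<Rightarrow> 'b::{banach, second_countable_topology}"
  assumes [measurable]: "f \<in> borel_measurable borel"
  shows "(\<integral>x. f (c - x) \<partial>lborel) = (\<integral>x. f x \<partial>lborel)"
proof -
  have "(\<integral>x. f x \<partial>lborel) = (\<integral>x. f x \<partial>distr lborel borel (\<lambda>x. c + (-1) *\<^sub>R x))"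
    by (subst lborel_affine[of "-1" c]) (auto simp: density_1)
  also have "\<dots> = (\<integral>x. f (c - x) \<partial>lborel)"
    by (subst integral_distr) auto
  finally show ?thesis by simp
qed

lemma integrable_lborel_shift:
  fixes f :: "'a::euclidean_space \<Rightarrow> 'b::{banach, second_countable_topology}"
  assumes f: "integrable lborel f"
  shows "integrable lborel (\<lambda>x. f (c + x))"
proof -
  have [measurable]: "f \<in> borel_measurable borel" using f by auto
  have "integrable (distr lborel borel ((+) c)) f"
    using f by (simp add: lborel_distr_plus)
  then show ?thesis by (subst (asm) integrable_distr_eq) auto
qed

lemma continuous_imp_borel [measurable_dest]:
  fixes f :: "'a::topological_space \<Rightarrow> 'b::topological_space"
  shows "continuous_on UNIV f \<Longrightarrow> f \<in> borel_measurable borel"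
  by (rule borel_measurable_continuous_onI)

section \<open>Compactly supported functions and integrals of their derivatives\<close>

lemma integrable_compact_support:
  fixes f :: "'a::euclidean_space \<Rightarrow> 'b::{banach, second_countable_topology}"
  assumes "continuous_on UNIV f" "\<And>x. x \<notin> cball 0 R \<Longrightarrow> f x = 0"
  shows "integrable lborel f"
proof -
  have "integrable lborel (\<lambda>x. indicator (cball 0 R) x *\<^sub>R f x)"
    by (rule borel_integrable_compact) (auto intro: continuous_on_subset assms)
  moreover have "(\<lambda>x. indicator (cball 0 R) x *\<^sub>R f x) = f"
    using assms(2) by (auto simp: indicator_def fun_eq_iff)
  ultimately show ?thesis by simp
qed

lemma compact_support_bounded:
  fixes f :: "'a::euclidean_space \<Rightarrow> 'b::real_normed_vector"
  assumes "continuous_on UNIV f" "\<And>x. x \<notin> cball 0 R \<Longrightarrow> f x = 0"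
  obtains B where "B > 0" "\<And>x. norm (f x) \<le> B"
proof -
  have "compact (f ` cball 0 R)"
    by (intro compact_continuous_image continuous_on_subset[OF assms(1)]) auto
  then obtain B where B: "B > 0" "\<And>y. y \<in> f ` cball 0 R \<Longrightarrow> norm y \<le> B"
    using compact_imp_bounded bounded_pos by metis
  then have "norm (f x) \<le> B" for x
    using assms(2)[of x] by (cases "x \<in> cball 0 R") auto
  with B show ?thesis using that by auto
qed

lemma segment_derivative_bound:
  fixes f :: "'a::real_normed_vector \<Rightarrow> 'b::real_normed_vector"
  assumes der: "\<And>x. (f has_derivative f' x) (at x)" and B: "\<And>x. norm (f' x h) \<le> B" and s: "s > 0"
  shows "norm (f (x + s *\<^sub>R h) - f x) \<le> B * s"
proof -
  have d: "((\<lambda>t. f (x + t *\<^sub>R h)) has_derivative (\<lambda>t. t *\<^sub>R f' (x + u *\<^sub>R h) h)) (at u within {0..s})" for u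
  proof -
    have "((\<lambda>t. f (x + t *\<^sub>R h)) has_derivative (\<lambda>t. f' (x + u *\<^sub>R h) (t *\<^sub>R h))) (at u within {0..s})"
      by (rule has_derivative_compose[OF _ der]) (auto intro!: derivative_eq_intros)
    moreover have "linear (f' (x + u *\<^sub>R h))"
      using der has_derivative_linear by blast
    ultimately show ?thesis by (simp add: linear_scale)
  qed
  have "norm ((\<lambda>t. f (x + t *\<^sub>R h)) s - (\<lambda>t. f (x + t *\<^sub>R h)) 0) \<le> B * norm (s - 0)"
  proof (rule differentiable_bound[of "{0..s}" _ "\<lambda>u t. t *\<^sub>R f' (x + u *\<^sub>R h) h"])
    show "onorm (\<lambda>t. t *\<^sub>R f' (x + u *\<^sub>R h) h) \<le> B" for u
      by (rule onorm_le) (use B[of "x + u *\<^sub>R h"] in \<open>simp add: mult.commute[of B] mult_left_mono\<close>)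
  qed (use d s in auto)
  then show ?thesis using s by simp
qed

text \<open>Translation invariance gives every difference quotient of \<open>f\<close> integral
  zero, and dominated convergence passes to the directional derivative. The argument uses neither
  coordinates nor iterated integrals.\<close>

lemma integral_derivative_compact_support:
  fixes f :: "'a::euclidean_space \<Rightarrow> 'b::{banach, second_countable_topology}"
  assumes der: "\<And>x. (f has_derivative f' x) (at x)"
    and cont: "continuous_on UNIV (\<lambda>x. f' x h)"
    and supp: "\<And>x. x \<notin> cball 0 R \<Longrightarrow> f x = 0"
  shows "(\<integral>x. f' x h \<partial>lborel) = 0"
proof -
  have cf: "continuous_on UNIV f"
    using der has_derivative_continuous_on[of UNIV f f'] by simp
  have [measurable]: "f \<in> borel_measurable borel" "(\<lambda>x. f' x h) \<in> borel_measurable borel"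
    using cf cont by auto
  have f'0: "f' x h = 0" if "x \<notin> cball 0 R" for x
  proof -
    have "((\<lambda>x. 0) has_derivative f' x) (at x)"
    proof (rule has_derivative_transform_within_open[OF der])
      show "open (- cball (0::'a) R)" by auto
    qed (use that supp in auto)
    moreover have "((\<lambda>x. 0) has_derivative (\<lambda>h. 0)) (at x)" by simp
    ultimately have "f' x = (\<lambda>h. 0)" by (rule has_derivative_unique)
    then show ?thesis by simp
  qed
  obtain B where B: "B > 0" "\<And>x. norm (f' x h) \<le> B"
    using compact_support_bounded[OF cont f'0] by blast
  \<comment> \<open>Step sizes at most 1 keep all difference quotients supported in the single ball
    \<open>cball 0 (R + norm h)\<close>, which carries the dominating function.\<close>
  define s where "s n = inverse (real (Suc n))" for n
  have s: "s n > 0" "s n \<le> 1" for n by (auto simp: s_def field_simps)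
  have s0: "s \<longlonglongrightarrow> 0" unfolding s_def by (rule LIMSEQ_inverse_real_of_nat)
  define d where "d n x = (f (x + s n *\<^sub>R h) - f x) /\<^sub>R s n" for n x
  have intf: "integrable lborel f" by (rule integrable_compact_support[OF cf supp])
  have sh: "integrable lborel (\<lambda>x. f (x + c))" "(\<integral>x. f (x + c) \<partial>lborel) = (\<integral>x. f x \<partial>lborel)" for c
    using integrable_lborel_shift[OF intf, of c] integral_lborel_shift[of f c] by (simp_all add: add.commute)
  have int0: "(\<integral>x. d n x \<partial>lborel) = 0" for n
    unfolding d_def using sh[of "s n *\<^sub>R h"] intf by simp
  have "(\<lambda>n. \<integral>x. d n x \<partial>lborel) \<longlonglongrightarrow> (\<integral>x. f' x h \<partial>lborel)"
  proof (rule integral_dominated_convergence[where w="\<lambda>x. B * indicator (cball 0 (R + norm h)) x"])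
    show "integrable lborel (\<lambda>x::'a. B * indicator (cball 0 (R + norm h)) x)"
      by (rule integrable_mult_right, rule integrable_real_indicator)
        (use emeasure_lborel_cball_finite[of "0::'a" "R + norm h"] in \<open>auto simp: less_top\<close>)
    show "AE x in lborel. (\<lambda>n. d n x) \<longlonglongrightarrow> f' x h"
    proof (rule AE_I2)
      fix x
      have "((\<lambda>t. f (x + t *\<^sub>R h)) has_derivative (\<lambda>t. f' (x + 0 *\<^sub>R h) (t *\<^sub>R h))) (at 0)"
        by (rule has_derivative_compose[OF _ der]) (auto intro!: derivative_eq_intros)
      moreover have "linear (f' x)" using der has_derivative_linear by blast
      ultimately have "((\<lambda>t. f (x + t *\<^sub>R h)) has_vector_derivative f' x h) (at 0)"
        by (simp add: has_vector_derivative_def linear_scale)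
      then have "(\<lambda>t. norm (f (x + t *\<^sub>R h) - f x - t *\<^sub>R f' x h) / norm t) \<midarrow>0\<rightarrow> 0"
        unfolding has_vector_derivative_def has_derivative_at by simp
      then have "(\<lambda>n. norm (f (x + s n *\<^sub>R h) - f x - s n *\<^sub>R f' x h) / norm (s n)) \<longlonglongrightarrow> 0"
        by (rule filterlim_compose) (use s s0 in \<open>auto simp: filterlim_at intro!: always_eventually less_imp_neq[symmetric]\<close>)
      moreover have "norm (f (x + s n *\<^sub>R h) - f x - s n *\<^sub>R f' x h) / norm (s n) = norm (d n x - f' x h)" for n
      proof -
        have "d n x - f' x h = (f (x + s n *\<^sub>R h) - f x - s n *\<^sub>R f' x h) /\<^sub>R s n"
          using s[of n] by (simp add: d_def scaleR_diff_right)
        then show ?thesis using s[of n] by (simp add: divide_inverse_commute)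
      qed
      ultimately show "(\<lambda>n. d n x) \<longlonglongrightarrow> f' x h"
        by (simp add: LIM_zero_iff tendsto_norm_zero_iff)
    qed
    show "AE x in lborel. norm (d n x) \<le> B * indicator (cball 0 (R + norm h)) x" for n
    proof (rule AE_I2)
      fix x
      show "norm (d n x) \<le> B * indicator (cball 0 (R + norm h)) x"
      proof (cases "x \<in> cball 0 (R + norm h)")
        case True
        have "norm (f (x + s n *\<^sub>R h) - f x) \<le> B * s n"
          by (rule segment_derivative_bound[OF der B(2) s(1)])
        moreover have "norm (d n x) = norm (f (x + s n *\<^sub>R h) - f x) / s n"
          using s[of n] by (simp add: d_def divide_inverse_commute)
        ultimately show ?thesis using True s[of n] by (simp add: pos_divide_le_eq)
      next
        case False
        have "norm x \<le> norm (x + s n *\<^sub>R h) + norm (s n *\<^sub>R h)"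
          using norm_triangle_ineq4[of "x + s n *\<^sub>R h" "s n *\<^sub>R h"] by simp
        moreover have "norm (s n *\<^sub>R h) \<le> norm h" using s[of n] by (simp add: mult_left_le_one_le)
        ultimately have "x + s n *\<^sub>R h \<notin> cball 0 R" using False by auto
        moreover have "x \<notin> cball 0 R" using False norm_ge_zero[of h] by (simp, linarith)
        ultimately show ?thesis using supp B(1) by (simp add: d_def)
      qed
    qed
  qed (auto simp: d_def)
  then show ?thesis using int0 by (simp add: LIMSEQ_const_iff)
qed

text \<open>\<open>p\<close> and \<open>q\<close> are the Wirtinger derivatives of \<open>f\<close>
  at \<open>z\<close>, with respect to z and its conjugate. They are read off from the real
  differential, so that the calculus of \<open>has_derivative\<close> applies.\<close>

definition wdv :: "(complex \<Rightarrow> complex) \<Rightarrow> complex \<Rightarrow> complex \<Rightarrow> complex \<Rightarrow> bool" where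
  "wdv f p q z \<longleftrightarrow> (f has_derivative (\<lambda>h. p * h + q * cnj h)) (at z)"

lemma wdv_unique:
  assumes "wdv f p q z" "wdv f p' q' z" shows "p = p'" "q = q'"
proof -
  have "(\<lambda>h. p * h + q * cnj h) = (\<lambda>h. p' * h + q' * cnj h)"
    using assms unfolding wdv_def by (rule has_derivative_unique)
  from fun_cong[OF this, of 1] fun_cong[OF this, of \<i>] show "p = p'" "q = q'"
    by (auto simp: algebra_simps complex_eq_iff)
qed

lemma wdv_const: "wdv (\<lambda>z. c) 0 0 z" by (simp add: wdv_def)
lemma wdv_ident: "wdv (\<lambda>z. z) 1 0 z" by (simp add: wdv_def)

lemma wdv_cnj: "wdv f p q z \<Longrightarrow> wdv (\<lambda>z. cnj (f z)) (cnj q) (cnj p) z"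
  unfolding wdv_def by (auto intro!: derivative_eq_intros simp: algebra_simps)

lemma wdv_add: "wdv f p q z \<Longrightarrow> wdv g p' q' z \<Longrightarrow> wdv (\<lambda>z. f z + g z) (p + p') (q + q') z"
  unfolding wdv_def by (auto intro!: derivative_eq_intros simp: algebra_simps)

lemma wdv_diff: "wdv f p q z \<Longrightarrow> wdv g p' q' z \<Longrightarrow> wdv (\<lambda>z. f z - g z) (p - p') (q - q') z"
  unfolding wdv_def by (auto intro!: derivative_eq_intros simp: algebra_simps)

lemma wdv_mult: "wdv f p q z \<Longrightarrow> wdv g p' q' z \<Longrightarrow>
    wdv (\<lambda>z. f z * g z) (p * g z + f z * p') (q * g z + f z * q') z"
  unfolding wdv_def by (auto intro!: derivative_eq_intros simp: algebra_simps)

lemma wdv_cong: "wdv f p q z \<Longrightarrow> p = p' \<Longrightarrow> q = q' \<Longrightarrow> wdv f p' q' z" by simp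

lemma wdv_local: "wdv f p q z \<Longrightarrow> open S \<Longrightarrow> z \<in> S \<Longrightarrow> (\<And>x. x \<in> S \<Longrightarrow> f x = g x) \<Longrightarrow> wdv g p q z"
  unfolding wdv_def by (rule has_derivative_transform_within_open)

text \<open>The differential of a real-valued function is real, so it may be fed into the real chain
  rule; composition then scales both Wirtinger derivatives by the same real number.\<close>

lemma wdv_real_compose:
  assumes u: "wdv (\<lambda>z. of_real (u z)) a b z" and g: "(g has_real_derivative g') (at (u z))"
  shows "wdv (\<lambda>z. of_real (g (u z))) (of_real g' * a) (of_real g' * b) z"
proof -
  have "((\<lambda>z. Re (of_real (u z))) has_derivative (\<lambda>h. Re (a * h + b * cnj h))) (at z)"
    using u unfolding wdv_def by (rule has_derivative_Re)
  then have u': "(u has_derivative (\<lambda>h. Re (a * h + b * cnj h))) (at z)" by simp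
  have im: "Im (a * h + b * cnj h) = 0" for h
  proof -
    have "((\<lambda>z. Im (of_real (u z))) has_derivative (\<lambda>h. Im (a * h + b * cnj h))) (at z)"
      using u unfolding wdv_def by (rule has_derivative_Im)
    then have "((\<lambda>z. 0) has_derivative (\<lambda>h. Im (a * h + b * cnj h))) (at z)" by simp
    then have "(\<lambda>h. Im (a * h + b * cnj h)) = (\<lambda>h. 0)"
      using has_derivative_unique has_derivative_const by blast
    then show ?thesis by metis
  qed
  have r: "of_real (Re (a * h + b * cnj h)) = a * h + b * cnj h" for h
    using im[of h] by (simp add: complex_eq_iff)
  have "((\<lambda>z. g (u z)) has_derivative (\<lambda>h. g' * Re (a * h + b * cnj h))) (at z)"
    using has_derivative_compose[OF u' g[unfolded has_field_derivative_def]] by simp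
  then have "((\<lambda>z. of_real (g (u z)) :: complex) has_derivative (\<lambda>h. of_real (g' * Re (a * h + b * cnj h)))) (at z)"
    by (rule has_derivative_of_real)
  moreover have "(\<lambda>h. of_real (g' * Re (a * h + b * cnj h))) = (\<lambda>h. of_real g' * a * h + of_real g' * b * cnj h)"
    unfolding of_real_mult r by (simp add: algebra_simps)
  ultimately show ?thesis unfolding wdv_def by simp
qed

lemma wdv_norm_sq: "wdv (\<lambda>z. of_real ((cmod z)\<^sup>2)) (cnj z) z z"
proof -
  have "wdv (\<lambda>z. z * cnj z) (1 * cnj z + z * cnj 0) (0 * cnj z + z * cnj 1) z"
    by (intro wdv_mult wdv_ident wdv_cnj)
  then show ?thesis by (simp add: complex_mult_cnj cmod_power2)
qed

lemma wdv_continuous: "(\<And>z. wdv f (p z) (q z) z) \<Longrightarrow> continuous_on UNIV f"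
  unfolding wdv_def by (rule has_derivative_continuous_on) auto

text \<open>Stokes' theorem for compact support. The directions 1 and i give two linear equations,
  which separate the two integrals.\<close>

lemma wdv_integral_zero:
  assumes der: "\<And>z. wdv f (p z) (q z) z" and cont: "continuous_on UNIV p" "continuous_on UNIV q"
    and supp: "\<And>z. z \<notin> cball 0 R \<Longrightarrow> f z = 0"
  shows "integrable lborel p" "integrable lborel q" "(\<integral>z. p z \<partial>lborel) = 0" "(\<integral>z. q z \<partial>lborel) = 0"
proof -
  have z: "p z = 0 \<and> q z = 0" if "z \<notin> cball 0 R" for z
  proof -
    have "wdv (\<lambda>z. 0) (p z) (q z) z"
      by (rule wdv_local[OF der, of "- cball 0 R"]) (use that supp in auto)
    then show ?thesis using wdv_unique[OF _ wdv_const] by blast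
  qed
  show i: "integrable lborel p" "integrable lborel q"
    by (intro integrable_compact_support[of _ R] cont; use z in auto)+
  have *: "(\<integral>z. p z * h + q z * cnj h \<partial>lborel) = 0" for h
    by (rule integral_derivative_compact_support[of f "\<lambda>z h. p z * h + q z * cnj h", OF der[unfolded wdv_def] _ supp])
      (auto intro!: continuous_intros cont)
  have "(\<integral>z. p z \<partial>lborel) * h + (\<integral>z. q z \<partial>lborel) * cnj h = 0" for h
    using *[of h] i by simp
  from this[of 1] this[of \<i>] show "(\<integral>z. p z \<partial>lborel) = 0" "(\<integral>z. q z \<partial>lborel) = 0"
    by (auto simp: algebra_simps complex_eq_iff)
qed

text \<open>A Bochner-Kodaira identity for the weight exp \<phi>, twisted by the multiplier
  \<open>H\<close> of |z|^2. Integrating total derivatives shows that the integral equals that of H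
  (|D|^2 + lap |\<beta>|^2) exp \<phi> with D = exp (-\<phi>) d(\<beta> exp \<phi>), and H >= 0 by
  ln x <= x - 1. Here \<open>lap\<close> is a quarter of the Laplacian. The parameter
  \<open>e\<close> regularises the logarithmic pole of H at the origin.\<close>

lemma twisted_basic_inequality:
  fixes \<phi> lap :: "complex \<Rightarrow> real" and p pp \<beta> \<beta>z \<beta>b \<beta>zz \<beta>zb \<beta>bb b :: "complex \<Rightarrow> complex"
  assumes \<phi>: "\<And>z. wdv (\<lambda>z. of_real (\<phi> z)) (p z) (cnj (p z)) z" "\<And>z. wdv p (pp z) (of_real (lap z)) z"
      "continuous_on UNIV pp" "continuous_on UNIV lap"
    and \<beta>: "\<And>z. wdv \<beta> (\<beta>z z) (\<beta>b z) z" "\<And>z. wdv \<beta>z (\<beta>zz z) (\<beta>zb z) z" "\<And>z. wdv \<beta>b (\<beta>zb z) (\<beta>bb z) z"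
      "continuous_on UNIV \<beta>zz" "continuous_on UNIV \<beta>zb" "continuous_on UNIV \<beta>bb"
    and supp: "\<And>z. z \<notin> cball 0 r \<Longrightarrow> \<beta> z = 0" "\<And>z. z \<notin> cball 0 r \<Longrightarrow> b z = 0"
    and lap: "\<And>z. z \<in> cball 0 r \<Longrightarrow> lap z \<ge> 0"
    and b: "\<And>z. \<beta>b z = z * b z" "continuous_on UNIV b"
    and c: "c > 0" and e: "e > 0"
  defines "Q \<equiv> \<lambda>z. (cmod z)\<^sup>2"
  defines "H \<equiv> \<lambda>q. c * (c * q - 1 + e - ln (c * q + e))"
  defines "H' \<equiv> \<lambda>q. c\<^sup>2 - c\<^sup>2 / (c * q + e)"
  shows "0 \<le> (\<integral>z. (H (Q z) * Q z * (cmod (b z))\<^sup>2 + (c\<^sup>2 - c\<^sup>2 * e / (c * Q z + e)\<^sup>2) * (cmod (\<beta> z))\<^sup>2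
      + 2 * (Q z * H' (Q z)) * Re (b z * cnj (\<beta> z))) * exp (\<phi> z) \<partial>lborel)"
proof -
  define H'' where "H'' = (\<lambda>q. c^3 / (c * q + e)\<^sup>2)"
  have Q0: "Q z \<ge> 0" for z by (simp add: Q_def)
  have pos: "c * Q z + e > 0" for z using Q0[of z] c e by (simp add: add_nonneg_pos)
  have cQ: "continuous_on UNIV Q" unfolding Q_def by (intro continuous_intros)
  have dH: "(H has_real_derivative H' (Q z)) (at (Q z))" for z
    unfolding H_def H'_def using pos[of z]
    by (auto intro!: derivative_eq_intros simp: field_simps power2_eq_square)
  have dH': "(H' has_real_derivative H'' (Q z)) (at (Q z))" for z
    unfolding H''_def H'_def using pos[of z]
    by (auto intro!: derivative_eq_intros simp: field_simps power2_eq_square power3_eq_cube)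
  have wQ: "wdv (\<lambda>z. of_real (Q z)) (cnj z) z z" for z
    unfolding Q_def by (rule wdv_norm_sq)
  define h h1 h2 where "h = (\<lambda>z. complex_of_real (H (Q z)))" and "h1 = (\<lambda>z. complex_of_real (H' (Q z)))"
    and "h2 = (\<lambda>z. complex_of_real (H'' (Q z)))"
  have wh: "wdv h (h1 z * cnj z) (h1 z * z) z" for z
    unfolding h_def h1_def by (rule wdv_real_compose[OF wQ dH])
  have wh1: "wdv h1 (h2 z * cnj z) (h2 z * z) z" for z
    unfolding h2_def h1_def by (rule wdv_real_compose[OF wQ dH'])
  define E where "E = (\<lambda>z. complex_of_real (exp (\<phi> z)))"
  have wE: "wdv E (E z * p z) (E z * cnj (p z)) z" for z
    unfolding E_def by (rule wdv_real_compose[OF \<phi>(1)]) (auto intro!: derivative_eq_intros)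
  \<comment> \<open>\<open>D\<close> is exp (-\<phi>) times the z-derivative of \<beta> exp \<phi>;
    its square is the nonnegative first-order term of the identity.\<close>
  define D where "D = (\<lambda>z. \<beta>z z + p z * \<beta> z)"
  define D1 where "D1 z = \<beta>zz z + (pp z * \<beta> z + p z * \<beta>z z)" for z
  define D2 where "D2 z = \<beta>zb z + (of_real (lap z) * \<beta> z + p z * \<beta>b z)" for z
  have wD: "wdv D (D1 z) (D2 z) z" for z
    unfolding D_def D1_def D2_def by (intro wdv_add wdv_mult \<beta> \<phi>)
  \<comment> \<open>In the z-derivative of \<open>B - A\<close> the mixed second derivatives of
    \<beta> occur only as a number minus its conjugate, hence disappear from the real part.\<close>
  define B where "B = (\<lambda>z. \<beta> z * (cnj (D z) * E z))"
  define A where "A = (\<lambda>z. cnj (\<beta> z) * (\<beta>b z * E z))"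
  define B1 where "B1 z = \<beta>z z * (cnj (D z) * E z) + \<beta> z * (cnj (D2 z) * E z + cnj (D z) * (E z * p z))" for z
  define B2 where "B2 z = \<beta>b z * (cnj (D z) * E z) + \<beta> z * (cnj (D1 z) * E z + cnj (D z) * (E z * cnj (p z)))" for z
  have wB: "wdv B (B1 z) (B2 z) z" for z
    unfolding B_def B1_def B2_def by (intro wdv_mult wdv_cnj \<beta> wD wE)
  define A1 where "A1 z = cnj (\<beta>b z) * (\<beta>b z * E z) + cnj (\<beta> z) * (\<beta>zb z * E z + \<beta>b z * (E z * p z))" for z
  define A2 where "A2 z = cnj (\<beta>z z) * (\<beta>b z * E z) + cnj (\<beta> z) * (\<beta>bb z * E z + \<beta>b z * (E z * cnj (p z)))" for z
  have wA: "wdv A (A1 z) (A2 z) z" for z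
    unfolding A_def A1_def A2_def by (intro wdv_mult wdv_cnj \<beta> wE)
  define U where "U = (\<lambda>z. \<beta> z * (cnj (\<beta> z) * E z))"
  define U1 where "U1 z = \<beta>z z * (cnj (\<beta> z) * E z) + \<beta> z * (cnj (\<beta>b z) * E z + cnj (\<beta> z) * (E z * p z))" for z
  define U2 where "U2 z = \<beta>b z * (cnj (\<beta> z) * E z) + \<beta> z * (cnj (\<beta>z z) * E z + cnj (\<beta> z) * (E z * cnj (p z)))" for z
  have wU: "wdv U (U1 z) (U2 z) z" for z
    unfolding U_def U1_def U2_def by (intro wdv_mult wdv_cnj \<beta> wE)
  \<comment> \<open>The identity integrates the z-derivative of \<open>Y\<close> minus the conjugate
    derivative of \<open>X\<close>. The derivative of the multiplier in \<open>Y\<close> leaves a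
    first-order term containing \<open>B\<close>, hence \<open>D\<close>; the field \<open>X\<close>
    is chosen to cancel it, at the price of a zero-order term in \<open>U\<close> and a second copy
    of the term in \<open>A\<close>.\<close>
  define Y where "Y = (\<lambda>z. h z * (B z - A z))"
  define Y1 where "Y1 z = (h1 z * cnj z) * (B z - A z) + h z * (B1 z - A1 z)" for z
  define Y2 where "Y2 z = (h1 z * z) * (B z - A z) + h z * (B2 z - A2 z)" for z
  have wY: "wdv Y (Y1 z) (Y2 z) z" for z
    unfolding Y_def Y1_def Y2_def by (intro wdv_mult wdv_diff wh wA wB)
  define X where "X = (\<lambda>z. cnj z * (h1 z * U z))"
  define X1 where "X1 z = cnj 0 * (h1 z * U z) + cnj z * ((h2 z * cnj z) * U z + h1 z * U1 z)" for z
  define X2 where "X2 z = cnj 1 * (h1 z * U z) + cnj z * ((h2 z * z) * U z + h1 z * U2 z)" for z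
  have wX: "wdv X (X1 z) (X2 z) z" for z
    unfolding X_def X1_def X2_def by (intro wdv_mult wdv_cnj wdv_ident wh1 wU)
  have cont: "continuous_on UNIV \<beta>" "continuous_on UNIV \<beta>z" "continuous_on UNIV \<beta>b" "continuous_on UNIV p"
      "continuous_on UNIV h" "continuous_on UNIV h1" "continuous_on UNIV E" "continuous_on UNIV D"
      "continuous_on UNIV A" "continuous_on UNIV B" "continuous_on UNIV U"
    using wdv_continuous[OF \<beta>(1)] wdv_continuous[OF \<beta>(2)] wdv_continuous[OF \<beta>(3)] wdv_continuous[OF \<phi>(2)]
      wdv_continuous[OF wh] wdv_continuous[OF wh1] wdv_continuous[OF wE] wdv_continuous[OF wD]
      wdv_continuous[OF wA] wdv_continuous[OF wB] wdv_continuous[OF wU] by auto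
  have ch2: "continuous_on UNIV h2"
    unfolding h2_def H''_def using pos by (intro continuous_intros cQ) (auto simp: less_imp_neq[symmetric])
  have cD: "continuous_on UNIV D1" "continuous_on UNIV D2"
    unfolding D1_def D2_def by (intro continuous_intros cont \<beta> \<phi>)+
  have cc: "continuous_on UNIV B1" "continuous_on UNIV B2" "continuous_on UNIV A1" "continuous_on UNIV A2"
      "continuous_on UNIV U1" "continuous_on UNIV U2"
    unfolding B1_def B2_def A1_def A2_def U1_def U2_def by (intro continuous_intros cont cD \<beta> \<phi>)+
  have cY: "continuous_on UNIV Y1" "continuous_on UNIV Y2" "continuous_on UNIV X1" "continuous_on UNIV X2"
    unfolding Y1_def Y2_def X1_def X2_def by (intro continuous_intros cont cc ch2)+
  have z: "Y z = 0" "X z = 0" if "z \<notin> cball 0 r" for z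
    using supp(1)[OF that] by (auto simp: Y_def X_def A_def B_def U_def)
  note iY = wdv_integral_zero[OF wY cY(1,2) z(1)] and iX = wdv_integral_zero[OF wX cY(3,4) z(2)]
  have iT: "integrable lborel (\<lambda>z. Re (Y1 z - X2 z))" "(\<integral>z. Re (Y1 z - X2 z) \<partial>lborel) = 0"
    using iY iX by (auto intro!: integrable_Re)
  define G where "G z = (H (Q z) * Q z * (cmod (b z))\<^sup>2 + (c\<^sup>2 - c\<^sup>2 * e / (c * Q z + e)\<^sup>2) * (cmod (\<beta> z))\<^sup>2
      + 2 * (Q z * H' (Q z)) * Re (b z * cnj (\<beta> z))) * exp (\<phi> z)" for z
  have cphi: "continuous_on UNIV (\<lambda>z. complex_of_real (\<phi> z))"
    using \<phi>(1) by (rule wdv_continuous)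
  have cphi': "continuous_on UNIV \<phi>"
    using continuous_on_Re[OF cphi] by simp
  have cG: "continuous_on UNIV G"
    unfolding G_def H_def H'_def using pos
    by (intro continuous_intros cQ b cont cphi') (auto simp: less_imp_neq[symmetric])
  have iG: "integrable lborel G"
    by (rule integrable_compact_support[OF cG, of r]) (use supp in \<open>auto simp: G_def\<close>)
  have Ezr: "E z = of_real (exp (\<phi> z))" for z by (simp add: E_def)
  have H0: "H (Q z) \<ge> 0" for z
    using ln_le_minus_one[OF pos[of z]] c unfolding H_def by (intro mult_nonneg_nonneg) auto
  \<comment> \<open>The left side is the mixed second derivative of H(|z|^2). Its deficit from c^2
    is the density that concentrates into a point mass as \<open>e\<close> tends to 0.\<close>
  have HH: "H' (Q z) + Q z * H'' (Q z) = c\<^sup>2 - c\<^sup>2 * e / (c * Q z + e)\<^sup>2" for z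
    unfolding H'_def H''_def using pos[of z]
    by (simp add: divide_simps power2_eq_square power3_eq_cube) (simp add: algebra_simps)
  have eq: "Re (Y1 z - X2 z) = H (Q z) * ((cmod (D z))\<^sup>2 + lap z * (cmod (\<beta> z))\<^sup>2) * exp (\<phi> z) - G z" for z
  proof -
    \<comment> \<open>Commuting the two first-order operators produces the curvature term
      \<open>lap\<close>; the brackets of the form w - cnj w are imaginary and drop out.\<close>
    have r1: "Re (B1 z - A1 z) = ((cmod (D z))\<^sup>2 + lap z * (cmod (\<beta> z))\<^sup>2 - (cmod (\<beta>b z))\<^sup>2) * exp (\<phi> z)"
    proof -
      have eq1: "B1 z - A1 z = (D z * cnj (D z) + of_real (lap z) * (\<beta> z * cnj (\<beta> z)) - \<beta>b z * cnj (\<beta>b z)) * E z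
         + ((\<beta> z * cnj (\<beta>zb z) - cnj (\<beta> z * cnj (\<beta>zb z)))
         + (\<beta> z * cnj (p z * \<beta>b z) - cnj (\<beta> z * cnj (p z * \<beta>b z)))) * E z"
        unfolding B1_def A1_def D2_def D_def complex_cnj_add complex_cnj_mult complex_cnj_cnj complex_cnj_complex_of_real
        by algebra
      show ?thesis unfolding eq1
      proof -
        show "Re ((D z * cnj (D z) + of_real (lap z) * (\<beta> z * cnj (\<beta> z)) - \<beta>b z * cnj (\<beta>b z)) * E z
         + ((\<beta> z * cnj (\<beta>zb z) - cnj (\<beta> z * cnj (\<beta>zb z)))
         + (\<beta> z * cnj (p z * \<beta>b z) - cnj (\<beta> z * cnj (p z * \<beta>b z)))) * E z) = ((cmod (D z))\<^sup>2 + lap z * (cmod (\<beta> z))\<^sup>2 - (cmod (\<beta>b z))\<^sup>2) * exp (\<phi> z)"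
        proof -
        have 1: "Re ((u - cnj u + (v - cnj v)) * E z) = 0" for u v by (simp add: Ezr)
        have 2: "x * cnj x = of_real ((cmod x)\<^sup>2)" for x by (simp add: complex_mult_cnj cmod_power2)
        show ?thesis
          unfolding plus_complex.sel(1) 1 unfolding 2 Ezr by (simp del: of_real_power)
      qed
      qed
    qed
    have u2: "U2 z = A z + B z"
      unfolding U2_def A_def B_def D_def complex_cnj_add complex_cnj_mult by (simp only: ring_distribs ac_simps)
    have "Y1 z - X2 z = h z * (B1 z - A1 z) - (h1 z + h2 z * (z * cnj z)) * U z - 2 * (h1 z * (cnj z * A z))"
      unfolding Y1_def X2_def u2 complex_cnj_one by (simp add: ring_distribs mult_ac)
    also have "\<dots> = of_real (H (Q z)) * (B1 z - A1 z) - of_real ((H' (Q z) + Q z * H'' (Q z)) * (cmod (\<beta> z))\<^sup>2 * exp (\<phi> z))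
        - of_real (2 * H' (Q z) * Q z * exp (\<phi> z)) * (b z * cnj (\<beta> z))"
    proof -
      have "z * cnj z = of_real (Q z)" by (simp add: Q_def complex_mult_cnj cmod_power2)
      moreover have "U z = of_real ((cmod (\<beta> z))\<^sup>2 * exp (\<phi> z))"
        by (simp add: U_def Ezr mult.assoc[symmetric] complex_mult_cnj cmod_power2)
      moreover have "cnj z * A z = (z * cnj z) * (b z * cnj (\<beta> z)) * of_real (exp (\<phi> z))"
        by (simp add: A_def b Ezr)
      ultimately show ?thesis unfolding h_def h1_def h2_def
        by (simp only: of_real_mult of_real_add of_real_numeral ac_simps)
    qed
    finally have Y1X2: "Y1 z - X2 z = of_real (H (Q z)) * (B1 z - A1 z) - of_real ((H' (Q z) + Q z * H'' (Q z)) * (cmod (\<beta> z))\<^sup>2 * exp (\<phi> z))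
        - of_real (2 * H' (Q z) * Q z * exp (\<phi> z)) * (b z * cnj (\<beta> z))" .
    have "Re (of_real x * w - of_real y - of_real u * v) = x * Re w - y - u * Re v" for x y u w v by simp
    then have "Re (Y1 z - X2 z) = H (Q z) * Re (B1 z - A1 z) - (H' (Q z) + Q z * H'' (Q z)) * (cmod (\<beta> z))\<^sup>2 * exp (\<phi> z)
        - 2 * H' (Q z) * Q z * exp (\<phi> z) * Re (b z * cnj (\<beta> z))"
      unfolding Y1X2 by blast
    also have "\<dots> = H (Q z) * ((cmod (D z))\<^sup>2 + lap z * (cmod (\<beta> z))\<^sup>2) * exp (\<phi> z) - G z"
    proof -
      have "(cmod (\<beta>b z))\<^sup>2 = Q z * (cmod (b z))\<^sup>2" by (simp add: b Q_def norm_mult power_mult_distrib)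
      then show ?thesis unfolding r1 G_def HH by (simp add: algebra_simps)
    qed
    finally show ?thesis .
  qed
  have "Re (Y1 z - X2 z) + G z \<ge> 0" for z
  proof -
    have "0 \<le> lap z * (cmod (\<beta> z))\<^sup>2"
      by (cases "z \<in> cball 0 r") (use lap[of z] supp(1)[of z] in \<open>auto intro!: mult_nonneg_nonneg\<close>)
    then have "0 \<le> H (Q z) * ((cmod (D z))\<^sup>2 + lap z * (cmod (\<beta> z))\<^sup>2) * exp (\<phi> z)"
      by (intro mult_nonneg_nonneg[OF mult_nonneg_nonneg[OF H0]] add_nonneg_nonneg) auto
    then show ?thesis unfolding eq by linarith
  qed
  then have "0 \<le> (\<integral>z. Re (Y1 z - X2 z) + G z \<partial>lborel)" by (intro integral_nonneg_AE) auto
  also have "\<dots> = (\<integral>z. G z \<partial>lborel)" using iT iG by simp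
  finally show ?thesis unfolding G_def .
qed


text \<open>The disc |z|^2 <= a has area pi a, so the image of Lebesgue measure under |z|^2 is pi
  times Lebesgue measure on the half-line. Comparing both measures on the sets {..a} replaces polar
  coordinates.\<close>

lemma nn_integral_norm_sq:
  fixes f :: "real \<Rightarrow> ennreal"
  assumes [measurable]: "f \<in> borel_measurable borel"
  shows "(\<integral>\<^sup>+z. f ((cmod z)\<^sup>2) \<partial>lborel) = ennreal pi * (\<integral>\<^sup>+s. f s * indicator {0..} s \<partial>lborel)"
proof -
  let ?M = "distr lborel borel (\<lambda>z::complex. (cmod z)\<^sup>2)" and ?N = "density lborel (\<lambda>s::real. ennreal pi * indicator {0..} s)"
  have M: "emeasure ?M {..a} = ennreal (pi * max 0 a)" for a
  proof -
    have "(\<lambda>z::complex. (cmod z)\<^sup>2) -` {..a} \<inter> space lborel = (if a < 0 then {} else cball 0 (sqrt a))"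
    proof -
      have "(cmod z)\<^sup>2 \<le> a \<longleftrightarrow> 0 \<le> a \<and> cmod z \<le> sqrt a" for z
        using real_sqrt_le_iff[of "(cmod z)\<^sup>2" a] order_trans[OF zero_le_power2[of "cmod z"], of a] by auto
      then show ?thesis by (auto simp: not_less)
    qed
    then show ?thesis
      by (subst emeasure_distr) (auto simp: emeasure_cball unit_ball_vol_2 max_def)
  qed
  have N: "emeasure ?N {..a} = ennreal (pi * max 0 a)" for a
  proof -
    have "emeasure ?N {..a} = (\<integral>\<^sup>+s. ennreal pi * indicator {0..a} s \<partial>lborel)"
      by (subst emeasure_density) (auto intro!: nn_integral_cong simp: indicator_def)
    also have "\<dots> = ennreal (pi * max 0 a)"
      by (subst nn_integral_cmult_indicator) (auto simp: max_def ennreal_mult)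
    finally show ?thesis .
  qed
  have eq: "?M = ?N"
  proof (rule measure_eqI_generator_eq[where E="range (\<lambda>a::real. {..a})" and \<Omega>=UNIV and A="\<lambda>i. {..real i}"])
    show "Int_stable (range (\<lambda>a::real. {..a}))"
      by (auto simp: Int_stable_def min_def intro!: image_eqI[where x="min _ _"])
    show "sets ?M = sigma_sets UNIV (range (\<lambda>a::real. {..a}))" "sets ?N = sigma_sets UNIV (range (\<lambda>a::real. {..a}))"
      by (simp_all add: borel_eq_atMost)
    show "(\<Union>i. {..real i}) = UNIV" by (auto intro: real_arch_simple)
  qed (auto simp: M N simp del: emeasure_density)
  have "(\<integral>\<^sup>+z. f ((cmod z)\<^sup>2) \<partial>lborel) = (\<integral>\<^sup>+s. f s \<partial>?M)"
    by (subst nn_integral_distr) auto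
  also have "\<dots> = (\<integral>\<^sup>+s. ennreal pi * (f s * indicator {0..} s) \<partial>lborel)"
    unfolding eq by (subst nn_integral_density) (auto intro!: nn_integral_cong simp: ac_simps)
  also have "\<dots> = ennreal pi * (\<integral>\<^sup>+s. f s * indicator {0..} s \<partial>lborel)"
    by (rule nn_integral_cmult) auto
  finally show ?thesis .
qed

lemma nn_integral_lborel_scale:
  fixes f :: "'a::euclidean_space \<Rightarrow> ennreal"
  assumes [measurable]: "f \<in> borel_measurable borel" and s: "s > 0"
  shows "(\<integral>\<^sup>+x. f x \<partial>lborel) = ennreal (s ^ DIM('a)) * (\<integral>\<^sup>+x. f (t + s *\<^sub>R x) \<partial>lborel)"
proof -
  have "(\<integral>\<^sup>+x. f x \<partial>lborel) = (\<integral>\<^sup>+x. f x \<partial>density (distr lborel borel (\<lambda>x. t + s *\<^sub>R x)) (\<lambda>_. ennreal (\<bar>s\<bar>^DIM('a))))"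
    using s by (subst lborel_affine[of s t]) auto
  also have "\<dots> = (\<integral>\<^sup>+x. ennreal (s^DIM('a)) * f (t + s *\<^sub>R x) \<partial>lborel)"
    using s by (subst nn_integral_density) (auto simp: nn_integral_distr)
  also have "\<dots> = ennreal (s ^ DIM('a)) * (\<integral>\<^sup>+x. f (t + s *\<^sub>R x) \<partial>lborel)"
    by (rule nn_integral_cmult) auto
  finally show ?thesis .
qed

lemma integral_lborel_scale:
  fixes f :: "'a::euclidean_space \<Rightarrow> real"
  assumes [measurable]: "f \<in> borel_measurable borel" and s: "s > 0"
  shows "(\<integral>x. f x \<partial>lborel) = s ^ DIM('a) * (\<integral>x. f (s *\<^sub>R x) \<partial>lborel)"
proof -
  have "(\<integral>x. f x \<partial>lborel) = (\<integral>x. f x \<partial>density (distr lborel borel (\<lambda>x. 0 + s *\<^sub>R x)) (\<lambda>_. ennreal (\<bar>s\<bar>^DIM('a))))"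
    using s by (subst lborel_affine[of s 0]) auto
  also have "\<dots> = (\<integral>x. s^DIM('a) * f (s *\<^sub>R x) \<partial>lborel)"
    using s by (subst integral_density) (auto simp: integral_distr)
  finally show ?thesis by simp
qed

text \<open>The primitive -1/(1 + s) of 1/(1 + s)^2 gives total mass 1 on the half-line; the factor
  pi comes from the radial formula and is the origin of the pi in the extension constant.\<close>

lemma fubini_study_mass:
  "integrable lborel (\<lambda>w::complex. 1 / (1 + (cmod w)\<^sup>2)\<^sup>2)" "(\<integral>w. 1 / (1 + (cmod w)\<^sup>2)\<^sup>2 \<partial>lborel) = pi"
proof -
  have "(\<integral>\<^sup>+s. ennreal (1 / (1 + s)\<^sup>2) * indicator {0..} s \<partial>lborel) = ennreal (0 - (- 1 / (1 + 0)))"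
  proof (rule nn_integral_FTC_atLeast)
    show "((\<lambda>s::real. - 1 / (1 + s)) has_real_derivative 1 / (1 + x)\<^sup>2) (at x)" if "0 \<le> x" for x
      using that by (auto intro!: derivative_eq_intros simp: power2_eq_square)
    have "((\<lambda>s::real. - (1 / (1 + s))) \<longlongrightarrow> - 0) at_top"
      by (intro tendsto_minus tendsto_divide_0[OF tendsto_const] filterlim_at_top_imp_at_infinity
          filterlim_tendsto_add_at_top[OF tendsto_const] filterlim_ident)
    then show "((\<lambda>s::real. - 1 / (1 + s)) \<longlongrightarrow> 0) at_top" by simp
  qed auto
  then have "(\<integral>\<^sup>+w. ennreal (1 / (1 + (cmod w)\<^sup>2)\<^sup>2) \<partial>lborel) = ennreal pi"
    using nn_integral_norm_sq[of "\<lambda>s. ennreal (1 / (1 + s)\<^sup>2)"] by simp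
  then have "has_bochner_integral lborel (\<lambda>w::complex. 1 / (1 + (cmod w)\<^sup>2)\<^sup>2) pi"
    by (intro has_bochner_integral_nn_integral) auto
  then show "integrable lborel (\<lambda>w::complex. 1 / (1 + (cmod w)\<^sup>2)\<^sup>2)" "(\<integral>w. 1 / (1 + (cmod w)\<^sup>2)\<^sup>2 \<partial>lborel) = pi"
    by (auto simp: has_bochner_integral_iff)
qed

text \<open>The substitution z = s w with s^2 = e/c turns the kernel into the fixed density 1/(1 +
  |w|^2)^2 and moves the argument of \<open>U\<close> to the origin.\<close>

lemma fubini_study_approximate_identity:
  fixes U :: "complex \<Rightarrow> real"
  assumes U: "continuous_on UNIV U" and B: "\<And>z. \<bar>U z\<bar> \<le> B" and c: "c > 0" and e: "\<And>n. e n > 0" "e \<longlonglongrightarrow> 0"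
  shows "(\<lambda>n. \<integral>z. c * e n / (c * (cmod z)\<^sup>2 + e n)\<^sup>2 * U z \<partial>lborel) \<longlonglongrightarrow> pi * U 0"
proof -
  define s where "s n = sqrt (e n / c)" for n
  have s: "s n > 0" "s n ^ 2 = e n / c" for n using c e(1)[of n] by (auto simp: s_def)
  have s0: "s \<longlonglongrightarrow> 0"
  proof -
    have "(\<lambda>n. sqrt (e n / c)) \<longlonglongrightarrow> sqrt (0 / c)" by (intro tendsto_intros e) (use c in auto)
    then show ?thesis unfolding s_def[abs_def] by simp
  qed
  have [measurable]: "U \<in> borel_measurable borel" using U by simp
  have eq: "(\<integral>z. c * e n / (c * (cmod z)\<^sup>2 + e n)\<^sup>2 * U z \<partial>lborel) = (\<integral>w. 1 / (1 + (cmod w)\<^sup>2)\<^sup>2 * U (s n *\<^sub>R w) \<partial>lborel)" for n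
  proof -
    have "(\<integral>z. c * e n / (c * (cmod z)\<^sup>2 + e n)\<^sup>2 * U z \<partial>lborel)
       = (s n)\<^sup>2 * (\<integral>w. c * e n / (c * (cmod (s n *\<^sub>R w))\<^sup>2 + e n)\<^sup>2 * U (s n *\<^sub>R w) \<partial>lborel)"
      by (subst integral_lborel_scale[OF _ s(1)[of n]]) auto
    also have "\<dots> = (\<integral>w. (s n)\<^sup>2 * (c * e n / (c * (cmod (s n *\<^sub>R w))\<^sup>2 + e n)\<^sup>2 * U (s n *\<^sub>R w)) \<partial>lborel)"
      by (rule integral_mult_right_zero[symmetric])
    also have "\<dots> = (\<integral>w. 1 / (1 + (cmod w)\<^sup>2)\<^sup>2 * U (s n *\<^sub>R w) \<partial>lborel)"
    proof (rule Bochner_Integration.integral_cong)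
      fix w :: complex
      have "c * (cmod (s n *\<^sub>R w))\<^sup>2 + e n = e n * (1 + (cmod w)\<^sup>2)"
        using c by (simp add: power_mult_distrib s(2) field_simps)
      then have "(s n)\<^sup>2 * (c * e n / (c * (cmod (s n *\<^sub>R w))\<^sup>2 + e n)\<^sup>2) = 1 / (1 + (cmod w)\<^sup>2)\<^sup>2"
        using c e(1)[of n] unfolding s(2) by (simp add: power_mult_distrib) (simp add: power2_eq_square)
      then show "(s n)\<^sup>2 * (c * e n / (c * (cmod (s n *\<^sub>R w))\<^sup>2 + e n)\<^sup>2 * U (s n *\<^sub>R w)) = 1 / (1 + (cmod w)\<^sup>2)\<^sup>2 * U (s n *\<^sub>R w)"
        by (simp only: mult.assoc[symmetric])
    qed simp
    finally show ?thesis .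
  qed
  have "(\<lambda>n. \<integral>w. 1 / (1 + (cmod w)\<^sup>2)\<^sup>2 * U (s n *\<^sub>R w) \<partial>lborel) \<longlonglongrightarrow> (\<integral>w. 1 / (1 + (cmod w)\<^sup>2)\<^sup>2 * U 0 \<partial>lborel)"
  proof (rule integral_dominated_convergence[where w="\<lambda>w::complex. 1 / (1 + (cmod w)\<^sup>2)\<^sup>2 * B"])
    show "integrable lborel (\<lambda>w::complex. 1 / (1 + (cmod w)\<^sup>2)\<^sup>2 * B)"
      using fubini_study_mass(1) by (rule integrable_mult_left)
    show "AE w in lborel. (\<lambda>n. 1 / (1 + (cmod w)\<^sup>2)\<^sup>2 * U (s n *\<^sub>R w)) \<longlonglongrightarrow> 1 / (1 + (cmod w)\<^sup>2)\<^sup>2 * U 0"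
    proof (rule AE_I2)
      fix w :: complex
      have "(\<lambda>n. s n *\<^sub>R w) \<longlonglongrightarrow> 0 *\<^sub>R w" by (intro tendsto_intros s0)
      then have "(\<lambda>n. U (s n *\<^sub>R w)) \<longlonglongrightarrow> U 0"
        using continuous_on_tendsto_compose[OF U, of "\<lambda>n. s n *\<^sub>R w" 0 sequentially] by simp
      then show "(\<lambda>n. 1 / (1 + (cmod w)\<^sup>2)\<^sup>2 * U (s n *\<^sub>R w)) \<longlonglongrightarrow> 1 / (1 + (cmod w)\<^sup>2)\<^sup>2 * U 0"
        by (intro tendsto_intros)
    qed
    show "AE w in lborel. norm (1 / (1 + (cmod w)\<^sup>2)\<^sup>2 * U (s n *\<^sub>R w)) \<le> 1 / (1 + (cmod w)\<^sup>2)\<^sup>2 * B" for n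
      using B by (auto simp: abs_mult intro!: divide_right_mono)
  qed auto
  also have "(\<integral>w. 1 / (1 + (cmod w)\<^sup>2)\<^sup>2 * U 0 \<partial>lborel) = pi * U 0"
    unfolding integral_mult_left_zero fubini_study_mass(2) ..
  finally show ?thesis unfolding eq .
qed

text \<open>The limit \<open>e\<close> -> 0 of the twisted inequality. The deficit of the mixed
  derivative contributes pi c |\<beta>(0)|^2 exp \<phi>(0). With q = c |z|^2, the inequality - q ln
  q <= 1 - q bounds the remaining quadratic form by the square of (1 - q) b - c \<beta>.\<close>

lemma core_inequality_aux:
  fixes \<phi> lap :: "complex \<Rightarrow> real" and p pp \<beta> \<beta>z \<beta>b \<beta>zz \<beta>zb \<beta>bb b :: "complex \<Rightarrow> complex"
  assumes \<phi>: "\<And>z. wdv (\<lambda>z. of_real (\<phi> z)) (p z) (cnj (p z)) z" "\<And>z. wdv p (pp z) (of_real (lap z)) z"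
      "continuous_on UNIV pp" "continuous_on UNIV lap"
    and \<beta>: "\<And>z. wdv \<beta> (\<beta>z z) (\<beta>b z) z" "\<And>z. wdv \<beta>z (\<beta>zz z) (\<beta>zb z) z" "\<And>z. wdv \<beta>b (\<beta>zb z) (\<beta>bb z) z"
      "continuous_on UNIV \<beta>zz" "continuous_on UNIV \<beta>zb" "continuous_on UNIV \<beta>bb"
    and supp: "\<And>z. z \<notin> cball 0 r \<Longrightarrow> \<beta> z = 0" "\<And>z. z \<notin> cball 0 r \<Longrightarrow> b z = 0"
    and lap: "\<And>z. z \<in> cball 0 r \<Longrightarrow> lap z \<ge> 0"
    and b: "\<And>z. \<beta>b z = z * b z" "continuous_on UNIV b"
    and c: "c > 0"
  shows "pi * c * (cmod (\<beta> 0))\<^sup>2 * exp (\<phi> 0)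
    \<le> (\<integral>z. (cmod ((1 - of_real (c * (cmod z)\<^sup>2)) * b z - of_real c * \<beta> z))\<^sup>2 * exp (\<phi> z) \<partial>lborel)"
proof -
  define e where "e n = inverse (real (Suc n))" for n
  have e: "e n > 0" "e n \<le> 1" for n by (auto simp: e_def field_simps)
  have e0: "e \<longlonglongrightarrow> 0" unfolding e_def by (rule LIMSEQ_inverse_real_of_nat)
  define Q where "Q z = (cmod z)\<^sup>2" for z
  have Q0: "Q z \<ge> 0" for z by (simp add: Q_def)
  have pos: "c * Q z + e n > 0" for z n using Q0[of z] c e(1)[of n] by (simp add: add_nonneg_pos)
  have pos': "c * Q z + e n \<noteq> 0" for z n using pos[of z n] by simp
  have cQ: "continuous_on UNIV Q" unfolding Q_def by (intro continuous_intros)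
  have c\<phi>: "continuous_on UNIV \<phi>"
    using continuous_on_Re[OF wdv_continuous[OF \<phi>(1)]] by simp
  have c\<beta>: "continuous_on UNIV \<beta>" by (rule wdv_continuous[OF \<beta>(1)])
  define U where "U z = (cmod (\<beta> z))\<^sup>2 * exp (\<phi> z)" for z
  have cU: "continuous_on UNIV U" unfolding U_def by (intro continuous_intros c\<phi> c\<beta>)
  have sU: "U z = 0" if "z \<notin> cball 0 r" for z using supp[OF that] by (simp add: U_def)
  obtain BU where BU: "\<And>z. norm (U z) \<le> BU" using compact_support_bounded[OF cU sU] by metis
  define G where "G z = (cmod ((1 - of_real (c * Q z)) * b z - of_real c * \<beta> z))\<^sup>2 * exp (\<phi> z)" for z
  have cG: "continuous_on UNIV G" unfolding G_def by (intro continuous_intros c\<phi> c\<beta> cQ b)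
  have iG: "integrable lborel G"
    by (rule integrable_compact_support[OF cG, of r]) (use supp in \<open>auto simp: G_def\<close>)
  \<comment> \<open>\<open>err\<close> collects what vanishes in the limit: its first summand comes
    from the estimate of the logarithm, its second from the regularised cross term.
    \<open>lhs\<close> is the concentrating mass.\<close>
  define err where "err n z = (e n * (c * Q z) * (cmod (b z))\<^sup>2 + 2 * c * (e n / (c * Q z + e n)) * (cmod (b z) * cmod (\<beta> z))) * exp (\<phi> z)" for n z
  define lhs where "lhs n z = c * (c * e n / (c * Q z + e n)\<^sup>2 * U z)" for n z
  have cerr: "continuous_on UNIV (err n)" "continuous_on UNIV (lhs n)" for n
    unfolding err_def lhs_def using pos' by (intro continuous_intros c\<phi> c\<beta> cQ b cU; auto)+
  have ierr: "integrable lborel (err n)" "integrable lborel (lhs n)" for n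
  proof -
    show "integrable lborel (err n)"
      by (rule integrable_compact_support[OF cerr(1), of r]) (use supp in \<open>auto simp: err_def\<close>)
    show "integrable lborel (lhs n)"
      by (rule integrable_compact_support[OF cerr(2), of r]) (use sU in \<open>auto simp: lhs_def\<close>)
  qed
  have main: "(\<integral>z. lhs n z \<partial>lborel) \<le> (\<integral>z. G z \<partial>lborel) + (\<integral>z. err n z \<partial>lborel)" for n
  proof -
    define T where "T z = (c * (c * Q z - 1 + e n - ln (c * Q z + e n)) * Q z * (cmod (b z))\<^sup>2
      + (c\<^sup>2 - c\<^sup>2 * e n / (c * Q z + e n)\<^sup>2) * (cmod (\<beta> z))\<^sup>2
      + 2 * (Q z * (c\<^sup>2 - c\<^sup>2 / (c * Q z + e n))) * Re (b z * cnj (\<beta> z))) * exp (\<phi> z)" for z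
    have T: "0 \<le> (\<integral>z. T z \<partial>lborel)"
      unfolding T_def Q_def by (rule twisted_basic_inequality[OF \<phi> \<beta> supp lap b c e(1)])
    have le: "T z \<le> G z + err n z - lhs n z" for z
    proof -
      define q where "q = c * Q z"
      have q: "q \<ge> 0" "q + e n > 0" using Q0[of z] c pos[of z n] by (auto simp: q_def)
      define x where "x = Re (b z * cnj (\<beta> z))"
      have x: "\<bar>x\<bar> \<le> cmod (b z) * cmod (\<beta> z)"
        using abs_Re_le_cmod[of "b z * cnj (\<beta> z)"] by (simp add: x_def norm_mult)
      \<comment> \<open>The only estimate of the logarithm: it turns q (q - 1 + e - ln (q + e)) into
        (1 - q)^2 + e q, the coefficient of |b|^2 in the perfect square up to an error.\<close>
      have "- ln (q + e n) \<le> 1 / (q + e n) - 1"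
        using ln_le_minus_one[of "1 / (q + e n)"] q by (simp add: ln_div)
      then have "q * (- ln (q + e n)) \<le> q * (1 / (q + e n) - 1)"
        using q by (intro mult_left_mono) auto
      also have "q * (1 / (q + e n)) \<le> 1" using q e(1)[of n] by (simp add: field_simps)
      then have "q * (1 / (q + e n) - 1) \<le> 1 - q" by (simp add: algebra_simps)
      finally have H: "q * (q - 1 + e n - ln (q + e n)) \<le> (1 - q)\<^sup>2 + e n * q"
        by (simp add: power2_eq_square algebra_simps)
      have gsq: "(cmod ((1 - of_real q) * b z - of_real c * \<beta> z))\<^sup>2 = (1 - q)\<^sup>2 * (cmod (b z))\<^sup>2 - 2 * c * (1 - q) * x + c\<^sup>2 * (cmod (\<beta> z))\<^sup>2"
        unfolding x_def cmod_power2 by (simp add: power2_eq_square algebra_simps)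
      have QH: "Q z * (c\<^sup>2 - c\<^sup>2 / (q + e n)) = - c * (1 - q) + c * (e n / (q + e n))"
      proof -
        have "Q z * (c\<^sup>2 - c\<^sup>2 / (q + e n)) = c * (q - q / (q + e n))"
          by (simp add: q_def power2_eq_square algebra_simps)
        also have "q / (q + e n) = 1 - e n / (q + e n)" using q by (simp add: field_simps)
        finally show ?thesis by (simp add: algebra_simps)
      qed
      have "T z = (q * (q - 1 + e n - ln (q + e n)) * (cmod (b z))\<^sup>2 + (c\<^sup>2 - c\<^sup>2 * e n / (q + e n)\<^sup>2) * (cmod (\<beta> z))\<^sup>2
        + 2 * (- c * (1 - q) + c * (e n / (q + e n))) * x) * exp (\<phi> z)"
        unfolding QH[symmetric] by (simp add: T_def q_def[symmetric] x_def)
      also have "\<dots> \<le> (((1 - q)\<^sup>2 + e n * q) * (cmod (b z))\<^sup>2 + (c\<^sup>2 - c\<^sup>2 * e n / (q + e n)\<^sup>2) * (cmod (\<beta> z))\<^sup>2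
        + (- 2 * c * (1 - q) * x + 2 * c * (e n / (q + e n)) * (cmod (b z) * cmod (\<beta> z)))) * exp (\<phi> z)"
      proof (intro mult_right_mono add_mono order_refl H)
        have "2 * c * (e n / (q + e n)) * x \<le> 2 * c * (e n / (q + e n)) * (cmod (b z) * cmod (\<beta> z))"
          using c q e(1)[of n] x by (intro mult_left_mono) auto
        then show "2 * (- c * (1 - q) + c * (e n / (q + e n))) * x \<le> - 2 * c * (1 - q) * x + 2 * c * (e n / (q + e n)) * (cmod (b z) * cmod (\<beta> z))"
          by (simp add: algebra_simps)
      qed auto
      also have "\<dots> = G z + err n z - lhs n z"
        unfolding G_def err_def lhs_def U_def q_def[symmetric] gsq
        by (simp add: power2_eq_square algebra_simps)
      finally show ?thesis .
    qed
    have "continuous_on UNIV T"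
      unfolding T_def using pos by (intro continuous_intros c\<phi> c\<beta> cQ b) (auto simp: less_imp_neq[symmetric])
    then have "integrable lborel T"
      by (rule integrable_compact_support[of _ r]) (use supp in \<open>auto simp: T_def\<close>)
    then have "(\<integral>z. T z \<partial>lborel) \<le> (\<integral>z. G z + err n z - lhs n z \<partial>lborel)"
      by (rule integral_mono) (use le iG ierr in auto)
    with T have "0 \<le> (\<integral>z. G z + err n z - lhs n z \<partial>lborel)" by simp
    then show ?thesis using iG ierr by simp
  qed
  have l1: "(\<lambda>n. \<integral>z. lhs n z \<partial>lborel) \<longlonglongrightarrow> c * (pi * U 0)"
    unfolding lhs_def Q_def integral_mult_right_zero
    by (rule tendsto_mult[OF tendsto_const[of c] fubini_study_approximate_identity[OF cU BU[unfolded real_norm_def] c e(1) e0]])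
  have l2: "(\<lambda>n. \<integral>z. err n z \<partial>lborel) \<longlonglongrightarrow> (\<integral>z. 0 \<partial>(lborel::complex measure))"
  proof (rule integral_dominated_convergence[where w="\<lambda>z. (c * Q z * (cmod (b z))\<^sup>2 + 2 * c * (cmod (b z) * cmod (\<beta> z))) * exp (\<phi> z)"])
    show "integrable lborel (\<lambda>z. (c * Q z * (cmod (b z))\<^sup>2 + 2 * c * (cmod (b z) * cmod (\<beta> z))) * exp (\<phi> z))"
      by (rule integrable_compact_support[of _ r]) (use supp in \<open>auto intro!: continuous_intros c\<phi> c\<beta> cQ b\<close>)
    \<comment> \<open>At the origin e / (c Q + e) equals 1 for every index, so pointwise convergence
      to 0 is available only off this null set.\<close>
    have "AE z in lborel. z \<noteq> (0::complex)" by (rule AE_lborel_singleton)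
    then show "AE z in lborel. (\<lambda>n. err n z) \<longlonglongrightarrow> 0"
    proof eventually_elim
      case (elim z)
      then have "c * Q z + 0 \<noteq> 0" using c by (simp add: Q_def)
      then have "(\<lambda>n. err n z) \<longlonglongrightarrow> (0 * (c * Q z) * (cmod (b z))\<^sup>2 + 2 * c * (0 / (c * Q z + 0)) * (cmod (b z) * cmod (\<beta> z))) * exp (\<phi> z)"
        unfolding err_def by (intro tendsto_intros e0)
      then show ?case by simp
    qed
    show "AE z in lborel. norm (err n z) \<le> (c * Q z * (cmod (b z))\<^sup>2 + 2 * c * (cmod (b z) * cmod (\<beta> z))) * exp (\<phi> z)" for n
    proof (rule AE_I2)
      fix z
      have q: "c * Q z \<ge> 0" using Q0[of z] c by simp
      have 1: "e n / (c * Q z + e n) \<le> 1" "e n / (c * Q z + e n) \<ge> 0" using q e(1)[of n] pos[of z n] by (auto simp: field_simps)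
      have "0 \<le> err n z" unfolding err_def using q 1 c e(1)[of n] Q0[of z]
        by (intro mult_nonneg_nonneg add_nonneg_nonneg) (auto simp del: times_divide_eq_right)
      moreover have "err n z \<le> (1 * (c * Q z) * (cmod (b z))\<^sup>2 + 2 * c * 1 * (cmod (b z) * cmod (\<beta> z))) * exp (\<phi> z)"
        unfolding err_def using q 1 c e[of n] Q0[of z]
        by (intro mult_right_mono add_mono mult_left_mono) auto
      ultimately show "norm (err n z) \<le> (c * Q z * (cmod (b z))\<^sup>2 + 2 * c * (cmod (b z) * cmod (\<beta> z))) * exp (\<phi> z)" by simp
    qed
  qed (use cerr in auto)
  have "c * (pi * U 0) \<le> (\<integral>z. G z \<partial>lborel) + 0"
  proof (rule LIMSEQ_le[OF l1])
    show "(\<lambda>n. (\<integral>z. G z \<partial>lborel) + (\<integral>z. err n z \<partial>lborel)) \<longlonglongrightarrow> (\<integral>z. G z \<partial>lborel) + 0"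
      using l2 by (intro tendsto_intros) simp
  qed (use main in auto)
  moreover have "c * (pi * U 0) = pi * c * (cmod (\<beta> 0))\<^sup>2 * exp (\<phi> 0)" by (simp add: U_def)
  ultimately show ?thesis unfolding G_def Q_def by simp
qed

section \<open>The weighted inequality\<close>

text \<open>A function together with its first and second Wirtinger derivatives. The same
  \<open>fzb\<close> occurs as conjugate derivative of \<open>fz\<close> and as z-derivative of
  \<open>fb\<close>, which builds the symmetry of mixed derivatives into the notion.\<close>

definition C2w :: "(complex \<Rightarrow> complex) \<Rightarrow> (complex \<Rightarrow> complex) \<Rightarrow> (complex \<Rightarrow> complex) \<Rightarrow> (complex \<Rightarrow> complex) \<Rightarrow>
    (complex \<Rightarrow> complex) \<Rightarrow> (complex \<Rightarrow> complex) \<Rightarrow> bool" where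
  "C2w f fz fb fzz fzb fbb \<longleftrightarrow> (\<forall>z. wdv f (fz z) (fb z) z) \<and> (\<forall>z. wdv fz (fzz z) (fzb z) z) \<and>
     (\<forall>z. wdv fb (fzb z) (fbb z) z) \<and> continuous_on UNIV fzz \<and> continuous_on UNIV fzb \<and> continuous_on UNIV fbb"

lemma C2wD:
  assumes "C2w f fz fb fzz fzb fbb"
  shows "wdv f (fz z) (fb z) z" "wdv fz (fzz z) (fzb z) z" "wdv fb (fzb z) (fbb z) z"
    "continuous_on UNIV fzz" "continuous_on UNIV fzb" "continuous_on UNIV fbb"
    "continuous_on UNIV f" "continuous_on UNIV fz" "continuous_on UNIV fb"
proof -
  show a: "wdv f (fz z) (fb z) z" "wdv fz (fzz z) (fzb z) z" "wdv fb (fzb z) (fbb z) z" for z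
    using assms by (auto simp: C2w_def)
  show "continuous_on UNIV fzz" "continuous_on UNIV fzb" "continuous_on UNIV fbb"
    using assms by (auto simp: C2w_def)
  show "continuous_on UNIV f" "continuous_on UNIV fz" "continuous_on UNIV fb"
    using wdv_continuous[OF a(1)] wdv_continuous[OF a(2)] wdv_continuous[OF a(3)] by auto
qed

lemma C2w_zero_outside:
  assumes "C2w f fz fb fzz fzb fbb" "\<And>z. z \<notin> cball 0 r \<Longrightarrow> f z = 0" "z \<notin> cball 0 r"
  shows "fz z = 0" "fb z = 0" "fzz z = 0" "fzb z = 0" "fbb z = 0"
proof -
  have op: "open (- cball (0::complex) r)" by auto
  have 1: "fz z = 0 \<and> fb z = 0" if "z \<in> - cball 0 r" for z
    using wdv_unique[OF wdv_local[OF C2wD(1)[OF assms(1)] op that, of "\<lambda>z. 0"] wdv_const] assms(2) by auto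
  have 2: "fzz z = 0 \<and> fzb z = 0" if "z \<in> - cball 0 r" for z
    using wdv_unique[OF wdv_local[OF C2wD(2)[OF assms(1)] op that, of "\<lambda>z. 0"] wdv_const] 1 by auto
  have 3: "fbb z = 0" if "z \<in> - cball 0 r" for z
    using wdv_unique[OF wdv_local[OF C2wD(3)[OF assms(1)] op that, of "\<lambda>z. 0"] wdv_const] 1 by auto
  show "fz z = 0" "fb z = 0" "fzz z = 0" "fzb z = 0" "fbb z = 0" using 1 2 3 assms(3) by auto
qed

lemma C2w_add:
  assumes "C2w f fz fb fzz fzb fbb" "C2w g gz gb gzz gzb gbb"
  shows "C2w (\<lambda>z. f z + g z) (\<lambda>z. fz z + gz z) (\<lambda>z. fb z + gb z) (\<lambda>z. fzz z + gzz z) (\<lambda>z. fzb z + gzb z) (\<lambda>z. fbb z + gbb z)"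
  using C2wD[OF assms(1)] C2wD[OF assms(2)] unfolding C2w_def by (auto intro!: wdv_add continuous_intros)

lemma C2w_mult:
  assumes "C2w f fz fb fzz fzb fbb" "C2w g gz gb gzz gzb gbb"
  shows "C2w (\<lambda>z. f z * g z) (\<lambda>z. fz z * g z + f z * gz z) (\<lambda>z. fb z * g z + f z * gb z)
     (\<lambda>z. (fzz z * g z + fz z * gz z) + (fz z * gz z + f z * gzz z))
     (\<lambda>z. (fzb z * g z + fz z * gb z) + (fb z * gz z + f z * gzb z))
     (\<lambda>z. (fbb z * g z + fb z * gb z) + (fb z * gb z + f z * gbb z))"
proof -
  note f = C2wD[OF assms(1)] and g = C2wD[OF assms(2)]
  show ?thesis unfolding C2w_def
    by (intro conjI allI wdv_add wdv_mult continuous_intros f g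
        wdv_cong[OF wdv_add[OF wdv_mult[OF f(3) g(1)] wdv_mult[OF f(1) g(3)]]]; simp add: algebra_simps)
qed

lemma C2w_const: "C2w (\<lambda>z. c) (\<lambda>z. 0) (\<lambda>z. 0) (\<lambda>z. 0) (\<lambda>z. 0) (\<lambda>z. 0)"
  by (auto simp: C2w_def wdv_const)

lemma C2w_ident: "C2w (\<lambda>z. z) (\<lambda>z. 1) (\<lambda>z. 0) (\<lambda>z. 0) (\<lambda>z. 0) (\<lambda>z. 0)"
  by (auto simp: C2w_def wdv_const wdv_ident)

lemma C2w_radial:
  assumes F: "\<And>s. (F has_real_derivative F' s) (at s)" "\<And>s. (F' has_real_derivative F'' s) (at s)" "continuous_on UNIV F''"
  shows "C2w (\<lambda>z. of_real (F ((cmod (z - a))\<^sup>2))) (\<lambda>z. of_real (F' ((cmod (z - a))\<^sup>2)) * cnj (z - a)) (\<lambda>z. of_real (F' ((cmod (z - a))\<^sup>2)) * (z - a))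
     (\<lambda>z. of_real (F'' ((cmod (z - a))\<^sup>2)) * cnj (z - a) * cnj (z - a))
     (\<lambda>z. of_real (F'' ((cmod (z - a))\<^sup>2)) * (z - a) * cnj (z - a) + of_real (F' ((cmod (z - a))\<^sup>2)))
     (\<lambda>z. of_real (F'' ((cmod (z - a))\<^sup>2)) * (z - a) * (z - a))"
proof -
  have w: "wdv (\<lambda>z. z - a) 1 0 z" for z using wdv_diff[OF wdv_ident wdv_const, of a z] by simp
  have wc: "wdv (\<lambda>z. cnj (z - a)) 0 1 z" for z using wdv_cnj[OF w, of z] by simp
  have Q: "wdv (\<lambda>z. of_real ((cmod (z - a))\<^sup>2)) (cnj (z - a)) (z - a) z" for z
  proof -
    have eq: "complex_of_real ((cmod (z - a))\<^sup>2) = (z - a) * cnj (z - a)" for z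
      by (simp only: complex_norm_square)
    show ?thesis unfolding eq using wdv_mult[OF w wc, of z] by simp
  qed
  have cF': "continuous_on UNIV F'" using F(2) by (meson DERIV_continuous_on has_field_derivative_at_within)
  have F1: "wdv (\<lambda>z. of_real (F ((cmod (z - a))\<^sup>2))) (of_real (F' ((cmod (z - a))\<^sup>2)) * cnj (z - a)) (of_real (F' ((cmod (z - a))\<^sup>2)) * (z - a)) z" for z
    by (rule wdv_real_compose[OF Q F(1)])
  have F2: "wdv (\<lambda>z. of_real (F' ((cmod (z - a))\<^sup>2))) (of_real (F'' ((cmod (z - a))\<^sup>2)) * cnj (z - a)) (of_real (F'' ((cmod (z - a))\<^sup>2)) * (z - a)) z" for z
    by (rule wdv_real_compose[OF Q F(2)])
  have "wdv (\<lambda>z. of_real (F' ((cmod (z - a))\<^sup>2)) * cnj (z - a)) (of_real (F'' ((cmod (z - a))\<^sup>2)) * cnj (z - a) * cnj (z - a))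
     (of_real (F'' ((cmod (z - a))\<^sup>2)) * (z - a) * cnj (z - a) + of_real (F' ((cmod (z - a))\<^sup>2))) z" for z
    using wdv_mult[OF F2 wc, of z] by simp
  moreover have "wdv (\<lambda>z. of_real (F' ((cmod (z - a))\<^sup>2)) * (z - a)) (of_real (F'' ((cmod (z - a))\<^sup>2)) * (z - a) * cnj (z - a) + of_real (F' ((cmod (z - a))\<^sup>2)))
     (of_real (F'' ((cmod (z - a))\<^sup>2)) * (z - a) * (z - a)) z" for z
    by (rule wdv_cong[OF wdv_mult[OF F2 w, of z]]) (simp_all add: mult_ac)
  moreover have "continuous_on UNIV (\<lambda>z. G ((cmod (z - a))\<^sup>2))" if "continuous_on UNIV G" for G :: "real \<Rightarrow> real"
    by (rule continuous_on_compose2[OF that]) (auto intro!: continuous_intros)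
  ultimately show ?thesis unfolding C2w_def using F1 F(3) cF' by (auto intro!: continuous_intros)
qed

text \<open>The dual side of the extension problem. A holomorphic F pairs with \<open>g\<close> to -
  pi F(0) \<gamma>(0), so these pairs test holomorphy and the value at the origin at once. A support
  radius strictly below \<open>R\<close> keeps the pair away from the circle on which the multiplier
  1 / (1 - |z|^2 / R^2) is singular.\<close>

definition tst :: "real \<Rightarrow> (complex \<Rightarrow> complex) \<Rightarrow> (complex \<Rightarrow> complex) \<Rightarrow> bool" where
  "tst R \<gamma> g \<longleftrightarrow> (\<exists>r \<gamma>z \<gamma>b \<gamma>zz \<gamma>zb \<gamma>bb. 0 < r \<and> r < R \<and> C2w \<gamma> \<gamma>z \<gamma>b \<gamma>zz \<gamma>zb \<gamma>bb \<and> (\<forall>z. \<gamma>b z = z * g z) \<and>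
     continuous_on UNIV g \<and> (\<forall>z. z \<notin> cball 0 r \<longrightarrow> \<gamma> z = 0 \<and> g z = 0))"

lemma tst_continuous: "tst R \<gamma> g \<Longrightarrow> continuous_on UNIV g" and tst_support: "tst R \<gamma> g \<Longrightarrow> z \<notin> cball 0 R \<Longrightarrow> g z = 0"
  by (auto simp: tst_def)

lemma tst_lin:
  assumes "tst R \<gamma> g" "tst R \<gamma>' g'"
  shows "tst R (\<lambda>z. \<gamma> z + a * \<gamma>' z) (\<lambda>z. g z + a * g' z)"
proof -
  obtain r \<gamma>z \<gamma>b \<gamma>zz \<gamma>zb \<gamma>bb where 1: "0 < r" "r < R" "C2w \<gamma> \<gamma>z \<gamma>b \<gamma>zz \<gamma>zb \<gamma>bb" "\<And>z. \<gamma>b z = z * g z"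
     "continuous_on UNIV g" "\<And>z. z \<notin> cball 0 r \<Longrightarrow> \<gamma> z = 0 \<and> g z = 0" using assms(1) unfolding tst_def by blast
  obtain r' \<gamma>z' \<gamma>b' \<gamma>zz' \<gamma>zb' \<gamma>bb' where 2: "0 < r'" "r' < R" "C2w \<gamma>' \<gamma>z' \<gamma>b' \<gamma>zz' \<gamma>zb' \<gamma>bb'" "\<And>z. \<gamma>b' z = z * g' z"
     "continuous_on UNIV g'" "\<And>z. z \<notin> cball 0 r' \<Longrightarrow> \<gamma>' z = 0 \<and> g' z = 0" using assms(2) unfolding tst_def by blast
  note C = C2w_add[OF 1(3) C2w_mult[OF C2w_const[of a] 2(3)]]
  show ?thesis unfolding tst_def
  proof (intro exI[of _ "max r r'"] exI conjI)
    show "C2w (\<lambda>z. \<gamma> z + a * \<gamma>' z) (\<lambda>z. \<gamma>z z + (0 * \<gamma>' z + a * \<gamma>z' z)) (\<lambda>z. \<gamma>b z + (0 * \<gamma>' z + a * \<gamma>b' z))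
       (\<lambda>z. \<gamma>zz z + (0 * \<gamma>' z + 0 * \<gamma>z' z + (0 * \<gamma>z' z + a * \<gamma>zz' z)))
       (\<lambda>z. \<gamma>zb z + (0 * \<gamma>' z + 0 * \<gamma>b' z + (0 * \<gamma>z' z + a * \<gamma>zb' z)))
       (\<lambda>z. \<gamma>bb z + (0 * \<gamma>' z + 0 * \<gamma>b' z + (0 * \<gamma>b' z + a * \<gamma>bb' z)))"
      by (rule C)
    show "\<forall>z. \<gamma>b z + (0 * \<gamma>' z + a * \<gamma>b' z) = z * (g z + a * g' z)" by (simp add: 1 2 algebra_simps)
    show "continuous_on UNIV (\<lambda>z. g z + a * g' z)" by (intro continuous_intros 1 2)
  qed (use 1 2 in auto)
qed

text \<open>The auxiliary inequality with c = 1 / R^2 is applied to \<beta> = \<gamma> m, where m =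
  1 / (1 - c |z|^2). Then d-bar \<beta> = z b with b = g m + c \<gamma> m^2, and (1 - c |z|^2) b - c
  \<beta> collapses to g. Since m = 1 at the origin, the value at 0 is unchanged.\<close>

lemma core_inequality:
  fixes \<phi> lap :: "complex \<Rightarrow> real" and p pp :: "complex \<Rightarrow> complex"
  assumes \<phi>: "\<And>z. wdv (\<lambda>z. of_real (\<phi> z)) (p z) (cnj (p z)) z" "\<And>z. wdv p (pp z) (of_real (lap z)) z"
      "continuous_on UNIV pp" "continuous_on UNIV lap"
    and lap: "\<And>z. z \<in> ball 0 R \<Longrightarrow> lap z \<ge> 0" and t: "tst R \<gamma> g"
  shows "pi / R\<^sup>2 * (cmod (\<gamma> 0))\<^sup>2 * exp (\<phi> 0) \<le> (\<integral>z. (cmod (g z))\<^sup>2 * exp (\<phi> z) \<partial>lborel)"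
proof -
  obtain r \<gamma>z \<gamma>b \<gamma>zz \<gamma>zb \<gamma>bb where 1: "0 < r" "r < R" "C2w \<gamma> \<gamma>z \<gamma>b \<gamma>zz \<gamma>zb \<gamma>bb" "\<And>z. \<gamma>b z = z * g z"
     "continuous_on UNIV g" "\<And>z. z \<notin> cball 0 r \<Longrightarrow> \<gamma> z = 0 \<and> g z = 0" using t unfolding tst_def by blast
  note \<gamma> = C2wD[OF 1(3)]
  have out: "\<gamma> z = 0" "g z = 0" "\<gamma>z z = 0" "\<gamma>b z = 0" "\<gamma>zz z = 0" "\<gamma>zb z = 0" "\<gamma>bb z = 0" if "z \<in> - cball 0 r" for z
  proof -
    have z: "z \<notin> cball 0 r" using that by auto
    have g0: "\<And>z. z \<notin> cball 0 r \<Longrightarrow> \<gamma> z = 0" using 1(6) by blast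
    show "\<gamma> z = 0" "g z = 0" "\<gamma>z z = 0" "\<gamma>b z = 0" "\<gamma>zz z = 0" "\<gamma>zb z = 0" "\<gamma>bb z = 0"
      using 1(6)[OF z] C2w_zero_outside[OF 1(3) g0 z] by auto
  qed
  define c where "c = 1 / R\<^sup>2"
  have c: "c > 0" using 1 by (simp add: c_def)
  have cR: "c * R\<^sup>2 = 1" using 1 by (simp add: c_def)
  define d where "d z = 1 - c * (cmod z)\<^sup>2" for z
  have d: "d z > 0" if "z \<in> ball 0 R" for z
  proof -
    have "(cmod z)\<^sup>2 < R\<^sup>2" using that by (intro power_strict_mono) auto
    then have "c * (cmod z)\<^sup>2 < c * R\<^sup>2" using c by simp
    then show ?thesis using cR by (simp add: d_def)
  qed
  define m where "m z = complex_of_real (1 / d z)" for z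
  have wd: "wdv (\<lambda>z. of_real (d z)) (- of_real c * cnj z) (- of_real c * z) z" for z
  proof -
    have "((\<lambda>q. 1 - c * q) has_real_derivative - c) (at ((cmod z)\<^sup>2))" by (auto intro!: derivative_eq_intros)
    from wdv_real_compose[OF wdv_norm_sq this] show ?thesis by (simp add: d_def)
  qed
  have wm: "wdv m (of_real c * cnj z * m z * m z) (of_real c * z * m z * m z) z" if "z \<in> ball 0 R" for z
  proof -
    have "((\<lambda>q. 1 / q) has_real_derivative - (1 / d z * (1 / d z))) (at (d z))"
      using d[OF that] by (auto intro!: derivative_eq_intros simp: power2_eq_square)
    from wdv_real_compose[OF wd this] show ?thesis
      unfolding m_def[abs_def] by (rule wdv_cong) (simp_all add: mult_ac)
  qed
  define mz mb where "mz z = of_real c * cnj z * m z * m z" and "mb z = of_real c * z * m z * m z" for z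
  note wm' = wm[folded mz_def mb_def]
  define mzz where "mzz z = ((0 * cnj z + of_real c * cnj 0) * m z + of_real c * cnj z * mz z) * m z + of_real c * cnj z * m z * mz z" for z
  define mzb where "mzb z = ((0 * cnj z + of_real c * cnj 1) * m z + of_real c * cnj z * mb z) * m z + of_real c * cnj z * m z * mb z" for z
  define mbb where "mbb z = ((0 * z + of_real c * 0) * m z + of_real c * z * mb z) * m z + of_real c * z * m z * mb z" for z
  have wmz: "wdv mz (mzz z) (mzb z) z" if "z \<in> ball 0 R" for z
    unfolding mz_def[abs_def] mzz_def mzb_def
    by (intro wdv_mult wdv_const wdv_cnj wdv_ident) (use wm'[OF that] in \<open>simp_all add: mz_def mb_def\<close>)
  have wmb: "wdv mb (mzb z) (mbb z) z" if "z \<in> ball 0 R" for z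
  proof -
    have "wdv mb (((0 * z + of_real c * 1) * m z + of_real c * z * mz z) * m z + of_real c * z * m z * mz z) (mbb z) z"
      unfolding mb_def[abs_def] mbb_def
      by (intro wdv_mult wdv_const wdv_cnj wdv_ident) (use wm'[OF that] in \<open>simp_all add: mz_def mb_def\<close>)
    then show ?thesis by (rule wdv_cong) (simp_all add: mzb_def mz_def mb_def mult_ac)
  qed
  have cm: "continuous_on (ball 0 R) m"
    unfolding m_def[abs_def] d_def[abs_def] using d by (intro continuous_intros) (auto simp: d_def less_imp_neq[symmetric])
  have cmz: "continuous_on (ball 0 R) mz" "continuous_on (ball 0 R) mb" "continuous_on (ball 0 R) mzz" "continuous_on (ball 0 R) mzb" "continuous_on (ball 0 R) mbb"
    unfolding mzz_def[abs_def] mzb_def[abs_def] mbb_def[abs_def] mz_def[abs_def] mb_def[abs_def] by (intro continuous_intros cm)+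
  have cov: "ball 0 R \<union> - cball 0 r = (UNIV :: complex set)" using 1 by auto
  \<comment> \<open>The multiplier is singular on the circle of radius \<open>R\<close>. Continuity
    on the plane follows from two open sets that cover it, on the second of which all products with
    derivatives of \<gamma> vanish.\<close>
  have glue: "continuous_on UNIV F" if "continuous_on (ball 0 R) F" "\<And>z. z \<in> - cball 0 r \<Longrightarrow> F z = 0" for F :: "complex \<Rightarrow> complex"
  proof -
    have "continuous_on (- cball 0 r) F"
      by (rule continuous_on_eq[OF continuous_on_const[of _ 0]]) (rule that(2)[symmetric])
    from continuous_on_open_Un[OF _ _ that(1) this] show ?thesis unfolding cov by auto
  qed
  define \<beta> where "\<beta> z = \<gamma> z * m z" for z
  define \<beta>z where "\<beta>z z = \<gamma>z z * m z + \<gamma> z * mz z" for z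
  define \<beta>b where "\<beta>b z = \<gamma>b z * m z + \<gamma> z * mb z" for z
  define \<beta>zz where "\<beta>zz z = (\<gamma>zz z * m z + \<gamma>z z * mz z) + (\<gamma>z z * mz z + \<gamma> z * mzz z)" for z
  define \<beta>zb where "\<beta>zb z = (\<gamma>zb z * m z + \<gamma>z z * mb z) + (\<gamma>b z * mz z + \<gamma> z * mzb z)" for z
  define \<beta>bb where "\<beta>bb z = (\<gamma>bb z * m z + \<gamma>b z * mb z) + (\<gamma>b z * mb z + \<gamma> z * mbb z)" for z
  have ext: "wdv F (p' z) (q' z) z" if "\<And>z. z \<in> ball 0 R \<Longrightarrow> wdv F (p' z) (q' z) z"
      "\<And>z. z \<in> - cball 0 r \<Longrightarrow> F z = 0 \<and> p' z = 0 \<and> q' z = 0" for F p' q' :: "complex \<Rightarrow> complex" and z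
  proof (cases "z \<in> ball 0 R")
    case False
    then have "z \<in> - cball 0 r" using cov by blast
    moreover have "wdv F 0 0 z"
      by (rule wdv_local[OF wdv_const[of 0], of "- cball 0 r"]) (use calculation that(2) in auto)
    ultimately show ?thesis using that(2)[of z] by simp
  qed (use that in auto)
  have b1: "wdv \<beta> (\<beta>z z) (\<beta>b z) z" for z
    by (rule ext) (auto simp: \<beta>_def[abs_def] \<beta>z_def \<beta>b_def out intro!: wdv_mult \<gamma> wm')
  have b2: "wdv \<beta>z (\<beta>zz z) (\<beta>zb z) z" for z
  proof (rule ext)
    fix z :: complex assume z: "z \<in> ball 0 R"
    show "wdv \<beta>z (\<beta>zz z) (\<beta>zb z) z" unfolding \<beta>z_def[abs_def] \<beta>zz_def \<beta>zb_def
      by (intro wdv_add wdv_mult \<gamma> wm'[OF z] wmz[OF z])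
  qed (auto simp: \<beta>z_def \<beta>zz_def \<beta>zb_def out)
  have b3: "wdv \<beta>b (\<beta>zb z) (\<beta>bb z) z" for z
  proof (rule ext)
    fix z :: complex assume z: "z \<in> ball 0 R"
    show "wdv \<beta>b (\<beta>zb z) (\<beta>bb z) z" unfolding \<beta>b_def[abs_def]
      by (rule wdv_cong[OF wdv_add[OF wdv_mult[OF \<gamma>(3) wm'[OF z]] wdv_mult[OF \<gamma>(1) wmb[OF z]]]])
        (simp_all add: \<beta>bb_def \<beta>zb_def)
  qed (auto simp: \<beta>b_def \<beta>zb_def \<beta>bb_def out)
  have sub: "continuous_on (ball 0 R) F" if "continuous_on UNIV F" for F :: "complex \<Rightarrow> complex"
    using that continuous_on_subset by blast
  note gc = \<gamma>(4)[THEN sub] \<gamma>(5)[THEN sub] \<gamma>(6)[THEN sub] \<gamma>(7)[THEN sub] \<gamma>(8)[THEN sub] \<gamma>(9)[THEN sub] 1(5)[THEN sub]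
  have czz: "continuous_on UNIV \<beta>zz"
  proof (rule glue)
    show "continuous_on (ball 0 R) \<beta>zz" unfolding \<beta>zz_def[abs_def] by (intro continuous_intros gc cm cmz)
    show "\<beta>zz z = 0" if "z \<in> - cball 0 r" for z using out[OF that] by (simp add: \<beta>zz_def)
  qed
  have czb: "continuous_on UNIV \<beta>zb"
  proof (rule glue)
    show "continuous_on (ball 0 R) \<beta>zb" unfolding \<beta>zb_def[abs_def] by (intro continuous_intros gc cm cmz)
    show "\<beta>zb z = 0" if "z \<in> - cball 0 r" for z using out[OF that] by (simp add: \<beta>zb_def)
  qed
  have cbb: "continuous_on UNIV \<beta>bb"
  proof (rule glue)
    show "continuous_on (ball 0 R) \<beta>bb" unfolding \<beta>bb_def[abs_def] by (intro continuous_intros gc cm cmz)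
    show "\<beta>bb z = 0" if "z \<in> - cball 0 r" for z using out[OF that] by (simp add: \<beta>bb_def)
  qed
  define b where "b z = g z * m z + of_real c * \<gamma> z * m z * m z" for z
  have cbc: "continuous_on UNIV b"
  proof (rule glue)
    show "continuous_on (ball 0 R) b" unfolding b_def[abs_def] by (intro continuous_intros gc cm cmz)
    show "b z = 0" if "z \<in> - cball 0 r" for z using out[OF that] by (simp add: b_def)
  qed
  have bb: "\<beta>b z = z * b z" for z
    by (simp add: \<beta>b_def b_def 1 mb_def algebra_simps)
  have sp: "\<beta> z = 0" "b z = 0" if "z \<notin> cball 0 r" for z using out that by (auto simp: \<beta>_def b_def)
  have "pi * c * (cmod (\<beta> 0))\<^sup>2 * exp (\<phi> 0)
    \<le> (\<integral>z. (cmod ((1 - of_real (c * (cmod z)\<^sup>2)) * b z - of_real c * \<beta> z))\<^sup>2 * exp (\<phi> z) \<partial>lborel)"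
    by (rule core_inequality_aux[OF \<phi> b1 b2 b3 czz czb cbb sp _ bb cbc c]) (use lap 1 in auto)
  moreover have "(1 - of_real (c * (cmod z)\<^sup>2)) * b z - of_real c * \<beta> z = g z" for z
  proof (cases "z \<in> ball 0 R")
    case True
    have e: "1 - of_real (c * (cmod z)\<^sup>2) = complex_of_real (d z)" by (simp add: d_def)
    have dm: "of_real (d z) * m z = 1" using d[OF True] by (simp add: m_def)
    have "of_real (d z) * b z - of_real c * \<beta> z = (of_real (d z) * m z) * g z + of_real c * \<gamma> z * m z * (of_real (d z) * m z) - of_real c * \<gamma> z * m z"
      by (simp add: b_def \<beta>_def algebra_simps)
    then show ?thesis unfolding e dm by simp
  next
    case False
    then have "z \<in> - cball 0 r" using cov by blast
    then show ?thesis using out by (simp add: b_def \<beta>_def)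
  qed
  ultimately show ?thesis by (simp add: \<beta>_def m_def d_def c_def)
qed

section \<open>Convolution\<close>

definition conv :: "('a::euclidean_space \<Rightarrow> 'b::{real_normed_field, banach, second_countable_topology}) \<Rightarrow> ('a \<Rightarrow> 'b) \<Rightarrow> 'a \<Rightarrow> 'b" where
  "conv u k x = (\<integral>y. u y * k (x - y) \<partial>lborel)"

definition loc_bounded :: "('a::euclidean_space \<Rightarrow> 'b::real_normed_vector) \<Rightarrow> bool" where
  "loc_bounded u \<longleftrightarrow> (\<forall>R. \<exists>B. \<forall>y\<in>cball 0 R. norm (u y) \<le> B)"

lemma loc_bounded_cball:
  assumes "loc_bounded u"
  obtains B where "B > 0" "\<And>y. y \<in> cball x d \<Longrightarrow> norm (u y) \<le> B"
proof -
  obtain B where B: "\<forall>y\<in>cball 0 (norm x + d). norm (u y) \<le> B" using assms unfolding loc_bounded_def by blast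
  have "norm (u y) \<le> max B 1" if "y \<in> cball x d" for y
  proof -
    have "norm y \<le> norm x + norm (y - x)" by (rule norm_triangle_sub)
    then have "y \<in> cball 0 (norm x + d)" using that by (simp add: dist_norm norm_minus_commute)
    then show ?thesis using B by fastforce
  qed
  then show ?thesis using that[of "max B 1"] by auto
qed

lemma loc_bounded_continuous: "continuous_on UNIV u \<Longrightarrow> loc_bounded (u :: 'a::euclidean_space \<Rightarrow> 'b::real_normed_vector)"
  unfolding loc_bounded_def
proof
  fix R assume u: "continuous_on UNIV u"
  have "bounded (u ` cball 0 R)"
    by (intro compact_imp_bounded compact_continuous_image continuous_on_subset[OF u]) auto
  then show "\<exists>B. \<forall>y\<in>cball 0 R. norm (u y) \<le> B" by (auto simp: bounded_iff)
qed

lemma conv_integrable: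
  fixes u k :: "'a::euclidean_space \<Rightarrow> 'b::{real_normed_field, banach, second_countable_topology}"
  assumes u: "u \<in> borel_measurable borel" "loc_bounded u"
    and k: "continuous_on UNIV k" "\<And>w. w \<notin> cball 0 d \<Longrightarrow> k w = 0"
  shows "integrable lborel (\<lambda>y. u y * k (x - y))"
proof -
  obtain B where B: "B > 0" "\<And>y. y \<in> cball x d \<Longrightarrow> norm (u y) \<le> B" using loc_bounded_cball[OF u(2)] by blast
  obtain K where K: "K > 0" "\<And>w. norm (k w) \<le> K" using compact_support_bounded[OF k] by blast
  have [measurable]: "u \<in> borel_measurable borel" "k \<in> borel_measurable borel" using u k by auto
  show ?thesis
  proof (rule Bochner_Integration.integrable_bound)
    show "integrable lborel (\<lambda>y. B * K * indicator (cball x d) y)"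
      by (rule integrable_mult_right, rule integrable_real_indicator)
        (use emeasure_lborel_cball_finite[of x d] in \<open>auto simp: less_top\<close>)
    show "AE y in lborel. norm (u y * k (x - y)) \<le> norm (B * K * indicator (cball x d) y)"
    proof (rule AE_I2)
      fix y
      show "norm (u y * k (x - y)) \<le> norm (B * K * indicator (cball x d) y)"
      proof (cases "y \<in> cball x d")
        case True
        then show ?thesis using B K by (simp add: norm_mult mult_mono less_imp_le)
      next
        case False
        then have "x - y \<notin> cball 0 d" by (auto simp: dist_norm norm_minus_commute)
        then show ?thesis using k(2) by simp
      qed
    qed
  qed auto
qed

lemma conv_bound:
  fixes u k :: "'a::euclidean_space \<Rightarrow> 'b::{real_normed_field, banach, second_countable_topology}"
  assumes u: "u \<in> borel_measurable borel" "\<And>y. y \<in> cball x d \<Longrightarrow> norm (u y) \<le> B"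
    and k: "k \<in> borel_measurable borel" "\<And>w. norm (k w) \<le> K" "\<And>w. w \<notin> cball 0 d \<Longrightarrow> k w = 0" and "B \<ge> 0" "K \<ge> 0"
  shows "norm (\<integral>y. u y * k (x - y) \<partial>lborel) \<le> B * K * measure lborel (cball x d)"
proof -
  have i: "integrable lborel (\<lambda>y. B * K * indicator (cball x d) y)"
    by (rule integrable_mult_right, rule integrable_real_indicator)
       (use emeasure_lborel_cball_finite[of x d] in \<open>auto simp: less_top\<close>)
  have le: "norm (u y * k (x - y)) \<le> B * K * indicator (cball x d) y" for y
  proof (cases "y \<in> cball x d")
    case True
    then show ?thesis using u(2)[OF True] k(2)[of "x - y"] assms(6,7) by (simp add: norm_mult mult_mono)
  next
    case False
    then have "x - y \<notin> cball 0 d" by (auto simp: dist_norm norm_minus_commute)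
    then show ?thesis using k(3) assms(6,7) by simp
  qed
  have [measurable]: "u \<in> borel_measurable borel" "k \<in> borel_measurable borel" using u k by auto
  have "integrable lborel (\<lambda>y. u y * k (x - y))"
    by (rule Bochner_Integration.integrable_bound[OF i]) (auto intro: order_trans[OF le] intro!: AE_I2)
  then have "norm (\<integral>y. u y * k (x - y) \<partial>lborel) \<le> (\<integral>y. B * K * indicator (cball x d) y \<partial>lborel)"
    by (rule Bochner_Integration.integral_norm_bound_integral) (use i le in auto)
  also have "\<dots> = B * K * measure lborel (cball x d)" by simp
  finally show ?thesis .
qed

lemma conv_continuous:
  fixes u k :: "'a::euclidean_space \<Rightarrow> 'b::{real_normed_field, banach, second_countable_topology}"
  assumes u: "u \<in> borel_measurable borel" "loc_bounded u"
    and k: "continuous_on UNIV k" "\<And>w. w \<notin> cball 0 d \<Longrightarrow> k w = 0"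
  shows "continuous_on UNIV (conv u k)"
proof -
  obtain K where K: "K > 0" "\<And>w. norm (k w) \<le> K" using compact_support_bounded[OF k] by blast
  have [measurable]: "u \<in> borel_measurable borel" "k \<in> borel_measurable borel" using u k by auto
  have "isCont (conv u k) x" for x
  proof -
    obtain B where B: "B > 0" "\<And>y. y \<in> cball x (d + 1) \<Longrightarrow> norm (u y) \<le> B" using loc_bounded_cball[OF u(2)] by blast
    have "((\<lambda>x. \<integral>y. u y * k (x - y) \<partial>lborel) \<longlongrightarrow> (\<integral>y. u y * k (x - y) \<partial>lborel)) (at x)"
    proof (rule tendsto_at_iff_sequentially[THEN iffD2], intro allI impI)
      fix X assume X: "\<forall>i. X i \<in> UNIV - {x}" "X \<longlonglongrightarrow> x"
      obtain N where N: "\<And>n. n \<ge> N \<Longrightarrow> dist (X n) x < 1" using X(2) metric_LIMSEQ_D[of X x 1] by auto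
      have "(\<lambda>n. \<integral>y. u y * k (X (n + N) - y) \<partial>lborel) \<longlonglongrightarrow> (\<integral>y. u y * k (x - y) \<partial>lborel)"
      proof (rule integral_dominated_convergence[where w="\<lambda>y. B * K * indicator (cball x (d + 1)) y"])
        show "integrable lborel (\<lambda>y. B * K * indicator (cball x (d + 1)) y)"
          by (rule integrable_mult_right, rule integrable_real_indicator)
            (use emeasure_lborel_cball_finite[of x "d + 1"] in \<open>auto simp: less_top\<close>)
        show "AE y in lborel. (\<lambda>n. u y * k (X (n + N) - y)) \<longlonglongrightarrow> u y * k (x - y)"
        proof (rule AE_I2)
          fix y
          have "(\<lambda>n. X (n + N) - y) \<longlonglongrightarrow> x - y" by (intro tendsto_intros LIMSEQ_ignore_initial_segment X)
          then have "(\<lambda>n. k (X (n + N) - y)) \<longlonglongrightarrow> k (x - y)"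
            using continuous_on_tendsto_compose[OF k(1)] by simp
          then show "(\<lambda>n. u y * k (X (n + N) - y)) \<longlonglongrightarrow> u y * k (x - y)" by (intro tendsto_intros)
        qed
        show "AE y in lborel. norm (u y * k (X (n + N) - y)) \<le> B * K * indicator (cball x (d + 1)) y" for n
        proof (rule AE_I2)
          fix y
          show "norm (u y * k (X (n + N) - y)) \<le> B * K * indicator (cball x (d + 1)) y"
          proof (cases "y \<in> cball x (d + 1)")
            case True
            then show ?thesis using B K by (simp add: norm_mult mult_mono less_imp_le)
          next
            case False
            have "dist x y \<le> dist (X (n + N)) x + dist (X (n + N)) y" by (rule dist_triangle3)
            then have "X (n + N) - y \<notin> cball 0 d" using False N[of "n + N"] by (auto simp: dist_norm norm_minus_commute)
            then show ?thesis using k(2) B K by (simp add: less_imp_le)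
          qed
        qed
      qed auto
      then show "((\<lambda>x. \<integral>y. u y * k (x - y) \<partial>lborel) \<circ> X) \<longlonglongrightarrow> (\<integral>y. u y * k (x - y) \<partial>lborel)"
        unfolding o_def by (rule LIMSEQ_offset)
    qed
    then show ?thesis unfolding isCont_def conv_def .
  qed
  then show ?thesis by (simp add: continuous_on_eq_continuous_at)
qed

text \<open>All regularity sits in the kernel: uniform continuity of its differential bounds the
  first-order Taylor remainder of \<open>k\<close> uniformly by o(|h|), and integration against the
  locally bounded \<open>u\<close> costs only a supremum and the volume of a ball.\<close>

lemma conv_has_derivative:
  fixes u k :: "'a::euclidean_space \<Rightarrow> 'b::{real_normed_field, banach, second_countable_topology}"
  assumes u: "u \<in> borel_measurable borel" "loc_bounded u"
    and k: "\<And>w. (k has_derivative k' w) (at w)" "\<And>w. w \<notin> cball 0 d \<Longrightarrow> k w = 0"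
    and k': "\<And>h. continuous_on UNIV (\<lambda>w. k' w h)"
      "\<And>e. e > 0 \<Longrightarrow> \<exists>\<eta>>0. \<forall>w w'. dist w w' < \<eta> \<longrightarrow> (\<forall>h. norm (k' w h - k' w' h) \<le> e * norm h)"
  shows "(conv u k has_derivative (\<lambda>h. conv u (\<lambda>w. k' w h) x)) (at x)"
proof -
  have ck: "continuous_on UNIV k" using k(1) has_derivative_continuous_on[of UNIV k k'] by simp
  have k'0: "k' w h = 0" if "w \<notin> cball 0 d" for w h
  proof -
    have "((\<lambda>x. 0) has_derivative k' w) (at w)"
    proof (rule has_derivative_transform_within_open[OF k(1)])
      show "open (- cball (0::'a) d)" by auto
    qed (use that k(2) in auto)
    then have "k' w = (\<lambda>h. 0)" using has_derivative_unique has_derivative_const by blast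
    then show ?thesis by simp
  qed
  have lin: "linear (k' w)" for w using k(1) has_derivative_linear by blast
  have [measurable]: "u \<in> borel_measurable borel" "k \<in> borel_measurable borel" "(\<lambda>w. k' w h) \<in> borel_measurable borel" for h
    using u ck k' by auto
  have int: "integrable lborel (\<lambda>y. u y * k (x - y))" for x by (rule conv_integrable[OF u ck k(2)])
  have int': "integrable lborel (\<lambda>y. u y * k' (x - y) h)" for x h by (rule conv_integrable[OF u k'(1) k'0])
  define D where "D h = conv u (\<lambda>w. k' w h) x" for h
  have linD: "linear D"
  proof (rule linearI)
    show "D (a + b) = D a + D b" for a b
      unfolding D_def conv_def using int' by (simp add: linear_add[OF lin] distrib_left)
    show "D (r *\<^sub>R a) = r *\<^sub>R D a" for r a
      unfolding D_def conv_def using int' by (simp add: linear_scale[OF lin])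
  qed
  obtain B where B: "B > 0" "\<And>y. y \<in> cball x (d + 1) \<Longrightarrow> norm (u y) \<le> B" using loc_bounded_cball[OF u(2)] by blast
  \<comment> \<open>The summand 1 keeps \<open>C\<close> positive, so that the accuracy
    \<open>e / C\<close> can be requested from the kernel.\<close>
  define C where "C = B * measure lborel (cball x (d + 1)) + 1"
  have C: "C > 0" using B by (simp add: C_def add_nonneg_pos)
  show ?thesis unfolding has_derivative_at_alt D_def[symmetric]
  proof (intro conjI allI impI)
    show "bounded_linear D" using linD by (simp add: linear_conv_bounded_linear)
    fix e :: real assume e: "e > 0"
    obtain \<eta> where \<eta>: "\<eta> > 0" "\<And>w w' h. dist w w' < \<eta> \<Longrightarrow> norm (k' w h - k' w' h) \<le> (e / C) * norm h"
      using k'(2)[of "e / C"] e C by auto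
    have lin_err: "norm (k (w + h) - k w - k' w h) \<le> norm h * (e / C)" if "norm h < \<eta>" for w h
    proof -
      have "norm (k (w + h) - k w - k' w ((w + h) - w)) \<le> norm ((w + h) - w) * (e / C)"
      proof (rule differentiable_bound_linearization[where S="ball w \<eta>" and f'=k' and a=w and b="w + h" and f=k])
        show "w + t *\<^sub>R (w + h - w) \<in> ball w \<eta>" if "t \<in> {0..1}" for t
          using that \<open>norm h < \<eta>\<close> mult_left_le_one_le[of "norm h" t] by (auto simp: dist_norm)
        show "(k has_derivative k' y) (at y within ball w \<eta>)" for y
          using k(1) has_derivative_at_withinI by blast
        show "onorm (k' y - k' w) \<le> e / C" if "y \<in> ball w \<eta>" for y
          using \<eta>(2)[of y w] that by (intro onorm_le) (auto simp: dist_commute)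
        show "w \<in> ball w \<eta>" using \<eta> by simp
      qed
      then show ?thesis by simp
    qed
    show "\<exists>da>0. \<forall>y. norm (y - x) < da \<longrightarrow> norm (conv u k y - conv u k x - D (y - x)) \<le> e * norm (y - x)"
    proof (intro exI[of _ "min \<eta> 1"] conjI allI impI)
      fix y assume y: "norm (y - x) < min \<eta> 1"
      define h where "h = y - x"
      have h: "norm h < \<eta>" "norm h < 1" using y by (auto simp: h_def)
      define F where "F w = k (w + h) - k w - k' w h" for w
      have "conv u k y - conv u k x - D h = (\<integral>t. u t * k (y - t) - u t * k (x - t) - u t * k' (x - t) h \<partial>lborel)"
        unfolding conv_def D_def using int int' by simp
      also have "\<dots> = (\<integral>t. u t * F (x - t) \<partial>lborel)"
        by (rule Bochner_Integration.integral_cong) (simp_all add: F_def h_def algebra_simps)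
      also have "norm \<dots> \<le> B * (norm h * (e / C)) * measure lborel (cball x (d + 1))"
      proof (rule conv_bound)
        show "F w = 0" if "w \<notin> cball 0 (d + 1)" for w
        proof -
          have "norm w \<le> norm (w + h) + norm h" using norm_triangle_ineq4[of "w + h" h] by simp
          then have "w + h \<notin> cball 0 d" "w \<notin> cball 0 d" using that h by auto
          then show ?thesis using k(2) k'0 by (simp add: F_def)
        qed
        show "norm (F w) \<le> norm h * (e / C)" for w unfolding F_def by (rule lin_err[OF h(1)])
        show "F \<in> borel_measurable borel" unfolding F_def[abs_def] by measurable
      qed (use B e C in auto)
      also have "\<dots> = (e * norm h) * ((C - 1) / C)" by (simp add: C_def)
      also have "\<dots> \<le> (e * norm h) * 1" using e C by (intro mult_left_mono) auto
      finally show "norm (conv u k y - conv u k x - D (y - x)) \<le> e * norm (y - x)" by (simp add: h_def)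
    qed (use \<eta> in auto)
  qed
qed

lemma uniformly_continuous_compact_support:
  fixes f :: "'a::euclidean_space \<Rightarrow> 'b::real_normed_vector"
  assumes f: "continuous_on UNIV f" "\<And>x. x \<notin> cball 0 R \<Longrightarrow> f x = 0" and e: "e > 0"
  obtains \<eta> where "\<eta> > 0" "\<And>x y. dist x y < \<eta> \<Longrightarrow> norm (f x - f y) < e"
proof -
  have "uniformly_continuous_on (cball 0 (R + 1)) f"
    by (rule compact_uniformly_continuous[OF continuous_on_subset[OF f(1)]]) auto
  then obtain \<eta> where \<eta>: "\<eta> > 0" "\<And>x y. x \<in> cball 0 (R + 1) \<Longrightarrow> y \<in> cball 0 (R + 1) \<Longrightarrow> dist y x < \<eta> \<Longrightarrow> dist (f y) (f x) < e"
    using e unfolding uniformly_continuous_on_def by metis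
  have "norm (f x - f y) < e" if "dist x y < min \<eta> 1" for x y
  proof (cases "x \<in> cball 0 R \<or> y \<in> cball 0 R")
    case True
    have "norm x \<le> norm y + dist x y" "norm y \<le> norm x + dist x y"
      by (auto simp: dist_norm norm_triangle_sub) (metis norm_minus_commute norm_triangle_sub)
    then have "x \<in> cball 0 (R + 1)" "y \<in> cball 0 (R + 1)" using True that by auto
    then show ?thesis using \<eta>(2)[of y x] that by (simp add: dist_norm)
  qed (use f(2) e in auto)
  then show ?thesis using that[of "min \<eta> 1"] \<eta>(1) by auto
qed

lemma conv_wdv:
  assumes u: "u \<in> borel_measurable borel" "loc_bounded u"
    and k: "\<And>w. wdv k (kz w) (kb w) w" "\<And>w. w \<notin> cball 0 d \<Longrightarrow> k w = 0"
    and c: "continuous_on UNIV kz" "continuous_on UNIV kb"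
    and s: "\<And>w. w \<notin> cball 0 d \<Longrightarrow> kz w = 0" "\<And>w. w \<notin> cball 0 d \<Longrightarrow> kb w = 0"
  shows "wdv (conv u k) (conv u kz x) (conv u kb x) x"
proof -
  have "(conv u k has_derivative (\<lambda>h. conv u (\<lambda>w. kz w * h + kb w * cnj h) x)) (at x)"
  proof (rule conv_has_derivative[OF u k(1)[unfolded wdv_def] k(2)])
    fix e :: real assume e: "e > 0"
    obtain \<eta>1 where 1: "\<eta>1 > 0" "\<And>x y. dist x y < \<eta>1 \<Longrightarrow> norm (kz x - kz y) < e / 2"
      using uniformly_continuous_compact_support[OF c(1) s(1), where e="e / 2"] e by auto
    obtain \<eta>2 where 2: "\<eta>2 > 0" "\<And>x y. dist x y < \<eta>2 \<Longrightarrow> norm (kb x - kb y) < e / 2"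
      using uniformly_continuous_compact_support[OF c(2) s(2), where e="e / 2"] e by auto
    show "\<exists>\<eta>>0. \<forall>w w'. dist w w' < \<eta> \<longrightarrow> (\<forall>h. norm (kz w * h + kb w * cnj h - (kz w' * h + kb w' * cnj h)) \<le> e * norm h)"
    proof (intro exI[of _ "min \<eta>1 \<eta>2"] conjI allI impI)
      fix w w' h :: complex assume d: "dist w w' < min \<eta>1 \<eta>2"
      have "kz w * h + kb w * cnj h - (kz w' * h + kb w' * cnj h) = (kz w - kz w') * h + (kb w - kb w') * cnj h"
        by (simp add: algebra_simps)
      also have "norm \<dots> \<le> norm (kz w - kz w') * norm h + norm (kb w - kb w') * norm h"
        by (rule order_trans[OF norm_triangle_ineq]) (simp add: norm_mult)
      also have "\<dots> \<le> e / 2 * norm h + e / 2 * norm h"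
        using 1(2)[of w w'] 2(2)[of w w'] d by (intro add_mono mult_right_mono) auto
      finally show "norm (kz w * h + kb w * cnj h - (kz w' * h + kb w' * cnj h)) \<le> e * norm h" by simp
    qed (use 1 2 in auto)
  qed (auto intro!: continuous_intros c)
  moreover have "conv u (\<lambda>w. kz w * h + kb w * cnj h) x = conv u kz x * h + conv u kb x * cnj h" for h
    unfolding conv_def using conv_integrable[OF u c(1) s(1)] conv_integrable[OF u c(2) s(2)]
    by (simp add: distrib_left mult.assoc[symmetric])
  ultimately show ?thesis unfolding wdv_def by simp
qed

text \<open>Truncated powers have truncated powers as derivatives. Composed with |z|^2 they give
  radial bumps of compact support with any prescribed finite smoothness and an explicit
  mass.\<close>

definition ppow :: "real \<Rightarrow> nat \<Rightarrow> real \<Rightarrow> real" where "ppow d n s = (max 0 (d - s)) ^ n"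

lemma ppow_deriv: "(ppow d (Suc (Suc n)) has_real_derivative - (real (Suc (Suc n)) * ppow d (Suc n) s)) (at s)"
proof -
  consider "s < d" | "s > d" | "s = d" by linarith
  then show ?thesis
  proof cases
    case 1
    have "((\<lambda>s. (d - s) ^ Suc (Suc n)) has_real_derivative - (real (Suc (Suc n)) * ppow d (Suc n) s)) (at s)"
    proof -
      have "((\<lambda>s. d - s) has_real_derivative - 1) (at s)" by (auto intro!: derivative_eq_intros)
      from DERIV_power[OF this, of "Suc (Suc n)"] show ?thesis using 1 by (simp add: ppow_def)
    qed
    then show ?thesis
      by (rule has_field_derivative_transform_within_open[of _ _ _ "{..<d}"]) (use 1 in \<open>auto simp: ppow_def\<close>)
  next
    case 2
    have "((\<lambda>s. 0) has_real_derivative - (real (Suc (Suc n)) * ppow d (Suc n) s)) (at s)"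
      using 2 by (auto intro!: derivative_eq_intros simp: ppow_def)
    then show ?thesis
      by (rule has_field_derivative_transform_within_open[of _ _ _ "{d<..}"]) (use 2 in \<open>auto simp: ppow_def\<close>)
  next
    case 3
    have "((\<lambda>h. (ppow d (Suc (Suc n)) (d + h) - ppow d (Suc (Suc n)) d) / h) \<longlongrightarrow> 0) (at 0)"
    proof (rule Lim_null_comparison)
      show "\<forall>\<^sub>F h in at 0. norm ((ppow d (Suc (Suc n)) (d + h) - ppow d (Suc (Suc n)) d) / h) \<le> \<bar>h\<bar> ^ Suc n"
      proof (rule eventually_at_filter[THEN iffD2], rule always_eventually, intro allI impI)
        fix h :: real assume "h \<noteq> 0"
        have "ppow d (Suc (Suc n)) (d + h) \<le> \<bar>h\<bar> ^ Suc (Suc n)" "0 \<le> ppow d (Suc (Suc n)) (d + h)"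
          unfolding ppow_def by (intro power_mono zero_le_power; simp)+
        then show "norm ((ppow d (Suc (Suc n)) (d + h) - ppow d (Suc (Suc n)) d) / h) \<le> \<bar>h\<bar> ^ Suc n"
          using \<open>h \<noteq> 0\<close> by (simp add: ppow_def pos_divide_le_eq mult_ac)
      qed
      have "((\<lambda>h::real. \<bar>h\<bar> ^ Suc n) \<longlongrightarrow> \<bar>0\<bar> ^ Suc n) (at 0)" by (intro tendsto_intros)
      then show "((\<lambda>h::real. \<bar>h\<bar> ^ Suc n) \<longlongrightarrow> 0) (at 0)" by simp
    qed
    then show ?thesis using 3 by (simp add: DERIV_def ppow_def)
  qed
qed

lemma ppow_continuous [continuous_intros]: "continuous_on A f \<Longrightarrow> continuous_on A (\<lambda>x. ppow d n (f x))"
  unfolding ppow_def by (intro continuous_intros)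

lemma ppow_nonneg [simp]: "ppow d n s \<ge> 0" by (simp add: ppow_def)

lemma ppow_zero: "s \<ge> d \<Longrightarrow> ppow d (Suc n) s = 0" by (simp add: ppow_def)

text \<open>The discriminant of a nonnegative Hermitian form, obtained at its minimiser a = -p / Y.
  It serves both as Cauchy-Schwarz and as the orthogonality estimate for near-minimisers.\<close>

lemma quadratic_form_bound:
  fixes p :: complex and X Y :: real
  assumes "\<And>a. 0 \<le> X + 2 * Re (cnj a * p) + (cmod a)\<^sup>2 * Y" "Y \<ge> 0"
  shows "(cmod p)\<^sup>2 \<le> X * Y"
proof (cases "Y = 0")
  case True
  have "(cmod p)\<^sup>2 = 0"
  proof (rule ccontr)
    assume n: "(cmod p)\<^sup>2 \<noteq> 0"
    \<comment> \<open>For Y = 0 the form is affine in \<open>a\<close>; this multiple of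
      \<open>p\<close> would give it the value -1.\<close>
    define t where "t = (X + 1) / (2 * (cmod p)\<^sup>2)"
    have "Re (cnj (- of_real t * p) * p) = - (t * (cmod p)\<^sup>2)"
      unfolding cmod_power2 by (simp add: power2_eq_square algebra_simps)
    then have "0 \<le> X - 2 * (t * (cmod p)\<^sup>2)" using assms(1)[of "- of_real t * p"] True by simp
    then show False using n by (simp add: t_def)
  qed
  then show ?thesis using True by simp
next
  case False
  then have Y: "Y > 0" using assms by simp
  have e1: "Re (cnj (- of_real (1 / Y) * p) * p) = - ((1 / Y) * (cmod p)\<^sup>2)"
    unfolding cmod_power2 by (simp add: power2_eq_square algebra_simps add_divide_distrib)
  have e2: "(cmod (- of_real (1 / Y) * p))\<^sup>2 * Y = (1 / Y) * (cmod p)\<^sup>2"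
    using Y by (simp add: norm_mult norm_divide power_mult_distrib power2_eq_square)
  have "0 \<le> X + 2 * (- ((1 / Y) * (cmod p)\<^sup>2)) + (1 / Y) * (cmod p)\<^sup>2"
    using assms(1)[of "- of_real (1 / Y) * p"] unfolding e1 e2 .
  then have "(cmod p)\<^sup>2 / Y \<le> X" by simp
  then show ?thesis using Y by (simp add: pos_divide_le_eq)
qed

section \<open>The weighted inner product on continuous functions of compact support\<close>

definition wip :: "(complex \<Rightarrow> real) \<Rightarrow> (complex \<Rightarrow> complex) \<Rightarrow> (complex \<Rightarrow> complex) \<Rightarrow> complex" where
  "wip w g h = (\<integral>z. g z * cnj (h z) * of_real (w z) \<partial>lborel)"

definition wn :: "(complex \<Rightarrow> real) \<Rightarrow> (complex \<Rightarrow> complex) \<Rightarrow> real" where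
  "wn w g = (\<integral>z. (cmod (g z))\<^sup>2 * w z \<partial>lborel)"

definition ccs :: "real \<Rightarrow> (complex \<Rightarrow> complex) \<Rightarrow> bool" where
  "ccs R g \<longleftrightarrow> continuous_on UNIV g \<and> (\<forall>z. z \<notin> cball 0 R \<longrightarrow> g z = 0)"

lemma ccs_lin: "ccs R g \<Longrightarrow> ccs R h \<Longrightarrow> ccs R (\<lambda>z. g z + a * h z)"
  by (auto simp: ccs_def intro!: continuous_intros)

lemma wip_integrable:
  assumes "ccs R g" "ccs R h" "continuous_on UNIV w"
  shows "integrable lborel (\<lambda>z. g z * cnj (h z) * of_real (w z))" "integrable lborel (\<lambda>z. (cmod (g z))\<^sup>2 * w z)"
  using assms by (auto simp: ccs_def intro!: integrable_compact_support[of _ R] continuous_intros)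

lemma wn_nonneg: "(\<And>z. w z \<ge> 0) \<Longrightarrow> wn w g \<ge> 0"
  unfolding wn_def by (intro integral_nonneg_AE) auto

lemma wip_self: "wip w g g = of_real (wn w g)"
proof -
  have "g z * cnj (g z) * of_real (w z) = of_real ((cmod (g z))\<^sup>2 * w z)" for z
    by (simp only: of_real_mult complex_norm_square)
  then show ?thesis unfolding wip_def wn_def by (simp only: integral_complex_of_real)
qed

lemma wip_lin:
  assumes "ccs R g" "ccs R g'" "ccs R h" "continuous_on UNIV w"
  shows "wip w (\<lambda>z. g z + a * g' z) h = wip w g h + a * wip w g' h"
proof -
  have "wip w (\<lambda>z. g z + a * g' z) h = (\<integral>z. g z * cnj (h z) * of_real (w z) + a * (g' z * cnj (h z) * of_real (w z)) \<partial>lborel)"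
    unfolding wip_def by (simp add: algebra_simps)
  then show ?thesis unfolding wip_def using wip_integrable[OF assms(1,3,4)] wip_integrable[OF assms(2,3,4)] by simp
qed

lemma wn_lin:
  assumes g: "ccs R g" and h: "ccs R h" and w: "continuous_on UNIV w"
  shows "wn w (\<lambda>z. g z + a * h z) = wn w g + 2 * Re (cnj a * wip w g h) + (cmod a)\<^sup>2 * wn w h"
proof -
  have pt: "(cmod (g z + a * h z))\<^sup>2 * w z = (cmod (g z))\<^sup>2 * w z + 2 * Re (cnj a * (g z * cnj (h z) * of_real (w z))) + (cmod a)\<^sup>2 * ((cmod (h z))\<^sup>2 * w z)" for z
  proof -
    have e1: "(cmod (g z + a * h z))\<^sup>2 = (cmod (g z))\<^sup>2 + 2 * Re (cnj a * (g z * cnj (h z))) + (cmod a)\<^sup>2 * (cmod (h z))\<^sup>2"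
      unfolding cmod_power2 by (simp add: power2_eq_square algebra_simps)
    have e2: "Re (cnj a * (g z * cnj (h z) * of_real (w z))) = Re (cnj a * (g z * cnj (h z))) * w z"
      by (simp add: algebra_simps)
    define r where "r = Re (cnj a * (g z * cnj (h z)))"
    show ?thesis unfolding e1 e2 r_def[symmetric] by (simp add: algebra_simps)
  qed
  have i: "integrable lborel (\<lambda>z. cnj a * (g z * cnj (h z) * of_real (w z)))"
    using wip_integrable[OF assms] by simp
  define S where "S z = Re (cnj a * (g z * cnj (h z) * of_real (w z)))" for z
  have iS: "integrable lborel S" unfolding S_def by (rule integrable_Re[OF i])
  have "wn w (\<lambda>z. g z + a * h z) = wn w g + 2 * (\<integral>z. S z \<partial>lborel) + (cmod a)\<^sup>2 * wn w h"
    unfolding wn_def pt S_def[symmetric] using wip_integrable(2)[OF assms] wip_integrable(2)[OF h g w] iS by simp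
  also have "(\<integral>z. S z \<partial>lborel) = Re (cnj a * wip w g h)"
    unfolding S_def integral_Re[OF i] wip_def by (simp only: integral_mult_right_zero)
  finally show ?thesis .
qed

lemma wip_cauchy_schwarz:
  assumes g: "ccs R g" and h: "ccs R h" and w: "continuous_on UNIV w" "\<And>z. w z \<ge> 0"
  shows "(cmod (wip w g h))\<^sup>2 \<le> wn w g * wn w h"
proof (rule quadratic_form_bound)
  show "0 \<le> wn w g + 2 * Re (cnj a * wip w g h) + (cmod a)\<^sup>2 * wn w h" for a
    using wn_nonneg[where w=w and g="\<lambda>z. g z + a * h z", OF w(2)] wn_lin[OF g h w(1), of a] by simp
qed (rule wn_nonneg[OF w(2)])

text \<open>If no point of the line g + a h has norm square below \<open>m\<close>, the form
  \<open>wn w (g + a h) - m\<close> is nonnegative in \<open>a\<close>. Its discriminant says that a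
  near-minimiser is almost orthogonal to every admissible direction.\<close>

lemma wip_near_minimizer:
  assumes g: "ccs R g" and h: "ccs R h" and w: "continuous_on UNIV w" "\<And>z. w z \<ge> 0"
    and m: "\<And>a. m \<le> wn w (\<lambda>z. g z + a * h z)"
  shows "(cmod (wip w g h))\<^sup>2 \<le> (wn w g - m) * wn w h"
proof (rule quadratic_form_bound)
  show "0 \<le> wn w g - m + 2 * Re (cnj a * wip w g h) + (cmod a)\<^sup>2 * wn w h" for a
    using m[of a] wn_lin[OF g h w(1), of a] by simp
qed (rule wn_nonneg[OF w(2)])

lemma wn_le:
  assumes g: "ccs R g" and w: "continuous_on UNIV w" "\<And>z. w z \<ge> 0" "\<And>z. z \<in> cball 0 R \<Longrightarrow> w z \<le> W"
    and b: "\<And>z. cmod (g z) \<le> B" and W: "W \<ge> 0"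
  shows "wn w g \<le> B\<^sup>2 * W * measure lborel (cball (0::complex) R)"
proof -
  have "wn w g \<le> (\<integral>z. B\<^sup>2 * W * indicator (cball (0::complex) R) z \<partial>lborel)"
    unfolding wn_def
  proof (rule Bochner_Integration.integral_mono)
    show "integrable lborel (\<lambda>z::complex. B\<^sup>2 * W * indicator (cball 0 R) z)"
      by (rule integrable_mult_right, rule integrable_real_indicator)
        (use emeasure_lborel_cball_finite[of "0::complex" R] in \<open>auto simp: less_top\<close>)
    show "(cmod (g z))\<^sup>2 * w z \<le> B\<^sup>2 * W * indicator (cball 0 R) z" for z
    proof (cases "z \<in> cball 0 R")
      case True
      then show ?thesis using b[of z] w(2,3) W by (simp add: mult_mono power_mono)
    next
      case False
      then show ?thesis using g by (simp add: ccs_def)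
    qed
  qed (use wip_integrable(2)[OF g g w(1)] in auto)
  then show ?thesis by simp
qed

text \<open>The mollifier is \<open>bker d A\<close> with \<open>d\<close> the squared radius; \<open>A = 1 / (pi * d ^ 4)\<close> makes its mass 1.\<close>

definition bker :: "real \<Rightarrow> complex \<Rightarrow> complex" where
  "bker d z = of_real (4 / (pi * d ^ 4) * ppow d 3 ((cmod z)\<^sup>2))"
definition bker1 :: "real \<Rightarrow> real \<Rightarrow> real" where
  "bker1 d s = - (12 / (pi * d ^ 4)) * ppow d 2 s"
definition bker2 :: "real \<Rightarrow> real \<Rightarrow> real" where
  "bker2 d s = 24 / (pi * d ^ 4) * ppow d 1 s"

section \<open>The mollifier and its test pairs\<close>

lemma bker_deriv:
  "((\<lambda>s. 4 / (pi * d ^ 4) * ppow d 3 s) has_real_derivative bker1 d s) (at s)"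
  "(bker1 d has_real_derivative bker2 d s) (at s)"
  "((\<lambda>s. 1 / (pi * d ^ 4) * ppow d 4 s) has_real_derivative - (4 / (pi * d ^ 4) * ppow d 3 s)) (at s)"
  "((\<lambda>s. - (4 / (pi * d ^ 4) * ppow d 3 s)) has_real_derivative - bker1 d s) (at s)"
proof -
  have 4: "(ppow d 4 has_real_derivative - (4 * ppow d 3 s)) (at s)"
    using ppow_deriv[of d 2 s] by (simp add: numeral_eq_Suc)
  have 3: "(ppow d 3 has_real_derivative - (3 * ppow d 2 s)) (at s)"
    using ppow_deriv[of d 1 s] by (simp add: numeral_eq_Suc)
  have 2: "(ppow d 2 has_real_derivative - (2 * ppow d 1 s)) (at s)"
    using ppow_deriv[of d 0 s] by (simp add: numeral_eq_Suc)
  show "((\<lambda>s. 4 / (pi * d ^ 4) * ppow d 3 s) has_real_derivative bker1 d s) (at s)"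
    by (rule DERIV_cong[OF DERIV_cmult[OF 3]]) (simp add: bker1_def)
  show "(bker1 d has_real_derivative bker2 d s) (at s)"
    unfolding bker1_def[abs_def] by (rule DERIV_cong[OF DERIV_cmult[OF 2]]) (simp add: bker2_def)
  show "((\<lambda>s. 1 / (pi * d ^ 4) * ppow d 4 s) has_real_derivative - (4 / (pi * d ^ 4) * ppow d 3 s)) (at s)"
    by (rule DERIV_cong[OF DERIV_cmult[OF 4]]) simp
  show "((\<lambda>s. - (4 / (pi * d ^ 4) * ppow d 3 s)) has_real_derivative - bker1 d s) (at s)"
    by (rule DERIV_cong[OF DERIV_minus[OF DERIV_cmult[OF 3]]]) (simp add: bker1_def)
qed

lemma bker_mass:
  assumes d: "d > 0"
  shows "(\<integral>\<^sup>+z. ennreal (cmod (bker d z)) \<partial>lborel) = 1"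
proof -
  define c where "c = 1 / (pi * d ^ 4)"
  have c: "c > 0" using d by (simp add: c_def)
  have "(\<integral>\<^sup>+z. ennreal (cmod (bker d z)) \<partial>lborel) = (\<integral>\<^sup>+z. ennreal (4 * c * ppow d 3 ((cmod z)\<^sup>2)) \<partial>lborel)"
    using c by (intro nn_integral_cong) (simp add: bker_def norm_mult norm_divide norm_power c_def)
  also have "\<dots> = ennreal pi * (\<integral>\<^sup>+s. ennreal (4 * c * ppow d 3 s) * indicator {0..} s \<partial>lborel)"
    by (rule nn_integral_norm_sq) (auto simp: ppow_def)
  also have "(\<integral>\<^sup>+s. ennreal (4 * c * ppow d 3 s) * indicator {0..} s \<partial>lborel) = (\<integral>\<^sup>+s. ennreal (4 * c * ppow d 3 s) * indicator {0..d} s \<partial>lborel)"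
    by (intro nn_integral_cong) (auto simp: indicator_def ppow_def)
  also have "\<dots> = ennreal ((- (c * ppow d 4 d)) - (- (c * ppow d 4 0)))"
  proof (rule nn_integral_FTC_Icc)
    show "((\<lambda>s. - (c * ppow d 4 s)) has_real_derivative 4 * c * ppow d 3 x) (at x)" for x
      using DERIV_minus[OF bker_deriv(3)[of d x]] by (simp add: c_def mult_ac)
  qed (use d c in \<open>auto simp: ppow_def\<close>)
  also have "(- (c * ppow d 4 d)) - (- (c * ppow d 4 0)) = 1 / pi" using d by (simp add: ppow_def c_def)
  also have "ennreal pi * ennreal (1 / pi) = 1" by (simp add: ennreal_mult[symmetric])
  finally show ?thesis .
qed

lemma bker_real: "bker d z = of_real (cmod (bker d z))"
  unfolding bker_def by (simp add: norm_mult norm_divide norm_power abs_mult)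

lemma bker_support: assumes "d > 0" "z \<notin> cball 0 (sqrt d)" shows "bker d z = 0" "bker1 d ((cmod z)\<^sup>2) = 0" "bker2 d ((cmod z)\<^sup>2) = 0"
proof -
  have "sqrt d ^ 2 \<le> (cmod z)\<^sup>2" using assms by (intro power_mono) auto
  then have "(cmod z)\<^sup>2 \<ge> d" using assms by simp
  then show "bker d z = 0" "bker1 d ((cmod z)\<^sup>2) = 0" "bker2 d ((cmod z)\<^sup>2) = 0"
    by (auto simp: bker_def bker1_def bker2_def ppow_def)
qed

lemma bker2_continuous: "continuous_on UNIV (bker2 d)"
  unfolding bker2_def[abs_def] by (intro continuous_intros)

lemmas bker_C2 = C2w_radial[where F="\<lambda>s. 4 / (pi * d ^ 4) * ppow d 3 s" and F'="bker1 d" and F''="bker2 d" for d,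
    OF bker_deriv(1,2) bker2_continuous]

lemma bker_C2_0: "C2w (bker d) (\<lambda>z. of_real (bker1 d ((cmod z)\<^sup>2)) * cnj z) (\<lambda>z. of_real (bker1 d ((cmod z)\<^sup>2)) * z)
     (\<lambda>z. of_real (bker2 d ((cmod z)\<^sup>2)) * cnj z * cnj z)
     (\<lambda>z. of_real (bker2 d ((cmod z)\<^sup>2)) * z * cnj z + of_real (bker1 d ((cmod z)\<^sup>2)))
     (\<lambda>z. of_real (bker2 d ((cmod z)\<^sup>2)) * z * z)"
proof -
  have "bker d = (\<lambda>z. of_real (4 / (pi * d ^ 4) * ppow d 3 ((cmod z)\<^sup>2)))" by (simp add: bker_def fun_eq_iff)
  then show ?thesis using bker_C2[of d 0] unfolding diff_zero by simp
qed

lemma bker_continuous: "continuous_on UNIV (bker d)" "continuous_on UNIV (\<lambda>z. complex_of_real (bker1 d ((cmod z)\<^sup>2)))"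
  unfolding bker_def[abs_def] bker1_def by (intro continuous_intros)+

text \<open>The conjugate derivative of a radial function is z times a radial function, so the bump
  is admissible, with the negative mollifier as its second component. Its value 1/pi at the origin
  is what normalises F(0).\<close>

lemma tst_bump: assumes "0 < d" "sqrt d < R"
  shows "tst R (\<lambda>z. of_real (1 / (pi * d ^ 4) * ppow d 4 ((cmod z)\<^sup>2))) (\<lambda>z. - bker d z)"
  unfolding tst_def
proof (intro exI[of _ "sqrt d"] exI conjI allI impI)
  have c: "continuous_on UNIV (\<lambda>s. - bker1 d s)" unfolding bker1_def by (intro continuous_intros)
  show "C2w (\<lambda>z. of_real (1 / (pi * d ^ 4) * ppow d 4 ((cmod z)\<^sup>2))) (\<lambda>z. of_real (- (4 / (pi * d ^ 4) * ppow d 3 ((cmod z)\<^sup>2))) * cnj z)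
     (\<lambda>z. of_real (- (4 / (pi * d ^ 4) * ppow d 3 ((cmod z)\<^sup>2))) * z)
     (\<lambda>z. of_real (- bker1 d ((cmod z)\<^sup>2)) * cnj z * cnj z)
     (\<lambda>z. of_real (- bker1 d ((cmod z)\<^sup>2)) * z * cnj z + of_real (- (4 / (pi * d ^ 4) * ppow d 3 ((cmod z)\<^sup>2))))
     (\<lambda>z. of_real (- bker1 d ((cmod z)\<^sup>2)) * z * z)"
    using C2w_radial[where a=0, OF bker_deriv(3,4) c] unfolding diff_zero .
  fix z
  show "complex_of_real (- (4 / (pi * d ^ 4) * ppow d 3 ((cmod z)\<^sup>2))) * z = z * - bker d z" by (simp add: bker_def)
  assume z: "z \<notin> cball 0 (sqrt d)"
  have "sqrt d ^ 2 \<le> (cmod z)\<^sup>2" using assms z by (intro power_mono) auto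
  then show "complex_of_real (1 / (pi * d ^ 4) * ppow d 4 ((cmod z)\<^sup>2)) = 0" using assms by (simp add: ppow_def)
  show "- bker d z = 0" using bker_support[OF assms(1) z] by simp
qed (use assms in \<open>auto intro!: continuous_intros bker_continuous\<close>)

text \<open>The holomorphic factor z passes through d-bar and makes the value at the origin 0. The
  second component is, up to sign, the kernel that computes d-bar of a mollified function at the
  point \<open>a\<close>.\<close>

lemma tst_shifted: assumes "0 < d" "cmod a + sqrt d < R"
  shows "tst R (\<lambda>z. z * bker d (z - a)) (\<lambda>z. of_real (bker1 d ((cmod (z - a))\<^sup>2)) * (z - a))"
proof -
  have sup: "z * bker d (z - a) = 0" "of_real (bker1 d ((cmod (z - a))\<^sup>2)) * (z - a) = 0" if "z \<notin> cball 0 (cmod a + sqrt d)" for z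
  proof -
    have "z - a \<notin> cball 0 (sqrt d)" using norm_triangle_sub[of z a] that by auto
    from bker_support[OF assms(1) this]
    show "z * bker d (z - a) = 0" "of_real (bker1 d ((cmod (z - a))\<^sup>2)) * (z - a) = 0" by simp_all
  qed
  have cont: "continuous_on UNIV (\<lambda>z. of_real (bker1 d ((cmod (z - a))\<^sup>2)) * (z - a))"
    unfolding bker1_def by (intro continuous_intros)
  have pos: "0 < cmod a + sqrt d" using assms by (intro add_nonneg_pos) auto
  note C = C2w_mult[OF C2w_ident bker_C2[of d a, folded bker_def]]
  show ?thesis unfolding tst_def
    by (rule exI[of _ "cmod a + sqrt d"], intro exI conjI, rule pos, rule assms(2), rule C)
      (use sup cont in auto)
qed

lemma wip_cnj: "wip w g h = cnj (wip w h g)"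
proof -
  have "cnj (wip w h g) = (\<integral>z. cnj (h z * cnj (g z) * of_real (w z)) \<partial>lborel)"
    unfolding wip_def by (rule Bochner_Integration.integral_cnj[symmetric])
  then show ?thesis by (simp add: wip_def mult_ac)
qed

text \<open>Jensen's inequality for the probability density |bker|, carried out as Cauchy-Schwarz
  after splitting the kernel into two square roots.\<close>

lemma conv_norm_sq_le:
  assumes [measurable]: "u \<in> borel_measurable borel" and d: "d > 0"
  shows "(ennreal (cmod (conv u (bker d) z)))\<^sup>2 \<le> (\<integral>\<^sup>+y. ennreal ((cmod (u y))\<^sup>2) * ennreal (cmod (bker d (z - y))) \<partial>lborel)"
proof -
  have [measurable]: "bker d \<in> borel_measurable borel" using bker_continuous by simp
  define f where "f y = ennreal (cmod (u y) * sqrt (cmod (bker d (z - y))))" for y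
  define g where "g y = ennreal (sqrt (cmod (bker d (z - y))))" for y
  have [measurable]: "f \<in> borel_measurable lborel" "g \<in> borel_measurable lborel" unfolding f_def g_def by measurable
  have "ennreal (cmod (conv u (bker d) z)) \<le> (\<integral>\<^sup>+y. ennreal (cmod (u y * bker d (z - y))) \<partial>lborel)"
  proof (cases "integrable lborel (\<lambda>y. u y * bker d (z - y))")
    case True
    then show ?thesis unfolding conv_def by (rule integral_norm_bound_ennreal)
  \<comment> \<open>A convolution integral that does not converge has the value 0 by convention, so
    the bound persists.\<close>
  qed (simp add: conv_def not_integrable_integral_eq)
  also have "\<dots> = (\<integral>\<^sup>+y. f y * g y \<partial>lborel)"
    by (intro nn_integral_cong) (simp add: f_def g_def norm_mult ennreal_mult[symmetric] mult.assoc)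
  finally have "(ennreal (cmod (conv u (bker d) z)))\<^sup>2 \<le> (\<integral>\<^sup>+y. f y * g y \<partial>lborel)\<^sup>2"
    by (rule power_mono) simp
  also have "\<dots> \<le> (\<integral>\<^sup>+y. (f y)\<^sup>2 \<partial>lborel) * (\<integral>\<^sup>+y. (g y)\<^sup>2 \<partial>lborel)"
    by (rule Cauchy_Schwarz_nn_integral) measurable
  also have "(\<integral>\<^sup>+y. (g y)\<^sup>2 \<partial>lborel) = (\<integral>\<^sup>+y. ennreal (cmod (bker d (z - y))) \<partial>lborel)"
    by (intro nn_integral_cong) (simp add: g_def ennreal_power)
  also have "\<dots> = 1" by (subst nn_integral_lborel_reflect) (simp_all add: bker_mass[OF d])
  also have "(\<integral>\<^sup>+y. (f y)\<^sup>2 \<partial>lborel) = (\<integral>\<^sup>+y. ennreal ((cmod (u y))\<^sup>2) * ennreal (cmod (bker d (z - y))) \<partial>lborel)"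
    by (intro nn_integral_cong) (simp add: f_def ennreal_power power_mult_distrib ennreal_mult[symmetric])
  finally show ?thesis by simp
qed

text \<open>Jensen's inequality followed by Fubini. Since the kernel reaches only distance sqrt d,
  moving the weight from z to y costs the factor 1 + \<eta>.\<close>

lemma conv_weighted_norm_le:
  fixes u :: "complex \<Rightarrow> complex" and \<phi> :: "complex \<Rightarrow> real"
  assumes [measurable]: "u \<in> borel_measurable borel" "\<phi> \<in> borel_measurable borel" and d: "d > 0" and \<eta>: "\<eta> \<ge> 0"
    and cmp: "\<And>z y. z \<in> ball 0 R0 \<Longrightarrow> dist z y \<le> sqrt d \<Longrightarrow> exp (- \<phi> z) \<le> (1 + \<eta>) * exp (- \<phi> y)"
  shows "(\<integral>\<^sup>+z. ennreal ((cmod (conv u (bker d) z))\<^sup>2 * exp (- \<phi> z)) * indicator (ball 0 R0) z \<partial>lborel)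
     \<le> ennreal (1 + \<eta>) * (\<integral>\<^sup>+y. ennreal ((cmod (u y))\<^sup>2 * exp (- \<phi> y)) \<partial>lborel)"
proof -
  have [measurable]: "bker d \<in> borel_measurable borel" "ball (0::complex) R0 \<in> sets borel" using bker_continuous by simp_all
  have "(\<integral>\<^sup>+z. ennreal ((cmod (conv u (bker d) z))\<^sup>2 * exp (- \<phi> z)) * indicator (ball 0 R0) z \<partial>lborel)
     \<le> (\<integral>\<^sup>+z. (\<integral>\<^sup>+y. ennreal ((cmod (u y))\<^sup>2) * ennreal (cmod (bker d (z - y))) * (ennreal (exp (- \<phi> z)) * indicator (ball 0 R0) z) \<partial>lborel) \<partial>lborel)"
  proof (rule nn_integral_mono)
    fix z
    have "ennreal ((cmod (conv u (bker d) z))\<^sup>2 * exp (- \<phi> z)) * indicator (ball 0 R0) z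
       = (ennreal (cmod (conv u (bker d) z)))\<^sup>2 * (ennreal (exp (- \<phi> z)) * indicator (ball 0 R0) z)"
      by (simp add: ennreal_mult ennreal_power mult.assoc)
    also have "\<dots> \<le> (\<integral>\<^sup>+y. ennreal ((cmod (u y))\<^sup>2) * ennreal (cmod (bker d (z - y))) \<partial>lborel) * (ennreal (exp (- \<phi> z)) * indicator (ball 0 R0) z)"
      by (intro mult_right_mono conv_norm_sq_le d) auto
    also have "\<dots> = (\<integral>\<^sup>+y. ennreal ((cmod (u y))\<^sup>2) * ennreal (cmod (bker d (z - y))) * (ennreal (exp (- \<phi> z)) * indicator (ball 0 R0) z) \<partial>lborel)"
      by (rule nn_integral_multc[symmetric]) measurable
    finally show "ennreal ((cmod (conv u (bker d) z))\<^sup>2 * exp (- \<phi> z)) * indicator (ball 0 R0) z \<le> \<dots>" .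
  qed
  also have "\<dots> = (\<integral>\<^sup>+y. (\<integral>\<^sup>+z. ennreal ((cmod (u y))\<^sup>2) * ennreal (cmod (bker d (z - y))) * (ennreal (exp (- \<phi> z)) * indicator (ball 0 R0) z) \<partial>lborel) \<partial>lborel)"
    by (rule lborel_pair.Fubini') measurable
  also have "\<dots> \<le> (\<integral>\<^sup>+y. ennreal (1 + \<eta>) * ennreal ((cmod (u y))\<^sup>2 * exp (- \<phi> y)) \<partial>lborel)"
  proof (rule nn_integral_mono)
    fix y
    have "(\<integral>\<^sup>+z. ennreal ((cmod (u y))\<^sup>2) * ennreal (cmod (bker d (z - y))) * (ennreal (exp (- \<phi> z)) * indicator (ball 0 R0) z) \<partial>lborel)
       \<le> (\<integral>\<^sup>+z. (ennreal (1 + \<eta>) * ennreal ((cmod (u y))\<^sup>2 * exp (- \<phi> y))) * ennreal (cmod (bker d (z - y))) \<partial>lborel)"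
    proof (rule nn_integral_mono)
      fix z
      show "ennreal ((cmod (u y))\<^sup>2) * ennreal (cmod (bker d (z - y))) * (ennreal (exp (- \<phi> z)) * indicator (ball 0 R0) z)
        \<le> (ennreal (1 + \<eta>) * ennreal ((cmod (u y))\<^sup>2 * exp (- \<phi> y))) * ennreal (cmod (bker d (z - y)))"
      proof (cases "z \<in> ball 0 R0 \<and> dist z y \<le> sqrt d")
        case True
        have "(cmod (u y))\<^sup>2 * cmod (bker d (z - y)) * exp (- \<phi> z) \<le> (cmod (u y))\<^sup>2 * cmod (bker d (z - y)) * ((1 + \<eta>) * exp (- \<phi> y))"
          using cmp True by (intro mult_left_mono) auto
        then have "ennreal ((cmod (u y))\<^sup>2 * cmod (bker d (z - y)) * exp (- \<phi> z)) \<le> ennreal ((1 + \<eta>) * ((cmod (u y))\<^sup>2 * exp (- \<phi> y)) * cmod (bker d (z - y)))"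
          by (simp add: mult_ac ennreal_leI)
        then show ?thesis using True \<eta> by (simp add: ennreal_mult)
      next
        case False
        then have "z \<notin> ball 0 R0 \<or> bker d (z - y) = 0"
          using bker_support(1)[OF d, of "z - y"] by (auto simp: dist_norm norm_minus_commute)
        then show ?thesis by auto
      qed
    qed
    also have "\<dots> = (ennreal (1 + \<eta>) * ennreal ((cmod (u y))\<^sup>2 * exp (- \<phi> y))) * (\<integral>\<^sup>+z. ennreal (cmod (bker d (z - y))) \<partial>lborel)"
      by (rule nn_integral_cmult) measurable
    also have "(\<integral>\<^sup>+z. ennreal (cmod (bker d (z - y))) \<partial>lborel) = 1"
      using nn_integral_lborel_shift[of "\<lambda>z. ennreal (cmod (bker d z))" "- y"] by (simp add: bker_mass[OF d])
    finally show "(\<integral>\<^sup>+z. ennreal ((cmod (u y))\<^sup>2) * ennreal (cmod (bker d (z - y))) * (ennreal (exp (- \<phi> z)) * indicator (ball 0 R0) z) \<partial>lborel)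
       \<le> ennreal (1 + \<eta>) * ennreal ((cmod (u y))\<^sup>2 * exp (- \<phi> y))" by simp
  qed
  also have "\<dots> = ennreal (1 + \<eta>) * (\<integral>\<^sup>+y. ennreal ((cmod (u y))\<^sup>2 * exp (- \<phi> y)) \<partial>lborel)"
    by (rule nn_integral_cmult) measurable
  finally show ?thesis .
qed

text \<open>Riesz representation with explicit minimising sequences. Among test pairs with
  \<gamma>(0) = 1 the norm square of g with weight exp \<phi> has an infimum m >= pi / R^2 exp
  \<phi>(0). For near-minimisers g the functions - (pi / m) cnj g exp \<phi> are almost holomorphic
  when tested weakly; mollified, they converge uniformly together with their differentials. The
  mollification costs the radius margin R - R0 and the factor 1 + \<eta>.\<close>

lemma extension_C2_weight:
  fixes \<phi> lap :: "complex \<Rightarrow> real" and p pp :: "complex \<Rightarrow> complex"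
  assumes \<phi>: "\<And>z. wdv (\<lambda>z. of_real (\<phi> z)) (p z) (cnj (p z)) z" "\<And>z. wdv p (pp z) (of_real (lap z)) z"
      "continuous_on UNIV pp" "continuous_on UNIV lap"
    and lap: "\<And>z. z \<in> ball 0 R \<Longrightarrow> lap z \<ge> 0" and R: "0 < R0" "R0 < R" and \<eta>: "\<eta> > 0"
  shows "\<exists>F. F holomorphic_on ball 0 R0 \<and> F 0 = 1 \<and>
    (\<integral>\<^sup>+z. ennreal ((cmod (F z))\<^sup>2 * exp (- \<phi> z)) * indicator (ball 0 R0) z \<partial>lborel) \<le> ennreal ((1 + \<eta>) * (pi * R\<^sup>2 * exp (- \<phi> 0)))"
proof -
  have c\<phi>: "continuous_on UNIV \<phi>"
    using continuous_on_Re[OF wdv_continuous[OF \<phi>(1)]] by simp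
  have [measurable]: "\<phi> \<in> borel_measurable borel" using c\<phi> by simp
  define w where "w z = exp (\<phi> z)" for z
  have cw: "continuous_on UNIV w" unfolding w_def by (intro continuous_intros c\<phi>)
  have w0: "w z \<ge> 0" for z by (simp add: w_def)
  have [measurable]: "w \<in> borel_measurable borel" using cw by simp
  obtain \<delta>0 where \<delta>0: "\<delta>0 > 0" "\<And>x y. x \<in> cball 0 (R + 1) \<Longrightarrow> y \<in> cball 0 (R + 1) \<Longrightarrow> dist y x < \<delta>0 \<Longrightarrow> dist (\<phi> y) (\<phi> x) < ln (1 + \<eta>)"
  proof -
    have "uniformly_continuous_on (cball 0 (R + 1)) \<phi>"
      by (rule compact_uniformly_continuous[OF continuous_on_subset[OF c\<phi>]]) auto
    moreover have "ln (1 + \<eta>) > 0" using \<eta> by simp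
    ultimately show ?thesis using that unfolding uniformly_continuous_on_def by metis
  qed
  \<comment> \<open>Below \<delta>0 the weight changes by at most the factor 1 + \<eta>; below R -
    R0 the kernels centred in the small disc stay inside radius \<open>R\<close>; below 1 all points
    stay in the ball used for uniform continuity.\<close>
  define \<delta> where "\<delta> = Min {\<delta>0, R - R0, 1} / 2"
  have \<delta>: "\<delta> > 0" "\<delta> < \<delta>0" "\<delta> < R - R0" "\<delta> < 1" using \<delta>0 R by (auto simp: \<delta>_def)
  define d where "d = \<delta>\<^sup>2"
  have d: "d > 0" "sqrt d = \<delta>" using \<delta> by (auto simp: d_def)
  have cmp: "exp (- \<phi> z) \<le> (1 + \<eta>) * exp (- \<phi> y)" if "z \<in> ball 0 R0" "dist z y \<le> sqrt d" for z y
  proof -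
    have z: "norm z < R0" using that(1) by simp
    have zy: "dist z y \<le> \<delta>" using that(2) d by simp
    have "norm y \<le> norm z + dist z y" by (metis dist_norm norm_minus_commute norm_triangle_sub)
    then have "z \<in> cball 0 (R + 1)" "y \<in> cball 0 (R + 1)" using z zy \<delta> R by auto
    then have "dist (\<phi> z) (\<phi> y) < ln (1 + \<eta>)" using \<delta>0(2)[of y z] zy \<delta> by auto
    then have "- \<phi> z \<le> ln (1 + \<eta>) + - \<phi> y" by (simp add: dist_real_def abs_less_iff)
    then have "exp (- \<phi> z) \<le> exp (ln (1 + \<eta>) + - \<phi> y)" by simp
    then show ?thesis unfolding exp_add using \<eta> by simp
  qed
  define S where "S = {wn w g | \<gamma> g. tst R \<gamma> g \<and> \<gamma> 0 = 1}"
  \<comment> \<open>The lower bound supplied by the core inequality. It reappears as pi^2 / m0 = pi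
    R^2 exp (- \<phi> 0), the asserted constant.\<close>
  define m0 where "m0 = pi / R\<^sup>2 * exp (\<phi> 0)"
  have m0: "m0 > 0" using R by (simp add: m0_def)
  have low: "m0 \<le> s" if "s \<in> S" for s
    using that core_inequality[OF \<phi> lap] unfolding S_def m0_def wn_def w_def by fastforce
  have bump: "tst R (\<lambda>z. of_real (1 / (pi * d ^ 4) * ppow d 4 ((cmod z)\<^sup>2))) (\<lambda>z. - bker d z)"
    by (rule tst_bump) (use d \<delta> R in auto)
  have bump0: "complex_of_real (1 / (pi * d ^ 4) * ppow d 4 ((cmod 0)\<^sup>2)) = of_real (1 / pi)"
    using d by (simp add: ppow_def)
  \<comment> \<open>Adding pi - 1 further copies of the bump raises its value at the origin from
    1/pi to 1.\<close>
  have Sne: "S \<noteq> {}"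
  proof -
    have "tst R (\<lambda>z. of_real (1 / (pi * d ^ 4) * ppow d 4 ((cmod z)\<^sup>2)) + (of_real pi - 1) * of_real (1 / (pi * d ^ 4) * ppow d 4 ((cmod z)\<^sup>2)))
       (\<lambda>z. - bker d z + (of_real pi - 1) * - bker d z)" by (rule tst_lin[OF bump bump])
    moreover have "complex_of_real (1 / (pi * d ^ 4) * ppow d 4 ((cmod 0)\<^sup>2)) + (of_real pi - 1) * of_real (1 / (pi * d ^ 4) * ppow d 4 ((cmod 0)\<^sup>2)) = 1"
      unfolding bump0 by (simp add: field_simps)
    ultimately show ?thesis unfolding S_def by blast
  qed
  define m where "m = Inf S"
  have bdd: "bdd_below S" using low by (auto simp: bdd_below_def)
  have mm0: "m0 \<le> m" unfolding m_def using Sne low by (rule cInf_greatest)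
  then have m: "m > 0" using m0 by simp
  have mle: "m \<le> wn w g" if "tst R \<gamma> g" "\<gamma> 0 = 1" for \<gamma> g
    unfolding m_def by (rule cInf_lower[OF _ bdd]) (use that in \<open>auto simp: S_def\<close>)
  define e where "e n = inverse (real (Suc n))" for n
  have e: "e n > 0" for n by (simp add: e_def)
  have emono: "e k \<le> e n" if "n \<le> k" for n k using that by (simp add: e_def)
  have e0: "e \<longlonglongrightarrow> 0" unfolding e_def by (rule LIMSEQ_inverse_real_of_nat)
  have "\<exists>\<gamma> g. tst R \<gamma> g \<and> \<gamma> 0 = 1 \<and> wn w g < m + e n" for n
  proof -
    have "Inf S < m + e n" using e[of n] by (simp add: m_def)
    then obtain s where "s \<in> S" "s < m + e n" using cInf_lessD[OF Sne] by blast
    then show ?thesis unfolding S_def by blast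
  qed
  then obtain \<gamma> g where tg: "\<And>n. tst R (\<gamma> n) (g n)" "\<And>n. \<gamma> n 0 = 1" "\<And>n. wn w (g n) < m + e n" by metis
  have cg: "ccs R (g n)" for n using tst_continuous[OF tg(1)] tst_support[OF tg(1)] by (auto simp: ccs_def)
  have near: "(cmod (wip w (g n) h))\<^sup>2 \<le> e n * wn w h" if "tst R \<gamma>' h" "\<gamma>' 0 = 0" for n h \<gamma>'
  proof -
    have ch: "ccs R h" using tst_continuous[OF that(1)] tst_support[OF that(1)] by (auto simp: ccs_def)
    have "(cmod (wip w (g n) h))\<^sup>2 \<le> (wn w (g n) - m) * wn w h"
    proof (rule wip_near_minimizer[OF cg ch cw w0])
      show "m \<le> wn w (\<lambda>z. g n z + a * h z)" for a
        by (rule mle[OF tst_lin[OF tg(1) that(1)]]) (simp add: tg that)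
    qed
    also have "\<dots> \<le> e n * wn w h" using tg(3)[of n] by (intro mult_right_mono wn_nonneg w0) auto
    finally show ?thesis .
  qed
  \<comment> \<open>Parallelogram argument: the difference \<open>D\<close> has value 0 at the
    origin, so moving either near-minimiser half way along \<open>D\<close> stays admissible, and
    both midpoint expansions have norm square at least \<open>m\<close>.\<close>
  have diff: "wn w (\<lambda>z. g n z + (-1) * g k z) \<le> 2 * (e n + e k)" for n k
  proof -
    define D where "D = (\<lambda>z. g n z + (-1) * g k z)"
    have tD: "tst R (\<lambda>z. \<gamma> n z + (-1) * \<gamma> k z) D" unfolding D_def by (rule tst_lin[OF tg(1) tg(1)])
    have cD: "ccs R D" unfolding D_def by (rule ccs_lin[OF cg cg])
    have 1: "m \<le> wn w (\<lambda>z. g n z + (-1/2) * D z)" by (rule mle[OF tst_lin[OF tg(1) tD]]) (simp add: tg)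
    have 2: "m \<le> wn w (\<lambda>z. g k z + (1/2) * D z)" by (rule mle[OF tst_lin[OF tg(1) tD]]) (simp add: tg)
    have "wip w D D = wip w (g n) D + (-1) * wip w (g k) D"
      unfolding D_def by (rule wip_lin[OF cg cg _ cw]) (use cD in \<open>simp add: D_def\<close>)
    then have 3: "wn w D = Re (wip w (g n) D) - Re (wip w (g k) D)"
      unfolding wip_self by (metis Re_complex_of_real minus_complex.sel(1) mult_minus1 uminus_add_conv_diff add.commute)
    have 4: "wn w (\<lambda>z. g n z + (-1/2) * D z) = wn w (g n) - Re (wip w (g n) D) + 1/4 * wn w D"
      using wn_lin[OF cg cD cw, of n "-1/2"] by (simp add: power2_eq_square)
    have 5: "wn w (\<lambda>z. g k z + (1/2) * D z) = wn w (g k) + Re (wip w (g k) D) + 1/4 * wn w D"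
      using wn_lin[OF cg cD cw, of k "1/2"] by (simp add: power2_eq_square)
    have "N \<le> 2 * (x + y)" if "m \<le> p - a + 1 / 4 * N" "m \<le> q + b + 1 / 4 * N" "N = a - b" "p < m + x" "q < m + y" for N p q a b x y :: real
    proof -
      have "2 * m \<le> p + q - (a - b) + 1 / 2 * N" using add_mono[OF that(1,2)] by simp
      then have "1 / 2 * N \<le> p + q - 2 * m" unfolding that(3)[symmetric] by simp
      then show ?thesis using that(4,5) by simp
    qed
    from this[OF 1[unfolded 4] 2[unfolded 5] 3 tg(3) tg(3)] have "wn w D \<le> 2 * (e n + e k)" .
    then show ?thesis unfolding D_def .
  qed
  \<comment> \<open>The pairing of the near-minimisers with the negative mollifier tends to m / pi;
    this factor turns it into the value 1 at the origin. The conjugate and the weight in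
    \<open>u\<close> make convolution with a kernel a multiple of \<open>wip\<close> against
    \<open>g n\<close>.\<close>
  define C where "C = pi / m"
  have C: "C > 0" using m by (simp add: C_def)
  define u where "u n y = - of_real C * cnj (g n y) * of_real (w y)" for n y
  have cu: "continuous_on UNIV (u n)" for n
    unfolding u_def using cg[of n] by (intro continuous_intros cw) (simp add: ccs_def)
  have um[measurable]: "u n \<in> borel_measurable borel" for n using cu by simp
  have ul: "loc_bounded (u n)" for n by (rule loc_bounded_continuous[OF cu])
  have conv_wip: "conv (u n) \<kappa> z = - of_real C * wip w (\<lambda>y. \<kappa> (z - y)) (g n)" for n \<kappa> z
    unfolding conv_def wip_def u_def by (simp add: mult_ac flip: integral_mult_right_zero)
  define kz where "kz v = of_real (bker1 d ((cmod v)\<^sup>2)) * cnj v" for v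
  define kb where "kb v = of_real (bker1 d ((cmod v)\<^sup>2)) * v" for v
  have ck: "continuous_on UNIV (bker d)" "continuous_on UNIV kz" "continuous_on UNIV kb"
    unfolding kz_def kb_def by (intro bker_continuous continuous_intros)+
  have sk: "bker d v = 0" "kz v = 0" "kb v = 0" if "v \<notin> cball 0 (sqrt d)" for v
    using bker_support[OF d(1) that] by (auto simp: kz_def kb_def)
  have sh: "ccs R (\<lambda>y. \<kappa> (z - y))" if "continuous_on UNIV \<kappa>" "\<And>v. v \<notin> cball 0 (sqrt d) \<Longrightarrow> \<kappa> v = 0" "z \<in> ball 0 R0" for \<kappa> :: "complex \<Rightarrow> complex" and z
    unfolding ccs_def
  proof (intro conjI allI impI)
    show "continuous_on UNIV (\<lambda>y. \<kappa> (z - y))" by (rule continuous_on_compose2[OF that(1)]) (auto intro!: continuous_intros)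
    fix y :: complex assume y: "y \<notin> cball 0 R"
    have "norm y \<le> norm z + norm (z - y)" using norm_triangle_sub[of y z] by (simp add: norm_minus_commute)
    then show "\<kappa> (z - y) = 0" using y that(2)[of "z - y"] that(3) d \<delta> by auto
  qed
  obtain W where W: "\<And>z. z \<in> cball 0 R \<Longrightarrow> w z \<le> W" "W \<ge> 0"
  proof -
    obtain W where "W > 0" "\<And>z. z \<in> cball 0 R \<Longrightarrow> norm (w z) \<le> W" using loc_bounded_cball[OF loc_bounded_continuous[OF cw]] by blast
    then show ?thesis using that[of W] by force
  qed
  define V where "V = W * measure lborel (cball (0::complex) R)"
  have V: "V \<ge> 0" using W by (simp add: V_def)
  have cauchy: "\<exists>M\<ge>0. \<forall>n k z. z \<in> ball 0 R0 \<longrightarrow> cmod (conv (u n) \<kappa> z - conv (u k) \<kappa> z) \<le> M * sqrt (e n + e k)"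
    if \<kappa>: "continuous_on UNIV \<kappa>" "\<And>v. v \<notin> cball 0 (sqrt d) \<Longrightarrow> \<kappa> v = 0" for \<kappa> :: "complex \<Rightarrow> complex"
  proof -
    obtain B where B: "B > 0" "\<And>v. norm (\<kappa> v) \<le> B" using compact_support_bounded[OF \<kappa>] by blast
    have "cmod (conv (u n) \<kappa> z - conv (u k) \<kappa> z) \<le> C * sqrt (B\<^sup>2 * V * 2) * sqrt (e n + e k)" if z: "z \<in> ball 0 R0" for n k z
    proof -
      define h where "h = (\<lambda>y. \<kappa> (z - y))"
      have ch: "ccs R h" unfolding h_def by (rule sh[OF \<kappa> z])
      define D where "D = (\<lambda>z. g n z + (-1) * g k z)"
      have cD: "ccs R D" unfolding D_def by (rule ccs_lin[OF cg cg])
      have "wip w D h = wip w (g n) h + (-1) * wip w (g k) h" unfolding D_def by (rule wip_lin[OF cg cg ch cw])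
      then have "wip w h D = wip w h (g n) - wip w h (g k)" unfolding wip_cnj[of w h] by simp
      then have "conv (u n) \<kappa> z - conv (u k) \<kappa> z = - of_real C * wip w h D"
        unfolding conv_wip h_def[symmetric] by (simp add: right_diff_distrib)
      then have "cmod (conv (u n) \<kappa> z - conv (u k) \<kappa> z) = C * cmod (wip w h D)" using C by (simp add: norm_mult)
      also have "cmod (wip w h D) \<le> sqrt (wn w h * wn w D)"
        using wip_cauchy_schwarz[OF ch cD cw w0] by (simp add: real_le_rsqrt)
      also have "\<dots> \<le> sqrt ((B\<^sup>2 * V) * (2 * (e n + e k)))"
      proof (intro real_sqrt_le_mono mult_mono)
        show "wn w h \<le> B\<^sup>2 * V" using wn_le[OF ch cw w0 W(1) _ W(2)] B by (simp add: V_def h_def mult.assoc)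
        show "wn w D \<le> 2 * (e n + e k)" unfolding D_def by (rule diff)
      qed (use V in \<open>auto intro: wn_nonneg w0\<close>)
      also have "\<dots> = sqrt (B\<^sup>2 * V * 2) * sqrt (e n + e k)" unfolding real_sqrt_mult[symmetric] by (simp only: mult.assoc)
      finally show ?thesis using C by (simp add: mult.assoc)
    qed
    then show ?thesis using C V by (intro exI[of _ "C * sqrt (B\<^sup>2 * V * 2)"]) auto
  qed
  obtain Mz where Mz: "Mz \<ge> 0" "\<And>n k z. z \<in> ball 0 R0 \<Longrightarrow> cmod (conv (u n) kz z - conv (u k) kz z) \<le> Mz * sqrt (e n + e k)"
    using cauchy[OF ck(2) sk(2)] by blast
  \<comment> \<open>The conjugate derivative of the mollified function at z is an inner product with
    a test pair of value 0 at the origin. Near-orthogonality sends it to 0 uniformly on the small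
    disc.\<close>
  have qb: "\<exists>M\<ge>0. \<forall>n z. z \<in> ball 0 R0 \<longrightarrow> cmod (conv (u n) kb z) \<le> M * sqrt (e n)"
  proof -
    obtain B where B: "B > 0" "\<And>v. norm (kb v) \<le> B" using compact_support_bounded[OF ck(3) sk(3)] by blast
    have "cmod (conv (u n) kb z) \<le> C * sqrt (B\<^sup>2 * V) * sqrt (e n)" if z: "z \<in> ball 0 R0" for n z
    proof -
      define h where "h = (\<lambda>y. of_real (bker1 d ((cmod (y - z))\<^sup>2)) * (y - z))"
      have t: "tst R (\<lambda>y. y * bker d (y - z)) h" unfolding h_def by (rule tst_shifted) (use d \<delta> z in auto)
      have hk: "kb (z - y) = - h y" for y by (simp add: kb_def h_def norm_minus_commute algebra_simps)
      have ch: "ccs R h" using tst_continuous[OF t] tst_support[OF t] by (auto simp: ccs_def)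
      have "wip w (\<lambda>y. kb (z - y)) (g n) = - wip w h (g n)" unfolding hk wip_def by simp
      then have "cmod (conv (u n) kb z) = C * cmod (wip w h (g n))" unfolding conv_wip using C by (simp add: norm_mult)
      also have "cmod (wip w h (g n)) = cmod (wip w (g n) h)" by (subst wip_cnj) simp
      also have "\<dots> \<le> sqrt (e n * wn w h)" using near[OF t] by (simp add: real_le_rsqrt)
      also have "\<dots> \<le> sqrt (e n * (B\<^sup>2 * V))"
      proof (intro real_sqrt_le_mono mult_left_mono)
        have "norm (h y) \<le> B" for y using B(2)[of "z - y"] unfolding hk by simp
        then show "wn w h \<le> B\<^sup>2 * V" using wn_le[OF ch cw w0 W(1) _ W(2)] by (simp add: V_def mult.assoc)
      qed (use e in \<open>simp add: less_imp_le\<close>)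
      also have "\<dots> = sqrt (B\<^sup>2 * V) * sqrt (e n)" unfolding real_sqrt_mult[symmetric] by (simp only: mult.commute)
      finally show ?thesis using C by (simp add: mult.assoc)
    qed
    then show ?thesis using C V by (intro exI[of _ "C * sqrt (B\<^sup>2 * V)"]) auto
  qed
  then obtain Mb where Mb: "Mb \<ge> 0" "\<And>n z. z \<in> ball 0 R0 \<Longrightarrow> cmod (conv (u n) kb z) \<le> Mb * sqrt (e n)" by blast
  have ex0: "\<exists>P. (\<lambda>n. conv (u n) kz z) \<longlonglongrightarrow> P" if z: "z \<in> ball 0 R0" for z
  proof -
    have "Cauchy (\<lambda>n. conv (u n) kz z)"
    proof (rule CauchyI)
      fix \<epsilon> :: real assume \<epsilon>: "\<epsilon> > 0"
      have "(\<lambda>n. Mz * sqrt (e n + e n)) \<longlonglongrightarrow> Mz * sqrt (0 + 0)" by (intro tendsto_intros e0)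
      then have "\<forall>\<^sub>F n in sequentially. Mz * sqrt (e n + e n) < \<epsilon>" using \<epsilon> by (intro order_tendstoD(2)[where y="Mz * sqrt (0 + 0)"]) auto
      then obtain N where N: "Mz * sqrt (e N + e N) < \<epsilon>" by (auto simp: eventually_sequentially)
      show "\<exists>M. \<forall>m\<ge>M. \<forall>n\<ge>M. norm (conv (u m) kz z - conv (u n) kz z) < \<epsilon>"
      proof (intro exI[of _ N] allI impI)
        fix i j assume "i \<ge> N" "j \<ge> N"
        then have "sqrt (e i + e j) \<le> sqrt (e N + e N)" by (intro real_sqrt_le_mono add_mono emono)
        then show "norm (conv (u i) kz z - conv (u j) kz z) < \<epsilon>"
          using Mz(2)[OF z, of i j] N mult_left_mono[OF _ Mz(1), of "sqrt (e i + e j)" "sqrt (e N + e N)"] by linarith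
      qed
    qed
    then show ?thesis using convergent_eq_Cauchy by (simp add: Cauchy_convergent convergentD)
  qed
  define P where "P z = lim (\<lambda>n. conv (u n) kz z)" for z
  have P: "(\<lambda>n. conv (u n) kz z) \<longlonglongrightarrow> P z" if "z \<in> ball 0 R0" for z
    unfolding P_def using ex0[OF that] by (simp add: convergent_LIMSEQ_iff[symmetric] convergent_def)
  have Pb: "cmod (conv (u n) kz z - P z) \<le> Mz * sqrt (2 * e n)" if z: "z \<in> ball 0 R0" for n z
  proof (rule tendsto_upperbound)
    show "(\<lambda>k. cmod (conv (u n) kz z - conv (u k) kz z)) \<longlonglongrightarrow> cmod (conv (u n) kz z - P z)" by (intro tendsto_intros P z)
    show "\<forall>\<^sub>F k in sequentially. cmod (conv (u n) kz z - conv (u k) kz z) \<le> Mz * sqrt (2 * e n)"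
      unfolding eventually_sequentially
    proof (intro exI[of _ n] allI impI)
      fix k assume "n \<le> k"
      then have "sqrt (e n + e k) \<le> sqrt (2 * e n)" using emono[of n k] by simp
      then show "cmod (conv (u n) kz z - conv (u k) kz z) \<le> Mz * sqrt (2 * e n)"
        using Mz(2)[OF z, of n k] mult_left_mono[OF _ Mz(1), of "sqrt (e n + e k)" "sqrt (2 * e n)"] by linarith
    qed
  qed simp
  have wF: "wdv (conv (u n) (bker d)) (conv (u n) kz z) (conv (u n) kb z) z" for n z
    by (rule conv_wdv[OF um ul _ sk(1) ck(2,3) sk(2,3)])
      (use C2wD(1)[OF bker_C2_0] in \<open>simp add: kz_def kb_def\<close>)
  \<comment> \<open>The bump has value 1/pi at the origin, so subtracting \<open>g n\<close> / pi
    from its second component leaves a direction of value 0. That direction is almost orthogonal to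
    \<open>g n\<close>, and the pairing tends to m / pi.\<close>
  have F0: "(\<lambda>n. conv (u n) (bker d) 0) \<longlonglongrightarrow> 1"
  proof -
    define h where "h = (\<lambda>z. - bker d z)"
    have eq: "conv (u n) (bker d) 0 = of_real C * wip w h (g n)" for n
    proof -
      have "bker d (0 - y) = - h y" for y by (simp add: h_def bker_def)
      then show ?thesis unfolding conv_wip wip_def by simp
    qed
    have ch: "ccs R h" using tst_continuous[OF bump] tst_support[OF bump] by (auto simp: ccs_def h_def)
    have lim: "(\<lambda>n. wip w h (g n)) \<longlonglongrightarrow> of_real (m / pi)"
    proof -
      define a where "a = complex_of_real (- 1 / pi)"
      define D where "D n = (\<lambda>z. h z + a * g n z)" for n
      have tD: "tst R (\<lambda>z. of_real (1 / (pi * d ^ 4) * ppow d 4 ((cmod z)\<^sup>2)) + a * \<gamma> n z) (D n)" for n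
        unfolding D_def h_def by (rule tst_lin[OF bump tg(1)])
      have tD0: "of_real (1 / (pi * d ^ 4) * ppow d 4 ((cmod 0)\<^sup>2)) + a * \<gamma> n 0 = 0" for n
        unfolding bump0 tg(2) by (simp add: a_def)
      have s: "wip w h (g n) = wip w (D n) (g n) + of_real (wn w (g n) / pi)" for n
      proof -
        have "wip w (D n) (g n) = wip w h (g n) + a * wip w (g n) (g n)" unfolding D_def by (rule wip_lin[OF ch cg cg cw])
        then show ?thesis unfolding wip_self by (simp add: a_def)
      qed
      have wb: "wn w (D n) \<le> 2 * wn w h + 2 * (m + 1)" for n
      proof -
        have i: "wn w (D n) = wn w h + 2 * Re (cnj a * wip w h (g n)) + (cmod a)\<^sup>2 * wn w (g n)"
          unfolding D_def by (rule wn_lin[OF ch cg cw])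
        have "wn w (\<lambda>z. h z + (- a) * g n z) = wn w h + 2 * Re (cnj (- a) * wip w h (g n)) + (cmod (- a))\<^sup>2 * wn w (g n)"
          by (rule wn_lin[OF ch cg cw])
        moreover have "wn w (\<lambda>z. h z + (- a) * g n z) \<ge> 0" by (rule wn_nonneg[OF w0])
        moreover have "Re (cnj (- a) * wip w h (g n)) = - Re (cnj a * wip w h (g n))" by simp
        ultimately have "0 \<le> wn w h + 2 * - Re (cnj a * wip w h (g n)) + (cmod a)\<^sup>2 * wn w (g n)" by (simp only: norm_minus_cancel)
        then have "wn w (D n) \<le> 2 * wn w h + 2 * ((cmod a)\<^sup>2 * wn w (g n))" unfolding i by linarith
        moreover have "(cmod a)\<^sup>2 * wn w (g n) \<le> 1 * (m + 1)"
        proof (intro mult_mono)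
          have "cmod a = 1 / pi" by (simp add: a_def norm_divide)
          moreover have "1 / pi \<le> 1" using pi_gt3 by simp
          ultimately show "(cmod a)\<^sup>2 \<le> 1" by (simp add: power_le_one)
          show "wn w (g n) \<le> m + 1" using tg(3)[of n] emono[of 0 n] by (simp add: e_def)
        qed (auto intro: wn_nonneg w0)
        ultimately show ?thesis by simp
      qed
      have "(\<lambda>n. wip w (D n) (g n)) \<longlonglongrightarrow> 0"
      proof (rule Lim_null_comparison)
        show "\<forall>\<^sub>F n in sequentially. norm (wip w (D n) (g n)) \<le> sqrt (e n * (2 * wn w h + 2 * (m + 1)))"
        proof (intro always_eventually allI)
          fix n
          have "cmod (wip w (D n) (g n)) = cmod (wip w (g n) (D n))" by (subst wip_cnj) simp
          also have "\<dots> \<le> sqrt (e n * wn w (D n))" using near[OF tD tD0] by (simp add: real_le_rsqrt)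
          also have "\<dots> \<le> sqrt (e n * (2 * wn w h + 2 * (m + 1)))"
            using wb e[of n] by (intro real_sqrt_le_mono mult_left_mono) auto
          finally show "norm (wip w (D n) (g n)) \<le> sqrt (e n * (2 * wn w h + 2 * (m + 1)))" .
        qed
        have "(\<lambda>n. sqrt (e n * (2 * wn w h + 2 * (m + 1)))) \<longlonglongrightarrow> sqrt (0 * (2 * wn w h + 2 * (m + 1)))"
          by (intro tendsto_intros e0)
        then show "(\<lambda>n. sqrt (e n * (2 * wn w h + 2 * (m + 1)))) \<longlonglongrightarrow> 0" by simp
      qed
      moreover have "(\<lambda>n. wn w (g n)) \<longlonglongrightarrow> m"
      proof (rule tendsto_sandwich[of "\<lambda>_. m" _ _ "\<lambda>n. m + e n"])
        show "(\<lambda>n. m + e n) \<longlonglongrightarrow> m" using tendsto_add[OF tendsto_const[of m] e0] by simp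
      qed (use mle[OF tg(1,2)] tg(3) in \<open>auto intro!: always_eventually less_imp_le\<close>)
      ultimately have "(\<lambda>n. wip w (D n) (g n) + of_real (wn w (g n) / pi)) \<longlonglongrightarrow> 0 + of_real (m / pi)"
        by (intro tendsto_intros) auto
      then show ?thesis unfolding s[symmetric] by simp
    qed
    have "(\<lambda>n. of_real C * wip w h (g n)) \<longlonglongrightarrow> of_real C * of_real (m / pi)" by (intro tendsto_intros lim)
    then show ?thesis unfolding eq using m by (simp add: C_def)
  qed
  \<comment> \<open>Convergence at the origin and uniform convergence of the differentials give a
    limit function. Its differential is complex linear because the conjugate parts tend to
    0.\<close>
  have "\<exists>F. \<forall>z\<in>ball 0 R0. (\<lambda>n. conv (u n) (bker d) z) \<longlonglongrightarrow> F z \<and> (F has_derivative (\<lambda>h. P z * h)) (at z within ball 0 R0)"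
  proof (rule has_derivative_sequence[where f="\<lambda>n. conv (u n) (bker d)" and S="ball 0 R0"
        and f'="\<lambda>n z h. conv (u n) kz z * h + conv (u n) kb z * cnj h" and g'="\<lambda>z h. P z * h"])
    show "(\<lambda>n. conv (u n) (bker d) 0) \<longlonglongrightarrow> 1" by (rule F0)
    show "convex (ball (0::complex) R0)" by simp
    show "(conv (u n) (bker d) has_derivative (\<lambda>h. conv (u n) kz z * h + conv (u n) kb z * cnj h)) (at z within ball 0 R0)" for n z
      using wF[of n z] unfolding wdv_def by (rule has_derivative_at_withinI)
    show "\<forall>\<^sub>F n in sequentially. \<forall>z\<in>ball 0 R0. \<forall>h. norm (conv (u n) kz z * h + conv (u n) kb z * cnj h - P z * h) \<le> \<epsilon> * norm h" if "\<epsilon> > 0" for \<epsilon>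
    proof -
      have "(\<lambda>n. Mz * sqrt (2 * e n) + Mb * sqrt (e n)) \<longlonglongrightarrow> Mz * sqrt (2 * 0) + Mb * sqrt 0" by (intro tendsto_intros e0)
      then have "\<forall>\<^sub>F n in sequentially. Mz * sqrt (2 * e n) + Mb * sqrt (e n) < \<epsilon>"
        using that by (intro order_tendstoD(2)[where y="Mz * sqrt (2 * 0) + Mb * sqrt 0"]) auto
      then show ?thesis
      proof eventually_elim
        case (elim n)
        show ?case
        proof (intro ballI allI)
          fix z h assume z: "z \<in> ball (0::complex) R0"
          have "conv (u n) kz z * h + conv (u n) kb z * cnj h - P z * h = (conv (u n) kz z - P z) * h + conv (u n) kb z * cnj h"
            by (simp add: algebra_simps)
          also have "norm \<dots> \<le> cmod (conv (u n) kz z - P z) * norm h + cmod (conv (u n) kb z) * norm h"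
            by (rule order_trans[OF norm_triangle_ineq]) (simp add: norm_mult)
          also have "\<dots> \<le> (Mz * sqrt (2 * e n)) * norm h + (Mb * sqrt (e n)) * norm h"
            by (intro add_mono mult_right_mono Pb Mb z) auto
          also have "\<dots> = (Mz * sqrt (2 * e n) + Mb * sqrt (e n)) * norm h" by (simp add: distrib_right)
          also have "\<dots> \<le> \<epsilon> * norm h" using elim by (intro mult_right_mono) auto
          finally show "norm (conv (u n) kz z * h + conv (u n) kb z * cnj h - P z * h) \<le> \<epsilon> * norm h" .
        qed
      qed
    qed
    show "0 \<in> ball (0::complex) R0" using R by simp
  qed
  then obtain F where F: "\<And>z. z \<in> ball 0 R0 \<Longrightarrow> (\<lambda>n. conv (u n) (bker d) z) \<longlonglongrightarrow> F z"
     "\<And>z. z \<in> ball 0 R0 \<Longrightarrow> (F has_derivative (\<lambda>h. P z * h)) (at z within ball 0 R0)" by blast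
  have "F holomorphic_on ball 0 R0"
    unfolding holomorphic_on_def field_differentiable_def has_field_derivative_def using F(2) by blast
  moreover have "F 0 = 1" using LIMSEQ_unique[OF F(1) F0] R by simp
  moreover have "(\<integral>\<^sup>+z. ennreal ((cmod (F z))\<^sup>2 * exp (- \<phi> z)) * indicator (ball 0 R0) z \<partial>lborel) \<le> ennreal ((1 + \<eta>) * (pi * R\<^sup>2 * exp (- \<phi> 0)))"
  proof -
    have [measurable]: "ball (0::complex) R0 \<in> sets borel" by simp
    have [measurable]: "conv (u n) (bker d) \<in> borel_measurable borel" for n
      using conv_continuous[OF um ul ck(1) sk(1)] by simp
    have bn: "(\<integral>\<^sup>+z. ennreal ((cmod (conv (u n) (bker d) z))\<^sup>2 * exp (- \<phi> z)) * indicator (ball 0 R0) z \<partial>lborel) \<le> ennreal ((1 + \<eta>) * (C\<^sup>2 * (m + e n)))" for n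
    proof -
      have pt: "(cmod (u n y))\<^sup>2 * exp (- \<phi> y) = C\<^sup>2 * ((cmod (g n y))\<^sup>2 * w y)" for y
        using C by (simp add: u_def norm_mult w_def exp_minus power_mult_distrib field_simps power2_eq_square)
      have "(\<integral>\<^sup>+y. ennreal ((cmod (u n y))\<^sup>2 * exp (- \<phi> y)) \<partial>lborel) = ennreal (\<integral>y. C\<^sup>2 * ((cmod (g n y))\<^sup>2 * w y) \<partial>lborel)"
        unfolding pt by (rule nn_integral_eq_integral) (use wip_integrable(2)[OF cg cg cw] w0 in auto)
      also have "\<dots> = ennreal (C\<^sup>2 * wn w (g n))" unfolding wn_def by simp
      finally have "(\<integral>\<^sup>+z. ennreal ((cmod (conv (u n) (bker d) z))\<^sup>2 * exp (- \<phi> z)) * indicator (ball 0 R0) z \<partial>lborel) \<le> ennreal (1 + \<eta>) * ennreal (C\<^sup>2 * wn w (g n))"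
        using conv_weighted_norm_le[OF um[of n] continuous_imp_borel[OF c\<phi>] d(1) less_imp_le[OF \<eta>] cmp] by simp
      also have "\<dots> = ennreal ((1 + \<eta>) * (C\<^sup>2 * wn w (g n)))" using \<eta> wn_nonneg[OF w0] by (simp add: ennreal_mult)
      also have "\<dots> \<le> ennreal ((1 + \<eta>) * (C\<^sup>2 * (m + e n)))"
        using tg(3)[of n] \<eta> by (intro ennreal_leI mult_left_mono) auto
      finally show ?thesis .
    qed
    have "(\<integral>\<^sup>+z. ennreal ((cmod (F z))\<^sup>2 * exp (- \<phi> z)) * indicator (ball 0 R0) z \<partial>lborel)
      = (\<integral>\<^sup>+z. liminf (\<lambda>n. ennreal ((cmod (conv (u n) (bker d) z))\<^sup>2 * exp (- \<phi> z)) * indicator (ball 0 R0) z) \<partial>lborel)"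
    proof (intro nn_integral_cong)
      fix z
      show "ennreal ((cmod (F z))\<^sup>2 * exp (- \<phi> z)) * indicator (ball 0 R0) z = liminf (\<lambda>n. ennreal ((cmod (conv (u n) (bker d) z))\<^sup>2 * exp (- \<phi> z)) * indicator (ball 0 R0) z)"
      proof (cases "z \<in> ball 0 R0")
        case True
        have "(\<lambda>n. ennreal ((cmod (conv (u n) (bker d) z))\<^sup>2 * exp (- \<phi> z))) \<longlonglongrightarrow> ennreal ((cmod (F z))\<^sup>2 * exp (- \<phi> z))"
          by (intro tendsto_ennrealI tendsto_intros F True)
        from lim_imp_Liminf[OF sequentially_bot this] show ?thesis using True by simp
      qed (simp add: Liminf_const)
    qed
    also have "\<dots> \<le> liminf (\<lambda>n. \<integral>\<^sup>+z. ennreal ((cmod (conv (u n) (bker d) z))\<^sup>2 * exp (- \<phi> z)) * indicator (ball 0 R0) z \<partial>lborel)"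
      by (rule nn_integral_liminf) measurable
    also have "\<dots> \<le> liminf (\<lambda>n. ennreal ((1 + \<eta>) * (C\<^sup>2 * (m + e n))))"
      by (intro Liminf_mono always_eventually allI bn)
    also have "\<dots> = ennreal ((1 + \<eta>) * (C\<^sup>2 * (m + 0)))"
      by (intro lim_imp_Liminf[OF sequentially_bot] tendsto_ennrealI tendsto_intros e0)
    also have "C\<^sup>2 * (m + 0) = pi\<^sup>2 / m" using m by (simp add: C_def power2_eq_square)
    also have "ennreal ((1 + \<eta>) * (pi\<^sup>2 / m)) \<le> ennreal ((1 + \<eta>) * (pi * R\<^sup>2 * exp (- \<phi> 0)))"
    proof (intro ennreal_leI mult_left_mono)
      have "pi\<^sup>2 / m \<le> pi\<^sup>2 / m0" using mm0 m0 by (intro divide_left_mono) auto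
      also have "\<dots> = pi * R\<^sup>2 * exp (- \<phi> 0)" using R by (simp add: m0_def exp_minus power2_eq_square field_simps)
      finally show "pi\<^sup>2 / m \<le> pi * R\<^sup>2 * exp (- \<phi> 0)" .
    qed (use \<eta> in auto)
    finally show ?thesis .
  qed
  ultimately show ?thesis by blast
qed

section \<open>Continuous subharmonic weights\<close>

definition cint :: "(complex \<Rightarrow> real) \<Rightarrow> bool" where
  "cint g \<longleftrightarrow> set_integrable lborel {0..2*pi} (\<lambda>\<theta>. g (cis \<theta>))"

definition cmean :: "(complex \<Rightarrow> real) \<Rightarrow> real" where
  "cmean g = 1 / (2 * pi) * (LINT \<theta>:{0..2*pi}|lborel. g (cis \<theta>))"

lemma cis_borel [measurable]: "cis \<in> borel_measurable borel"
  by (intro continuous_imp_borel) (auto intro!: continuous_intros)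

lemma cint_continuous:
  assumes "continuous_on (sphere 0 1) g" shows "cint g"
proof -
  have "continuous_on {0..2*pi} (\<lambda>\<theta>. g (cis \<theta>))"
    by (rule continuous_on_compose2[OF assms]) (auto intro!: continuous_intros)
  then show ?thesis unfolding cint_def set_integrable_def by (intro borel_integrable_compact) auto
qed

lemma cint_bounded:
  assumes [measurable]: "g \<in> borel_measurable borel" and B: "\<And>z. z \<in> sphere 0 1 \<Longrightarrow> \<bar>g z\<bar> \<le> B"
  shows "cint g"
  unfolding cint_def set_integrable_def
proof (rule Bochner_Integration.integrable_bound)
  show "integrable lborel (\<lambda>\<theta>. indicator {0..2*pi} \<theta> *\<^sub>R B)"
    by (intro borel_integrable_compact) auto
  show "AE \<theta> in lborel. norm (indicator {0..2*pi} \<theta> *\<^sub>R g (cis \<theta>)) \<le> norm (indicator {0..2*pi} \<theta> *\<^sub>R B)"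
    using B by (intro AE_I2) (auto simp: indicator_def intro: order_trans[OF B])
qed measurable

lemma cmean_add: "cint g \<Longrightarrow> cint h \<Longrightarrow> cmean (\<lambda>z. g z + h z) = cmean g + cmean h"
  and cint_add: "cint g \<Longrightarrow> cint h \<Longrightarrow> cint (\<lambda>z. g z + h z)"
  unfolding cint_def cmean_def by (auto simp: distrib_left)

lemma cmean_diff: "cint g \<Longrightarrow> cint h \<Longrightarrow> cmean (\<lambda>z. g z - h z) = cmean g - cmean h"
  and cint_diff: "cint g \<Longrightarrow> cint h \<Longrightarrow> cint (\<lambda>z. g z - h z)"
  unfolding cint_def cmean_def by (auto simp: right_diff_distrib)

lemma cmean_cmult: "cmean (\<lambda>z. c * g z) = c * cmean g" and cint_cmult: "cint g \<Longrightarrow> cint (\<lambda>z. c * g z)"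
  unfolding cint_def cmean_def by auto

lemma cmean_const [simp]: "cmean (\<lambda>z. c) = c" and cint_const [simp]: "cint (\<lambda>z. c)"
proof -
  show "cint (\<lambda>z. c)" by (rule cint_continuous) simp
  have "(LINT \<theta>:{0..2*pi}|lborel. c) = 2 * pi * c"
    unfolding set_lebesgue_integral_def by simp
  then show "cmean (\<lambda>z. c) = c" by (simp add: cmean_def)
qed

lemma cmean_mono:
  assumes "cint g" "cint h" "\<And>z. z \<in> sphere 0 1 \<Longrightarrow> g z \<le> h z" shows "cmean g \<le> cmean h"
  unfolding cmean_def using assms unfolding cint_def
  by (intro mult_left_mono set_integral_mono) auto

lemma cmean_cong: "(\<And>z. z \<in> sphere 0 1 \<Longrightarrow> g z = h z) \<Longrightarrow> cmean g = cmean h"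
  unfolding cmean_def by (intro arg_cong2[where f="(*)"] refl set_lebesgue_integral_cong) auto

lemma cmean_holomorphic_cball:
  assumes P: "P holomorphic_on cball 0 1" shows "cmean (\<lambda>z. Re (P z)) = Re (P 0)"
proof -
  have cP: "continuous_on (cball 0 1) P" using P holomorphic_on_imp_continuous_on by blast
  have "((\<lambda>u. P u / (u - 0)) has_contour_integral (2 * of_real pi * \<i> * P 0)) (circlepath 0 1)"
    by (rule Cauchy_integral_circlepath_simple) (use P in auto)
  then have "((\<lambda>t. P (0 + of_real 1 * cis t) / (0 + of_real 1 * cis t) * of_real 1 * \<i> * cis t) has_integral (2 * of_real pi * \<i> * P 0)) {0..2*pi}"
    unfolding circlepath_def by (subst (asm) has_contour_integral_part_circlepath_iff) auto
  then have "((\<lambda>t. \<i> * P (cis t)) has_integral (2 * of_real pi * \<i> * P 0)) {0..2*pi}"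
    by (rule has_integral_eq[rotated]) auto
  then have "((\<lambda>t. (-\<i>) * (\<i> * P (cis t))) has_integral ((-\<i>) * (2 * of_real pi * \<i> * P 0))) {0..2*pi}"
    by (rule has_integral_mult_right)
  then have "((\<lambda>t. P (cis t)) has_integral (2 * of_real pi * P 0)) {0..2*pi}"
    by (simp add: mult.assoc[symmetric]) (simp add: mult_ac)
  then have "((\<lambda>t. Re (P (cis t))) has_integral Re (2 * of_real pi * P 0)) {0..2*pi}"
    by (rule has_integral_Re)
  moreover have "cint (\<lambda>z. Re (P z))"
    by (rule cint_continuous) (auto intro!: continuous_intros continuous_on_subset[OF cP])
  ultimately have "(LINT \<theta>:{0..2*pi}|lborel. Re (P (cis \<theta>))) = 2 * pi * Re (P 0)"
    unfolding cint_def by (subst set_borel_integral_eq_integral) (auto dest: integral_unique)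
  then show ?thesis by (simp add: cmean_def)
qed

lemma cmean_holomorphic:
  assumes P: "P holomorphic_on UNIV" shows "cmean (\<lambda>z. Re (P z)) = Re (P 0)"
  by (rule cmean_holomorphic_cball[OF holomorphic_on_subset[OF P]]) simp

lemma conv_reflect:
  fixes u k :: "'a::euclidean_space \<Rightarrow> 'b::{real_normed_field, banach, second_countable_topology}"
  assumes [measurable]: "u \<in> borel_measurable borel" "k \<in> borel_measurable borel"
  shows "conv u k x = (\<integral>w. u (x - w) * k w \<partial>lborel)"
  unfolding conv_def using integral_lborel_reflect[of "\<lambda>y. u y * k (x - y)" x] by simp

text \<open>The displacement \<open>D\<close> is the same at every base point, so the circle mean
  commutes with convolution by Fubini; a nonnegative kernel then averages the inequalities at the
  points x - w.\<close>

lemma conv_submean: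
  fixes u k :: "'a::euclidean_space \<Rightarrow> real"
  assumes u[measurable]: "u \<in> borel_measurable borel" and ul: "loc_bounded u"
    and k: "continuous_on UNIV k" "\<And>w. w \<notin> cball 0 d \<Longrightarrow> k w = 0" "\<And>w. k w \<ge> 0"
    and D: "continuous_on UNIV D"
    and sub: "\<And>w. w \<in> cball 0 d \<Longrightarrow> u (x - w) \<le> cmean (\<lambda>\<zeta>. u (x - w + D \<zeta>))"
  shows "conv u k x \<le> cmean (\<lambda>\<zeta>. conv u k (x + D \<zeta>))"
proof -
  have km[measurable]: "k \<in> borel_measurable borel" and [measurable]: "D \<in> borel_measurable borel" using k D by auto
  obtain K where K: "K > 0" "\<And>w. norm (k w) \<le> K" using compact_support_bounded[OF k(1,2)] by blast
  have "bounded (D ` sphere 0 1)"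
    by (intro compact_imp_bounded compact_continuous_image continuous_on_subset[OF D]) auto
  then obtain E where E: "E > 0" "\<And>\<zeta>. \<zeta> \<in> sphere 0 1 \<Longrightarrow> norm (D \<zeta>) \<le> E" by (auto simp: bounded_pos)
  obtain B where B: "B > 0" "\<And>y. y \<in> cball x (E + d) \<Longrightarrow> norm (u y) \<le> B" using loc_bounded_cball[OF ul] by blast
  have Bw: "\<bar>u (x - w + D \<zeta>)\<bar> \<le> B" if "w \<in> cball 0 d" "\<zeta> \<in> sphere 0 1" for w \<zeta>
  proof -
    have "norm (w - D \<zeta>) \<le> norm w + norm (D \<zeta>)" by (rule norm_triangle_ineq4)
    then have "norm (w - D \<zeta>) \<le> E + d" using that E(2)[of \<zeta>] by simp
    then show ?thesis using B(2)[of "x - w + D \<zeta>"] by (simp add: dist_norm)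
  qed
  define H where "H \<theta> w = indicator {0..2*pi} \<theta> *\<^sub>R (u (x + D (cis \<theta>) - w) * k w)" for \<theta> w
  have [measurable]: "(\<lambda>(\<theta>, w). H \<theta> w) \<in> borel_measurable (lborel \<Otimes>\<^sub>M lborel)"
    unfolding H_def by measurable
  have iH: "integrable (lborel \<Otimes>\<^sub>M lborel) (\<lambda>(\<theta>, w). H \<theta> w)"
  proof (rule Bochner_Integration.integrable_bound)
    show "integrable (lborel \<Otimes>\<^sub>M lborel) (\<lambda>p. indicator ({0..2*pi} \<times> cball (0::'a) d) p *\<^sub>R (B * K))"
      unfolding lborel_prod by (rule borel_integrable_compact) (auto intro!: compact_Times)
    show "AE p in lborel \<Otimes>\<^sub>M lborel. norm (case p of (\<theta>, w) \<Rightarrow> H \<theta> w) \<le> norm (indicator ({0..2*pi} \<times> cball (0::'a) d) p *\<^sub>R (B * K))"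
    proof (rule AE_I2)
      fix p :: "real \<times> 'a"
      obtain \<theta> w where p: "p = (\<theta>, w)" by force
      show "norm (case p of (\<theta>, w) \<Rightarrow> H \<theta> w) \<le> norm (indicator ({0..2*pi} \<times> cball (0::'a) d) p *\<^sub>R (B * K))"
      proof (cases "\<theta> \<in> {0..2*pi} \<and> w \<in> cball 0 d")
        case True
        have "\<bar>u (x + D (cis \<theta>) - w)\<bar> \<le> B" using Bw[of w "cis \<theta>"] True by (simp add: algebra_simps)
        then have "\<bar>u (x + D (cis \<theta>) - w) * k w\<bar> \<le> B * K" using K(2)[of w] B K by (simp add: abs_mult mult_mono)
        then show ?thesis using True B K by (simp add: p H_def)
      next
        case False
        then have "H \<theta> w = 0" using k(2) by (auto simp: H_def)
        then show ?thesis by (simp add: p)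
      qed
    qed
  qed measurable
  have "cmean (\<lambda>\<zeta>. conv u k (x + D \<zeta>)) = 1 / (2 * pi) * (\<integral>\<theta>. (\<integral>w. H \<theta> w \<partial>lborel) \<partial>lborel)"
    unfolding cmean_def set_lebesgue_integral_def conv_reflect[OF u km] H_def by simp
  also have "(\<integral>\<theta>. (\<integral>w. H \<theta> w \<partial>lborel) \<partial>lborel) = (\<integral>w. (\<integral>\<theta>. H \<theta> w \<partial>lborel) \<partial>lborel)"
    by (rule lborel_pair.Fubini_integral[symmetric]) (rule iH)
  also have "1 / (2 * pi) * (\<integral>w. (\<integral>\<theta>. H \<theta> w \<partial>lborel) \<partial>lborel) = (\<integral>w. 1 / (2 * pi) * (\<integral>\<theta>. H \<theta> w \<partial>lborel) \<partial>lborel)"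
    by simp
  also have "\<dots> = (\<integral>w. cmean (\<lambda>\<zeta>. u (x - w + D \<zeta>)) * k w \<partial>lborel)"
  proof (rule Bochner_Integration.integral_cong)
    fix w
    have "(\<integral>\<theta>. H \<theta> w \<partial>lborel) = (\<integral>\<theta>. (indicator {0..2*pi} \<theta> *\<^sub>R u (x + D (cis \<theta>) - w)) * k w \<partial>lborel)"
      by (simp add: H_def mult.assoc)
    also have "\<dots> = (\<integral>\<theta>. indicator {0..2*pi} \<theta> *\<^sub>R u (x + D (cis \<theta>) - w) \<partial>lborel) * k w"
      by (rule integral_mult_left_zero)
    finally show "1 / (2 * pi) * (\<integral>\<theta>. H \<theta> w \<partial>lborel) = cmean (\<lambda>\<zeta>. u (x - w + D \<zeta>)) * k w"
      by (simp add: cmean_def set_lebesgue_integral_def algebra_simps)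
  qed simp
  finally have eq: "cmean (\<lambda>\<zeta>. conv u k (x + D \<zeta>)) = (\<integral>w. cmean (\<lambda>\<zeta>. u (x - w + D \<zeta>)) * k w \<partial>lborel)" .
  have i2: "integrable lborel (\<lambda>w. cmean (\<lambda>\<zeta>. u (x - w + D \<zeta>)) * k w)"
  proof -
    have "integrable lborel (\<lambda>w. 1 / (2 * pi) * (\<integral>\<theta>. H \<theta> w \<partial>lborel))"
      by (intro integrable_mult_right lborel_pair.integrable_snd iH)
    moreover have "1 / (2 * pi) * (\<integral>\<theta>. H \<theta> w \<partial>lborel) = cmean (\<lambda>\<zeta>. u (x - w + D \<zeta>)) * k w" for w
    proof -
      have "(\<integral>\<theta>. H \<theta> w \<partial>lborel) = (\<integral>\<theta>. (indicator {0..2*pi} \<theta> *\<^sub>R u (x + D (cis \<theta>) - w)) * k w \<partial>lborel)"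
        by (simp add: H_def mult.assoc)
      also have "\<dots> = (\<integral>\<theta>. indicator {0..2*pi} \<theta> *\<^sub>R u (x + D (cis \<theta>) - w) \<partial>lborel) * k w"
        by (rule integral_mult_left_zero)
      finally show ?thesis by (simp add: cmean_def set_lebesgue_integral_def algebra_simps)
    qed
    ultimately show ?thesis by simp
  qed
  have i1: "integrable lborel (\<lambda>w. u (x - w) * k w)"
  proof -
    have "integrable lborel (\<lambda>y. u y * k (x - y))" by (rule conv_integrable[OF u ul k(1,2)])
    then have "integrable (distr lborel borel (\<lambda>w. x + (-1) *\<^sub>R w)) (\<lambda>y. u y * k (x - y))"
      using lborel_affine[of "-1" x] by (simp add: density_1)
    then show ?thesis by (subst (asm) integrable_distr_eq) auto
  qed
  show ?thesis unfolding eq unfolding conv_reflect[OF u km]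
  proof (rule Bochner_Integration.integral_mono[OF i1 i2])
    fix w
    show "u (x - w) * k w \<le> cmean (\<lambda>\<zeta>. u (x - w + D \<zeta>)) * k w"
      by (cases "w \<in> cball 0 d") (use sub k in \<open>auto intro!: mult_right_mono\<close>)
  qed
qed

text \<open>On a small circle the second-order Taylor polynomial is the real part of a holomorphic
  polynomial plus the constant lap0 \<rho>^2. The mean value property leaves 0 <= (lap0 + e)
  \<rho>^2 once the remainder is below e \<rho>^2.\<close>

lemma laplacian_nonneg:
  fixes \<phi> lap :: "complex \<Rightarrow> real"
  assumes \<phi>: "\<And>z. wdv (\<lambda>z. of_real (\<phi> z)) (p z) (cnj (p z)) z" "wdv p pp (of_real lap0) z"
    and sub: "\<rho>0 > 0" "\<And>\<rho>. 0 < \<rho> \<Longrightarrow> \<rho> < \<rho>0 \<Longrightarrow> \<phi> z \<le> cmean (\<lambda>\<zeta>. \<phi> (z + of_real \<rho> * \<zeta>))"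
  shows "lap0 \<ge> 0"
proof (rule field_le_epsilon[of 0, simplified])
  fix e :: real assume e: "e > 0"
  define e' where "e' = e / 2"
  have e': "e' > 0" using e by (simp add: e'_def)
  have c\<phi>: "continuous_on UNIV \<phi>" using continuous_on_Re[OF wdv_continuous[OF \<phi>(1)]] by simp
  have "(p has_derivative (\<lambda>h. pp * h + of_real lap0 * cnj h)) (at z)" using \<phi>(2) unfolding wdv_def .
  then obtain d where d: "d > 0" "\<And>y. norm (y - z) < d \<Longrightarrow> norm (p y - p z - (pp * (y - z) + of_real lap0 * cnj (y - z))) \<le> e' * norm (y - z)"
    using e' unfolding has_derivative_at_alt by blast
  \<comment> \<open>\<open>G\<close> is the Taylor remainder. As \<open>p\<close> is differentiated
    only at \<open>z\<close>, the remainder is estimated through its gradient 2 Re (q h), where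
    \<open>q\<close> is small to first order.\<close>
  define G where "G y = \<phi> y - (\<phi> z + 2 * Re (p z * (y - z)) + Re (pp * (y - z) * (y - z)) + lap0 * (cmod (y - z))\<^sup>2)" for y
  define q where "q y = p y - p z - (pp * (y - z) + of_real lap0 * cnj (y - z))" for y
  have dG: "(G has_derivative (\<lambda>h. 2 * Re (q y * h))) (at y)" for y
  proof -
    have r: "(\<phi> has_derivative (\<lambda>h. 2 * Re (p y * h))) (at y)"
      using has_derivative_Re[OF \<phi>(1)[of y, unfolded wdv_def]] by (simp add: algebra_simps)
    have "((\<lambda>y. (cmod (y - z))\<^sup>2) has_derivative (\<lambda>h. 2 * Re (cnj (y - z) * h))) (at y)"
      unfolding cmod_power2 by (auto intro!: derivative_eq_intros simp: algebra_simps)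
    note s = this
    show ?thesis unfolding G_def q_def
      by (rule derivative_eq_intros r s refl | simp)+ (auto simp: algebra_simps fun_eq_iff)
  qed
  have Gb: "\<bar>G y\<bar> \<le> e * (norm (y - z))\<^sup>2" if y: "norm (y - z) < d" for y
  proof -
    have "norm (G y - G z) \<le> (2 * (e' * norm (y - z))) * norm (y - z)"
    proof (rule differentiable_bound[of "cball z (norm (y - z))" G "\<lambda>y h. 2 * Re (q y * h)"])
      show "(G has_derivative (\<lambda>h. 2 * Re (q v * h))) (at v within cball z (norm (y - z)))" for v
        using dG has_derivative_at_withinI by blast
      show "onorm (\<lambda>h. 2 * Re (q v * h)) \<le> 2 * (e' * norm (y - z))" if v: "v \<in> cball z (norm (y - z))" for v
      proof (rule onorm_le)
        fix h :: complex
        have n: "norm (v - z) \<le> norm (y - z)" using v by (simp add: dist_norm norm_minus_commute)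
        have "norm (q v) \<le> e' * norm (v - z)" unfolding q_def using d(2)[of v] n y by simp
        also have "\<dots> \<le> e' * norm (y - z)" using n e' by simp
        finally have "norm (q v) * norm h \<le> (e' * norm (y - z)) * norm h" by (rule mult_right_mono) simp
        moreover have "\<bar>Re (q v * h)\<bar> \<le> norm (q v) * norm h" using abs_Re_le_cmod[of "q v * h"] by (simp add: norm_mult)
        ultimately show "norm (2 * Re (q v * h)) \<le> 2 * (e' * norm (y - z)) * norm h" by simp
      qed
    qed (auto simp: dist_norm norm_minus_commute)
    moreover have "G z = 0" by (simp add: G_def)
    ultimately show ?thesis by (simp add: e'_def power2_eq_square)
  qed
  define \<rho> where "\<rho> = min d \<rho>0 / 2"
  have \<rho>: "0 < \<rho>" "\<rho> < d" "\<rho> < \<rho>0" using d sub(1) by (auto simp: \<rho>_def)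
  define P where "P \<zeta> = of_real (\<phi> z + lap0 * \<rho>\<^sup>2 + e * \<rho>\<^sup>2) + (2 * p z * (of_real \<rho> * \<zeta>) + pp * (of_real \<rho> * \<zeta>) * (of_real \<rho> * \<zeta>))" for \<zeta>
  have holP: "P holomorphic_on UNIV" unfolding P_def by (intro holomorphic_intros)
  have "\<phi> z \<le> cmean (\<lambda>\<zeta>. \<phi> (z + of_real \<rho> * \<zeta>))" using sub(2) \<rho> by blast
  also have "\<dots> \<le> cmean (\<lambda>\<zeta>. Re (P \<zeta>))"
  proof (rule cmean_mono)
    show "cint (\<lambda>\<zeta>. \<phi> (z + of_real \<rho> * \<zeta>))"
      by (rule cint_continuous, rule continuous_on_compose2[OF c\<phi>]) (auto intro!: continuous_intros)
    show "cint (\<lambda>\<zeta>. Re (P \<zeta>))"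
      by (rule cint_continuous) (auto intro!: continuous_intros simp: P_def)
    fix \<zeta> :: complex assume "\<zeta> \<in> sphere 0 1"
    then have "norm (of_real \<rho> * \<zeta>) = \<rho>" using \<rho> by (simp add: norm_mult)
    then have "G (z + of_real \<rho> * \<zeta>) \<le> e * \<rho>\<^sup>2" using Gb[of "z + of_real \<rho> * \<zeta>"] \<rho> by simp
    then show "\<phi> (z + of_real \<rho> * \<zeta>) \<le> Re (P \<zeta>)"
      using \<open>norm (of_real \<rho> * \<zeta>) = \<rho>\<close> unfolding G_def P_def by (simp add: mult.assoc)
  qed
  also have "\<dots> = \<phi> z + lap0 * \<rho>\<^sup>2 + e * \<rho>\<^sup>2" unfolding cmean_holomorphic[OF holP] by (simp add: P_def)
  finally have "0 \<le> (lap0 + e) * \<rho>\<^sup>2" by (simp add: distrib_right)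
  then show "0 \<le> lap0 + e" using \<rho> by (simp add: zero_le_mult_iff)
qed


lemma conv_real_kernel:
  assumes [measurable]: "u \<in> borel_measurable borel"
  shows "conv (\<lambda>y. complex_of_real (u y)) (\<lambda>y. of_real (k y)) z = of_real (conv u k z)"
proof -
  have "of_real (u y) * of_real (k (z - y)) = complex_of_real (u y * k (z - y))" for y by simp
  then show ?thesis unfolding conv_def by (simp only: integral_complex_of_real)
qed

text \<open>Mollification on a slightly larger disc yields a C^2 weight with nonnegative Laplacian
  within \<kappa> of \<Phi>, to which the C^2 case applies.\<close>

lemma extension_continuous_weight:
  fixes \<Phi> :: "complex \<Rightarrow> real"
  assumes c: "continuous_on (ball 0 R1) \<Phi>" and R1: "R1 > 1" and \<eta>: "\<eta> > 0"
    and sub: "\<And>z \<rho>. 0 < \<rho> \<Longrightarrow> cball z \<rho> \<subseteq> ball 0 R1 \<Longrightarrow> \<Phi> z \<le> cmean (\<lambda>\<zeta>. \<Phi> (z + of_real \<rho> * \<zeta>))"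
  shows "\<exists>F. F holomorphic_on ball 0 1 \<and> F 0 = 1 \<and>
    (\<integral>\<^sup>+z. ennreal ((cmod (F z))\<^sup>2 * exp (- \<Phi> z)) * indicator (ball 0 1) z \<partial>lborel) \<le> ennreal ((1 + \<eta>) * (pi * exp (- \<Phi> 0)))"
proof -
  \<comment> \<open>The factors are 1 + \<kappa> from the C^2 case, (1 + \<kappa>)^2 from the larger
    radius, and exp \<kappa> twice: once for exchanging the weights on the disc and once at the
    centre.\<close>
  have "((\<lambda>\<kappa>. (1 + \<kappa>) * (1 + \<kappa>)\<^sup>2 * exp (2 * \<kappa>)) \<longlongrightarrow> (1 + 0) * (1 + 0)\<^sup>2 * exp (2 * 0)) (at_right (0::real))"
    by (intro tendsto_intros)
  then have "\<forall>\<^sub>F \<kappa> in at_right 0. (1 + \<kappa>) * (1 + \<kappa>)\<^sup>2 * exp (2 * \<kappa>) < 1 + \<eta>"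
    using \<eta> by (intro order_tendstoD(2)[where y="(1 + 0) * (1 + 0)\<^sup>2 * exp (2 * 0)"]) auto
  moreover have "\<forall>\<^sub>F \<kappa> in at_right (0::real). \<kappa> \<in> {0<..<R1 - 1}"
    using R1 by (intro eventually_at_right_real) auto
  ultimately have "\<forall>\<^sub>F \<kappa> in at_right 0. (1 + \<kappa>) * (1 + \<kappa>)\<^sup>2 * exp (2 * \<kappa>) < 1 + \<eta> \<and> \<kappa> \<in> {0<..<R1 - 1}"
    by (rule eventually_conj)
  then obtain \<kappa> where \<kappa>: "(1 + \<kappa>) * (1 + \<kappa>)\<^sup>2 * exp (2 * \<kappa>) < 1 + \<eta>" "0 < \<kappa>" "\<kappa> < R1 - 1"
    using eventually_happens[of _ "at_right (0::real)"] by (auto simp: trivial_limit_at_right_real)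
  define R where "R = 1 + \<kappa>"
  define R2 where "R2 = (R + R1) / 2"
  have R: "1 < R" "R < R2" "R2 < R1" using \<kappa> by (auto simp: R_def R2_def)
  have c2: "continuous_on (cball 0 R2) \<Phi>" by (rule continuous_on_subset[OF c]) (use R in auto)
  \<comment> \<open>The cut-off makes the weight bounded and measurable on the plane; convolutions
    and small circles at points of the disc of radius \<open>R\<close> see only the part where it
    agrees with \<Phi>.\<close>
  define u where "u y = indicator (cball 0 R2) y *\<^sub>R \<Phi> y" for y
  have um[measurable]: "u \<in> borel_measurable borel"
    unfolding u_def by (rule borel_measurable_continuous_on_indicator[OF _ c2]) simp
  obtain B where B: "\<And>y. y \<in> cball 0 R2 \<Longrightarrow> \<bar>\<Phi> y\<bar> \<le> B"
  proof -
    have "bounded (\<Phi> ` cball 0 R2)" by (intro compact_imp_bounded compact_continuous_image c2) auto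
    then obtain B where "\<forall>x\<in>\<Phi> ` cball 0 R2. norm x \<le> B" unfolding bounded_iff by blast
    then show ?thesis using that[of B] by (metis imageI real_norm_def)
  qed
  have ub: "\<bar>u y\<bar> \<le> max B 0" for y using B[of y] by (auto simp: u_def indicator_def)
  have ul: "loc_bounded u" unfolding loc_bounded_def using ub by auto
  obtain \<delta>0 where \<delta>0: "\<delta>0 > 0" "\<And>x y. x \<in> cball 0 R2 \<Longrightarrow> y \<in> cball 0 R2 \<Longrightarrow> dist y x < \<delta>0 \<Longrightarrow> dist (\<Phi> y) (\<Phi> x) < \<kappa>"
  proof -
    have "uniformly_continuous_on (cball 0 R2) \<Phi>"
      by (rule compact_uniformly_continuous[OF c2]) auto
    then show ?thesis using that \<kappa>(2) unfolding uniformly_continuous_on_def by metis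
  qed
  define \<delta> where "\<delta> = min \<delta>0 (R2 - R) / 3"
  have \<delta>: "\<delta> > 0" "\<delta> < \<delta>0" "2 * \<delta> < R2 - R" using \<delta>0(1) R by (auto simp: \<delta>_def min_def)
  define d where "d = \<delta>\<^sup>2"
  have d: "d > 0" "sqrt d = \<delta>" using \<delta> by (auto simp: d_def)
  define k where "k w = cmod (bker d w)" for w
  have bk: "bker d = (\<lambda>w. of_real (k w))" using bker_real[of d] by (auto simp: k_def fun_eq_iff)
  have ck: "continuous_on UNIV k" unfolding k_def by (intro continuous_intros bker_continuous)
  have km[measurable]: "k \<in> borel_measurable borel" using ck by simp
  have sk: "k w = 0" if "w \<notin> cball 0 \<delta>" for w using bker_support(1)[OF d(1)] that by (simp add: k_def d(2))
  have k1: "has_bochner_integral lborel k 1"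
    by (rule has_bochner_integral_nn_integral) (use bker_mass[OF d(1)] in \<open>auto simp: k_def\<close>)
  define \<phi> where "\<phi> = conv u k"
  define uC where "uC y = complex_of_real (u y)" for y
  have uCm: "uC \<in> borel_measurable borel" unfolding uC_def by measurable
  have uCl: "loc_bounded uC" using ul by (simp add: loc_bounded_def uC_def)
  have \<phi>C: "conv uC (bker d) = (\<lambda>z. of_real (\<phi> z))" unfolding bk uC_def \<phi>_def by (intro ext conv_real_kernel um)
  define kz kb kzz kzb where "kz v = of_real (bker1 d ((cmod v)\<^sup>2)) * cnj v" and "kb v = of_real (bker1 d ((cmod v)\<^sup>2)) * v"
    and "kzz v = of_real (bker2 d ((cmod v)\<^sup>2)) * cnj v * cnj v"
    and "kzb v = of_real (bker2 d ((cmod v)\<^sup>2)) * v * cnj v + of_real (bker1 d ((cmod v)\<^sup>2))" for v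
  have "C2w (bker d) kz kb kzz kzb (\<lambda>z. of_real (bker2 d ((cmod z)\<^sup>2)) * z * z)"
    unfolding kz_def[abs_def] kb_def[abs_def] kzz_def[abs_def] kzb_def[abs_def] by (rule bker_C2_0)
  note C2 = C2wD[OF this]
  have s': "bker d v = 0" "kz v = 0" "kb v = 0" "kzz v = 0" "kzb v = 0" if "v \<notin> cball 0 (sqrt d)" for v
    using bker_support[OF d(1) that] by (auto simp: kz_def kb_def kzz_def kzb_def)
  define lap where "lap z = Re (conv uC kzb z)" for z
  have w1: "wdv (conv uC (bker d)) (conv uC kz z) (conv uC kb z) z" for z
    by (rule conv_wdv[OF uCm uCl C2(1) s'(1) C2(8,9) s'(2,3)])
  have w2: "wdv (conv uC kz) (conv uC kzz z) (conv uC kzb z) z" for z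
    by (rule conv_wdv[OF uCm uCl C2(2) s'(2) C2(4,5) s'(4,5)])
  have cn: "conv uC kb z = cnj (conv uC kz z)" for z
  proof -
    have "conv uC kb z = (\<integral>y. cnj (uC y * kz (z - y)) \<partial>lborel)" unfolding conv_def by (simp add: uC_def kz_def kb_def)
    then show ?thesis unfolding conv_def by (simp only: Bochner_Integration.integral_cnj)
  qed
  have lr: "conv uC kzb z = of_real (lap z)" for z
  proof -
    have "kzb v = of_real (Re (kzb v))" for v
      by (simp add: kzb_def complex_eq_iff)
    then have "conv uC kzb z = of_real (conv u (\<lambda>v. Re (kzb v)) z)"
      using conv_real_kernel[OF um, of "\<lambda>v. Re (kzb v)" z] by (simp add: uC_def[abs_def])
    then show ?thesis by (simp add: lap_def)
  qed
  have W1: "wdv (\<lambda>z. of_real (\<phi> z)) (conv uC kz z) (cnj (conv uC kz z)) z" for z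
    using w1[of z] unfolding cn \<phi>C .
  have W2: "wdv (conv uC kz) (conv uC kzz z) (of_real (lap z)) z" for z
    using w2[of z] unfolding lr .
  have C: "continuous_on UNIV (conv uC kzz)" by (rule conv_continuous[OF uCm uCl C2(4) s'(4)])
  have C': "continuous_on UNIV lap"
    unfolding lap_def[abs_def] by (rule continuous_on_Re[OF conv_continuous[OF uCm uCl C2(5) s'(5)]])
  have L: "lap z \<ge> 0" if z: "z \<in> ball 0 R" for z
  proof (rule laplacian_nonneg[OF W1 W2 \<delta>(1)])
    fix \<rho> :: real assume \<rho>: "0 < \<rho>" "\<rho> < \<delta>"
    show "\<phi> z \<le> cmean (\<lambda>\<zeta>. \<phi> (z + of_real \<rho> * \<zeta>))" unfolding \<phi>_def
    proof (rule conv_submean[OF um ul ck sk])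
      fix w :: complex assume w: "w \<in> cball 0 \<delta>"
      have n: "norm (z - w) < R + \<delta>" using norm_triangle_ineq4[of z w] w z by simp
      have in2: "z - w + of_real \<rho> * \<zeta> \<in> cball 0 R2" if "norm \<zeta> \<le> 1" for \<zeta>
      proof -
        have "norm (z - w + of_real \<rho> * \<zeta>) \<le> norm (z - w) + norm (of_real \<rho> * \<zeta>)" by (rule norm_triangle_ineq)
        moreover have "norm (of_real \<rho> * \<zeta>) \<le> \<rho>" using \<rho> that by (simp add: norm_mult mult_left_le)
        ultimately show ?thesis using n \<rho> \<delta> by simp
      qed
      have "cball (z - w) \<rho> \<subseteq> ball 0 R1"
      proof
        fix y assume "y \<in> cball (z - w) \<rho>"
        then have "norm (y - (z - w)) \<le> \<rho>" by (simp add: dist_norm norm_minus_commute)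
        then have "norm y < R + \<delta> + \<rho>" using norm_triangle_sub[of y "z - w"] n by linarith
        then show "y \<in> ball 0 R1" using \<rho> \<delta> R by simp
      qed
      then have "\<Phi> (z - w) \<le> cmean (\<lambda>\<zeta>. \<Phi> (z - w + of_real \<rho> * \<zeta>))" using sub[OF \<rho>(1)] by blast
      also have "\<dots> = cmean (\<lambda>\<zeta>. u (z - w + of_real \<rho> * \<zeta>))"
        by (rule cmean_cong) (use in2 in \<open>simp add: u_def\<close>)
      also have "\<Phi> (z - w) = u (z - w)" using in2[of 0] by (simp add: u_def)
      finally show "u (z - w) \<le> cmean (\<lambda>\<zeta>. u (z - w + of_real \<rho> * \<zeta>))" .
    qed (auto simp: k_def intro!: continuous_intros)
  qed
  have close: "\<bar>\<phi> z - \<Phi> z\<bar> \<le> \<kappa>" if z: "z \<in> cball 0 R" for z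
  proof -
    have i1: "integrable lborel (\<lambda>w. u (z - w) * k w)"
    proof -
      have "integrable lborel (\<lambda>y. u y * k (z - y))" by (rule conv_integrable[OF um ul ck sk])
      then have "integrable (distr lborel borel (\<lambda>w. z + (-1) *\<^sub>R w)) (\<lambda>y. u y * k (z - y))"
        using lborel_affine[of "-1" z] by (simp add: density_1)
      then show ?thesis by (subst (asm) integrable_distr_eq) auto
    qed
    have ik: "integrable lborel k" "(\<integral>w. k w \<partial>lborel) = 1" using k1 by (auto simp: has_bochner_integral_iff)
    have "\<phi> z - \<Phi> z = (\<integral>w. u (z - w) * k w - \<Phi> z * k w \<partial>lborel)"
      unfolding \<phi>_def conv_reflect[OF um km] using i1 ik by simp
    also have "\<bar>\<dots>\<bar> \<le> (\<integral>w. \<kappa> * k w \<partial>lborel)"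
    proof (rule Bochner_Integration.integral_abs_bound_integral)
      fix w :: complex
      show "\<bar>u (z - w) * k w - \<Phi> z * k w\<bar> \<le> \<kappa> * k w"
      proof (cases "w \<in> cball 0 \<delta>")
        case True
        have "norm (z - w) \<le> R + \<delta>" using norm_triangle_ineq4[of z w] True z by simp
        then have zw: "z - w \<in> cball 0 R2" "z \<in> cball 0 R2" using \<delta> z R by auto
        have "dist (\<Phi> (z - w)) (\<Phi> z) < \<kappa>" by (rule \<delta>0(2)) (use zw True \<delta> in \<open>auto simp: dist_norm\<close>)
        then have "\<bar>u (z - w) - \<Phi> z\<bar> \<le> \<kappa>" using zw by (simp add: u_def dist_real_def)
        then have "\<bar>u (z - w) - \<Phi> z\<bar> * k w \<le> \<kappa> * k w" by (rule mult_right_mono) (simp add: k_def)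
        moreover have "\<bar>u (z - w) * k w - \<Phi> z * k w\<bar> = \<bar>u (z - w) - \<Phi> z\<bar> * k w"
          by (simp add: left_diff_distrib[symmetric] abs_mult k_def)
        ultimately show ?thesis by simp
      qed (simp add: sk)
    qed (use i1 ik in auto)
    also have "\<dots> = \<kappa>" using ik by simp
    finally show ?thesis .
  qed
  obtain F where F: "F holomorphic_on ball 0 1" "F 0 = 1"
    "(\<integral>\<^sup>+z. ennreal ((cmod (F z))\<^sup>2 * exp (- \<phi> z)) * indicator (ball 0 1) z \<partial>lborel) \<le> ennreal ((1 + \<kappa>) * (pi * R\<^sup>2 * exp (- \<phi> 0)))"
    using extension_C2_weight[OF W1 W2 C C' L, of R 1 \<kappa>] R \<kappa>(2) by auto
  have "(\<integral>\<^sup>+z. ennreal ((cmod (F z))\<^sup>2 * exp (- \<Phi> z)) * indicator (ball 0 1) z \<partial>lborel)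
     \<le> (\<integral>\<^sup>+z. ennreal (exp \<kappa>) * (ennreal ((cmod (F z))\<^sup>2 * exp (- \<phi> z)) * indicator (ball 0 1) z) \<partial>lborel)"
  proof (rule nn_integral_mono)
    fix z :: complex
    show "ennreal ((cmod (F z))\<^sup>2 * exp (- \<Phi> z)) * indicator (ball 0 1) z \<le> ennreal (exp \<kappa>) * (ennreal ((cmod (F z))\<^sup>2 * exp (- \<phi> z)) * indicator (ball 0 1) z)"
    proof (cases "z \<in> ball 0 1")
      case True
      then have "- \<Phi> z \<le> \<kappa> + - \<phi> z" using close[of z] R by simp
      then have "exp (- \<Phi> z) \<le> exp \<kappa> * exp (- \<phi> z)" unfolding exp_add[symmetric] by simp
      then have "(cmod (F z))\<^sup>2 * exp (- \<Phi> z) \<le> exp \<kappa> * ((cmod (F z))\<^sup>2 * exp (- \<phi> z))"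
        using mult_left_mono[of "exp (- \<Phi> z)" "exp \<kappa> * exp (- \<phi> z)" "(cmod (F z))\<^sup>2"] by (simp add: mult_ac)
      then show ?thesis using True by (simp add: ennreal_mult[symmetric] ennreal_leI)
    qed simp
  qed
  also have "\<dots> = ennreal (exp \<kappa>) * (\<integral>\<^sup>+z. ennreal ((cmod (F z))\<^sup>2 * exp (- \<phi> z)) * indicator (ball 0 1) z \<partial>lborel)"
  proof (rule nn_integral_cmult)
    have "continuous_on (ball 0 1) (\<lambda>z. (cmod (F z))\<^sup>2 * exp (- \<phi> z))"
      by (intro continuous_intros holomorphic_on_imp_continuous_on[OF F(1)] continuous_on_subset[OF conv_continuous[OF um ul ck sk]]) (auto simp: \<phi>_def intro: continuous_on_subset[OF conv_continuous[OF um ul ck sk]])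
    then have "(\<lambda>z. indicator (ball 0 1) z *\<^sub>R ((cmod (F z))\<^sup>2 * exp (- \<phi> z))) \<in> borel_measurable borel"
      by (intro borel_measurable_continuous_on_indicator) auto
    then have E1: "(\<lambda>z. ennreal (indicator (ball 0 1) z *\<^sub>R ((cmod (F z))\<^sup>2 * exp (- \<phi> z)))) \<in> borel_measurable borel" by measurable
    have E2: "(\<lambda>z. ennreal (indicator (ball 0 1) z *\<^sub>R ((cmod (F z))\<^sup>2 * exp (- \<phi> z)))) = (\<lambda>z. ennreal ((cmod (F z))\<^sup>2 * exp (- \<phi> z)) * indicator (ball 0 1) z)"
      by (auto simp: indicator_def fun_eq_iff)
    show "(\<lambda>z. ennreal ((cmod (F z))\<^sup>2 * exp (- \<phi> z)) * indicator (ball 0 1) z) \<in> borel_measurable lborel"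
      using E1 unfolding E2 by simp
  qed
  also have "\<dots> \<le> ennreal (exp \<kappa>) * ennreal ((1 + \<kappa>) * (pi * R\<^sup>2 * exp (- \<phi> 0)))"
    by (rule mult_left_mono[OF F(3)]) simp
  also have "\<dots> = ennreal (exp \<kappa> * ((1 + \<kappa>) * (pi * R\<^sup>2 * exp (- \<phi> 0))))"
    using \<kappa> by (subst ennreal_mult) auto
  also have "\<dots> \<le> ennreal ((1 + \<eta>) * (pi * exp (- \<Phi> 0)))"
  proof (rule ennreal_leI)
    have "- \<phi> 0 \<le> \<kappa> + - \<Phi> 0" using close[of 0] R by simp
    then have "exp (- \<phi> 0) \<le> exp \<kappa> * exp (- \<Phi> 0)" unfolding exp_add[symmetric] by simp
    then have "exp \<kappa> * ((1 + \<kappa>) * (pi * R\<^sup>2 * exp (- \<phi> 0))) \<le> exp \<kappa> * ((1 + \<kappa>) * (pi * R\<^sup>2 * (exp \<kappa> * exp (- \<Phi> 0))))"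
      using \<kappa> by (intro mult_left_mono) auto
    also have "\<dots> = ((1 + \<kappa>) * (1 + \<kappa>)\<^sup>2 * exp (2 * \<kappa>)) * (pi * exp (- \<Phi> 0))"
      unfolding R_def exp_double by (simp add: power2_eq_square)
    also have "\<dots> \<le> (1 + \<eta>) * (pi * exp (- \<Phi> 0))"
      using \<kappa>(1) by (intro mult_right_mono) auto
    finally show "exp \<kappa> * ((1 + \<kappa>) * (pi * R\<^sup>2 * exp (- \<phi> 0))) \<le> (1 + \<eta>) * (pi * exp (- \<Phi> 0))" .
  qed
  finally show ?thesis using F by blast
qed

section \<open>Marginals by transport\<close>

lemma cmean_eq_integral:
  assumes "continuous_on (sphere 0 1) g"
  shows "cmean g = 1 / (2 * pi) * integral {0..2*pi} (\<lambda>\<theta>. g (cis \<theta>))"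
  using cint_continuous[OF assms] unfolding cint_def cmean_def by (simp add: set_borel_integral_eq_integral(2))

lemma continuous_on_Pair_const [continuous_intros]: "continuous_on A (Pair z)"
  using continuous_on_Pair[OF continuous_on_const continuous_on_id, of A z] by simp

text \<open>The inequality of arithmetic and geometric means: ln x <= x - 1 at x = h z / cmean h,
  averaged over the circle.\<close>

lemma cmean_jensen_ln:
  assumes h: "continuous_on (sphere 0 1) h" "\<And>z. z \<in> sphere 0 1 \<Longrightarrow> h z > 0"
  shows "cmean h > 0" "cmean (\<lambda>z. ln (h z)) \<le> ln (cmean h)"
proof -
  have "\<exists>x\<in>sphere 0 1. \<forall>y\<in>sphere (0::complex) 1. h x \<le> h y"
    by (rule continuous_attains_inf[OF _ _ h(1)]) auto
  then obtain x where x: "x \<in> sphere 0 1" "\<And>y. y \<in> sphere 0 1 \<Longrightarrow> h x \<le> h y" by blast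
  have "cmean (\<lambda>z. h x) \<le> cmean h" by (rule cmean_mono) (use x h in \<open>auto intro: cint_continuous\<close>)
  then show M: "cmean h > 0" using h(2)[OF x(1)] by simp
  have "h z \<noteq> 0" if "z \<in> sphere 0 1" for z using h(2)[OF that] by simp
  then have cl: "cint (\<lambda>z. ln (h z))" by (intro cint_continuous continuous_intros h) auto
  have "cmean (\<lambda>z. ln (h z)) \<le> cmean (\<lambda>z. (ln (cmean h) - 1) + 1 / cmean h * h z)"
  proof (rule cmean_mono[OF cl])
    show "cint (\<lambda>z. ln (cmean h) - 1 + 1 / cmean h * h z)" by (intro cint_add cint_const cint_cmult cint_continuous h)
    fix z :: complex assume z: "z \<in> sphere 0 1"
    have "ln (h z / cmean h) \<le> h z / cmean h - 1" using h(2)[OF z] M by (intro ln_le_minus_one) simp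
    then show "ln (h z) \<le> ln (cmean h) - 1 + 1 / cmean h * h z" using h(2)[OF z] M by (simp add: ln_div)
  qed
  also have "\<dots> = (ln (cmean h) - 1) + 1 / cmean h * cmean h"
    by (subst cmean_add, simp, intro cint_cmult cint_continuous h, subst cmean_cmult, simp)
  finally show "cmean (\<lambda>z. ln (h z)) \<le> ln (cmean h)" using M by simp
qed

text \<open>The maps \<open>T z\<close> transport the uniform density on \<open>[0,1]\<close> to the normalised density \<open>exp (- u z)\<close>.
  Their circle mean \<open>T0\<close> parametrises \<open>[-L, L]\<close>, and \<open>ln T0'\<close> is bounded below by the mean of \<open>ln (T z)'\<close>.\<close>

lemma transport_inequality:
  fixes u :: "complex \<Rightarrow> real \<Rightarrow> real" and v :: "real \<Rightarrow> real"
  assumes u: "continuous_on (sphere 0 1 \<times> {-L..L}) (\<lambda>(z, t). u z t)" and v: "continuous_on {-L..L} v" and L: "L > 0"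
    and H: "\<And>X. continuous_on (sphere 0 1) X \<Longrightarrow> (\<And>z. z \<in> sphere 0 1 \<Longrightarrow> X z \<in> {-L..L}) \<Longrightarrow> v (cmean X) \<le> cmean (\<lambda>z. u z (X z))"
  shows "cmean (\<lambda>z. ln (integral {-L..L} (\<lambda>t. exp (- u z t)))) \<le> ln (integral {-L..L} (\<lambda>t. exp (- v t)))"
proof -
  define I where "I = {-L..L}"
  define S where "S = sphere (0::complex) 1"
  define E where "E z t = exp (- u z t)" for z t
  have cE: "continuous_on (S \<times> I) (\<lambda>p. E (fst p) (snd p))"
    using u unfolding E_def S_def I_def by (intro continuous_intros) (simp add: case_prod_beta')
  have cEz: "continuous_on I (E z)" if "z \<in> S" for z
    using continuous_on_compose2[OF cE, of I "\<lambda>t. (z, t)"] that by (auto intro!: continuous_intros)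
  have compSI: "compact (S \<times> I)" unfolding S_def I_def by (intro compact_Times) auto
  have ne: "S \<times> I \<noteq> {}" using L by (auto simp: S_def I_def intro!: exI[of _ 1])
  obtain m where m: "m > 0" "\<And>z t. z \<in> S \<Longrightarrow> t \<in> I \<Longrightarrow> m \<le> E z t"
  proof -
    obtain p where "p \<in> S \<times> I" "\<And>q. q \<in> S \<times> I \<Longrightarrow> E (fst p) (snd p) \<le> E (fst q) (snd q)"
      using continuous_attains_inf[OF compSI ne cE] by blast
    then show ?thesis using that[of "E (fst p) (snd p)"] by (force simp: E_def)
  qed
  obtain M where M: "M > 0" "\<And>z t. z \<in> S \<Longrightarrow> t \<in> I \<Longrightarrow> E z t \<le> M"
  proof -
    obtain p where "p \<in> S \<times> I" "\<And>q. q \<in> S \<times> I \<Longrightarrow> E (fst p) (snd p) \<ge> E (fst q) (snd q)"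
      using continuous_attains_sup[OF compSI ne cE] by blast
    then show ?thesis using that[of "E (fst p) (snd p)"] by (force simp: E_def)
  qed
  have inte: "E z integrable_on {a..b}" if "z \<in> S" "{a..b} \<subseteq> I" for z a b
    by (intro integrable_continuous_real continuous_on_subset[OF cEz] that)
  define W where "W z t = integral {-L..t} (E z)" for z t
  define w where "w z = W z L" for z
  have Wdiff: "W z b - W z a \<ge> m * (b - a)" if "z \<in> S" "-L \<le> a" "a \<le> b" "b \<le> L" for z a b
  proof -
    have i: "W z a + integral {a..b} (E z) = W z b" unfolding W_def
      by (rule Henstock_Kurzweil_Integration.integral_combine) (use that in \<open>auto intro!: inte simp: I_def\<close>)
    have j: "integral {a..b} (\<lambda>t. m) \<le> integral {a..b} (E z)"
      by (rule integral_le) (use that in \<open>auto intro!: inte m simp: I_def\<close>)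
    have k: "integral {a..b} (\<lambda>t. m) = m * (b - a)" using that by (simp add: mult.commute)
    show ?thesis using i j unfolding k by linarith
  qed
  \<comment> \<open>The uniform lower bound on the density makes the distribution functions
    injective with a Lipschitz inverse, uniformly in z. Uniqueness and joint continuity of the
    quantile maps both rest on this.\<close>
  have Wabs: "m * \<bar>b - a\<bar> \<le> \<bar>W z b - W z a\<bar>" if "z \<in> S" "a \<in> I" "b \<in> I" for z a b
    using Wdiff[of z a b] Wdiff[of z b a] that m(1) by (cases "a \<le> b") (auto simp: I_def)
  have W0: "W z (-L) = 0" for z by (simp add: W_def)
  have wpos: "w z > 0" if "z \<in> S" for z
  proof -
    have "m * (L - - L) \<le> W z L - W z (-L)" using Wdiff[of z "-L" L] that L by simp
    moreover have "m * (L - - L) > 0" using m L by simp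
    ultimately show ?thesis unfolding w_def W0 by linarith
  qed
  have wM: "w z \<le> 2 * L * M" if "z \<in> S" for z
  proof -
    have "integral {-L..L} (E z) \<le> integral {-L..L} (\<lambda>t. M)"
      by (rule integral_le) (use that in \<open>auto intro!: inte M simp: I_def\<close>)
    then show ?thesis using L by (simp add: w_def W_def)
  qed
  have Wcont: "continuous_on I (W z)" if "z \<in> S" for z
    unfolding W_def I_def by (rule indefinite_integral_continuous_1) (use inte[of z "-L" L] that in \<open>simp add: I_def\<close>)
  \<comment> \<open>\<open>T z s\<close> is the quantile: the point up to which the density
    \<open>E z\<close> carries the fraction \<open>s\<close> of its mass.\<close>
  define T where "T z s = (SOME t. t \<in> I \<and> W z t = s * w z)" for z s
  have T: "T z s \<in> I" "W z (T z s) = s * w z" if "z \<in> S" "s \<in> {0..1}" for z s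
  proof -
    have "\<exists>t\<ge>-L. t \<le> L \<and> W z t = s * w z"
    proof (rule IVT')
      show "W z (-L) \<le> s * w z" using W0 wpos[OF that(1)] that by simp
      show "s * w z \<le> W z L" using wpos[OF that(1)] that by (simp add: w_def[symmetric] mult_left_le_one_le)
    qed (use L Wcont[OF that(1)] in \<open>auto simp: I_def\<close>)
    then have "\<exists>t. t \<in> I \<and> W z t = s * w z" by (auto simp: I_def)
    from someI_ex[OF this] show "T z s \<in> I" "W z (T z s) = s * w z" unfolding T_def by auto
  qed
  have Tuniq: "T z s = t" if "z \<in> S" "s \<in> {0..1}" "t \<in> I" "W z t = s * w z" for z s t
  proof -
    have "m * \<bar>t - T z s\<bar> \<le> 0" using Wabs[of z "T z s" t] T[of z s] that by simp
    then show ?thesis using m by (simp add: mult_le_0_iff)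
  qed
  have T0e: "T z 0 = -L" if "z \<in> S" for z by (rule Tuniq) (use that L W0 in \<open>auto simp: I_def\<close>)
  have T1e: "T z 1 = L" if "z \<in> S" for z by (rule Tuniq) (use that L in \<open>auto simp: I_def w_def\<close>)
  have Eunif: "\<exists>d>0. \<forall>z\<in>S. \<forall>z'\<in>S. dist z z' < d \<longrightarrow> (\<forall>t\<in>I. \<bar>E z t - E z' t\<bar> \<le> \<epsilon>)" if \<epsilon>: "\<epsilon> > 0" for \<epsilon>
  proof -
    have "uniformly_continuous_on (S \<times> I) (\<lambda>p. E (fst p) (snd p))"
      by (rule compact_uniformly_continuous[OF cE compSI])
    then obtain d where d: "d > 0" "\<And>p q. p \<in> S \<times> I \<Longrightarrow> q \<in> S \<times> I \<Longrightarrow> dist q p < d \<Longrightarrow> dist (E (fst q) (snd q)) (E (fst p) (snd p)) < \<epsilon>"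
      using \<epsilon> unfolding uniformly_continuous_on_def by metis
    have "\<bar>E z t - E z' t\<bar> \<le> \<epsilon>" if "z \<in> S" "z' \<in> S" "dist z z' < d" "t \<in> I" for z z' t
      using d(2)[of "(z', t)" "(z, t)"] that by (simp add: dist_Pair_Pair dist_real_def)
    then show ?thesis using d(1) by blast
  qed
  have Wz: "\<bar>W z t - W z' t\<bar> \<le> 2 * L * \<epsilon>" if "z \<in> S" "z' \<in> S" "t \<in> I" "\<And>t. t \<in> I \<Longrightarrow> \<bar>E z t - E z' t\<bar> \<le> \<epsilon>" "\<epsilon> > 0" for z z' t \<epsilon>
  proof -
    have sub: "{-L..t} \<subseteq> I" using that(3) by (auto simp: I_def)
    have "W z t - W z' t = integral {-L..t} (\<lambda>t. E z t - E z' t)"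
      unfolding W_def by (rule Henstock_Kurzweil_Integration.integral_diff[symmetric]) (intro inte sub that)+
    also have "norm \<dots> \<le> integral {-L..t} (\<lambda>t. \<epsilon>)"
      by (rule Henstock_Kurzweil_Integration.integral_norm_bound_integral)
        (use that sub in \<open>auto intro!: Henstock_Kurzweil_Integration.integrable_diff inte\<close>)
    also have "\<dots> = (t + L) * \<epsilon>" using that(3) by (simp add: I_def)
    also have "\<dots> \<le> 2 * L * \<epsilon>" using that(3,5) by (intro mult_right_mono) (auto simp: I_def)
    finally show ?thesis by simp
  qed
  have cT: "continuous_on (S \<times> {0..1}) (\<lambda>p. T (fst p) (snd p))"
    unfolding continuous_on_iff
  proof (intro ballI allI impI)
    fix p :: "complex \<times> real" and e :: real assume p: "p \<in> S \<times> {0..1}" and e: "e > 0"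
    obtain z s where zs: "p = (z, s)" "z \<in> S" "s \<in> {0..1}" using p by auto
    \<comment> \<open>With this \<epsilon> and the second bound in \<open>d'\<close>, the variations
      of the density, of its total mass and of \<open>s\<close> contribute at most m e / 4
      each.\<close>
    define \<epsilon> where "\<epsilon> = m * e / (8 * L)"
    have \<epsilon>: "\<epsilon> > 0" using m e L by (simp add: \<epsilon>_def)
    obtain d where d: "d > 0" "\<And>z z' t. z \<in> S \<Longrightarrow> z' \<in> S \<Longrightarrow> dist z z' < d \<Longrightarrow> t \<in> I \<Longrightarrow> \<bar>E z t - E z' t\<bar> \<le> \<epsilon>"
      using Eunif[OF \<epsilon>] by blast
    define d' where "d' = min d (m * e / (4 * (2 * L * M)))"
    have d': "d' > 0" using d m e L M by (simp add: d'_def)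
    show "\<exists>d>0. \<forall>q\<in>S \<times> {0..1}. dist q p < d \<longrightarrow> dist (T (fst q) (snd q)) (T (fst p) (snd p)) < e"
    proof (intro exI[of _ d'] conjI ballI impI)
      fix q assume q: "q \<in> S \<times> {0..1}" "dist q p < d'"
      obtain z' s' where zs': "q = (z', s')" "z' \<in> S" "s' \<in> {0..1}" using q by auto
      have dz: "dist z' z < d" "\<bar>s' - s\<bar> < m * e / (4 * (2 * L * M))"
        using q(2) dist_fst_le[of q p] dist_snd_le[of q p] by (auto simp: zs zs' d'_def dist_real_def)
      define t t' where "t = T z s" and "t' = T z' s'"
      have t: "t \<in> I" "t' \<in> I" "W z t = s * w z" "W z' t' = s' * w z'" using T zs zs' by (auto simp: t_def t'_def)
      have E': "\<bar>E z' a - E z a\<bar> \<le> \<epsilon>" if "a \<in> I" for a using d(2)[of z' z a] zs zs' dz that by simp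
      have a1: "\<bar>W z' t' - W z t'\<bar> \<le> 2 * L * \<epsilon>" by (rule Wz) (use zs zs' t E' \<epsilon> in auto)
      have a2: "\<bar>w z' - w z\<bar> \<le> 2 * L * \<epsilon>" unfolding w_def by (rule Wz) (use zs zs' E' \<epsilon> L in \<open>auto simp: I_def\<close>)
      have "m * \<bar>t' - t\<bar> \<le> \<bar>W z t' - W z t\<bar>" by (rule Wabs) (use zs t in auto)
      also have "W z t' - W z t = (W z t' - W z' t') + s' * (w z' - w z) + (s' - s) * w z" unfolding t by (simp add: algebra_simps)
      also have "\<bar>\<dots>\<bar> \<le> \<bar>W z t' - W z' t'\<bar> + \<bar>s' * (w z' - w z)\<bar> + \<bar>(s' - s) * w z\<bar>" by linarith
      also have "\<dots> \<le> 2 * L * \<epsilon> + 2 * L * \<epsilon> + \<bar>s' - s\<bar> * (2 * L * M)"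
      proof (intro add_mono)
        show "\<bar>W z t' - W z' t'\<bar> \<le> 2 * L * \<epsilon>" using a1 by simp
        have "\<bar>s' * (w z' - w z)\<bar> \<le> 1 * \<bar>w z' - w z\<bar>" unfolding abs_mult using zs' by (intro mult_right_mono) auto
        then show "\<bar>s' * (w z' - w z)\<bar> \<le> 2 * L * \<epsilon>" using a2 by simp
        show "\<bar>(s' - s) * w z\<bar> \<le> \<bar>s' - s\<bar> * (2 * L * M)"
          unfolding abs_mult using wpos[of z] wM[of z] zs by (intro mult_left_mono) auto
      qed
      also have "\<dots> < m * e / 4 + m * e / 4 + m * e / 4"
      proof -
        have x1: "2 * L * \<epsilon> = m * e / 4" using L by (simp add: \<epsilon>_def)
        have x2: "\<bar>s' - s\<bar> * (2 * L * M) < m * e / 4"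
          using dz(2) L M by (simp add: pos_less_divide_eq mult_ac)
        show ?thesis unfolding x1 using x2 by (intro add_strict_left_mono)
      qed
      also have "\<dots> \<le> m * e" using m e by simp
      finally show "dist (T (fst q) (snd q)) (T (fst p) (snd p)) < e"
        using m by (simp add: zs zs' t_def t'_def dist_real_def)
    qed (rule d')
  qed
  have cw: "continuous_on S w"
    unfolding continuous_on_iff
  proof (intro ballI allI impI)
    fix z e assume z: "z \<in> S" and e: "(e::real) > 0"
    have "e / (4 * L) > 0" using e L by simp
    from Eunif[OF this] obtain d where d: "d > 0" "\<And>z z' t. z \<in> S \<Longrightarrow> z' \<in> S \<Longrightarrow> dist z z' < d \<Longrightarrow> t \<in> I \<Longrightarrow> \<bar>E z t - E z' t\<bar> \<le> e / (4 * L)"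
      by blast
    have "dist (w z') (w z) < e" if "z' \<in> S" "dist z' z < d" for z'
    proof -
      have "\<bar>w z' - w z\<bar> \<le> 2 * L * (e / (4 * L))" unfolding w_def
        by (rule Wz) (use that z d(2)[of z' z] e L in \<open>auto simp: I_def\<close>)
      then show ?thesis using e L by (simp add: dist_real_def)
    qed
    then show "\<exists>d>0. \<forall>x'\<in>S. dist x' z < d \<longrightarrow> dist (w x') (w z) < e" using d(1) by blast
  qed
  have cET: "continuous_on (S \<times> {0..1}) (\<lambda>p. E (fst p) (T (fst p) (snd p)))"
  proof -
    have "continuous_on (S \<times> {0..1}) (\<lambda>p. E (fst (fst p, T (fst p) (snd p))) (snd (fst p, T (fst p) (snd p))))"
      by (rule continuous_on_compose2[OF cE]) (use T in \<open>auto intro!: continuous_intros cT\<close>)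
    then show ?thesis by simp
  qed
  \<comment> \<open>The one-dimensional transport equation T' E(T) = w, solved for the derivative of
    the quantile map.\<close>
  define T' where "T' z s = w z / E z (T z s)" for z s
  have Epos: "E z t > 0" for z t by (simp add: E_def)
  have cT': "continuous_on (S \<times> {0..1}) (\<lambda>p. T' (fst p) (snd p))"
    unfolding T'_def using Epos
    by (intro continuous_intros cET continuous_on_compose2[OF cw]) (auto simp: less_imp_neq[symmetric])
  have sec: "continuous_on S (\<lambda>z. g z s)" if "continuous_on (S \<times> {0..1}) (\<lambda>p. g (fst p) (snd p))" "s \<in> {0..1}" for g :: "complex \<Rightarrow> real \<Rightarrow> real" and s
  proof -
    have "continuous_on S (\<lambda>z. g (fst (z, s)) (snd (z, s)))"
      by (rule continuous_on_compose2[OF that(1)]) (use that(2) in \<open>auto intro!: continuous_intros\<close>)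
    then show ?thesis by simp
  qed
  have dT: "(T z has_real_derivative T' z s) (at s)" if z: "z \<in> S" and s: "0 < s" "s < 1" for z s
  proof -
    have Ts: "T z s \<in> I" "W z (T z s) = s * w z" using T z s by auto
    have "T z s \<noteq> -L" "T z s \<noteq> L" using Ts(2) W0[of z] wpos[OF z] s by (auto simp: w_def)
    then have int: "-L < T z s" "T z s < L" using Ts(1) by (auto simp: I_def)
    have "(W z has_real_derivative E z (T z s)) (at (T z s) within {-L..L})"
      unfolding W_def by (rule integral_has_real_derivative) (use cEz[OF z] Ts in \<open>auto simp: I_def\<close>)
    then have "(W z has_real_derivative E z (T z s)) (at (T z s))"
      using int by (simp add: at_within_Icc_at)
    then have d: "((\<lambda>t. W z t / w z) has_real_derivative E z (T z s) / w z) (at (T z s))"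
      by (rule DERIV_cdivide)
    have "continuous_on {0<..<1} (T z)"
    proof -
      have "continuous_on {0<..<1} (\<lambda>s. T (fst (z, s)) (snd (z, s)))"
        by (rule continuous_on_compose2[OF cT]) (use z in \<open>auto intro!: continuous_intros\<close>)
      then show ?thesis by simp
    qed
    then have "isCont (T z) s" using s by (simp add: continuous_on_eq_continuous_at)
    then have "DERIV (T z) s :> inverse (E z (T z s) / w z)"
      by (intro DERIV_inverse_function[where f="\<lambda>t. W z t / w z" and a=0 and b=1] d s) (use Epos wpos[OF z] T[OF z] in \<open>auto simp: less_imp_neq[symmetric]\<close>)
    then show ?thesis by (simp add: T'_def)
  qed
  have cisS: "cis \<theta> \<in> S" for \<theta> by (simp add: S_def)
  have cpar: "continuous_on (U \<times> cbox 0 (2*pi)) (\<lambda>(s, \<theta>). g (cis \<theta>) s)" if "continuous_on (S \<times> {0..1}) (\<lambda>p. g (fst p) (snd p))" "U \<subseteq> {0..1}" for g :: "complex \<Rightarrow> real \<Rightarrow> real" and U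
  proof -
    have "continuous_on (U \<times> cbox 0 (2*pi)) (\<lambda>p. g (fst (cis (snd p), fst p)) (snd (cis (snd p), fst p)))"
      by (rule continuous_on_compose2[OF that(1)]) (use that(2) cisS in \<open>auto intro!: continuous_intros\<close>)
    then show ?thesis by (simp add: case_prod_beta')
  qed
  define T0 where "T0 s = cmean (\<lambda>z. T z s)" for s
  define T0' where "T0' s = cmean (\<lambda>z. T' z s)" for s
  have T0i: "T0 s = 1 / (2 * pi) * integral (cbox 0 (2*pi)) (\<lambda>\<theta>. T (cis \<theta>) s)" if "s \<in> {0..1}" for s
    unfolding T0_def using cmean_eq_integral[OF sec[OF cT that, unfolded S_def]] by simp
  have T0'i: "T0' s = 1 / (2 * pi) * integral (cbox 0 (2*pi)) (\<lambda>\<theta>. T' (cis \<theta>) s)" if "s \<in> {0..1}" for s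
    unfolding T0'_def using cmean_eq_integral[OF sec[OF cT' that, unfolded S_def]] by simp
  have cT0: "continuous_on {0..1} T0"
  proof -
    have "continuous_on {0..1} (\<lambda>s. 1 / (2 * pi) * integral (cbox 0 (2*pi)) (\<lambda>\<theta>. T (cis \<theta>) s))"
      by (intro continuous_intros integral_continuous_on_param cpar cT) auto
    then show ?thesis by (rule continuous_on_eq) (simp add: T0i)
  qed
  have dT0: "(T0 has_real_derivative T0' s) (at s)" if s: "0 < s" "s < 1" for s
  proof -
    have "((\<lambda>s. integral (cbox 0 (2*pi)) (\<lambda>\<theta>. T (cis \<theta>) s)) has_field_derivative integral (cbox 0 (2*pi)) (\<lambda>\<theta>. T' (cis \<theta>) s)) (at s within {0<..<1})"
    proof (rule leibniz_rule_field_derivative)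
      show "((\<lambda>s. T (cis \<theta>) s) has_field_derivative T' (cis \<theta>) x) (at x within {0<..<1})" if "x \<in> {0<..<1}" for x \<theta>
        by (rule has_field_derivative_at_within, rule dT[OF cisS]) (use that in auto)
      show "(\<lambda>\<theta>. T (cis \<theta>) x) integrable_on cbox 0 (2 * pi)" if "x \<in> {0<..<1}" for x
      proof (rule integrable_continuous)
        have "continuous_on (cbox 0 (2 * pi)) (\<lambda>\<theta>. case (x, \<theta>) of (s, \<theta>) \<Rightarrow> T (cis \<theta>) s)"
          by (rule continuous_on_compose2[OF cpar[OF cT, of "{x}"]]) (use that in \<open>auto intro!: continuous_intros\<close>)
        then show "continuous_on (cbox 0 (2 * pi)) (\<lambda>\<theta>. T (cis \<theta>) x)" by simp
      qed
      show "continuous_on ({0<..<1} \<times> cbox 0 (2 * pi)) (\<lambda>(x, t). T' (cis t) x)" by (rule cpar[OF cT']) auto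
    qed (use s in auto)
    then have "((\<lambda>s. integral (cbox 0 (2*pi)) (\<lambda>\<theta>. T (cis \<theta>) s)) has_field_derivative integral (cbox 0 (2*pi)) (\<lambda>\<theta>. T' (cis \<theta>) s)) (at s)"
      using s by (simp add: at_within_open[of s "{0<..<1}"])
    then have "((\<lambda>s. 1 / (2 * pi) * integral (cbox 0 (2*pi)) (\<lambda>\<theta>. T (cis \<theta>) s)) has_field_derivative 1 / (2 * pi) * integral (cbox 0 (2*pi)) (\<lambda>\<theta>. T' (cis \<theta>) s)) (at s)"
      by (rule DERIV_cmult)
    then have "(T0 has_field_derivative 1 / (2 * pi) * integral (cbox 0 (2*pi)) (\<lambda>\<theta>. T' (cis \<theta>) s)) (at s)"
      by (rule has_field_derivative_transform_within_open[of _ _ _ "{0<..<1}"]) (use s in \<open>auto simp: T0i\<close>)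
    then show ?thesis using T0'i[of s] s by simp
  qed
  have T0I: "T0 s \<in> {-L..L}" if s: "s \<in> {0..1}" for s
  proof -
    have ci: "cint (\<lambda>z. T z s)" by (rule cint_continuous) (use sec[OF cT s] in \<open>simp add: S_def\<close>)
    have "cmean (\<lambda>z. -L) \<le> T0 s" "T0 s \<le> cmean (\<lambda>z. L)"
      unfolding T0_def by (rule cmean_mono; use ci T(1)[OF _ s] in \<open>auto simp: S_def I_def\<close>)+
    then show ?thesis by simp
  qed
  have ends: "T0 0 = -L" "T0 1 = L"
  proof -
    have "T0 0 = cmean (\<lambda>z. -L)" unfolding T0_def by (rule cmean_cong) (use T0e in \<open>simp add: S_def\<close>)
    then show "T0 0 = -L" by simp
    have "T0 1 = cmean (\<lambda>z. L)" unfolding T0_def by (rule cmean_cong) (use T1e in \<open>simp add: S_def\<close>)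
    then show "T0 1 = L" by simp
  qed
  \<comment> \<open>Change of variables by \<open>T0\<close>. The endpoints, where the quantile maps
    are only known to be continuous, form the finite exceptional set.\<close>
  have "((\<lambda>s. T0' s *\<^sub>R exp (- v (T0 s))) has_integral (integral {T0 0..T0 1} (\<lambda>t. exp (- v t)) - integral {T0 1..T0 0} (\<lambda>t. exp (- v t)))) {0..1}"
  proof (rule has_integral_substitution_general[where s="{0,1}" and c="-L" and d=L])
    show "continuous_on {-L..L} (\<lambda>t. exp (- v t))" by (intro continuous_intros v)
    show "T0 ` {0..1} \<subseteq> {-L..L}" using T0I by blast
    show "(T0 has_real_derivative T0' x) (at x within {0..1})" if "x \<in> {0..1} - {0, 1}" for x
      by (rule has_field_derivative_at_within, rule dT0) (use that in auto)
  qed (use cT0 in auto)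
  then have sub: "((\<lambda>s. T0' s * exp (- v (T0 s))) has_integral (integral {-L..L} (\<lambda>t. exp (- v t)))) {0..1}"
    using L unfolding ends by simp
  define c where "c = cmean (\<lambda>z. ln (w z))"
  \<comment> \<open>Concavity of the logarithm gives ln T0' >= mean of ln T', which is c plus the
    mean of u(T). Hypothesis \<open>H\<close> for the continuous circle z -> T z s bounds the latter
    below by v(T0), so ln T0' - v(T0) >= c.\<close>
  have low: "exp c \<le> T0' s * exp (- v (T0 s))" if s: "s \<in> {0..1}" for s
  proof -
    have cTs: "continuous_on (sphere 0 1) (\<lambda>z. T z s)" "continuous_on (sphere 0 1) (\<lambda>z. T' z s)"
      using sec[OF cT s] sec[OF cT' s] by (auto simp: S_def)
    have cu: "continuous_on (sphere 0 1) (\<lambda>z. u z (T z s))"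
    proof -
      have "continuous_on S (\<lambda>z. ln (E z (T z s)))" using Epos by (intro continuous_intros sec[OF cET s]) (auto simp: less_imp_neq[symmetric])
      then have "continuous_on S (\<lambda>z. - ln (E z (T z s)))" by (rule continuous_on_minus)
      then show ?thesis by (simp add: E_def S_def)
    qed
    have clw: "continuous_on (sphere 0 1) (\<lambda>z. ln (w z))" using wpos cw unfolding S_def by (intro continuous_intros) (auto simp: less_imp_neq[symmetric])
    have T'pos: "T' z s > 0" if "z \<in> S" for z using wpos[OF that] Epos by (simp add: T'_def)
    have lnT': "ln (T' z s) = ln (w z) + u z (T z s)" if "z \<in> S" for z
      using wpos[OF that] by (simp add: T'_def E_def ln_div)
    have "v (T0 s) \<le> cmean (\<lambda>z. u z (T z s))" unfolding T0_def
      by (rule H[OF cTs(1)]) (use T(1)[OF _ s] in \<open>auto simp: S_def I_def\<close>)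
    moreover have "cmean (\<lambda>z. ln (T' z s)) \<le> ln (T0' s)" "T0' s > 0"
      unfolding T0'_def using cmean_jensen_ln[OF cTs(2)] T'pos by (auto simp: S_def)
    moreover have "cmean (\<lambda>z. ln (T' z s)) = c + cmean (\<lambda>z. u z (T z s))"
    proof -
      have "cmean (\<lambda>z. ln (T' z s)) = cmean (\<lambda>z. ln (w z) + u z (T z s))"
        by (rule cmean_cong) (use lnT' in \<open>simp add: S_def\<close>)
      also have "\<dots> = c + cmean (\<lambda>z. u z (T z s))" unfolding c_def
        by (rule cmean_add) (intro cint_continuous clw cu)+
      finally show ?thesis .
    qed
    ultimately have "c \<le> ln (T0' s) - v (T0 s)" "T0' s > 0" by linarith+
    then have "exp c \<le> exp (ln (T0' s) + - v (T0 s))" by simp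
    then show ?thesis unfolding exp_add using \<open>T0' s > 0\<close> by simp
  qed
  have "exp c \<le> integral {-L..L} (\<lambda>t. exp (- v t))"
  proof (rule has_integral_le[OF _ sub])
    show "((\<lambda>s. exp c) has_integral exp c) {0..1::real}" using has_integral_const_real[of "exp c" 0 1] by simp
  qed (rule low)
  then have "ln (exp c) \<le> ln (integral {-L..L} (\<lambda>t. exp (- v t)))"
    using exp_gt_zero[of c] by (subst ln_le_cancel_iff) linarith+
  then show ?thesis by (simp add: c_def w_def W_def E_def[abs_def])
qed

section \<open>Integrating out the coordinates\<close>

definition vmean :: "(complex \<Rightarrow> 'a::euclidean_space) \<Rightarrow> 'a" where
  "vmean X = (\<Sum>b\<in>Basis. cmean (\<lambda>\<zeta>. X \<zeta> \<bullet> b) *\<^sub>R b)"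

text \<open>The circle \<open>X\<close> is continuous and bears no relation to the disc in \<tau>.
  This freedom makes the class stable under marginals, since quantile maps can be inserted as one
  coordinate of \<open>X\<close>.\<close>

definition adp :: "real \<Rightarrow> (complex \<Rightarrow> 'a::euclidean_space \<Rightarrow> real) \<Rightarrow> bool" where
  "adp R \<psi> \<longleftrightarrow> continuous_on (ball 0 R \<times> UNIV) (\<lambda>(\<tau>, x). \<psi> \<tau> x) \<and>
     (\<forall>\<tau> \<rho> X. 0 < \<rho> \<longrightarrow> cball \<tau> \<rho> \<subseteq> ball 0 R \<longrightarrow> continuous_on (sphere 0 1) X \<longrightarrow>
        \<psi> \<tau> (vmean X) \<le> cmean (\<lambda>\<zeta>. \<psi> (\<tau> + of_real \<rho> * \<zeta>) (X \<zeta>)))"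

definition upd :: "'a::euclidean_space \<Rightarrow> 'a \<Rightarrow> real \<Rightarrow> 'a" where
  "upd b x t = x + (t - x \<bullet> b) *\<^sub>R b"

definition marg :: "real \<Rightarrow> 'a::euclidean_space \<Rightarrow> (complex \<Rightarrow> 'a \<Rightarrow> real) \<Rightarrow> complex \<Rightarrow> 'a \<Rightarrow> real" where
  "marg L b \<psi> \<tau> x = - ln (integral {-L..L} (\<lambda>t. exp (- \<psi> \<tau> (upd b x t))))"

lemma upd_continuous [continuous_intros]:
  "continuous_on A f \<Longrightarrow> continuous_on A g \<Longrightarrow> continuous_on A (\<lambda>p. upd b (f p) (g p))"
  unfolding upd_def by (intro continuous_intros)

lemma vmean_inner: "b \<in> Basis \<Longrightarrow> vmean X \<bullet> b = cmean (\<lambda>\<zeta>. X \<zeta> \<bullet> b)"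
  unfolding vmean_def by (simp add: inner_sum_left_Basis)

lemma vmean_upd:
  assumes b: "b \<in> Basis" and X: "continuous_on (sphere 0 1) X"
  shows "vmean (\<lambda>\<zeta>. upd b (X \<zeta>) (Y \<zeta>)) = upd b (vmean X) (cmean Y)"
proof (rule euclidean_eqI)
  fix i :: 'a assume i: "i \<in> Basis"
  have eq: "upd b x t \<bullet> i = (if i = b then t else x \<bullet> i)" for x t
    using b i by (auto simp: upd_def inner_add_left inner_Basis)
  show "vmean (\<lambda>\<zeta>. upd b (X \<zeta>) (Y \<zeta>)) \<bullet> i = upd b (vmean X) (cmean Y) \<bullet> i"
    unfolding vmean_inner[OF i] eq by (simp add: vmean_inner[OF i])
qed

lemma integral_exp_pos:
  fixes f :: "real \<Rightarrow> real" and L :: real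
  assumes "continuous_on {-L..L} f" and L: "L > 0"
  shows "integral {-L..L} (\<lambda>t. exp (- f t)) > (0::real)"
proof -
  have c: "continuous_on {-L..L} (\<lambda>t. exp (- f t))" using assms by (intro continuous_intros)
  have "\<exists>x\<in>{-L..L}. \<forall>y\<in>{-L..L}. exp (- f x) \<le> exp (- f y)"
    by (rule continuous_attains_inf[OF _ _ c]) (use L in auto)
  then obtain x where x: "\<And>y. y \<in> {-L..L} \<Longrightarrow> exp (- f x) \<le> exp (- f y)" by blast
  have "integral {-L..L} (\<lambda>t. exp (- f x)) \<le> integral {-L..L} (\<lambda>t. exp (- f t))"
    by (rule integral_le) (use x c in \<open>auto intro: integrable_continuous_real\<close>)
  moreover have "integral {-L..L} (\<lambda>t. exp (- f x)) > 0" using L by simp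
  ultimately show ?thesis by linarith
qed

text \<open>The transport inequality on the fibre coordinate \<open>b\<close>. Replacing that
  coordinate of \<open>X\<close> by a continuous \<open>Y\<close> gives a circle that
  \<open>adp\<close> admits, and its mean is the mean of \<open>X\<close> with the coordinate
  replaced by the mean of \<open>Y\<close>; this is hypothesis \<open>H\<close>.\<close>

lemma adp_marg:
  fixes \<psi> :: "complex \<Rightarrow> 'a::euclidean_space \<Rightarrow> real"
  assumes a: "adp R \<psi>" and b: "b \<in> Basis" and L: "L > 0"
  shows "adp R (marg L b \<psi>)"
proof -
  have c: "continuous_on (ball 0 R \<times> UNIV) (\<lambda>(\<tau>, x). \<psi> \<tau> x)"
    and s: "\<And>\<tau> \<rho> X. 0 < \<rho> \<Longrightarrow> cball \<tau> \<rho> \<subseteq> ball 0 R \<Longrightarrow> continuous_on (sphere 0 1) X \<Longrightarrow>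
        \<psi> \<tau> (vmean X) \<le> cmean (\<lambda>\<zeta>. \<psi> (\<tau> + of_real \<rho> * \<zeta>) (X \<zeta>))"
    using a unfolding adp_def by blast+
  have comp: "continuous_on A (\<lambda>p. \<psi> (f p) (g p))" if "continuous_on A f" "continuous_on A g" "f ` A \<subseteq> ball 0 R" for A f and g :: "'x::topological_space \<Rightarrow> 'a"
  proof -
    have "continuous_on A (\<lambda>p. case (f p, g p) of (\<tau>, x) \<Rightarrow> \<psi> \<tau> x)"
      by (rule continuous_on_compose2[OF c]) (use that in \<open>auto intro!: continuous_intros\<close>)
    then show ?thesis by simp
  qed
  have pos: "integral {-L..L} (\<lambda>t. exp (- \<psi> \<tau> (upd b x t))) > 0" if "\<tau> \<in> ball 0 R" for \<tau> x
    by (rule integral_exp_pos[OF comp L]) (use that in \<open>auto intro!: continuous_intros\<close>)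
  have cI: "continuous_on (ball 0 R \<times> UNIV) (\<lambda>p. integral (cbox (-L) L) (\<lambda>t. exp (- \<psi> (fst p) (upd b (snd p) t))))"
  proof (rule integral_continuous_on_param)
    have "continuous_on ((ball 0 R \<times> UNIV) \<times> cbox (- L) L) (\<lambda>q. \<psi> (fst (fst q)) (upd b (snd (fst q)) (snd q)))"
      by (rule comp) (auto intro!: continuous_intros)
    then show "continuous_on ((ball 0 R \<times> UNIV) \<times> cbox (- L) L) (\<lambda>(p, t). exp (- \<psi> (fst p) (upd b (snd p) t)))"
      by (auto simp: case_prod_beta' intro!: continuous_intros)
  qed
  have "continuous_on (ball 0 R \<times> UNIV) (\<lambda>(\<tau>, x). marg L b \<psi> \<tau> x)"
    unfolding marg_def case_prod_beta'
    by (intro continuous_intros) (use cI pos in \<open>auto simp: less_imp_neq[symmetric]\<close>)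
  moreover have "marg L b \<psi> \<tau> (vmean X) \<le> cmean (\<lambda>\<zeta>. marg L b \<psi> (\<tau> + of_real \<rho> * \<zeta>) (X \<zeta>))"
    if \<rho>: "0 < \<rho>" and sub: "cball \<tau> \<rho> \<subseteq> ball 0 R" and X: "continuous_on (sphere 0 1) X" for \<tau> \<rho> X
  proof -
    have in': "\<tau> + of_real \<rho> * \<zeta> \<in> ball 0 R" if "\<zeta> \<in> sphere 0 1" for \<zeta>
    proof -
      have "\<tau> + of_real \<rho> * \<zeta> \<in> cball \<tau> \<rho>" using that \<rho> by (simp add: dist_norm norm_mult)
      then show ?thesis using sub by blast
    qed
    have \<tau>: "\<tau> \<in> ball 0 R" using sub \<rho> by (meson centre_in_cball less_imp_le subsetD)
    have "cmean (\<lambda>\<zeta>. ln (integral {-L..L} (\<lambda>t. exp (- \<psi> (\<tau> + of_real \<rho> * \<zeta>) (upd b (X \<zeta>) t)))))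
       \<le> ln (integral {-L..L} (\<lambda>t. exp (- \<psi> \<tau> (upd b (vmean X) t))))"
    proof (rule transport_inequality[where u="\<lambda>\<zeta> t. \<psi> (\<tau> + of_real \<rho> * \<zeta>) (upd b (X \<zeta>) t)" and v="\<lambda>t. \<psi> \<tau> (upd b (vmean X) t)", OF _ _ L])
      have "continuous_on (sphere 0 1 \<times> {-L..L}) (\<lambda>p. \<psi> (\<tau> + of_real \<rho> * fst p) (upd b (X (fst p)) (snd p)))"
        by (rule comp) (use in' in \<open>auto intro!: continuous_intros continuous_on_compose2[OF X]\<close>)
      then show "continuous_on (sphere 0 1 \<times> {-L..L}) (\<lambda>(\<zeta>, t). \<psi> (\<tau> + of_real \<rho> * \<zeta>) (upd b (X \<zeta>) t))"
        by (simp add: case_prod_beta')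
      show "continuous_on {-L..L} (\<lambda>t. \<psi> \<tau> (upd b (vmean X) t))"
        by (rule comp) (use \<tau> in \<open>auto intro!: continuous_intros\<close>)
      fix Y :: "complex \<Rightarrow> real" assume Y: "continuous_on (sphere 0 1) Y"
      show "\<psi> \<tau> (upd b (vmean X) (cmean Y)) \<le> cmean (\<lambda>\<zeta>. \<psi> (\<tau> + of_real \<rho> * \<zeta>) (upd b (X \<zeta>) (Y \<zeta>)))"
        using s[OF \<rho> sub, of "\<lambda>\<zeta>. upd b (X \<zeta>) (Y \<zeta>)"] unfolding vmean_upd[OF b X] using X Y by (auto intro!: continuous_intros)
    qed
    then show ?thesis unfolding marg_def
      using cmean_cmult[of "-1" "\<lambda>\<zeta>. ln (integral {-L..L} (\<lambda>t. exp (- \<psi> (\<tau> + of_real \<rho> * \<zeta>) (upd b (X \<zeta>) t))))"] by simp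
  qed
  ultimately show ?thesis unfolding adp_def by blast
qed

interpretation lborel_product: product_sigma_finite "\<lambda>b::'a::euclidean_space. (lborel :: real measure)"
  by standard

text \<open>Marginals remain functions on the full space, constant in the coordinates already
  integrated, so that all stages of the induction have one type.\<close>

definition mix :: "'a::euclidean_space set \<Rightarrow> 'a \<Rightarrow> ('a \<Rightarrow> real) \<Rightarrow> 'a" where
  "mix S x y = (\<Sum>b\<in>Basis. (if b \<in> S then y b else x \<bullet> b) *\<^sub>R b)"

lemma mix_measurable [measurable]:
  "(\<lambda>y. mix S x y) \<in> borel_measurable (Pi\<^sub>M S (\<lambda>_. lborel))"
proof -
  have "(\<lambda>y. if b \<in> S then y b else x \<bullet> b) \<in> borel_measurable (Pi\<^sub>M S (\<lambda>_. lborel))" for b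
    by (cases "b \<in> S") (use measurable_component_singleton[of b S "\<lambda>_. lborel"] in auto)
  then show ?thesis unfolding mix_def by (intro borel_measurable_sum borel_measurable_scaleR) auto
qed

text \<open>Induction on the set of coordinates already integrated: each new one is peeled off the
  product measure and handled by \<open>adp_marg\<close>, so the sub-mean value property is
  available again for the next.\<close>

lemma marginals_exist:
  fixes \<psi> :: "complex \<Rightarrow> 'a::euclidean_space \<Rightarrow> real"
  assumes a: "adp R \<psi>" and L: "L > 0" and S: "finite S" "S \<subseteq> Basis"
  shows "\<exists>\<psi>'. adp R \<psi>' \<and> (\<forall>\<tau>\<in>ball 0 R. \<forall>x. ennreal (exp (- \<psi>' \<tau> x)) =
     (\<integral>\<^sup>+y. ennreal (exp (- \<psi> \<tau> (mix S x y))) * (\<Prod>b\<in>S. indicator {-L..L} (y b)) \<partial>Pi\<^sub>M S (\<lambda>_. lborel)))"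
  using S
proof (induction S)
  case empty
  have "mix {} x y = x" for x :: 'a and y by (simp add: mix_def euclidean_representation)
  then show ?case using a by (intro exI[of _ \<psi>]) (simp add: PiM_empty nn_integral_count_space_finite)
next
  case (insert i S)
  then obtain \<psi>' where \<psi>': "adp R \<psi>'" "\<And>\<tau> x. \<tau> \<in> ball 0 R \<Longrightarrow> ennreal (exp (- \<psi>' \<tau> x)) =
     (\<integral>\<^sup>+y. ennreal (exp (- \<psi> \<tau> (mix S x y))) * (\<Prod>b\<in>S. indicator {-L..L} (y b)) \<partial>Pi\<^sub>M S (\<lambda>_. lborel))" by auto
  have i: "i \<in> Basis" using insert by auto
  show ?case
  proof (intro exI[of _ "marg L i \<psi>'"] conjI ballI allI)
    show "adp R (marg L i \<psi>')" by (rule adp_marg[OF \<psi>'(1) i L])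
    fix \<tau> :: complex and x :: 'a assume \<tau>: "\<tau> \<in> ball 0 R"
    have cont: "continuous_on UNIV (\<psi> \<tau>)" if "adp R \<psi>" for \<psi> :: "complex \<Rightarrow> 'a \<Rightarrow> real"
    proof -
      have c: "continuous_on (ball 0 R \<times> UNIV) (\<lambda>(\<tau>, x). \<psi> \<tau> x)" using that by (simp add: adp_def)
      have "continuous_on UNIV (\<lambda>x. case (\<tau>, x) of (\<tau>, x) \<Rightarrow> \<psi> \<tau> x)"
        by (rule continuous_on_compose2[OF c]) (use \<tau> in \<open>auto intro!: continuous_intros\<close>)
      then show ?thesis by simp
    qed
    have [measurable]: "\<psi> \<tau> \<in> borel_measurable borel" using cont[OF a] by simp
    have c': "continuous_on {-L..L} (\<lambda>t. \<psi>' \<tau> (upd i x t))"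
      by (rule continuous_on_compose2[OF cont[OF \<psi>'(1)]]) (auto intro!: continuous_intros)
    have c'': "continuous_on {-L..L} (\<lambda>t. exp (- \<psi>' \<tau> (upd i x t)))" by (intro continuous_intros c')
    have mix_eq: "mix (insert i S) x (y(i := t)) = mix S (upd i x t) y" for y t
      unfolding mix_def
      by (rule sum.cong) (use insert(2) i in \<open>auto simp: upd_def inner_add_left inner_Basis\<close>)
    have prod_eq: "(\<Prod>b\<in>insert i S. indicator {-L..L} ((y(i := t)) b)) = (indicator {-L..L} t * (\<Prod>b\<in>S. indicator {-L..L} (y b)) :: ennreal)" for y t
    proof -
      have "(\<Prod>b\<in>S. indicator {-L..L} ((y(i := t)) b)) = (\<Prod>b\<in>S. indicator {-L..L} (y b) :: ennreal)"
        by (rule prod.cong) (use insert(2) in auto)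
      then show ?thesis using insert(1,2) by simp
    qed
    have "ennreal (exp (- marg L i \<psi>' \<tau> x)) = ennreal (integral {-L..L} (\<lambda>t. exp (- \<psi>' \<tau> (upd i x t))))"
      unfolding marg_def using integral_exp_pos[OF c' L] by simp
    also have "\<dots> = (\<integral>\<^sup>+t. ennreal (exp (- \<psi>' \<tau> (upd i x t))) * indicator {-L..L} t \<partial>lborel)"
      by (rule nn_integral_has_integral_lebesgue'[symmetric])
        (use integrable_continuous_real[OF c''] in \<open>auto simp: has_integral_integral\<close>)
    also have "\<dots> = (\<integral>\<^sup>+t. (\<integral>\<^sup>+y. ennreal (exp (- \<psi> \<tau> (mix (insert i S) x (y(i := t))))) * (\<Prod>b\<in>insert i S. indicator {-L..L} ((y(i := t)) b)) \<partial>Pi\<^sub>M S (\<lambda>_. lborel)) \<partial>lborel)"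
    proof (rule nn_integral_cong)
      fix t :: real
      have "ennreal (exp (- \<psi>' \<tau> (upd i x t))) * indicator {-L..L} t
        = (\<integral>\<^sup>+y. ennreal (exp (- \<psi> \<tau> (mix S (upd i x t) y))) * (\<Prod>b\<in>S. indicator {-L..L} (y b)) \<partial>Pi\<^sub>M S (\<lambda>_. lborel)) * indicator {-L..L} t"
        unfolding \<psi>'(2)[OF \<tau>] ..
      also have "\<dots> = (\<integral>\<^sup>+y. ennreal (exp (- \<psi> \<tau> (mix S (upd i x t) y))) * (\<Prod>b\<in>S. indicator {-L..L} (y b)) * indicator {-L..L} t \<partial>Pi\<^sub>M S (\<lambda>_. lborel))"
        by (rule nn_integral_multc[symmetric]) measurable
      also have "\<dots> = (\<integral>\<^sup>+y. ennreal (exp (- \<psi> \<tau> (mix (insert i S) x (y(i := t))))) * (\<Prod>b\<in>insert i S. indicator {-L..L} ((y(i := t)) b)) \<partial>Pi\<^sub>M S (\<lambda>_. lborel))"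
        unfolding mix_eq prod_eq by (simp add: mult_ac)
      finally show "ennreal (exp (- \<psi>' \<tau> (upd i x t))) * indicator {-L..L} t = \<dots>" .
    qed
    also have "\<dots> = (\<integral>\<^sup>+y. ennreal (exp (- \<psi> \<tau> (mix (insert i S) x y))) * (\<Prod>b\<in>insert i S. indicator {-L..L} (y b)) \<partial>Pi\<^sub>M (insert i S) (\<lambda>_. lborel))"
      by (rule lborel_product.product_nn_integral_insert_rev[symmetric, OF insert(1,2)]) measurable
    finally show "ennreal (exp (- marg L i \<psi>' \<tau> x)) = \<dots>" .
  qed
qed

text \<open>Once every coordinate is integrated, the constant circle at 0 suffices, and the property
  in \<open>adp\<close> becomes ordinary subharmonicity in \<tau>.\<close>

lemma full_marginal:
  fixes \<psi> :: "complex \<Rightarrow> 'a::euclidean_space \<Rightarrow> real"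
  assumes a: "adp R \<psi>" and L: "L > 0"
  shows "\<exists>\<Phi>. continuous_on (ball 0 R) \<Phi> \<and>
    (\<forall>\<tau> \<rho>. 0 < \<rho> \<longrightarrow> cball \<tau> \<rho> \<subseteq> ball 0 R \<longrightarrow> \<Phi> \<tau> \<le> cmean (\<lambda>\<zeta>. \<Phi> (\<tau> + of_real \<rho> * \<zeta>))) \<and>
    (\<forall>\<tau>\<in>ball 0 R. ennreal (exp (- \<Phi> \<tau>)) = (\<integral>\<^sup>+x. ennreal (exp (- \<psi> \<tau> x)) * indicator {x. \<forall>b\<in>Basis. x \<bullet> b \<in> {-L..L}} x \<partial>lborel))"
proof -
  obtain \<psi>' where \<psi>': "adp R \<psi>'" "\<And>\<tau> x. \<tau> \<in> ball 0 R \<Longrightarrow> ennreal (exp (- \<psi>' \<tau> x)) =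
     (\<integral>\<^sup>+y. ennreal (exp (- \<psi> \<tau> (mix Basis x y))) * (\<Prod>b\<in>Basis. indicator {-L..L} (y b)) \<partial>Pi\<^sub>M Basis (\<lambda>_. lborel))"
    using marginals_exist[OF a L, of Basis] by auto
  define \<Phi> where "\<Phi> \<tau> = \<psi>' \<tau> 0" for \<tau>
  have c: "continuous_on (ball 0 R \<times> UNIV) (\<lambda>(\<tau>, x). \<psi>' \<tau> x)" using \<psi>'(1) by (simp add: adp_def)
  have "continuous_on (ball 0 R) (\<lambda>\<tau>. case (\<tau>, 0) of (\<tau>, x) \<Rightarrow> \<psi>' \<tau> x)"
    by (rule continuous_on_compose2[OF c]) (auto intro!: continuous_intros)
  then have "continuous_on (ball 0 R) \<Phi>" by (simp add: \<Phi>_def)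
  moreover have "\<Phi> \<tau> \<le> cmean (\<lambda>\<zeta>. \<Phi> (\<tau> + of_real \<rho> * \<zeta>))" if "0 < \<rho>" "cball \<tau> \<rho> \<subseteq> ball 0 R" for \<tau> \<rho>
  proof -
    have "vmean (\<lambda>\<zeta>. 0::'a) = 0" by (simp add: vmean_def)
    moreover have "\<psi>' \<tau> (vmean (\<lambda>\<zeta>. 0)) \<le> cmean (\<lambda>\<zeta>. \<psi>' (\<tau> + of_real \<rho> * \<zeta>) 0)"
      using \<psi>'(1)[unfolded adp_def, THEN conjunct2, rule_format, OF that continuous_on_const] .
    ultimately show ?thesis by (simp add: \<Phi>_def)
  qed
  moreover have "ennreal (exp (- \<Phi> \<tau>)) = (\<integral>\<^sup>+x. ennreal (exp (- \<psi> \<tau> x)) * indicator {x. \<forall>b\<in>Basis. x \<bullet> b \<in> {-L..L}} x \<partial>lborel)" if \<tau>: "\<tau> \<in> ball 0 R" for \<tau>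
  proof -
    have c0: "continuous_on (ball 0 R \<times> UNIV) (\<lambda>(\<tau>, x). \<psi> \<tau> x)" using a by (simp add: adp_def)
    have "continuous_on UNIV (\<lambda>x. case (\<tau>, x) of (\<tau>, x) \<Rightarrow> \<psi> \<tau> x)"
      by (rule continuous_on_compose2[OF c0]) (use \<tau> in \<open>auto intro!: continuous_intros\<close>)
    then have [measurable]: "\<psi> \<tau> \<in> borel_measurable borel" by simp
    have [measurable]: "{x::'a. \<forall>b\<in>Basis. x \<bullet> b \<in> {-L..L}} \<in> sets borel" by measurable
    define F where "F x = ennreal (exp (- \<psi> \<tau> x)) * indicator {x. \<forall>b\<in>Basis. x \<bullet> b \<in> {-L..L}} x" for x
    have [measurable]: "F \<in> borel_measurable borel" unfolding F_def by measurable
    have "(\<integral>\<^sup>+x. F x \<partial>lborel) = (\<integral>\<^sup>+x. F x \<partial>distr (\<Pi>\<^sub>M b\<in>Basis. lborel) borel (\<lambda>f. \<Sum>b\<in>Basis. f b *\<^sub>R b))"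
      by (subst lborel_eq) simp
    also have "\<dots> = (\<integral>\<^sup>+y. F (\<Sum>b\<in>Basis. y b *\<^sub>R b) \<partial>Pi\<^sub>M Basis (\<lambda>_. lborel))"
      by (rule nn_integral_distr) measurable
    also have "\<dots> = (\<integral>\<^sup>+y. ennreal (exp (- \<psi> \<tau> (mix Basis 0 y))) * (\<Prod>b\<in>Basis. indicator {-L..L} (y b)) \<partial>Pi\<^sub>M Basis (\<lambda>_. lborel))"
    proof (rule nn_integral_cong)
      fix y :: "'a \<Rightarrow> real"
      have m: "mix Basis 0 y = (\<Sum>b\<in>Basis. y b *\<^sub>R b)" by (simp add: mix_def)
      have "(\<Prod>b\<in>Basis. indicator {-L..L} (y b) :: ennreal) = indicator {x. \<forall>b\<in>Basis. x \<bullet> b \<in> {-L..L}} (\<Sum>b\<in>Basis. y b *\<^sub>R b)"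
      proof (cases "\<forall>b\<in>Basis. y b \<in> {-L..L}")
        case True
        then show ?thesis by simp
      next
        case False
        then obtain b where b: "b \<in> Basis" "y b \<notin> {-L..L}" by blast
        then have "(\<Prod>b\<in>Basis. indicator {-L..L} (y b) :: ennreal) = 0" by (intro prod_zero bexI[of _ b]) auto
        moreover have "(\<Sum>b\<in>Basis. y b *\<^sub>R b) \<notin> {x. \<forall>b\<in>Basis. x \<bullet> b \<in> {-L..L}}" using b by auto
        ultimately show ?thesis by simp
      qed
      then show "F (\<Sum>b\<in>Basis. y b *\<^sub>R b) = ennreal (exp (- \<psi> \<tau> (mix Basis 0 y))) * (\<Prod>b\<in>Basis. indicator {-L..L} (y b))"
        by (simp add: F_def m)
    qed
    finally show ?thesis unfolding \<psi>'(2)[OF \<tau>] \<Phi>_def F_def by simp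
  qed
  ultimately show ?thesis by blast
qed

section \<open>Local sub-mean value inequalities\<close>

text \<open>Real parts of complex polynomials. On the unit circle the conjugate of z is 1/z, so
  there these functions are closed under products and include all real polynomials in the
  coordinates.\<close>

inductive_set trig :: "(complex \<Rightarrow> real) set" where
  monomial: "(\<lambda>z. Re (c * z ^ k)) \<in> trig"
| add: "f \<in> trig \<Longrightarrow> g \<in> trig \<Longrightarrow> (\<lambda>z. f z + g z) \<in> trig"

text \<open>Re a Re b is the sum of Re (a b) / 2 and Re (a cnj b) / 2. For monomials on the circle,
  a cnj b or its conjugate is again a monomial, of degree |j - k|.\<close>

lemma trig_mult_monomial:
  assumes "f \<in> trig" shows "\<exists>h\<in>trig. \<forall>z\<in>sphere 0 1. f z * Re (c * z ^ k) = h z"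
  using assms
proof induction
  case (monomial d j)
  have cz: "cnj z ^ i * z ^ i = 1" "z ^ i * cnj z ^ i = 1" if "z \<in> sphere 0 1" for z :: complex and i
  proof -
    have "z * cnj z = 1" using that by (simp add: complex_norm_square[symmetric])
    then show "cnj z ^ i * z ^ i = 1" "z ^ i * cnj z ^ i = 1" by (simp_all add: power_mult_distrib[symmetric] mult.commute)
  qed
  have prod: "Re a * Re b = Re (a * b / 2) + Re (a * cnj b / 2)" for a b :: complex
    by (simp add: field_simps)
  have diff: "\<exists>e l. \<forall>z\<in>sphere 0 1. Re ((d * z ^ j) * cnj (c * z ^ k) / 2) = Re (e * z ^ l)"
  proof (cases "k \<le> j")
    case True
    have "(d * z ^ j) * cnj (c * z ^ k) / 2 = (d * cnj c / 2) * z ^ (j - k)" if "z \<in> sphere 0 1" for z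
    proof -
      have "z ^ j = z ^ (j - k) * z ^ k" using True by (simp add: power_add[symmetric])
      then have "(d * z ^ j) * cnj (c * z ^ k) / 2 = (d * cnj c / 2) * z ^ (j - k) * (z ^ k * cnj z ^ k)" by simp
      then show ?thesis using cz(2)[OF that] by simp
    qed
    then show ?thesis by metis
  next
    case False
    have "Re ((d * z ^ j) * cnj (c * z ^ k) / 2) = Re ((cnj d * c / 2) * z ^ (k - j))" if "z \<in> sphere 0 1" for z
    proof -
      have "z ^ k = z ^ (k - j) * z ^ j" using False by (simp add: power_add[symmetric])
      then have "cnj ((d * z ^ j) * cnj (c * z ^ k) / 2) = (cnj d * c / 2) * z ^ (k - j) * (cnj z ^ j * z ^ j)" by simp
      then have "cnj ((d * z ^ j) * cnj (c * z ^ k) / 2) = (cnj d * c / 2) * z ^ (k - j)" using cz(1)[OF that] by simp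
      then show ?thesis by (metis complex_cnj(1) complex.sel(1) cnj.sel(1))
    qed
    then show ?thesis by metis
  qed
  then obtain e l where el: "\<And>z. z \<in> sphere 0 1 \<Longrightarrow> Re ((d * z ^ j) * cnj (c * z ^ k) / 2) = Re (e * z ^ l)" by blast
  have sum: "(d * z ^ j) * (c * z ^ k) / 2 = (d * c / 2) * z ^ (j + k)" for z by (simp add: power_add)
  have "Re (d * z ^ j) * Re (c * z ^ k) = Re ((d * c / 2) * z ^ (j + k)) + Re (e * z ^ l)" if "z \<in> sphere 0 1" for z
    unfolding prod[of "d * z ^ j"] sum el[OF that] ..
  then show ?case
    by (intro bexI[OF _ trig.add[OF trig.monomial[of "d * c / 2" "j + k"] trig.monomial[of e l]]]) blast
next
  case (add f g)
  then obtain h1 h2 where "h1 \<in> trig" "h2 \<in> trig" "\<forall>z\<in>sphere 0 1. f z * Re (c * z ^ k) = h1 z" "\<forall>z\<in>sphere 0 1. g z * Re (c * z ^ k) = h2 z" by blast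
  then show ?case by (intro bexI[OF _ trig.add[of h1 h2]]) (auto simp: distrib_right)
qed

lemma trig_mult:
  assumes "g \<in> trig" "f \<in> trig" shows "\<exists>h\<in>trig. \<forall>z\<in>sphere 0 1. f z * g z = h z"
  using assms
proof induction
  case (monomial c k)
  then show ?case by (intro trig_mult_monomial)
next
  case (add g1 g2)
  then obtain h1 h2 where "h1 \<in> trig" "h2 \<in> trig" "\<forall>z\<in>sphere 0 1. f z * g1 z = h1 z" "\<forall>z\<in>sphere 0 1. f z * g2 z = h2 z" by blast
  then show ?case by (intro bexI[OF _ trig.add[of h1 h2]]) (auto simp: distrib_left)
qed

lemma real_polynomial_trig:
  fixes f :: "complex \<Rightarrow> real"
  assumes "real_polynomial_function f" shows "\<exists>h\<in>trig. \<forall>z\<in>sphere 0 1. f z = h z"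
  using assms
proof induction
  case (linear f)
  then have l: "linear f" by (rule bounded_linear.linear)
  have "f z = Re (Complex (f 1) (- f \<i>) * z ^ 1)" for z
  proof -
    have "z = Re z *\<^sub>R 1 + Im z *\<^sub>R \<i>" by (simp add: complex_eq_iff)
    then have "f z = f (Re z *\<^sub>R 1 + Im z *\<^sub>R \<i>)" by simp
    also have "\<dots> = Re z * f 1 + Im z * f \<i>" unfolding linear_add[OF l] linear_scale[OF l] by simp
    finally show ?thesis by (simp add: mult.commute)
  qed
  then show ?case by (intro bexI[OF _ trig.monomial[of "Complex (f 1) (- f \<i>)" 1]] ballI)
next
  case (const c)
  show ?case by (intro bexI[OF _ trig.monomial[of "of_real c" 0]]) auto
next
  case (add f g)
  then obtain h1 h2 where "h1 \<in> trig" "h2 \<in> trig" "\<forall>z\<in>sphere 0 1. f z = h1 z" "\<forall>z\<in>sphere 0 1. g z = h2 z" by blast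
  then show ?case by (intro bexI[OF _ trig.add[of h1 h2]]) auto
next
  case (mult f g)
  then obtain h1 h2 where h: "h1 \<in> trig" "h2 \<in> trig" "\<forall>z\<in>sphere 0 1. f z = h1 z" "\<forall>z\<in>sphere 0 1. g z = h2 z" by blast
  obtain h where "h \<in> trig" "\<forall>z\<in>sphere 0 1. h1 z * h2 z = h z" using trig_mult[OF h(2,1)] by blast
  then show ?case using h by (intro bexI[of _ h]) auto
qed

lemma trig_holomorphic:
  assumes "f \<in> trig" shows "\<exists>P. P holomorphic_on UNIV \<and> (\<forall>z. f z = Re (P z))"
  using assms
proof induction
  case (monomial c k)
  show ?case by (intro exI[of _ "\<lambda>z. c * z ^ k"]) (auto intro!: holomorphic_intros)
next
  case (add f g)
  then obtain P Q where "P holomorphic_on UNIV" "Q holomorphic_on UNIV" "\<forall>z. f z = Re (P z)" "\<forall>z. g z = Re (Q z)" by blast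
  then show ?case by (intro exI[of _ "\<lambda>z. P z + Q z"]) (auto intro!: holomorphic_intros)
qed

text \<open>Stone-Weierstrass gives real polynomials, and on the circle these are real parts of
  complex polynomials, which extend to entire functions.\<close>

lemma circle_approximation:
  fixes f :: "complex \<Rightarrow> real"
  assumes "continuous_on (sphere 0 1) f" "e > 0"
  obtains P where "P holomorphic_on UNIV" "\<And>z. z \<in> sphere 0 1 \<Longrightarrow> \<bar>f z - Re (P z)\<bar> < e"
proof -
  obtain g where g: "real_polynomial_function g" "\<And>z. z \<in> sphere 0 1 \<Longrightarrow> \<bar>f z - g z\<bar> < e"
    using Stone_Weierstrass_real_polynomial_function[OF compact_sphere assms] by blast
  obtain h where h: "h \<in> trig" "\<forall>z\<in>sphere 0 1. g z = h z" using real_polynomial_trig[OF g(1)] by blast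
  obtain P where P: "P holomorphic_on UNIV" "\<forall>z. h z = Re (P z)" using trig_holomorphic[OF h(1)] by blast
  show ?thesis by (rule that[OF P(1)]) (use g h P in auto)
qed

text \<open>Comparison with the real part of an entire function replaces the solution of the Dirichlet problem.\<close>

lemma local_submean_imp_submean:
  fixes v :: "complex \<Rightarrow> real"
  assumes c: "continuous_on (cball 0 1) v"
    and loc: "\<And>\<zeta> e. \<zeta> \<in> ball 0 1 \<Longrightarrow> e > 0 \<Longrightarrow> \<exists>r>0. \<forall>\<rho>. 0 < \<rho> \<longrightarrow> \<rho> < r \<longrightarrow> v \<zeta> \<le> cmean (\<lambda>\<omega>. v (\<zeta> + of_real \<rho> * \<omega>)) + e * \<rho>\<^sup>2"
  shows "v 0 \<le> cmean v"
proof (rule field_le_epsilon)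
  fix e' :: real assume e': "e' > 0"
  \<comment> \<open>Two parts cover the maximum of \<open>h\<close>, the third the final comparison
    on the circle.\<close>
  define e where "e = e' / 3"
  have e: "e > 0" using e' by (simp add: e_def)
  have cs: "continuous_on (sphere 0 1) v" by (rule continuous_on_subset[OF c]) auto
  obtain P where P: "P holomorphic_on UNIV" "\<And>z. z \<in> sphere 0 1 \<Longrightarrow> \<bar>v z - Re (P z)\<bar> < e"
    using circle_approximation[OF cs e] by blast
  have cP: "continuous_on A P" for A
    by (rule continuous_on_subset[OF holomorphic_on_imp_continuous_on[OF P(1)]]) simp
  \<comment> \<open>The term e |z|^2 excludes an interior maximum: its mean over a small circle
    gains e \<rho>^2, while the local hypothesis is invoked with loss only (e / 2) \<rho>^2.\<close>
  define h where "h z = v z - Re (P z) + e * (cmod z)\<^sup>2" for z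
  have ch: "continuous_on (cball 0 1) h" unfolding h_def by (intro continuous_intros c cP)
  have "\<exists>x\<in>cball 0 1. \<forall>y\<in>cball 0 1. h y \<le> h x" by (rule continuous_attains_sup[OF _ _ ch]) auto
  then obtain x where x: "x \<in> cball 0 1" "\<And>y. y \<in> cball 0 1 \<Longrightarrow> h y \<le> h x" by blast
  have "h x \<le> 2 * e"
  proof (cases "x \<in> sphere 0 1")
    case True
    then show ?thesis using P(2)[OF True] by (simp add: h_def)
  next
    case False
    then have xb: "x \<in> ball 0 1" using x(1) by auto
    obtain r where r: "r > 0" "\<And>\<rho>. 0 < \<rho> \<Longrightarrow> \<rho> < r \<Longrightarrow> v x \<le> cmean (\<lambda>\<omega>. v (x + of_real \<rho> * \<omega>)) + (e / 2) * \<rho>\<^sup>2"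
      using loc[OF xb, of "e / 2"] e by auto
    define \<rho> where "\<rho> = min r (1 - cmod x) / 2"
    have \<rho>: "0 < \<rho>" "\<rho> < r" "\<rho> < 1 - cmod x" using r(1) xb by (auto simp: \<rho>_def)
    have inb: "x + of_real \<rho> * \<omega> \<in> cball 0 1" if "\<omega> \<in> sphere 0 1" for \<omega>
      using norm_triangle_ineq[of x "of_real \<rho> * \<omega>"] that \<rho> by (simp add: norm_mult)
    have cv: "cint (\<lambda>\<omega>. v (x + of_real \<rho> * \<omega>))"
      by (rule cint_continuous, rule continuous_on_compose2[OF c]) (use inb in \<open>auto intro!: continuous_intros\<close>)
    \<comment> \<open>On the small circle |x + \<rho> \<omega>|^2 is a constant plus 2 \<rho> Re
      (cnj x \<omega>). So the difference of \<open>v\<close> and \<open>h\<close> there is the real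
      part of the entire function \<open>Q\<close>.\<close>
    define Q where "Q \<omega> = P (x + of_real \<rho> * \<omega>) - of_real (e * ((cmod x)\<^sup>2 + \<rho>\<^sup>2)) - of_real (2 * e * \<rho>) * (cnj x * \<omega>)" for \<omega>
    have "(\<lambda>\<omega>. P (x + of_real \<rho> * \<omega>)) holomorphic_on UNIV"
      by (rule holomorphic_on_compose_gen[where t=UNIV, unfolded o_def]) (auto intro!: holomorphic_intros P(1))
    then have hQ: "Q holomorphic_on UNIV" unfolding Q_def by (intro holomorphic_intros)
    have cQ: "cint (\<lambda>\<omega>. Re (Q \<omega>))"
      by (intro cint_continuous continuous_on_Re continuous_on_subset[OF holomorphic_on_imp_continuous_on[OF hQ]]) simp
    have "h (x + of_real \<rho> * \<omega>) = v (x + of_real \<rho> * \<omega>) - Re (Q \<omega>)" if "\<omega> \<in> sphere 0 1" for \<omega>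
    proof -
      have "(cmod (x + of_real \<rho> * \<omega>))\<^sup>2 = (cmod x)\<^sup>2 + \<rho>\<^sup>2 * (cmod \<omega>)\<^sup>2 + 2 * \<rho> * Re (cnj x * \<omega>)"
        unfolding cmod_power2 by (simp add: power2_eq_square algebra_simps)
      then have "(cmod (x + of_real \<rho> * \<omega>))\<^sup>2 = (cmod x)\<^sup>2 + \<rho>\<^sup>2 + 2 * \<rho> * Re (cnj x * \<omega>)" using that by simp
      then have "e * (cmod (x + of_real \<rho> * \<omega>))\<^sup>2 = e * ((cmod x)\<^sup>2 + \<rho>\<^sup>2) + 2 * e * \<rho> * Re (cnj x * \<omega>)"
        by (simp add: distrib_left)
      moreover have "Re (Q \<omega>) = Re (P (x + of_real \<rho> * \<omega>)) - e * ((cmod x)\<^sup>2 + \<rho>\<^sup>2) - 2 * e * \<rho> * Re (cnj x * \<omega>)"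
        unfolding Q_def by (simp only: minus_complex.sel Re_complex_of_real times_complex.sel Im_complex_of_real)
      ultimately show ?thesis by (simp add: h_def)
    qed
    then have "v (x + of_real \<rho> * \<omega>) - Re (Q \<omega>) \<le> h x" if "\<omega> \<in> sphere 0 1" for \<omega>
      using x(2)[OF inb[OF that]] that by simp
    then have "cmean (\<lambda>\<omega>. v (x + of_real \<rho> * \<omega>) - Re (Q \<omega>)) \<le> cmean (\<lambda>\<omega>. h x)"
      by (intro cmean_mono cint_diff cv cQ) auto
    also have "cmean (\<lambda>\<omega>. v (x + of_real \<rho> * \<omega>) - Re (Q \<omega>)) = cmean (\<lambda>\<omega>. v (x + of_real \<rho> * \<omega>)) - Re (Q 0)"
      using cmean_diff[OF cv cQ] cmean_holomorphic[OF hQ] by simp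
    also have "Re (Q 0) = Re (P x) - e * ((cmod x)\<^sup>2 + \<rho>\<^sup>2)" by (simp add: Q_def)
    finally have "cmean (\<lambda>\<omega>. v (x + of_real \<rho> * \<omega>)) - Re (P x) + e * (cmod x)\<^sup>2 + e * \<rho>\<^sup>2 \<le> h x" by (simp add: distrib_left)
    moreover have "v x \<le> cmean (\<lambda>\<omega>. v (x + of_real \<rho> * \<omega>)) + (e / 2) * \<rho>\<^sup>2" by (rule r(2)[OF \<rho>(1,2)])
    ultimately have "e * \<rho>\<^sup>2 \<le> (e / 2) * \<rho>\<^sup>2" by (simp add: h_def)
    then have "e * \<rho>\<^sup>2 \<le> 0" by simp
    then show ?thesis using e \<rho> by (simp add: mult_le_0_iff)
  qed
  then have "v 0 \<le> Re (P 0) + 2 * e" using x(2)[of 0] by (simp add: h_def)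
  also have "Re (P 0) = cmean (\<lambda>z. Re (P z))" by (rule cmean_holomorphic[OF P(1), symmetric])
  also have "\<dots> \<le> cmean (\<lambda>z. v z + e)"
  proof (rule cmean_mono)
    show "cint (\<lambda>z. Re (P z))" by (intro cint_continuous continuous_intros cP)
    show "cint (\<lambda>z. v z + e)" by (intro cint_continuous continuous_intros cs)
    show "Re (P z) \<le> v z + e" if "z \<in> sphere 0 1" for z using P(2)[OF that] by linarith
  qed
  also have "cmean (\<lambda>z. v z + e) = cmean v + e" using cmean_add[OF cint_continuous[OF cs] cint_const, of e] by simp
  finally show "v 0 \<le> cmean v + e'" by (simp add: e_def)
qed

lemma holomorphic_second_order:
  assumes P: "P holomorphic_on UNIV" and e: "e > 0"
  shows "\<exists>r>0. \<forall>h. cmod h < r \<longrightarrow> cmod (P (a + h) - P a - deriv P a * h - (deriv (deriv P) a / 2) * h\<^sup>2) \<le> e * (cmod h)\<^sup>2"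
proof -
  have dP: "(P has_field_derivative deriv P z) (at z)" for z using holomorphic_derivI[OF P] by simp
  have "deriv P holomorphic_on UNIV" using P by (rule holomorphic_deriv) simp
  then have dP': "(deriv P has_field_derivative deriv (deriv P) z) (at z)" for z using holomorphic_derivI[of "deriv P" UNIV z] by simp
  obtain r where r: "r > 0" "\<And>y. norm (y - a) < r \<Longrightarrow> norm (deriv P y - deriv P a - deriv (deriv P) a * (y - a)) \<le> e * norm (y - a)"
    using dP'[of a] e unfolding has_field_derivative_def has_derivative_at_alt by blast
  show ?thesis
  proof (intro exI[of _ r] conjI allI impI r)
    fix h :: complex assume h: "cmod h < r"
    define F where "F y = P y - deriv P a * (y - a) - (deriv (deriv P) a / 2) * (y - a)\<^sup>2" for y
    have dF: "(F has_field_derivative deriv P y - deriv P a - deriv (deriv P) a * (y - a)) (at y within cball a (cmod h))" for y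
      unfolding F_def by (rule derivative_eq_intros has_field_derivative_at_within[OF dP] refl | simp)+
    have "norm (F (a + h) - F a) \<le> (e * cmod h) * norm (a + h - a)"
    proof (rule field_differentiable_bound[OF convex_cball dF])
      fix y assume y: "y \<in> cball a (cmod h)"
      then have n: "norm (y - a) \<le> cmod h" by (simp add: dist_norm norm_minus_commute)
      then have "norm (deriv P y - deriv P a - deriv (deriv P) a * (y - a)) \<le> e * norm (y - a)" using r(2) h by simp
      also have "\<dots> \<le> e * cmod h" using n e by simp
      finally show "norm (deriv P y - deriv P a - deriv (deriv P) a * (y - a)) \<le> e * cmod h" .
    qed (auto simp: dist_norm)
    then show "cmod (P (a + h) - P a - deriv P a * h - (deriv (deriv P) a / 2) * h\<^sup>2) \<le> e * (cmod h)\<^sup>2"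
      by (simp add: F_def power2_eq_square algebra_simps)
  qed
qed

text \<open>The uniqueness argument for Haar measure. The double integral of h(f x) b(f x + y), with
  \<open>b\<close> the indicator of the unit ball, is evaluated in both orders by translations
  alone; an isometry preserves \<open>b\<close>, so the volume of the ball cancels.\<close>

lemma nn_integral_lborel_isometry:
  fixes f g :: "'a::euclidean_space \<Rightarrow> 'a" and h :: "'a \<Rightarrow> ennreal"
  assumes f: "linear f" "linear g" "\<And>x. f (g x) = x" "\<And>x. norm (f x) = norm x" and h[measurable]: "h \<in> borel_measurable borel"
  shows "(\<integral>\<^sup>+x. h (f x) \<partial>lborel) = (\<integral>\<^sup>+x. h x \<partial>lborel)"
proof -
  have [measurable]: "f \<in> borel_measurable borel" "g \<in> borel_measurable borel"
    using f by (auto intro!: continuous_imp_borel linear_continuous_on simp: linear_conv_bounded_linear[symmetric])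
  let ?B = "ball (0::'a) 1"
  have [measurable]: "?B \<in> sets borel" by simp
  define b where "b = (indicator ?B :: 'a \<Rightarrow> ennreal)"
  have [measurable]: "b \<in> borel_measurable borel" unfolding b_def by measurable
  have Bf: "(\<integral>\<^sup>+x. b (f x) \<partial>lborel) = (\<integral>\<^sup>+x. b x \<partial>lborel)"
    by (intro nn_integral_cong) (simp add: b_def indicator_def f)
  have Bv: "(\<integral>\<^sup>+x. b x \<partial>lborel) = emeasure lborel ?B" by (simp add: b_def)
  have B0: "emeasure lborel ?B \<noteq> 0" "emeasure lborel ?B \<noteq> \<infinity>"
    by (simp_all add: emeasure_ball unit_ball_vol_pos less_imp_neq[symmetric])
  have "(\<integral>\<^sup>+x. h (f x) \<partial>lborel) * (\<integral>\<^sup>+y. b y \<partial>lborel) = (\<integral>\<^sup>+x. (\<integral>\<^sup>+y. h (f x) * b y \<partial>lborel) \<partial>lborel)"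
    by (subst nn_integral_cmult, simp, subst nn_integral_multc) auto
  also have "\<dots> = (\<integral>\<^sup>+x. (\<integral>\<^sup>+y. h (f x) * b (f x + y) \<partial>lborel) \<partial>lborel)"
  proof (rule nn_integral_cong)
    fix x
    show "(\<integral>\<^sup>+y. h (f x) * b y \<partial>lborel) = (\<integral>\<^sup>+y. h (f x) * b (f x + y) \<partial>lborel)"
      by (rule nn_integral_lborel_shift[symmetric, where f="\<lambda>y. h (f x) * b y"]) measurable
  qed
  also have "\<dots> = (\<integral>\<^sup>+y. (\<integral>\<^sup>+x. h (f x) * b (f x + y) \<partial>lborel) \<partial>lborel)"
    by (rule lborel_pair.Fubini') measurable
  also have "\<dots> = (\<integral>\<^sup>+y. (\<integral>\<^sup>+x. h (f x - y) * b (f x) \<partial>lborel) \<partial>lborel)"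
  proof (rule nn_integral_cong)
    fix y
    have "(\<integral>\<^sup>+x. h (f x) * b (f x + y) \<partial>lborel) = (\<integral>\<^sup>+x. h (f (- g y + x)) * b (f (- g y + x) + y) \<partial>lborel)"
      by (rule nn_integral_lborel_shift[symmetric, where f="\<lambda>x. h (f x) * b (f x + y)"]) measurable
    also have "\<dots> = (\<integral>\<^sup>+x. h (f x - y) * b (f x) \<partial>lborel)"
      by (intro nn_integral_cong) (simp add: linear_add[OF f(1)] linear_diff[OF f(1)] linear_neg[OF f(1)] f(3))
    finally show "(\<integral>\<^sup>+x. h (f x) * b (f x + y) \<partial>lborel) = (\<integral>\<^sup>+x. h (f x - y) * b (f x) \<partial>lborel)" .
  qed
  also have "\<dots> = (\<integral>\<^sup>+x. (\<integral>\<^sup>+y. h (f x - y) * b (f x) \<partial>lborel) \<partial>lborel)"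
    by (rule lborel_pair.Fubini'[symmetric]) measurable
  also have "\<dots> = (\<integral>\<^sup>+x. (\<integral>\<^sup>+y. h y \<partial>lborel) * b (f x) \<partial>lborel)"
    by (intro nn_integral_cong, subst nn_integral_multc) (auto simp: nn_integral_lborel_reflect)
  also have "\<dots> = (\<integral>\<^sup>+y. h y \<partial>lborel) * (\<integral>\<^sup>+x. b (f x) \<partial>lborel)"
    by (rule nn_integral_cmult) measurable
  finally have "emeasure lborel ?B * (\<integral>\<^sup>+x. h (f x) \<partial>lborel) = emeasure lborel ?B * (\<integral>\<^sup>+x. h x \<partial>lborel)"
    unfolding Bf Bv by (simp add: mult.commute)
  then show ?thesis using B0 by (simp add: ennreal_mult_cancel_left)
qed

section \<open>Complex scaling of pairs and circles in complex lines\<close>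

definition csc :: "complex \<Rightarrow> complex \<times> (complex^'n) \<Rightarrow> complex \<times> (complex^'n)" where
  "csc \<zeta> w = (\<zeta> * fst w, \<chi> i. \<zeta> * snd w $ i)"

lemma csc_linear: "linear (csc \<zeta>)" and csc_linear': "linear (\<lambda>\<zeta>. csc \<zeta> w)"
  by (auto intro!: linearI simp: csc_def vec_eq_iff algebra_simps)

lemma csc_csc: "csc a (csc b w) = csc (a * b) w" by (simp add: csc_def vec_eq_iff)
lemma csc_1: "csc 1 w = w" by (simp add: csc_def vec_eq_iff prod_eq_iff)

lemma norm_csc: "norm (csc \<zeta> w) = cmod \<zeta> * norm w"
proof -
  have v: "norm (\<chi> i. \<zeta> * v $ i) = cmod \<zeta> * norm v" for v :: "complex^'n"
    unfolding norm_vec_def by (simp add: norm_mult L2_set_right_distrib)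
  show ?thesis unfolding csc_def norm_prod_def
    by (simp add: v norm_mult power_mult_distrib distrib_left[symmetric] real_sqrt_mult)
qed

lemma csc_continuous [continuous_intros]:
  "continuous_on A f \<Longrightarrow> continuous_on A g \<Longrightarrow> continuous_on A (\<lambda>x. csc (f x) (g x))"
  unfolding csc_def by (intro continuous_intros)

lemma csc_inv: "csc (cis \<theta>) (csc (cis (- \<theta>)) w) = w"
  by (simp add: csc_csc cis_mult csc_1)

lemma cline_csc: "cline p w \<zeta> = p + csc \<zeta> w" by (simp add: cline_def csc_def prod_eq_iff vec_eq_iff)

text \<open>Along a holomorphic disc, U equals its value on the tangent complex line plus the linear
  term U'(A)(\<eta>^2 q), up to o(|\<eta>|^2). The linear term is the real part of c \<eta>^2 and
  has mean 0 on circles, so the linear inequality gives a local one along the disc, which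
  \<open>local_submean_imp_submean\<close> globalises. Continuity of the first derivative suffices,
  as the deviation from the line is already of second order.\<close>

lemma polydisc_submean:
  fixes U :: "complex \<times> (complex^'n) \<Rightarrow> real" and P :: "'n \<Rightarrow> complex \<Rightarrow> complex"
  assumes dU: "\<And>p. (U has_derivative U' p) (at p)"
    and C1: "\<And>p0 e. e > 0 \<Longrightarrow> \<exists>\<eta>>0. \<forall>p. dist p p0 < \<eta> \<longrightarrow> (\<forall>h. \<bar>U' p h - U' p0 h\<bar> \<le> e * norm h)"
    and sub: "\<And>p w. fst p \<in> ball 0 R \<Longrightarrow> norm w \<le> \<rho>0 \<Longrightarrow> U p \<le> cmean (\<lambda>\<omega>. U (p + csc \<omega> w))" and \<rho>0: "\<rho>0 > 0"
    and P: "\<And>i. P i holomorphic_on UNIV" and \<rho>: "0 < \<rho>" "cball \<tau> \<rho> \<subseteq> ball 0 R"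
  shows "U (\<tau>, \<chi> i. P i 0) \<le> cmean (\<lambda>\<zeta>. U (\<tau> + of_real \<rho> * \<zeta>, \<chi> i. P i \<zeta>))"
proof -
  define G where "G \<zeta> = (\<tau> + of_real \<rho> * \<zeta>, (\<chi> i. P i \<zeta>) :: complex^'n)" for \<zeta>
  have cU: "continuous_on UNIV U" using dU has_derivative_continuous_on[of UNIV U U'] by simp
  have cP: "continuous_on UNIV (P i)" for i by (rule holomorphic_on_imp_continuous_on[OF P])
  have cG: "continuous_on UNIV G" unfolding G_def by (intro continuous_intros cP)
  have cUc: "continuous_on A f \<Longrightarrow> continuous_on A (\<lambda>x. U (f x))" for A and f :: "complex \<Rightarrow> complex \<times> (complex^'n)"
    by (rule continuous_on_compose2[OF cU]) auto
  have "U (G 0) \<le> cmean (\<lambda>\<zeta>. U (G \<zeta>))"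
  proof (rule local_submean_imp_submean)
    show "continuous_on (cball 0 1) (\<lambda>\<zeta>. U (G \<zeta>))" by (intro cUc continuous_on_subset[OF cG]) auto
    fix \<zeta> :: complex and e :: real assume \<zeta>: "\<zeta> \<in> ball 0 1" and e: "e > 0"
    define G1 where "G1 = (of_real \<rho> :: complex, (\<chi> i. deriv (P i) \<zeta>) :: complex^'n)"
    define q where "q = (0 :: complex, (\<chi> i. deriv (deriv (P i)) \<zeta> / 2) :: complex^'n)"
    define A where "A = G \<zeta>"
    have fA: "fst A \<in> ball 0 R"
    proof -
      have "dist \<tau> (\<tau> + of_real \<rho> * \<zeta>) \<le> \<rho>" using \<zeta> \<rho>(1) by (simp add: dist_norm norm_mult mult_left_le)
      then show ?thesis using \<rho>(2) by (auto simp: A_def G_def)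
    qed
    have bl: "bounded_linear (U' A)" using dU by (rule has_derivative_bounded_linear)
    have lin: "linear (U' A)" using bl by (rule bounded_linear.linear)
    obtain K where K: "K > 0" "\<And>h. \<bar>U' A h\<bar> \<le> K * norm h"
      using bounded_linear.pos_bounded[OF bl] by (auto simp: mult.commute)
    \<comment> \<open>\<epsilon>1 controls the Taylor remainder of the disc, multiplied by the bound
      \<open>K\<close> of the differential; \<epsilon>2 controls the variation of \<open>U'\<close>,
      multiplied by the second-order deviation. Each product is given e / 2.\<close>
    define \<epsilon>1 where "\<epsilon>1 = min 1 (e / (2 * K))"
    define \<epsilon>2 where "\<epsilon>2 = e / (2 * (norm q + 1))"
    have \<epsilon>: "\<epsilon>1 > 0" "\<epsilon>1 \<le> 1" "\<epsilon>2 > 0" using e K by (auto simp: \<epsilon>1_def \<epsilon>2_def intro!: divide_pos_pos add_nonneg_pos)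
    have tot: "\<epsilon>2 * (norm q + \<epsilon>1) + K * \<epsilon>1 \<le> e"
    proof -
      have "\<epsilon>2 * (norm q + \<epsilon>1) \<le> \<epsilon>2 * (norm q + 1)" using \<epsilon> by (intro mult_left_mono) auto
      also have "\<dots> = e / 2" using norm_ge_zero[of q] by (simp add: \<epsilon>2_def field_simps add_nonneg_eq_0_iff)
      finally have 1: "\<epsilon>2 * (norm q + \<epsilon>1) \<le> e / 2" .
      have "K * \<epsilon>1 \<le> K * (e / (2 * K))" using K by (intro mult_left_mono) (auto simp: \<epsilon>1_def)
      then have 2: "K * \<epsilon>1 \<le> e / 2" using K by simp
      show ?thesis using 1 2 by simp
    qed
    define E where "E \<eta> = G (\<zeta> + \<eta>) - (A + csc \<eta> G1) - csc (\<eta>\<^sup>2) q" for \<eta>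
    have "\<forall>\<^sub>F \<eta> in nhds 0. \<forall>i. cmod (P i (\<zeta> + \<eta>) - P i \<zeta> - deriv (P i) \<zeta> * \<eta> - (deriv (deriv (P i)) \<zeta> / 2) * \<eta>\<^sup>2) \<le> (\<epsilon>1 / CARD('n)) * (cmod \<eta>)\<^sup>2"
    proof (rule eventually_all_finite)
      fix i
      have "\<epsilon>1 / CARD('n) > 0" using \<epsilon> by simp
      from holomorphic_second_order[OF P this, of i \<zeta>]
      show "\<forall>\<^sub>F \<eta> in nhds 0. cmod (P i (\<zeta> + \<eta>) - P i \<zeta> - deriv (P i) \<zeta> * \<eta> - (deriv (deriv (P i)) \<zeta> / 2) * \<eta>\<^sup>2) \<le> (\<epsilon>1 / CARD('n)) * (cmod \<eta>)\<^sup>2"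
        unfolding eventually_nhds_metric by (simp add: dist_norm)
    qed
    then obtain r1 where r1: "r1 > 0" "\<And>\<eta> i. cmod \<eta> < r1 \<Longrightarrow> cmod (P i (\<zeta> + \<eta>) - P i \<zeta> - deriv (P i) \<zeta> * \<eta> - (deriv (deriv (P i)) \<zeta> / 2) * \<eta>\<^sup>2) \<le> (\<epsilon>1 / CARD('n)) * (cmod \<eta>)\<^sup>2"
      unfolding eventually_nhds_metric by (auto simp: dist_norm)
    have Eb: "norm (E \<eta>) \<le> \<epsilon>1 * (cmod \<eta>)\<^sup>2" if "cmod \<eta> < r1" for \<eta>
    proof -
      have "fst (E \<eta>) = 0" by (simp add: E_def G_def A_def csc_def G1_def q_def algebra_simps)
      then have "norm (E \<eta>) = norm (snd (E \<eta>))" by (simp add: norm_prod_def)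
      also have "\<dots> \<le> (\<Sum>i\<in>UNIV. cmod (snd (E \<eta>) $ i))" unfolding norm_vec_def by (rule L2_set_le_sum) simp
      also have "\<dots> \<le> (\<Sum>i\<in>(UNIV::'n set). (\<epsilon>1 / CARD('n)) * (cmod \<eta>)\<^sup>2)"
      proof (rule sum_mono)
        fix i
        have "snd (E \<eta>) $ i = P i (\<zeta> + \<eta>) - P i \<zeta> - deriv (P i) \<zeta> * \<eta> - (deriv (deriv (P i)) \<zeta> / 2) * \<eta>\<^sup>2"
          by (simp add: E_def G_def A_def csc_def G1_def q_def algebra_simps)
        then show "cmod (snd (E \<eta>) $ i) \<le> (\<epsilon>1 / CARD('n)) * (cmod \<eta>)\<^sup>2" using r1(2)[OF that] by simp
      qed
      also have "\<dots> = \<epsilon>1 * (cmod \<eta>)\<^sup>2" by simp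
      finally show ?thesis .
    qed
    obtain r2 where r2: "r2 > 0" "\<And>p h. dist p A < r2 \<Longrightarrow> \<bar>U' p h - U' A h\<bar> \<le> \<epsilon>2 * norm h"
      using C1[OF \<epsilon>(3), of A] by blast
    have cont0: "((\<lambda>\<eta>. G (\<zeta> + \<eta>)) \<longlongrightarrow> A) (nhds 0)" "((\<lambda>\<eta>. A + csc \<eta> G1) \<longlongrightarrow> A) (nhds 0)"
    proof -
      have "continuous_on UNIV (\<lambda>\<eta>. G (\<zeta> + \<eta>))" by (rule continuous_on_compose2[OF cG]) (auto intro!: continuous_intros)
      then have "isCont (\<lambda>\<eta>. G (\<zeta> + \<eta>)) 0" by (simp add: continuous_on_eq_continuous_at)
      then show "((\<lambda>\<eta>. G (\<zeta> + \<eta>)) \<longlongrightarrow> A) (nhds 0)"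
        using tendsto_at_iff_tendsto_nhds[of "\<lambda>\<eta>. G (\<zeta> + \<eta>)" 0] by (simp add: A_def isCont_def)
      have "continuous_on UNIV (\<lambda>\<eta>. A + csc \<eta> G1)" by (intro continuous_intros)
      then have "isCont (\<lambda>\<eta>. A + csc \<eta> G1) 0" by (simp add: continuous_on_eq_continuous_at)
      moreover have "csc 0 G1 = 0" by (simp add: csc_def prod_eq_iff vec_eq_iff)
      ultimately show "((\<lambda>\<eta>. A + csc \<eta> G1) \<longlongrightarrow> A) (nhds 0)"
        using tendsto_at_iff_tendsto_nhds[of "\<lambda>\<eta>. A + csc \<eta> G1" 0] by (simp add: isCont_def)
    qed
    have "\<forall>\<^sub>F \<eta> in nhds 0. dist (G (\<zeta> + \<eta>)) A < r2 \<and> dist (A + csc \<eta> G1) A < r2"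
      using tendstoD[OF cont0(1) r2(1)] tendstoD[OF cont0(2) r2(1)] by (rule eventually_conj)
    then obtain r3 where r3: "r3 > 0" "\<And>\<eta>. cmod \<eta> < r3 \<Longrightarrow> dist (G (\<zeta> + \<eta>)) A < r2 \<and> dist (A + csc \<eta> G1) A < r2"
      unfolding eventually_nhds_metric by (auto simp: dist_norm)
    have pt: "U (A + csc \<eta> G1) + U' A (csc (\<eta>\<^sup>2) q) \<le> U (G (\<zeta> + \<eta>)) + e * (cmod \<eta>)\<^sup>2" if \<eta>: "cmod \<eta> < min r1 r3" for \<eta>
    proof -
      define a b where "a = G (\<zeta> + \<eta>)" and "b = A + csc \<eta> G1"
      have ab: "a - b = csc (\<eta>\<^sup>2) q + E \<eta>" by (simp add: a_def b_def E_def)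
      have "norm (a - b) \<le> norm (csc (\<eta>\<^sup>2) q) + norm (E \<eta>)" unfolding ab by (rule norm_triangle_ineq)
      also have "\<dots> \<le> (cmod \<eta>)\<^sup>2 * norm q + \<epsilon>1 * (cmod \<eta>)\<^sup>2" using Eb[of \<eta>] \<eta> by (simp add: norm_csc norm_power)
      finally have nab: "norm (a - b) \<le> (norm q + \<epsilon>1) * (cmod \<eta>)\<^sup>2" by (simp add: distrib_right mult.commute)
      have inb: "a \<in> ball A r2" "b \<in> ball A r2" using r3(2)[of \<eta>] \<eta> by (auto simp: a_def b_def dist_commute)
      have "norm (U a - U b - U' A (a - b)) \<le> norm (a - b) * \<epsilon>2"
      proof (rule differentiable_bound_linearization[where S="ball A r2" and f'=U'])
        show "b + t *\<^sub>R (a - b) \<in> ball A r2" if "t \<in> {0..1}" for t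
        proof -
          have "b + t *\<^sub>R (a - b) = (1 - t) *\<^sub>R b + t *\<^sub>R a" by (simp add: algebra_simps)
          then show ?thesis using convexD_alt[OF convex_ball inb(2,1)] that by simp
        qed
        show "(U has_derivative U' x) (at x within ball A r2)" for x using dU has_derivative_at_withinI by blast
        show "onorm (U' x - U' A) \<le> \<epsilon>2" if "x \<in> ball A r2" for x
          by (rule onorm_le) (use r2(2)[of x] that in \<open>auto simp: dist_commute\<close>)
        show "A \<in> ball A r2" using r2 by simp
      qed
      also have "\<dots> \<le> ((norm q + \<epsilon>1) * (cmod \<eta>)\<^sup>2) * \<epsilon>2" using nab \<epsilon> by (intro mult_right_mono) auto
      finally have 1: "\<bar>U a - U b - U' A (a - b)\<bar> \<le> (\<epsilon>2 * (norm q + \<epsilon>1)) * (cmod \<eta>)\<^sup>2" by (simp add: mult_ac)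
      have 2: "U' A (a - b) = U' A (csc (\<eta>\<^sup>2) q) + U' A (E \<eta>)" unfolding ab by (rule linear_add[OF lin])
      have "\<bar>U' A (E \<eta>)\<bar> \<le> K * (\<epsilon>1 * (cmod \<eta>)\<^sup>2)"
        by (rule order_trans[OF K(2) mult_left_mono[OF Eb]]) (use K(1) \<eta> in auto)
      then have 3: "\<bar>U' A (E \<eta>)\<bar> \<le> (K * \<epsilon>1) * (cmod \<eta>)\<^sup>2" by (simp add: mult_ac)
      have "(\<epsilon>2 * (norm q + \<epsilon>1)) * (cmod \<eta>)\<^sup>2 + (K * \<epsilon>1) * (cmod \<eta>)\<^sup>2 \<le> e * (cmod \<eta>)\<^sup>2"
        unfolding distrib_right[symmetric] using tot by (rule mult_right_mono) simp
      then show ?thesis using 1 2 3 unfolding a_def[symmetric] b_def[symmetric] by linarith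
    qed
    define r where "r = min (min r1 r3) (\<rho>0 / (norm G1 + 1))"
    have r: "r > 0" using r1 r3 \<rho>0 by (auto simp: r_def intro!: divide_pos_pos add_nonneg_pos)
    show "\<exists>r>0. \<forall>\<rho>. 0 < \<rho> \<longrightarrow> \<rho> < r \<longrightarrow> U (G \<zeta>) \<le> cmean (\<lambda>\<omega>. U (G (\<zeta> + of_real \<rho> * \<omega>))) + e * \<rho>\<^sup>2"
    proof (intro exI[of _ r] conjI r allI impI)
      fix s :: real assume s: "0 < s" "s < r"
      have "norm (csc (of_real s) G1) \<le> \<rho>0"
      proof -
        have "s * norm G1 \<le> s * (norm G1 + 1)" using s by simp
        also have "\<dots> \<le> (\<rho>0 / (norm G1 + 1)) * (norm G1 + 1)" using s by (intro mult_right_mono) (auto simp: r_def)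
        also have "\<dots> = \<rho>0" using norm_ge_zero[of G1] by (simp add: add_nonneg_eq_0_iff)
        finally show ?thesis using s by (simp add: norm_csc)
      qed
      from sub[OF fA this]
      have 1: "U A \<le> cmean (\<lambda>\<omega>. U (A + csc (of_real s * \<omega>) G1))" by (simp add: csc_csc mult.commute)
      \<comment> \<open>A real-linear functional on the plane is z -> Re (c z); its values at 1 and
        i determine \<open>c\<close>.\<close>
      define c where "c = Complex (U' A (csc 1 q)) (- U' A (csc \<i> q))"
      have lc: "U' A (csc z q) = Re (c * z)" for z
      proof -
        have "csc z q = csc (Re z *\<^sub>R 1 + Im z *\<^sub>R \<i>) q" by (rule arg_cong[where f="\<lambda>z. csc z q"]) (simp add: complex_eq_iff)
        also have "\<dots> = Re z *\<^sub>R csc 1 q + Im z *\<^sub>R csc \<i> q" by (simp add: linear_add[OF csc_linear'] linear_scale[OF csc_linear'])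
        finally show ?thesis by (simp add: linear_add[OF lin] linear_scale[OF lin] c_def mult.commute)
      qed
      define Q where "Q \<omega> = c * (of_real s * \<omega>)\<^sup>2" for \<omega>
      have hQ: "Q holomorphic_on UNIV" unfolding Q_def by (intro holomorphic_intros)
      have ci1: "cint (\<lambda>\<omega>. U (A + csc (of_real s * \<omega>) G1))" by (intro cint_continuous cUc continuous_intros)
      have ci2: "cint (\<lambda>\<omega>. Re (Q \<omega>))" unfolding Q_def by (intro cint_continuous continuous_intros)
      have ci3: "cint (\<lambda>\<omega>. U (G (\<zeta> + of_real s * \<omega>)))"
        by (intro cint_continuous cUc continuous_on_compose2[OF cG] continuous_intros) auto
      have "cmean (\<lambda>\<omega>. U (A + csc (of_real s * \<omega>) G1) + Re (Q \<omega>)) \<le> cmean (\<lambda>\<omega>. U (G (\<zeta> + of_real s * \<omega>)) + e * s\<^sup>2)"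
      proof (rule cmean_mono)
        fix \<omega> :: complex assume "\<omega> \<in> sphere 0 1"
        then have n: "cmod (of_real s * \<omega>) = s" using s by (simp add: norm_mult)
        show "U (A + csc (of_real s * \<omega>) G1) + Re (Q \<omega>) \<le> U (G (\<zeta> + of_real s * \<omega>)) + e * s\<^sup>2"
          using pt[of "of_real s * \<omega>"] s unfolding n lc Q_def by (simp add: r_def)
      qed (intro cint_add ci1 ci2 ci3 cint_const)+
      also have "\<dots> = cmean (\<lambda>\<omega>. U (G (\<zeta> + of_real s * \<omega>))) + e * s\<^sup>2" using cmean_add[OF ci3 cint_const] by simp
      also have "cmean (\<lambda>\<omega>. U (A + csc (of_real s * \<omega>) G1) + Re (Q \<omega>)) = cmean (\<lambda>\<omega>. U (A + csc (of_real s * \<omega>) G1))"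
        unfolding cmean_add[OF ci1 ci2] cmean_holomorphic[OF hQ] by (simp add: Q_def)
      finally show "U (G \<zeta>) \<le> cmean (\<lambda>\<omega>. U (G (\<zeta> + of_real s * \<omega>))) + e * s\<^sup>2" using 1 by (simp add: A_def)
    qed
  qed
  then show ?thesis by (simp add: G_def)
qed

lemma cvec_continuous [continuous_intros]: "continuous_on A f \<Longrightarrow> continuous_on A (\<lambda>x. cvec (f x))"
  unfolding cvec_def by (intro continuous_intros)

text \<open>Each coordinate of a continuous real circle is uniformly close to the real part of an
  entire function, and so are the values at the centre, both being circle means. As \<open>U\<close>
  sees only real parts, it may be evaluated on the holomorphic disc, and uniform continuity absorbs
  the error.\<close>

lemma adp_of_polydisc_submean:
  fixes U :: "complex \<times> (complex^'n) \<Rightarrow> real"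
  assumes c: "continuous_on UNIV U"
    and sub: "\<And>P \<tau> \<rho>. (\<And>i. P i holomorphic_on UNIV) \<Longrightarrow> 0 < \<rho> \<Longrightarrow> cball \<tau> \<rho> \<subseteq> ball 0 R \<Longrightarrow>
        U (\<tau>, \<chi> i. P i 0) \<le> cmean (\<lambda>\<zeta>. U (\<tau> + of_real \<rho> * \<zeta>, \<chi> i. P i \<zeta>))"
    and ind: "\<And>\<tau> z. U (\<tau>, z) = U (\<tau>, cvec (\<chi> i. Re (z $ i)))"
  shows "adp R (\<lambda>\<tau> x. U (\<tau>, cvec x))"
  unfolding adp_def
proof (intro conjI allI impI)
  have cc: "continuous_on A (\<lambda>q. U (f q, cvec (g q)))" if "continuous_on A f" "continuous_on A g" for A and f :: "'b::topological_space \<Rightarrow> complex" and g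
    by (rule continuous_on_compose2[OF c]) (use that in \<open>auto intro!: continuous_intros\<close>)
  show "continuous_on (ball 0 R \<times> UNIV) (\<lambda>(\<tau>, x). U (\<tau>, cvec x))"
    unfolding case_prod_beta' by (intro cc continuous_intros)
  fix \<tau> :: complex and \<rho> :: real and X :: "complex \<Rightarrow> real^'n" assume \<rho>: "0 < \<rho>" "cball \<tau> \<rho> \<subseteq> ball 0 R" and X: "continuous_on (sphere 0 1) X"
  have vm: "vmean Y $ i = cmean (\<lambda>\<zeta>. Y \<zeta> $ i)" for Y :: "complex \<Rightarrow> real^'n" and i
    using vmean_inner[of "axis i 1" Y] by (simp add: inner_axis)
  show "U (\<tau>, cvec (vmean X)) \<le> cmean (\<lambda>\<zeta>. U (\<tau> + of_real \<rho> * \<zeta>, cvec (X \<zeta>)))"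
  proof (rule field_le_epsilon)
    fix e :: real assume e: "e > 0"
    have "bounded (X ` sphere 0 1)" by (intro compact_imp_bounded compact_continuous_image X) auto
    then obtain B where B: "B > 0" "\<And>\<zeta>. \<zeta> \<in> sphere 0 1 \<Longrightarrow> norm (X \<zeta>) \<le> B" by (auto simp: bounded_pos)
    define M where "M = max B (norm (vmean X)) + 1"
    have "uniformly_continuous_on (cball \<tau> \<rho> \<times> cball 0 M) (\<lambda>q. U (fst q, cvec (snd q)))"
      by (rule compact_uniformly_continuous) (auto intro!: cc continuous_intros compact_Times)
    then obtain d where d: "d > 0" "\<And>q q'. q \<in> cball \<tau> \<rho> \<times> cball 0 M \<Longrightarrow> q' \<in> cball \<tau> \<rho> \<times> cball 0 M \<Longrightarrow> dist q' q < d \<Longrightarrow>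
        dist (U (fst q', cvec (snd q'))) (U (fst q, cvec (snd q))) < e / 2"
      unfolding uniformly_continuous_on_def using e by (meson half_gt_zero)
    \<comment> \<open>Summed over the n coordinates this stays below the modulus \<open>d\<close>
      and below 1; the latter keeps the approximating circle in the ball of radius
      \<open>M\<close>.\<close>
    define d' where "d' = min d 1 / (2 * CARD('n))"
    have d': "d' > 0" using d by (simp add: d'_def)
    have nd: "CARD('n) * d' < d" "CARD('n) * d' \<le> 1" using d(1) by (auto simp: d'_def)
    have "\<forall>i. \<exists>P. P holomorphic_on UNIV \<and> (\<forall>z\<in>sphere 0 1. \<bar>X z $ i - Re (P z)\<bar> < d')"
    proof
      fix i
      have "continuous_on (sphere 0 1) (\<lambda>z. X z $ i)" by (intro continuous_intros X)
      from circle_approximation[OF this d'] show "\<exists>P. P holomorphic_on UNIV \<and> (\<forall>z\<in>sphere 0 1. \<bar>X z $ i - Re (P z)\<bar> < d')" by metis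
    qed
    then obtain P where P: "\<And>i. P i holomorphic_on UNIV" "\<And>i z. z \<in> sphere 0 1 \<Longrightarrow> \<bar>X z $ i - Re (P i z)\<bar> < d'" by metis
    define Y where "Y z = (\<chi> i. Re (P i z)) " for z
    have cP: "continuous_on A (P i)" for A i by (rule continuous_on_subset[OF holomorphic_on_imp_continuous_on[OF P(1)]]) simp
    have cY: "continuous_on A Y" for A unfolding Y_def by (intro continuous_intros cP)
    have close: "norm (X z - Y z) \<le> CARD('n) * d'" if "z \<in> sphere 0 1" for z
    proof -
      have "norm (X z - Y z) \<le> (\<Sum>i\<in>UNIV. \<bar>(X z - Y z) $ i\<bar>)" by (rule norm_le_l1_cart)
      also have "\<dots> \<le> (\<Sum>i\<in>(UNIV::'n set). d')" by (rule sum_mono) (use P(2)[OF that] in \<open>simp add: Y_def less_imp_le\<close>)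
      finally show ?thesis by simp
    qed
    have Y0: "Y 0 $ i = cmean (\<lambda>z. Re (P i z))" for i unfolding Y_def using cmean_holomorphic[OF P(1)] by simp
    have close0: "norm (vmean X - Y 0) \<le> CARD('n) * d'"
    proof -
      have "\<bar>(vmean X - Y 0) $ i\<bar> \<le> d'" for i
      proof -
        have ci: "cint (\<lambda>z. X z $ i)" "cint (\<lambda>z. Re (P i z))" by (intro cint_continuous continuous_intros X cP)+
        have b: "- d' \<le> X z $ i - Re (P i z)" "X z $ i - Re (P i z) \<le> d'" if "z \<in> sphere 0 1" for z
          using P(2)[OF that, of i] by linarith+
        have "cmean (\<lambda>z. X z $ i - Re (P i z)) \<le> cmean (\<lambda>z. d')"
          by (rule cmean_mono[OF cint_diff[OF ci] cint_const b(2)])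
        moreover have "cmean (\<lambda>z. - d') \<le> cmean (\<lambda>z. X z $ i - Re (P i z))"
          by (rule cmean_mono[OF cint_const cint_diff[OF ci] b(1)])
        moreover have "(vmean X - Y 0) $ i = cmean (\<lambda>z. X z $ i - Re (P i z))"
          unfolding vector_minus_component vm Y0 cmean_diff[OF ci] ..
        ultimately show ?thesis by simp
      qed
      then have "(\<Sum>i\<in>UNIV. \<bar>(vmean X - Y 0) $ i\<bar>) \<le> (\<Sum>i\<in>(UNIV::'n set). d')" by (intro sum_mono)
      then show ?thesis using norm_le_l1_cart[of "vmean X - Y 0"] by simp
    qed
    have YB: "Y z \<in> cball 0 M" "X z \<in> cball 0 M" if "z \<in> sphere 0 1" for z
      using norm_triangle_sub[of "Y z" "X z"] close[OF that] nd B(2)[OF that] by (auto simp: M_def norm_minus_commute)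
    have "U (\<tau>, cvec (vmean X)) \<le> U (\<tau>, cvec (Y 0)) + e / 2"
    proof -
      have "Y 0 \<in> cball 0 M" "vmean X \<in> cball 0 M"
        using norm_triangle_sub[of "Y 0" "vmean X"] close0 nd by (auto simp: M_def norm_minus_commute)
      then have "dist (U (\<tau>, cvec (vmean X))) (U (\<tau>, cvec (Y 0))) < e / 2"
        using d(2)[of "(\<tau>, Y 0)" "(\<tau>, vmean X)"] close0 nd \<rho> by (simp add: dist_Pair_Pair dist_norm)
      then show ?thesis unfolding dist_real_def by linarith
    qed
    also have "U (\<tau>, cvec (Y 0)) = U (\<tau>, \<chi> i. P i 0)" by (subst (2) ind) (simp add: Y_def)
    also have "\<dots> \<le> cmean (\<lambda>\<zeta>. U (\<tau> + of_real \<rho> * \<zeta>, \<chi> i. P i \<zeta>))" by (rule sub[OF P(1) \<rho>])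
    also have "\<dots> = cmean (\<lambda>\<zeta>. U (\<tau> + of_real \<rho> * \<zeta>, cvec (Y \<zeta>)))"
      by (rule cmean_cong, subst ind) (simp add: Y_def)
    also have "\<dots> \<le> cmean (\<lambda>\<zeta>. U (\<tau> + of_real \<rho> * \<zeta>, cvec (X \<zeta>)) + e / 2)"
    proof (rule cmean_mono)
      show "cint (\<lambda>\<zeta>. U (\<tau> + of_real \<rho> * \<zeta>, cvec (Y \<zeta>)))" by (intro cint_continuous cc continuous_intros cY)
      show "cint (\<lambda>\<zeta>. U (\<tau> + of_real \<rho> * \<zeta>, cvec (X \<zeta>)) + e / 2)" by (intro cint_continuous continuous_intros cc X)
      fix \<zeta> :: complex assume \<zeta>: "\<zeta> \<in> sphere 0 1"
      have "\<tau> + of_real \<rho> * \<zeta> \<in> cball \<tau> \<rho>" using \<zeta> \<rho>(1) by (simp add: dist_norm norm_mult)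
      then have "dist (U (\<tau> + of_real \<rho> * \<zeta>, cvec (X \<zeta>))) (U (\<tau> + of_real \<rho> * \<zeta>, cvec (Y \<zeta>))) < e / 2"
        using d(2)[of "(\<tau> + of_real \<rho> * \<zeta>, Y \<zeta>)" "(\<tau> + of_real \<rho> * \<zeta>, X \<zeta>)"] close[OF \<zeta>] nd YB[OF \<zeta>]
        by (simp add: dist_Pair_Pair dist_norm)
      then show "U (\<tau> + of_real \<rho> * \<zeta>, cvec (Y \<zeta>)) \<le> U (\<tau> + of_real \<rho> * \<zeta>, cvec (X \<zeta>)) + e / 2"
        unfolding dist_real_def by linarith
    qed
    also have "\<dots> = cmean (\<lambda>\<zeta>. U (\<tau> + of_real \<rho> * \<zeta>, cvec (X \<zeta>))) + e / 2"
      using cmean_add[OF cint_continuous[OF cc] cint_const] X by (simp add: continuous_intros)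
    finally show "U (\<tau>, cvec (vmean X)) \<le> cmean (\<lambda>\<zeta>. U (\<tau> + of_real \<rho> * \<zeta>, cvec (X \<zeta>))) + e" by simp
  qed
qed

text \<open>The exponent 2 makes the kernel C^1, the smoothness that \<open>polydisc_submean\<close>
  asks of a convolution. Radial symmetry is what later makes convolution increase the
  weight.\<close>

lemma radial_mollifier:
  assumes \<delta>: "(\<delta>::real) > 0"
  obtains k :: "'a::euclidean_space \<Rightarrow> real" and V :: "'a \<Rightarrow> 'a"
  where "continuous_on UNIV k" "\<And>w. k w \<ge> 0" "\<And>w. w \<notin> cball 0 \<delta> \<Longrightarrow> k w = 0" "(\<integral>w. k w \<partial>lborel) = 1"
    "\<And>w w'. norm w = norm w' \<Longrightarrow> k w = k w'"
    "\<And>w. (k has_derivative (\<lambda>h. V w \<bullet> h)) (at w)" "continuous_on UNIV V" "\<And>w. w \<notin> cball 0 \<delta> \<Longrightarrow> V w = 0"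
proof -
  define g where "g w = ppow (\<delta>\<^sup>2) 2 (w \<bullet> w)" for w :: 'a
  define m where "m = (\<integral>w. g w \<partial>lborel)"
  have out: "w \<bullet> w \<ge> \<delta>\<^sup>2" if "w \<notin> cball 0 \<delta>" for w :: 'a
    using that \<delta> unfolding power2_norm_eq_inner[symmetric] by (intro power_mono) auto
  have gc: "continuous_on UNIV g" unfolding g_def by (intro continuous_intros)
  have g0: "g w = 0" if "w \<notin> cball 0 \<delta>" for w
    using out[OF that] ppow_zero[of "\<delta>\<^sup>2" _ 1] by (simp add: g_def numeral_2_eq_2)
  have gi: "integrable lborel g" by (rule integrable_compact_support[OF gc g0])
  have m: "m > 0"
  proof -
    define B where "B = ball (0::'a) (\<delta>/2)"
    have [measurable]: "B \<in> sets borel" by (simp add: B_def)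
    have em: "emeasure lborel B < \<infinity>" unfolding B_def by (rule emeasure_bounded_finite) simp
    have "0 < (\<delta>\<^sup>2/2)\<^sup>2 * measure lborel B"
      using \<delta> by (auto intro!: mult_pos_pos simp: B_def content_ball_pos)
    also have "\<dots> = (\<integral>w. (\<delta>\<^sup>2/2)\<^sup>2 * indicator B w \<partial>lborel)" by simp
    also have "\<dots> \<le> m" unfolding m_def
    proof (rule Bochner_Integration.integral_mono)
      show "integrable lborel (\<lambda>w. (\<delta>\<^sup>2/2)\<^sup>2 * indicator B w)" using em by (intro integrable_mult_right) (simp add: integrable_indicator_iff)
      fix w :: 'a
      show "(\<delta>\<^sup>2/2)\<^sup>2 * indicator B w \<le> g w"
      proof (cases "w \<in> B")
        case True
        then have "w \<bullet> w \<le> (\<delta>/2)\<^sup>2" unfolding power2_norm_eq_inner[symmetric] by (intro power_mono) (auto simp: B_def)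
        moreover have "(\<delta>/2)\<^sup>2 \<le> \<delta>\<^sup>2/2" by (simp add: power2_eq_square)
        ultimately have "\<delta>\<^sup>2/2 \<le> \<delta>\<^sup>2 - w \<bullet> w" by simp
        then have "\<delta>\<^sup>2/2 \<le> max 0 (\<delta>\<^sup>2 - w \<bullet> w)" by linarith
        then have "(\<delta>\<^sup>2/2)\<^sup>2 \<le> (max 0 (\<delta>\<^sup>2 - w \<bullet> w))\<^sup>2" by (rule power_mono) simp
        then show ?thesis using True by (simp add: g_def ppow_def)
      qed (simp add: g_def)
    qed (rule gi)
    finally show ?thesis .
  qed
  define k where "k w = g w / m" for w
  define V where "V w = (- 4 * ppow (\<delta>\<^sup>2) 1 (w \<bullet> w) / m) *\<^sub>R w" for w :: 'a
  show thesis
  proof (rule that[of k V])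
    show "continuous_on UNIV k" unfolding k_def by (intro continuous_intros gc) (use m in auto)
    show "k w \<ge> 0" for w using m by (simp add: k_def g_def)
    show "w \<notin> cball 0 \<delta> \<Longrightarrow> k w = 0" for w using g0 by (simp add: k_def)
    show "(\<integral>w. k w \<partial>lborel) = 1" using m by (simp add: k_def m_def[symmetric])
    show "norm w = norm w' \<Longrightarrow> k w = k w'" for w w' by (simp add: k_def g_def power2_norm_eq_inner[symmetric])
    show "continuous_on UNIV V" unfolding V_def by (intro continuous_intros) (use m in auto)
    show "w \<notin> cball 0 \<delta> \<Longrightarrow> V w = 0" for w using out[of w] ppow_zero[of "\<delta>\<^sup>2" _ 0] by (simp add: V_def)
    fix w :: 'a
    have "(ppow (\<delta>\<^sup>2) 2 has_real_derivative - (2 * ppow (\<delta>\<^sup>2) 1 (w \<bullet> w))) (at (w \<bullet> w))"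
      using ppow_deriv[of "\<delta>\<^sup>2" 0 "w \<bullet> w"] unfolding numeral_2_eq_2 One_nat_def by simp
    then have 1: "(ppow (\<delta>\<^sup>2) 2 has_derivative (\<lambda>h. - (2 * ppow (\<delta>\<^sup>2) 1 (w \<bullet> w)) * h)) (at (w \<bullet> w))"
      unfolding has_field_derivative_def .
    have 2: "((\<lambda>w. w \<bullet> w) has_derivative (\<lambda>h. 2 * (w \<bullet> h))) (at w)"
      by (auto intro!: derivative_eq_intros simp: inner_commute)
    have "((\<lambda>w. ppow (\<delta>\<^sup>2) 2 (w \<bullet> w)) has_derivative (\<lambda>h. - (2 * ppow (\<delta>\<^sup>2) 1 (w \<bullet> w)) * (2 * (w \<bullet> h)))) (at w)"
      by (rule has_derivative_compose[OF 2 1])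
    from has_derivative_mult_left[OF this, of "inverse m"]
    show "(k has_derivative (\<lambda>h. V w \<bullet> h)) (at w)"
      unfolding k_def g_def V_def by (simp add: divide_inverse mult_ac)
  qed
qed

text \<open>Convolution commutes with displacement along complex circles, hence preserves their
  inequality, and C^1 smoothness then extends it to holomorphic discs and to \<open>adp\<close>. The
  lower bound comes from the radial kernel, which is invariant under w -> csc (cis \<theta>) w and
  so averages \<psi> over full circles centred at p. The upper bound is that of any average.\<close>

lemma mollification:
  fixes \<psi> :: "complex \<times> (complex^'n) \<Rightarrow> real"
  assumes \<psi>[measurable]: "\<psi> \<in> borel_measurable borel" and l: "loc_bounded \<psi>" and \<delta>: "0 < \<delta>" "\<delta> \<le> \<rho>1"
    and sub: "\<And>p w. fst p \<in> ball 0 (R + \<delta>) \<Longrightarrow> norm w \<le> \<rho>1 \<Longrightarrow> \<psi> p \<le> cmean (\<lambda>\<zeta>. \<psi> (p + csc \<zeta> w))"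
    and ind: "\<And>\<tau> z. \<psi> (\<tau>, z) = \<psi> (\<tau>, cvec (\<chi> i. Re (z $ i)))"
  obtains U where "adp R (\<lambda>\<tau> x. U (\<tau>, cvec x))" "\<And>p. fst p \<in> ball 0 R \<Longrightarrow> \<psi> p \<le> U p"
    "\<And>p C. (\<And>q. q \<in> cball p \<delta> \<Longrightarrow> \<psi> q \<le> C) \<Longrightarrow> U p \<le> C"
proof -
  obtain k :: "complex \<times> (complex^'n) \<Rightarrow> real" and V where
    k: "continuous_on UNIV k" "\<And>w. k w \<ge> 0" "\<And>w. w \<notin> cball 0 \<delta> \<Longrightarrow> k w = 0" "(\<integral>w. k w \<partial>lborel) = 1"
      "\<And>w w'. norm w = norm w' \<Longrightarrow> k w = k w'"
    and V: "\<And>w. (k has_derivative (\<lambda>h. V w \<bullet> h)) (at w)" "continuous_on UNIV V" "\<And>w. w \<notin> cball 0 \<delta> \<Longrightarrow> V w = 0"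
    by (rule radial_mollifier[OF \<delta>(1)]) (rule that)
  have km[measurable]: "k \<in> borel_measurable borel" using k(1) by auto
  have ki: "integrable lborel k" by (rule integrable_compact_support[OF k(1,3)])
  define U where "U = conv \<psi> k"
  have Uw: "U p = (\<integral>w. \<psi> (p - w) * k w \<partial>lborel)" for p unfolding U_def by (rule conv_reflect[OF \<psi> km])
  have Ui: "integrable lborel (\<lambda>w. \<psi> (p - w) * k w)" for p
  proof -
    have "integrable lborel (\<lambda>y. \<psi> y * k (p - y))" by (rule conv_integrable[OF \<psi> l k(1,3)])
    then have "integrable (distr lborel borel (\<lambda>w. p + (-1) *\<^sub>R w)) (\<lambda>y. \<psi> y * k (p - y))"
      using lborel_affine[of "-1" p] by (simp add: density_1)
    then show ?thesis by (subst (asm) integrable_distr_eq) auto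
  qed
  have Uc: "continuous_on UNIV U" unfolding U_def by (rule conv_continuous[OF \<psi> l k(1,3)])
  define U' where "U' p h = conv \<psi> (\<lambda>w. V w \<bullet> h) p" for p h
  have Vc: "continuous_on UNIV (\<lambda>w. V w \<bullet> h)" for h by (intro continuous_intros V)
  have Vuc: "\<exists>\<eta>>0. \<forall>w w'. dist w w' < \<eta> \<longrightarrow> (\<forall>h. norm (V w \<bullet> h - V w' \<bullet> h) \<le> e * norm h)" if e: "e > 0" for e
  proof -
    obtain \<eta> where \<eta>: "\<eta> > 0" "\<And>x y. dist x y < \<eta> \<Longrightarrow> norm (V x - V y) < e"
      using uniformly_continuous_compact_support[OF V(2,3) e] by blast
    have "norm (V w \<bullet> h - V w' \<bullet> h) \<le> e * norm h" if "dist w w' < \<eta>" for w w' h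
    proof -
      have "norm (V w \<bullet> h - V w' \<bullet> h) = norm ((V w - V w') \<bullet> h)" by (simp add: inner_diff_left)
      also have "\<dots> \<le> norm (V w - V w') * norm h" using Cauchy_Schwarz_ineq2 by auto
      also have "\<dots> \<le> e * norm h" using \<eta>(2)[OF that] by (intro mult_right_mono) auto
      finally show ?thesis .
    qed
    then show ?thesis using \<eta>(1) by blast
  qed
  have dU: "(U has_derivative U' p) (at p)" for p
    unfolding U_def U'_def[abs_def] by (rule conv_has_derivative[OF \<psi> l V(1) k(3) Vc Vuc])
  have C1: "\<exists>\<eta>>0. \<forall>p. dist p p0 < \<eta> \<longrightarrow> (\<forall>h. \<bar>U' p h - U' p0 h\<bar> \<le> e * norm h)" if e: "e > 0" for p0 e
  proof -
    obtain B where B: "B > 0" "\<And>y. y \<in> cball p0 (\<delta> + 1) \<Longrightarrow> norm (\<psi> y) \<le> B" using loc_bounded_cball[OF l] by blast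
    define M where "M = measure lborel (cball p0 (\<delta> + 1))"
    have M: "M \<ge> 0" by (simp add: M_def)
    define e' where "e' = e / (B * M + 1)"
    have e': "e' > 0" "B * M * e' \<le> e" using e B(1) M unfolding e'_def
      by (auto intro!: divide_pos_pos add_nonneg_pos simp: field_simps add_pos_nonneg)
    obtain \<eta> where \<eta>: "\<eta> > 0" "\<And>w w' h. dist w w' < \<eta> \<Longrightarrow> norm (V w \<bullet> h - V w' \<bullet> h) \<le> e' * norm h"
      using Vuc[OF e'(1)] by blast
    have "\<bar>U' p h - U' p0 h\<bar> \<le> e * norm h" if p: "dist p p0 < min \<eta> 1" for p h
    proof -
      define \<kappa> where "\<kappa> w = V (w + (p - p0)) \<bullet> h - V w \<bullet> h" for w
      have \<kappa>c: "continuous_on UNIV \<kappa>" unfolding \<kappa>_def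
        by (intro continuous_intros continuous_on_compose2[OF V(2)]) auto
      have i: "integrable lborel (\<lambda>y. \<psi> y * (V (p - y) \<bullet> h))" for p
        by (rule conv_integrable[OF \<psi> l Vc, of \<delta>]) (use V(3) in auto)
      have "U' p h - U' p0 h = (\<integral>y. \<psi> y * (V (p - y) \<bullet> h) - \<psi> y * (V (p0 - y) \<bullet> h) \<partial>lborel)"
        unfolding U'_def conv_def using i by simp
      also have "\<dots> = (\<integral>y. \<psi> y * \<kappa> (p0 - y) \<partial>lborel)" by (simp add: \<kappa>_def algebra_simps)
      also have "norm \<dots> \<le> B * (e' * norm h) * measure lborel (cball p0 (\<delta> + 1))"
      proof (rule conv_bound[OF \<psi> B(2)])
        show "\<kappa> \<in> borel_measurable borel" using \<kappa>c by auto
        show "norm (\<kappa> w) \<le> e' * norm h" for w unfolding \<kappa>_def using p by (intro \<eta>(2)) (auto simp: dist_norm)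
        show "\<kappa> w = 0" if w: "w \<notin> cball 0 (\<delta> + 1)" for w
        proof -
          have "norm w \<le> norm (w + (p - p0)) + norm (p - p0)" using norm_triangle_ineq4[of "w + (p - p0)" "p - p0"] by simp
          moreover have "norm w > \<delta> + 1" using w by simp
          moreover have "norm (p - p0) < 1" using p by (simp add: dist_norm)
          ultimately have "norm (w + (p - p0)) > \<delta>" "norm w > \<delta>" by linarith+
          then have "V (w + (p - p0)) = 0" "V w = 0" by (auto intro!: V(3))
          then show ?thesis unfolding \<kappa>_def by simp
        qed
      qed (use B e' in auto)
      also have "\<dots> = (B * M * e') * norm h" by (simp add: M_def)
      also have "\<dots> \<le> e * norm h" using e' by (intro mult_right_mono) auto
      finally show ?thesis by simp
    qed
    then show ?thesis using \<eta>(1) by (intro exI[of _ "min \<eta> 1"]) auto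
  qed
  have cintp: "cint (\<lambda>\<zeta>. \<psi> (p + csc \<zeta> w))" for p w
  proof -
    obtain B where B: "B > 0" "\<And>y. y \<in> cball p (norm w) \<Longrightarrow> norm (\<psi> y) \<le> B" using loc_bounded_cball[OF l] by blast
    have [measurable]: "(\<lambda>\<zeta>. p + csc \<zeta> w) \<in> borel_measurable borel"
      by (intro continuous_imp_borel continuous_intros)
    show ?thesis
    proof (rule cint_bounded[where B=B])
      show "(\<lambda>\<zeta>. \<psi> (p + csc \<zeta> w)) \<in> borel_measurable borel" by measurable
      fix \<zeta> :: complex assume "\<zeta> \<in> sphere 0 1"
      then show "\<bar>\<psi> (p + csc \<zeta> w)\<bar> \<le> B" using B(2)[of "p + csc \<zeta> w"] by (simp add: dist_norm norm_csc)
    qed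
  qed
  have Usub: "U p \<le> cmean (\<lambda>\<omega>. U (p + csc \<omega> w))" if p: "fst p \<in> ball 0 R" and w: "norm w \<le> \<rho>1" for p w
    unfolding U_def
  proof (rule conv_submean[OF \<psi> l k(1,3,2)])
    show "continuous_on UNIV (\<lambda>\<omega>. csc \<omega> w)" by (intro continuous_intros)
    fix v :: "complex \<times> (complex^'n)" assume v: "v \<in> cball 0 \<delta>"
    have "norm (fst v) \<le> \<delta>" using norm_fst_le[of "fst v" "snd v"] v by simp
    then have "fst (p - v) \<in> ball 0 (R + \<delta>)" using p norm_triangle_ineq4[of "fst p" "fst v"] by (auto simp: fst_diff)
    then show "\<psi> (p - v) \<le> cmean (\<lambda>\<zeta>. \<psi> (p - v + csc \<zeta> w))" using w by (rule sub)
  qed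
  have Uind: "U (\<tau>, z) = U (\<tau>, cvec (\<chi> i. Re (z $ i)))" for \<tau> z
    unfolding Uw
  proof (rule Bochner_Integration.integral_cong)
    fix w :: "complex \<times> (complex^'n)"
    have e: "\<psi> q = \<psi> (fst q, cvec (\<chi> i. Re (snd q $ i)))" for q using ind[of "fst q" "snd q"] by simp
    have "\<psi> ((\<tau>, z) - w) = \<psi> ((\<tau>, cvec (\<chi> i. Re (z $ i))) - w)"
      unfolding e[of "(\<tau>, z) - w"] e[of "(\<tau>, cvec (\<chi> i. Re (z $ i))) - w"] by (simp add: cvec_def)
    then show "\<psi> ((\<tau>, z) - w) * k w = \<psi> ((\<tau>, cvec (\<chi> i. Re (z $ i))) - w) * k w" by simp
  qed simp
  have a: "adp R (\<lambda>\<tau> x. U (\<tau>, cvec x))"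
  proof (rule adp_of_polydisc_submean[OF Uc _ Uind])
    fix P :: "'n \<Rightarrow> complex \<Rightarrow> complex" and \<tau> :: complex and \<rho> :: real
    assume P: "\<And>i. P i holomorphic_on UNIV" "0 < \<rho>" "cball \<tau> \<rho> \<subseteq> ball 0 R"
    have r: "\<rho>1 > 0" using \<delta> by simp
    show "U (\<tau>, \<chi> i. P i 0) \<le> cmean (\<lambda>\<zeta>. U (\<tau> + of_real \<rho> * \<zeta>, \<chi> i. P i \<zeta>))"
      by (rule polydisc_submean[OF dU C1 Usub r P])
  qed
  have ge: "\<psi> p \<le> U p" if p: "fst p \<in> ball 0 R" for p
  proof -
    \<comment> \<open>Adding \<open>B\<close> makes \<psi> nonnegative wherever the kernel lives, so
      the order of integration may be exchanged in \<open>ennreal\<close>.\<close>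
    obtain B where B: "B > 0" "\<And>y. y \<in> cball p \<delta> \<Longrightarrow> norm (\<psi> y) \<le> B" using loc_bounded_cball[OF l] by blast
    have Bn: "\<psi> (p - w) + B \<ge> 0" if "norm w \<le> \<delta>" for w using B(2)[of "p - w"] that by (simp add: dist_norm)
    have pB: "\<psi> p + B \<ge> 0" using Bn[of 0] \<delta> by simp
    define F where "F \<theta> w = ennreal ((\<psi> (p - csc (cis \<theta>) w) + B) * k w)" for \<theta> w
    have [measurable]: "(\<lambda>q. csc (cis (fst q)) (snd q)) \<in> borel_measurable (lborel \<Otimes>\<^sub>M (lborel :: (complex \<times> (complex^'n)) measure))"
    proof -
      have "(\<lambda>q. csc (cis (fst q)) (snd q :: (complex \<times> (complex^'n)))) \<in> borel_measurable borel"
        by (intro continuous_imp_borel continuous_intros)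
      then show ?thesis by (simp add: lborel_prod)
    qed
    have [measurable]: "(\<lambda>(\<theta>, w). F \<theta> w) \<in> borel_measurable (lborel \<Otimes>\<^sub>M lborel)"
      unfolding F_def case_prod_beta' by measurable
    define J where "J = (\<integral>\<^sup>+w. ennreal ((\<psi> (p - w) + B) * k w) \<partial>lborel)"
    have i1: "integrable lborel (\<lambda>w. (\<psi> (p - w) + B) * k w)"
      unfolding distrib_right by (intro Bochner_Integration.integrable_add Ui integrable_mult_right ki)
    have JU: "J = ennreal (U p + B)"
    proof -
      have "J = ennreal (\<integral>w. (\<psi> (p - w) + B) * k w \<partial>lborel)" unfolding J_def
      proof (rule nn_integral_eq_integral[OF i1], rule AE_I2)
        fix w show "0 \<le> (\<psi> (p - w) + B) * k w"
          using Bn[of w] k(2,3)[of w] by (cases "norm w \<le> \<delta>") auto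
      qed
      also have "(\<integral>w. (\<psi> (p - w) + B) * k w \<partial>lborel) = U p + B"
        unfolding distrib_right Uw using Ui ki k(4) by simp
      finally show ?thesis .
    qed
    \<comment> \<open>Multiplication by cis \<theta> is an isometry and leaves the radial kernel
      unchanged, so the integral over w is the same for every \<theta>.\<close>
    have FJ: "(\<integral>\<^sup>+w. F \<theta> w \<partial>lborel) = J" for \<theta>
    proof -
      have "F \<theta> w = ennreal ((\<psi> (p - csc (cis \<theta>) w) + B) * k (csc (cis \<theta>) w))" for w
        unfolding F_def using k(5)[of "csc (cis \<theta>) w" w] by (simp add: norm_csc)
      then have "(\<integral>\<^sup>+w. F \<theta> w \<partial>lborel) = (\<integral>\<^sup>+w. (\<lambda>w. ennreal ((\<psi> (p - w) + B) * k w)) (csc (cis \<theta>) w) \<partial>lborel)"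
        by simp
      also have "\<dots> = J" unfolding J_def
        by (rule nn_integral_lborel_isometry[OF csc_linear csc_linear csc_inv[of \<theta>]]) (simp add: norm_csc, measurable)
      finally show ?thesis .
    qed
    have "ennreal (2 * pi) * ennreal (\<psi> p + B) = (\<integral>\<^sup>+w. ennreal (2 * pi * (\<psi> p + B)) * ennreal (k w) \<partial>lborel)"
    proof -
      have "(\<integral>\<^sup>+w. ennreal (k w) \<partial>lborel) = 1" using nn_integral_eq_integral[OF ki] k(2,4) by simp
      moreover have "(\<integral>\<^sup>+w. ennreal (2 * pi * (\<psi> p + B)) * ennreal (k w) \<partial>lborel) = ennreal (2 * pi * (\<psi> p + B)) * (\<integral>\<^sup>+w. ennreal (k w) \<partial>lborel)"
        by (rule nn_integral_cmult) measurable
      moreover have "ennreal (2 * pi * (\<psi> p + B)) = ennreal (2 * pi) * ennreal (\<psi> p + B)" by (rule ennreal_mult) (use pB in auto)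
      ultimately show ?thesis by (simp only: mult_1_right)
    qed
    also have "\<dots> \<le> (\<integral>\<^sup>+w. (\<integral>\<^sup>+\<theta>. F \<theta> w * indicator {0..2*pi} \<theta> \<partial>lborel) \<partial>lborel)"
    proof (rule nn_integral_mono)
      fix w :: "complex \<times> (complex^'n)"
      show "ennreal (2 * pi * (\<psi> p + B)) * ennreal (k w) \<le> (\<integral>\<^sup>+\<theta>. F \<theta> w * indicator {0..2*pi} \<theta> \<partial>lborel)"
      proof (cases "norm w \<le> \<delta>")
        case False
        then show ?thesis using k(3)[of w] by simp
      next
        case True
        have c1: "cint (\<lambda>\<zeta>. \<psi> (p + csc \<zeta> (- w)) + B)" by (intro cint_add cintp cint_const)
        have m: "p + csc \<zeta> (- w) = p - csc \<zeta> w" for \<zeta> using linear_neg[OF csc_linear, of \<zeta> w] by simp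
        have R: "fst p \<in> ball 0 (R + \<delta>)" using p \<delta> by auto
        have "\<psi> p \<le> cmean (\<lambda>\<zeta>. \<psi> (p + csc \<zeta> (- w)))" by (rule sub[OF R]) (use True \<delta> in simp)
        then have "2 * pi * (\<psi> p + B) \<le> 2 * pi * cmean (\<lambda>\<zeta>. \<psi> (p + csc \<zeta> (- w)) + B)"
          unfolding cmean_add[OF cintp cint_const] by simp
        also have "\<dots> = (\<integral>\<theta>. indicator {0..2*pi} \<theta> * (\<psi> (p - csc (cis \<theta>) w) + B) \<partial>lborel)"
          unfolding cmean_def set_lebesgue_integral_def m by simp
        finally have 1: "2 * pi * (\<psi> p + B) \<le> (\<integral>\<theta>. indicator {0..2*pi} \<theta> * (\<psi> (p - csc (cis \<theta>) w) + B) \<partial>lborel)" .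
        have i2: "integrable lborel (\<lambda>\<theta>. indicator {0..2*pi} \<theta> * (\<psi> (p - csc (cis \<theta>) w) + B))"
          using c1 unfolding cint_def set_integrable_def m by simp
        have nB: "\<psi> (p - csc (cis \<theta>) w) + B \<ge> 0" for \<theta> using Bn[of "csc (cis \<theta>) w"] True by (simp add: norm_csc)
        have "ennreal (2 * pi * (\<psi> p + B)) * ennreal (k w) \<le> (\<integral>\<^sup>+\<theta>. ennreal (indicator {0..2*pi} \<theta> * (\<psi> (p - csc (cis \<theta>) w) + B)) \<partial>lborel) * ennreal (k w)"
        proof (rule mult_right_mono)
          have "(\<integral>\<^sup>+\<theta>. ennreal (indicator {0..2*pi} \<theta> * (\<psi> (p - csc (cis \<theta>) w) + B)) \<partial>lborel)
             = ennreal (\<integral>\<theta>. indicator {0..2*pi} \<theta> * (\<psi> (p - csc (cis \<theta>) w) + B) \<partial>lborel)"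
            by (rule nn_integral_eq_integral[OF i2]) (use nB in simp)
          then show "ennreal (2 * pi * (\<psi> p + B)) \<le> (\<integral>\<^sup>+\<theta>. ennreal (indicator {0..2*pi} \<theta> * (\<psi> (p - csc (cis \<theta>) w) + B)) \<partial>lborel)"
            using ennreal_leI[OF 1] by simp
        qed simp
        also have "\<dots> = (\<integral>\<^sup>+\<theta>. ennreal (indicator {0..2*pi} \<theta> * (\<psi> (p - csc (cis \<theta>) w) + B)) * ennreal (k w) \<partial>lborel)"
          using i2 by (intro nn_integral_multc[symmetric]) (auto dest: borel_measurable_integrable)
        also have "\<dots> = (\<integral>\<^sup>+\<theta>. F \<theta> w * indicator {0..2*pi} \<theta> \<partial>lborel)"
          by (intro nn_integral_cong) (auto simp: F_def indicator_def ennreal_mult nB k(2))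
        finally show ?thesis .
      qed
    qed
    also have "\<dots> = (\<integral>\<^sup>+\<theta>. (\<integral>\<^sup>+w. F \<theta> w * indicator {0..2*pi} \<theta> \<partial>lborel) \<partial>lborel)"
      by (rule lborel_pair.Fubini') measurable
    also have "\<dots> = (\<integral>\<^sup>+\<theta>. J * indicator {0..2*pi} \<theta> \<partial>lborel)"
    proof (rule nn_integral_cong)
      fix \<theta>
      have [measurable]: "(\<lambda>w. csc (cis \<theta>) w) \<in> borel_measurable (borel :: (complex \<times> (complex^'n)) measure)"
        by (intro continuous_imp_borel continuous_intros)
      have [measurable]: "F \<theta> \<in> borel_measurable borel" unfolding F_def[abs_def] by measurable
      show "(\<integral>\<^sup>+w. F \<theta> w * indicator {0..2*pi} \<theta> \<partial>lborel) = J * indicator {0..2*pi} \<theta>"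
        by (subst nn_integral_multc) (auto simp: FJ)
    qed
    also have "\<dots> = ennreal (2 * pi) * J" by (simp add: nn_integral_cmult mult.commute)
    finally have "ennreal (\<psi> p + B) \<le> J"
      using pi_gt_zero by (subst (asm) ennreal_mult_le_mult_iff) (auto simp: ennreal_eq_0_iff not_le)
    then have "ennreal (\<psi> p + B) \<le> ennreal (U p + B)" unfolding JU .
    moreover have "U p + B \<ge> 0"
    proof -
      have "0 \<le> (\<integral>w. (\<psi> (p - w) + B) * k w \<partial>lborel)"
      proof (rule Bochner_Integration.integral_nonneg)
        fix w show "0 \<le> (\<psi> (p - w) + B) * k w"
          using Bn[of w] k(2,3)[of w] by (cases "norm w \<le> \<delta>") auto
      qed
      also have "\<dots> = U p + B" unfolding distrib_right Uw using Ui ki k(4) by simp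
      finally show ?thesis .
    qed
    ultimately show ?thesis by simp
  qed
  have le: "U p \<le> C" if C: "\<And>q. q \<in> cball p \<delta> \<Longrightarrow> \<psi> q \<le> C" for p C
  proof -
    have "U p \<le> (\<integral>w. C * k w \<partial>lborel)" unfolding Uw
    proof (rule Bochner_Integration.integral_mono[OF Ui])
      show "integrable lborel (\<lambda>w. C * k w)" using ki by simp
      fix w show "\<psi> (p - w) * k w \<le> C * k w"
      proof (cases "norm w \<le> \<delta>")
        case True
        then show ?thesis using C[of "p - w"] k(2) by (intro mult_right_mono) (auto simp: dist_norm)
      next
        case False
        then show ?thesis using k(3)[of w] by simp
      qed
    qed
    then show ?thesis using k(4) by simp
  qed
  show thesis by (rule that[OF a ge le])
qed

section \<open>Approximation of tube-invariant plurisubharmonic weights\<close>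

definition repart :: "complex^'n \<Rightarrow> real^'n" where "repart z = (\<chi> i. Re (z $ i))"

lemma repart_cvec [simp]: "repart (cvec x) = x" by (simp add: repart_def cvec_def vec_eq_iff)

lemma repart_add: "repart (y + z) = repart y + repart z" by (simp add: repart_def vec_eq_iff)

lemma norm_repart_le: "norm (repart z) \<le> norm z"
  unfolding norm_vec_def by (rule L2_set_mono) (auto simp: repart_def abs_Re_le_cmod)

lemma dist_repart_le: "dist (repart y) (repart z) \<le> dist y z"
  using norm_repart_le[of "y - z"] by (simp add: dist_norm repart_def vec_eq_iff minus_vec_def)

lemma repart_continuous [continuous_intros]: "continuous_on A f \<Longrightarrow> continuous_on A (\<lambda>x. repart (f x))"
  unfolding repart_def by (intro continuous_intros)

lemma tube_repart: "z \<in> tube V \<longleftrightarrow> repart z \<in> V" by (simp add: tube_def repart_def)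

text \<open>The distance to a convex set is a maximum of affine functions: the nearest point y of K
  and the unit vector from y towards x give the one that touches at x.\<close>

lemma infdist_support:
  fixes K :: "'a::euclidean_space set"
  assumes K: "convex K" "closed K" "K \<noteq> {}"
  obtains v y where "infdist x K = v \<bullet> (x - y)" "\<And>x'. v \<bullet> (x' - y) \<le> infdist x' K"
proof -
  define y where "y = closest_point K x"
  have y: "y \<in> K" unfolding y_def by (rule closest_point_in_set[OF K(2,3)])
  have iy: "infdist x K = norm (x - y)"
  proof (rule antisym)
    show "infdist x K \<le> norm (x - y)" using infdist_le[OF y, of x] by (simp add: dist_norm)
    show "norm (x - y) \<le> infdist x K"
      unfolding infdist_notempty[OF K(3)]
    proof (rule cINF_greatest[OF K(3)])
      fix k assume "k \<in> K"
      then show "norm (x - y) \<le> dist x k" using closest_point_exists(2)[OF K(2,3), of x] by (simp add: y_def dist_norm)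
    qed
  qed
  \<comment> \<open>If x lies in K, the quotient is 0 by convention, and the zero function is then
    the supporting one.\<close>
  define v where "v = (x - y) /\<^sub>R norm (x - y)"
  have nv: "norm v \<le> 1" by (cases "x = y") (auto simp: v_def)
  show thesis
  proof (rule that[of v y])
    show "infdist x K = v \<bullet> (x - y)"
      unfolding iy v_def by (cases "x = y") (auto simp: power2_norm_eq_inner[symmetric] power2_eq_square)
    fix x'
    show "v \<bullet> (x' - y) \<le> infdist x' K"
      unfolding infdist_notempty[OF K(3)]
    proof (rule cINF_greatest[OF K(3)])
      fix k assume k: "k \<in> K"
      have "(x - y) \<bullet> (k - y) \<le> 0" unfolding y_def by (rule closest_point_dot[OF K(1,2) k])
      then have "v \<bullet> (k - y) \<le> 0" unfolding v_def by (simp add: mult_nonneg_nonpos)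
      moreover have "v \<bullet> (x' - y) = v \<bullet> (x' - k) + v \<bullet> (k - y)" by (simp add: inner_diff_right)
      moreover have "v \<bullet> (x' - k) \<le> norm v * norm (x' - k)" by (rule norm_cauchy_schwarz)
      moreover have "norm v * norm (x' - k) \<le> 1 * norm (x' - k)" by (rule mult_right_mono[OF nv]) simp
      ultimately show "v \<bullet> (x' - y) \<le> dist x' k" by (simp add: dist_norm)
    qed
  qed
qed

section \<open>Upper semicontinuous functions\<close>

lemma usc_on_iff_open:
  fixes u :: "'a::topological_space \<Rightarrow> ereal"
  assumes o: "open \<Omega>"
  shows "usc_on \<Omega> u \<longleftrightarrow> (\<forall>c. open {p \<in> \<Omega>. u p < c})"
proof (intro iffI allI)
  fix c assume u: "usc_on \<Omega> u"
  show "open {p \<in> \<Omega>. u p < c}"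
  proof (rule Topological_Spaces.openI)
    fix x assume x: "x \<in> {p \<in> \<Omega>. u p < c}"
    then have "\<forall>\<^sub>F y in at x within \<Omega>. u y < c" using u by (auto simp: usc_on_def)
    then obtain S where S: "open S" "x \<in> S" "\<And>y. y \<in> S \<Longrightarrow> y \<noteq> x \<Longrightarrow> y \<in> \<Omega> \<Longrightarrow> u y < c"
      unfolding eventually_at_topological by blast
    show "\<exists>T. open T \<and> x \<in> T \<and> T \<subseteq> {p \<in> \<Omega>. u p < c}"
      by (rule exI[of _ "S \<inter> \<Omega>"]) (use S x o in auto)
  qed
next
  assume op: "\<forall>c. open {p \<in> \<Omega>. u p < c}"
  show "usc_on \<Omega> u"
    unfolding usc_on_def eventually_at_topological
  proof (intro ballI allI impI)
    fix x c assume "x \<in> \<Omega>" "u x < c"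
    then show "\<exists>S. open S \<and> x \<in> S \<and> (\<forall>y\<in>S. y \<noteq> x \<longrightarrow> y \<in> \<Omega> \<longrightarrow> u y < c)"
      using op by (intro exI[of _ "{p \<in> \<Omega>. u p < c}"]) auto
  qed
qed

lemma usc_borel:
  fixes u :: "'a::topological_space \<Rightarrow> ereal"
  assumes o: "open \<Omega>" and u: "usc_on \<Omega> u"
  shows "(\<lambda>p. if p \<in> \<Omega> then u p else -\<infinity>) \<in> borel_measurable borel"
proof (rule borel_measurableI_less)
  fix c
  have op: "open {p \<in> \<Omega>. u p < c}" using u usc_on_iff_open[OF o] by blast
  show "{x \<in> space borel. (if x \<in> \<Omega> then u x else -\<infinity>) < c} \<in> sets borel"
  proof (cases "c = -\<infinity>")
    case True
    then show ?thesis by simp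
  next
    case False
    then have "{x \<in> space borel. (if x \<in> \<Omega> then u x else -\<infinity>) < c} = {p \<in> \<Omega>. u p < c} \<union> - \<Omega>"
      by (auto split: if_splits)
    then show ?thesis using op o by auto
  qed
qed

lemma usc_bounded_above:
  fixes u :: "'a::topological_space \<Rightarrow> ereal"
  assumes u: "usc_on \<Omega> u" "\<And>p. p \<in> \<Omega> \<Longrightarrow> u p \<noteq> \<infinity>" and o: "open \<Omega>" and C: "compact C" "C \<subseteq> \<Omega>"
  obtains c :: real where "\<And>p. p \<in> C \<Longrightarrow> u p < ereal c"
proof -
  let ?S = "\<lambda>n::nat. {p \<in> \<Omega>. u p < ereal (real n)}"
  have op: "open (?S n)" for n using u(1) usc_on_iff_open[OF o] by blast
  have cov: "C \<subseteq> (\<Union>n\<in>UNIV. ?S n)"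
  proof
    fix p assume "p \<in> C"
    then have p: "p \<in> \<Omega>" using C by blast
    then obtain n :: nat where "u p < ereal (real n)" using u(2)[OF p] less_PInf_Ex_of_nat[of "u p"] by blast
    then show "p \<in> (\<Union>n\<in>UNIV. ?S n)" using p by blast
  qed
  obtain D where D0: "D \<subseteq> UNIV" and D: "finite D" "C \<subseteq> (\<Union>n\<in>D. ?S n)"
    by (rule compactE_image[OF C(1) op cov])
  show thesis
  proof (rule that)
    fix p assume "p \<in> C"
    then obtain n where n: "n \<in> D" "u p < ereal (real n)" using D(2) by blast
    have "real n \<le> real (Max (insert 0 D))" using n D(1) by simp
    then have "ereal (real n) \<le> ereal (real (Max (insert 0 D)))" by simp
    with n(2) show "u p < ereal (real (Max (insert 0 D)))" by (rule less_le_trans)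
  qed
qed

text \<open>A finite value at the centre excludes the default -\<infinity> of
  \<open>circle_mean\<close>. So \<open>u\<close> is almost everywhere finite and integrable on the
  circle, and the two integrals can be compared.\<close>

lemma circle_mean_le_cmean:
  assumes le: "u p \<le> circle_mean u p w" and u: "u p \<noteq> -\<infinity>" "u p \<noteq> \<infinity>" and g: "cint (\<lambda>\<zeta>. g (p + csc \<zeta> w))"
    and ug: "\<And>\<zeta>. \<zeta> \<in> sphere 0 1 \<Longrightarrow> u (p + csc \<zeta> w) \<le> ereal (g (p + csc \<zeta> w))"
  shows "real_of_ereal (u p) \<le> cmean (\<lambda>\<zeta>. g (p + csc \<zeta> w))"
proof -
  have c: "(AE \<theta> in lborel. \<theta> \<in> {0..2*pi} \<longrightarrow> u (p + csc (cis \<theta>) w) \<noteq> -\<infinity>)"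
    "set_integrable lborel {0..2*pi} (\<lambda>\<theta>. real_of_ereal (u (p + csc (cis \<theta>) w)))"
    and e: "circle_mean u p w = ereal (1/(2*pi) * (LINT \<theta>:{0..2*pi}|lborel. real_of_ereal (u (p + csc (cis \<theta>) w))))"
    using le u(1) unfolding circle_mean_def cline_csc by (auto split: if_splits)
  have "real_of_ereal (u p) \<le> 1/(2*pi) * (LINT \<theta>:{0..2*pi}|lborel. real_of_ereal (u (p + csc (cis \<theta>) w)))"
    using le u unfolding e by (cases "u p") auto
  also have "\<dots> \<le> cmean (\<lambda>\<zeta>. g (p + csc \<zeta> w))"
    unfolding cmean_def
  proof (rule mult_left_mono)
    show "(LINT \<theta>:{0..2*pi}|lborel. real_of_ereal (u (p + csc (cis \<theta>) w))) \<le> (LINT \<theta>:{0..2*pi}|lborel. g (p + csc (cis \<theta>) w))"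
    proof (rule set_integral_mono_AE[OF c(2)])
      show "set_integrable lborel {0..2*pi} (\<lambda>\<theta>. g (p + csc (cis \<theta>) w))" using g by (simp add: cint_def)
      show "AE \<theta>\<in>{0..2*pi} in lborel. real_of_ereal (u (p + csc (cis \<theta>) w)) \<le> g (p + csc (cis \<theta>) w)"
        using c(1)
      proof eventually_elim
        case (elim \<theta>)
        have "u (p + csc (cis \<theta>) w) \<le> ereal (g (p + csc (cis \<theta>) w))" by (rule ug) simp
        then show ?case using elim by (cases "u (p + csc (cis \<theta>) w)") auto
      qed
    qed
  qed simp
  finally show ?thesis .
qed

section \<open>Gluing with the cone\<close>

definition cone :: "real \<Rightarrow> real \<Rightarrow> (real^'n) set \<Rightarrow> complex^'n \<Rightarrow> real" where
  "cone N M K z = N * infdist (repart z) K - M"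

text \<open>The maximum is formed only within distance \<delta>0 of K, where \<open>u\<close> is
  available; for a steep cone \<open>u\<close> has lost well before that distance. On K the cone
  equals -M, a floor that keeps the result finite where \<open>u\<close> is -\<infinity>. The value
  0 off the disc is a filler.\<close>

definition glue :: "real \<Rightarrow> real \<Rightarrow> real \<Rightarrow> real \<Rightarrow> (real^'n) set \<Rightarrow> (complex \<times> (complex^'n) \<Rightarrow> ereal) \<Rightarrow> complex \<times> (complex^'n) \<Rightarrow> real" where
  "glue R1 \<delta>0 N M K u p = (if fst p \<in> cball 0 R1 then
     (if infdist (repart (snd p)) K \<le> \<delta>0 then real_of_ereal (max (u p) (ereal (cone N M K (snd p)))) else cone N M K (snd p)) else 0)"

lemma cone_continuous [continuous_intros]: "continuous_on A f \<Longrightarrow> continuous_on A (\<lambda>x. cone N M K (f x))"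
  unfolding cone_def by (intro continuous_intros)

text \<open>Along a complex line, the affine function supporting the distance is the real part of a
  polynomial. It agrees with the cone at the centre, lies below it on the circle, and has the mean
  value property.\<close>

lemma cone_submean:
  assumes K: "convex K" "closed K" "K \<noteq> {}" and N: "N \<ge> 0"
  shows "cone N M K (snd p) \<le> cmean (\<lambda>\<zeta>. cone N M K (snd (p + csc \<zeta> w)))"
proof -
  obtain v y where v: "infdist (repart (snd p)) K = v \<bullet> (repart (snd p) - y)" "\<And>x'. v \<bullet> (x' - y) \<le> infdist x' K"
    using infdist_support[OF K] by blast
  define P where "P \<zeta> = of_real N * (\<Sum>i\<in>UNIV. of_real (v $ i) * (snd p $ i + \<zeta> * snd w $ i - of_real (y $ i))) - of_real M" for \<zeta>
  have P: "P holomorphic_on UNIV" unfolding P_def by (intro holomorphic_intros)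
  have RP: "Re (P \<zeta>) = N * (v \<bullet> (repart (snd (p + csc \<zeta> w)) - y)) - M" for \<zeta>
    by (simp add: P_def inner_vec_def repart_def csc_def)
  have "cone N M K (snd p) = Re (P 0)" unfolding RP cone_def v(1) by (simp add: csc_def zero_vec_def[symmetric])
  also have "\<dots> = cmean (\<lambda>\<zeta>. Re (P \<zeta>))" by (rule cmean_holomorphic[OF P, symmetric])
  also have "\<dots> \<le> cmean (\<lambda>\<zeta>. cone N M K (snd (p + csc \<zeta> w)))"
  proof (rule cmean_mono)
    show "cint (\<lambda>\<zeta>. Re (P \<zeta>))" unfolding P_def by (intro cint_continuous continuous_intros)
    show "cint (\<lambda>\<zeta>. cone N M K (snd (p + csc \<zeta> w)))" by (intro cint_continuous continuous_intros)
    show "Re (P \<zeta>) \<le> cone N M K (snd (p + csc \<zeta> w))" for \<zeta>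
      unfolding RP cone_def using mult_left_mono[OF v(2) N] by simp
  qed
  finally show ?thesis .
qed

text \<open>\<open>c\<close> bounds \<open>u\<close> over the disc of radius R1 within distance
  \<delta>0 of K, and \<open>Nc\<close> lets the cone reach \<open>c\<close> already at distance
  \<delta>0 / 2, half way to where \<open>u\<close> is no longer consulted.\<close>

context
  fixes u :: "complex \<times> (complex^'n) \<Rightarrow> ereal" and V K :: "(real^'n) set" and R1 R2 \<delta>0 N M c :: real
  assumes u: "psh_on (ball 0 R2 \<times> tube V) u"
    and indep: "\<And>\<tau> z z'. \<tau> \<in> ball 0 R2 \<Longrightarrow> z \<in> tube V \<Longrightarrow> z' \<in> tube V \<Longrightarrow> repart z = repart z' \<Longrightarrow> u (\<tau>, z) = u (\<tau>, z')"
    and R1: "R1 < R2" and K: "convex K" "compact K" "K \<noteq> {}" and \<delta>0: "\<delta>0 > 0" "{x. infdist x K \<le> \<delta>0} \<subseteq> V"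
    and NM: "N \<ge> 0" "M \<ge> 0" and c: "\<And>\<tau> x. \<tau> \<in> cball 0 R1 \<Longrightarrow> infdist x K \<le> \<delta>0 \<Longrightarrow> u (\<tau>, cvec x) < ereal c"
    and Nc: "c \<le> N * (\<delta>0 / 2) - M"
begin

lemma glue_dom: "fst p \<in> cball 0 R1 \<Longrightarrow> infdist (repart (snd p)) K \<le> \<delta>0 \<Longrightarrow> p \<in> ball 0 R2 \<times> tube V"
  using R1 \<delta>0(2) by (cases p) (auto simp: tube_repart)

lemma glue_indep: "fst p \<in> cball 0 R1 \<Longrightarrow> infdist (repart (snd p)) K \<le> \<delta>0 \<Longrightarrow> u p = u (fst p, cvec (repart (snd p)))"
  using glue_dom[of p] indep[of "fst p" "snd p" "cvec (repart (snd p))"] by (auto simp: tube_repart)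

lemma glue_u: "fst p \<in> cball 0 R1 \<Longrightarrow> infdist (repart (snd p)) K \<le> \<delta>0 \<Longrightarrow> u p < ereal c"
  using glue_indep[of p] c by auto

lemma glue_max: "fst p \<in> cball 0 R1 \<Longrightarrow> infdist (repart (snd p)) K \<le> \<delta>0 \<Longrightarrow> ereal (glue R1 \<delta>0 N M K u p) = max (u p) (ereal (cone N M K (snd p)))"
  using glue_u[of p] by (cases "u p") (auto simp: glue_def max_def)

lemma glue_ge: assumes p: "fst p \<in> cball 0 R1" shows "cone N M K (snd p) \<le> glue R1 \<delta>0 N M K u p"
proof (cases "infdist (repart (snd p)) K \<le> \<delta>0")
  case True
  have "ereal (cone N M K (snd p)) \<le> ereal (glue R1 \<delta>0 N M K u p)"
    unfolding glue_max[OF p True] by (rule max.cobounded2)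
  then show ?thesis by simp
qed (use p in \<open>simp add: glue_def\<close>)

lemma glue_bounds: "\<bar>glue R1 \<delta>0 N M K u p\<bar> \<le> \<bar>cone N M K (snd p)\<bar> + M + \<bar>c\<bar>"
proof (cases "fst p \<in> cball 0 R1 \<and> infdist (repart (snd p)) K \<le> \<delta>0")
  case True
  then have "ereal (glue R1 \<delta>0 N M K u p) \<le> ereal (max c (cone N M K (snd p)))"
  proof -
    have "u p \<le> ereal c" using glue_u True by (blast intro: less_imp_le)
    also have "\<dots> \<le> ereal (max c (cone N M K (snd p)))" by simp
    finally have "max (u p) (ereal (cone N M K (snd p))) \<le> ereal (max c (cone N M K (snd p)))" by simp
    then show ?thesis using glue_max True by metis
  qed
  moreover have "cone N M K (snd p) \<le> glue R1 \<delta>0 N M K u p" using glue_ge True by blast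
  ultimately show ?thesis using NM by (auto simp: max_def split: if_splits)
next
  case False
  then show ?thesis using NM by (auto simp: glue_def)
qed

lemma glue_loc_bounded: "loc_bounded (glue R1 \<delta>0 N M K u)"
proof -
  have "loc_bounded (\<lambda>p :: complex \<times> (complex^'n). \<bar>cone N M K (snd p)\<bar> + M + \<bar>c\<bar>)" by (intro loc_bounded_continuous continuous_intros)
  then have "\<exists>B. \<forall>y\<in>cball (0 :: complex \<times> (complex^'n)) R. norm (\<bar>cone N M K (snd y)\<bar> + M + \<bar>c\<bar>) \<le> B" for R
    unfolding loc_bounded_def by blast
  moreover have "norm (glue R1 \<delta>0 N M K u y) \<le> norm (\<bar>cone N M K (snd y)\<bar> + M + \<bar>c\<bar>)" for y
    unfolding real_norm_def using glue_bounds[of y] by linarith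
  ultimately show ?thesis unfolding loc_bounded_def by (blast intro: order_trans)
qed

lemma glue_borel: "glue R1 \<delta>0 N M K u \<in> borel_measurable borel"
proof -
  have [measurable]: "(\<lambda>p. if p \<in> ball 0 R2 \<times> tube V then u p else -\<infinity>) \<in> borel_measurable borel"
    using u by (intro usc_borel) (auto simp: psh_on_def)
  have cl: "closed {p :: complex \<times> (complex^'n). infdist (repart (snd p)) K \<le> \<delta>0}" "closed {p :: complex \<times> (complex^'n). fst p \<in> cball 0 R1}"
    unfolding mem_cball dist_0_norm by (intro closed_Collect_le continuous_intros)+
  have [measurable]: "{p :: complex \<times> (complex^'n). infdist (repart (snd p)) K \<le> \<delta>0} \<in> sets borel" "{p :: complex \<times> (complex^'n). fst p \<in> cball 0 R1} \<in> sets borel"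
    using cl by (auto intro: borel_closed)
  have [measurable]: "(\<lambda>p :: complex \<times> (complex^'n). cone N M K (snd p)) \<in> borel_measurable borel" by (intro continuous_imp_borel continuous_intros)
  have "glue R1 \<delta>0 N M K u = (\<lambda>p. if p \<in> {p. fst p \<in> cball 0 R1} then
     (if p \<in> {p. infdist (repart (snd p)) K \<le> \<delta>0} then real_of_ereal (max (if p \<in> ball 0 R2 \<times> tube V then u p else -\<infinity>) (ereal (cone N M K (snd p)))) else cone N M K (snd p)) else 0)"
  proof (rule ext)
    fix p
    show "glue R1 \<delta>0 N M K u p = (if p \<in> {p. fst p \<in> cball 0 R1} then
     (if p \<in> {p. infdist (repart (snd p)) K \<le> \<delta>0} then real_of_ereal (max (if p \<in> ball 0 R2 \<times> tube V then u p else -\<infinity>) (ereal (cone N M K (snd p)))) else cone N M K (snd p)) else 0)"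
      unfolding glue_def mem_Collect_eq using glue_dom[of p] by presburger
  qed
  also have "\<dots> \<in> borel_measurable borel" by measurable
  finally show ?thesis .
qed

lemma glue_repart: "glue R1 \<delta>0 N M K u (\<tau>, z) = glue R1 \<delta>0 N M K u (\<tau>, cvec (\<chi> i. Re (z $ i)))"
  unfolding repart_def[symmetric] using glue_indep[of "(\<tau>, z)"] by (simp add: glue_def cone_def)

text \<open>Where the glued function equals the cone, the inequality of the cone is enough, because
  the glued function lies above the cone on the circle. Otherwise \<open>u\<close> exceeds the cone,
  so the distance to K is below \<delta>0 / 2, and a displacement of at most \<delta>0 / 4 stays
  where \<open>u\<close> is available.\<close>

lemma glue_submean:
  assumes p: "cmod (fst p) + norm w \<le> R1" and w: "norm w \<le> \<delta>0 / 4"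
  shows "glue R1 \<delta>0 N M K u p \<le> cmean (\<lambda>\<zeta>. glue R1 \<delta>0 N M K u (p + csc \<zeta> w))"
proof -
  let ?g = "glue R1 \<delta>0 N M K u"
  have nw: "norm (csc \<zeta> w) \<le> norm w" if "cmod \<zeta> \<le> 1" for \<zeta> using that by (simp add: norm_csc mult_left_le_one_le)
  have f1: "fst (p + csc \<zeta> w) \<in> cball 0 R1" if "cmod \<zeta> \<le> 1" for \<zeta>
  proof -
    have "norm (fst (csc \<zeta> w)) \<le> norm w" using norm_fst_le[of "fst (csc \<zeta> w)" "snd (csc \<zeta> w)"] nw[OF that] by simp
    then show ?thesis using p norm_triangle_ineq[of "fst p" "fst (csc \<zeta> w)"] by simp
  qed
  have f2: "infdist (repart (snd (p + csc \<zeta> w))) K \<le> infdist (repart (snd p)) K + \<delta>0 / 4" if "cmod \<zeta> \<le> 1" for \<zeta>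
  proof -
    have "dist (repart (snd (p + csc \<zeta> w))) (repart (snd p)) \<le> norm (snd (csc \<zeta> w))"
      using norm_repart_le[of "snd (csc \<zeta> w)"] by (simp add: repart_add dist_norm)
    also have "\<dots> \<le> norm w" using norm_snd_le[of "snd (csc \<zeta> w)" "fst (csc \<zeta> w)"] nw[OF that] by simp
    finally show ?thesis using infdist_triangle[of "repart (snd (p + csc \<zeta> w))" K "repart (snd p)"] w by simp
  qed
  have p0: "fst p \<in> cball 0 R1" unfolding mem_cball dist_0_norm using p norm_ge_zero[of w] by linarith
  obtain B where B: "B > 0" "\<And>y. y \<in> cball p (norm w) \<Longrightarrow> norm (?g y) \<le> B" using loc_bounded_cball[OF glue_loc_bounded] by blast
  have ci: "cint (\<lambda>\<zeta>. ?g (p + csc \<zeta> w))"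
  proof (rule cint_bounded[where B=B])
    have [measurable]: "(\<lambda>\<zeta>. p + csc \<zeta> w) \<in> borel_measurable borel" by (intro continuous_imp_borel continuous_intros)
    show "(\<lambda>\<zeta>. ?g (p + csc \<zeta> w)) \<in> borel_measurable borel" by (rule measurable_compose[OF _ glue_borel]) measurable
    fix \<zeta> :: complex assume "\<zeta> \<in> sphere 0 1"
    then show "\<bar>?g (p + csc \<zeta> w)\<bar> \<le> B" using B(2)[of "p + csc \<zeta> w"] nw[of \<zeta>] by (simp add: dist_norm)
  qed
  have main: ?thesis if "?g p = cone N M K (snd p)"
  proof -
    have "cone N M K (snd p) \<le> cmean (\<lambda>\<zeta>. cone N M K (snd (p + csc \<zeta> w)))"
      by (rule cone_submean) (use K NM compact_imp_closed in auto)
    also have "\<dots> \<le> cmean (\<lambda>\<zeta>. ?g (p + csc \<zeta> w))"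
    proof (rule cmean_mono[OF _ ci])
      show "cint (\<lambda>\<zeta>. cone N M K (snd (p + csc \<zeta> w)))" by (intro cint_continuous continuous_intros)
      show "cone N M K (snd (p + csc \<zeta> w)) \<le> ?g (p + csc \<zeta> w)" if "\<zeta> \<in> sphere 0 1" for \<zeta>
        by (rule glue_ge[OF f1]) (use that in simp)
    qed
    finally show ?thesis using that by simp
  qed
  show ?thesis
  proof (cases "?g p = cone N M K (snd p)")
    case False
    then have i: "infdist (repart (snd p)) K \<le> \<delta>0" using p0 by (auto simp: glue_def split: if_splits)
    have gp: "ereal (?g p) = u p" "u p > ereal (cone N M K (snd p))" using glue_max[OF p0 i] False by (auto simp: max_def split: if_splits)
    have "ereal (cone N M K (snd p)) < ereal c" using gp(2) glue_u[OF p0 i] by (rule less_trans)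
    then have "N * infdist (repart (snd p)) K < N * (\<delta>0 / 2)" using Nc by (simp add: cone_def)
    then have i2: "infdist (repart (snd p)) K \<le> \<delta>0 / 2" using NM(1) by (meson linorder_not_less mult_left_mono nle_le)
    have i3: "infdist (repart (snd (p + csc \<zeta> w))) K \<le> \<delta>0" if "cmod \<zeta> \<le> 1" for \<zeta> using f2[OF that] i2 \<delta>0 by simp
    have "u p \<le> circle_mean u p w"
      using u glue_dom[OF f1 i3] unfolding psh_on_def cline_csc by blast
    moreover have "u p \<noteq> -\<infinity>" "u p \<noteq> \<infinity>" using gp(1) by auto
    moreover have "u (p + csc \<zeta> w) \<le> ereal (?g (p + csc \<zeta> w))" if "\<zeta> \<in> sphere 0 1" for \<zeta>
      using glue_max[OF f1 i3, of \<zeta>] that by simp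
    ultimately have "real_of_ereal (u p) \<le> cmean (\<lambda>\<zeta>. ?g (p + csc \<zeta> w))" using ci by (intro circle_mean_le_cmean)
    then show ?thesis using gp(1) by (metis real_of_ereal.simps(1))
  qed (rule main)
qed

end

lemma open_tube: "open V \<Longrightarrow> open (tube V)"
proof -
  assume "open V"
  then have "open (repart -` V)" by (intro open_vimage continuous_intros)
  then show ?thesis by (simp add: tube_repart vimage_def tube_def repart_def)
qed

text \<open>The three bounds have different uses: lying above \<open>u\<close> near K and above
  \<open>B\<close> elsewhere controls the integral of exp (- \<psi>) at the centre, while the upper
  bound deep inside K, down to the floor -M, makes the weights approach \<open>u\<close> in the
  limit.\<close>

lemma glued_weight:
  fixes u :: "complex \<times> (complex^'n) \<Rightarrow> ereal" and V K :: "(real^'n) set"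
    and B M d \<delta>0 :: real
  assumes u: "psh_on (ball 0 R2 \<times> tube V) u" and R2: "R2 > 1"
    and indep: "\<And>\<tau> z z'. \<tau> \<in> ball 0 R2 \<Longrightarrow> z \<in> tube V \<Longrightarrow> z' \<in> tube V \<Longrightarrow> repart z = repart z' \<Longrightarrow> u (\<tau>, z) = u (\<tau>, z')"
    and K: "convex K" "compact K" "K \<noteq> {}" and \<delta>0: "\<delta>0 > 0" "{x. infdist x K \<le> \<delta>0} \<subseteq> V"
    and M: "M \<ge> 0" and d: "d > 0"
  obtains R \<psi> \<delta> where "R > 1" "0 < \<delta>" "\<delta> \<le> d" "adp R \<psi>"
    "\<And>\<tau> x. \<tau> \<in> ball 0 R \<Longrightarrow> infdist x K \<le> \<delta>0 \<Longrightarrow> u (\<tau>, cvec x) \<le> ereal (\<psi> \<tau> x)"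
    "\<And>\<tau> x. \<tau> \<in> ball 0 R \<Longrightarrow> infdist x K > \<delta>0 \<Longrightarrow> B \<le> \<psi> \<tau> x"
    "\<And>\<tau> x C. - M \<le> C \<Longrightarrow> cball x \<delta> \<subseteq> K \<Longrightarrow> cball \<tau> \<delta> \<subseteq> ball 0 1 \<Longrightarrow> (\<forall>q\<in>cball (\<tau>, cvec x) \<delta>. u q \<le> ereal C) \<Longrightarrow> \<psi> \<tau> x \<le> C"
proof -
  \<comment> \<open>The gap between 1 and R2 is divided into thirds: the result holds up to
    \<open>R\<close>, the gluing up to \<open>R1\<close>, and the middle third accommodates
    smoothing and circles.\<close>
  define R where "R = 1 + (R2 - 1) / 3"
  define R1 where "R1 = 1 + 2 * (R2 - 1) / 3"
  have R: "1 < R" "R < R1" "R1 < R2" using R2 by (auto simp: R_def R1_def field_simps)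
  have uu: "open (ball (0::complex) R2 \<times> tube V)" "usc_on (ball 0 R2 \<times> tube V) u" "\<And>p. p \<in> ball 0 R2 \<times> tube V \<Longrightarrow> u p \<noteq> \<infinity>"
    using u by (auto simp: psh_on_def)
  define C where "C = (\<lambda>q. (fst q, cvec (snd q))) ` (cball (0::complex) R1 \<times> {x. infdist x K \<le> \<delta>0})"
  have "compact C" unfolding C_def
    by (intro compact_continuous_image continuous_intros compact_Times compact_cball compact_infdist_le K \<delta>0)
  moreover have "C \<subseteq> ball 0 R2 \<times> tube V" unfolding C_def using R \<delta>0 by (auto simp: tube_repart)
  ultimately obtain c where c0: "\<And>p. p \<in> C \<Longrightarrow> u p < ereal c"
    using usc_bounded_above[OF uu(2,3,1)] by blast
  have c: "u (\<tau>, cvec x) < ereal c" if "\<tau> \<in> cball 0 R1" "infdist x K \<le> \<delta>0" for \<tau> x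
    by (rule c0) (use that in \<open>auto simp: C_def image_iff\<close>)
  \<comment> \<open>At distance \<open>h\<close> = \<delta>0 / 2 the cone is to have the value
    \<open>m\<close>, which dominates both the bound \<open>c\<close> of \<open>u\<close> and the
    prescribed level \<open>B\<close>; this fixes the slope \<open>N\<close>.\<close>
  define m where "m = max (max c B) 0"
  have m: "m \<ge> 0" "c \<le> m" "B \<le> m" by (auto simp: m_def)
  define h where "h = \<delta>0 / 2"
  have h: "h > 0" using \<delta>0(1) by (simp add: h_def)
  define N where "N = (m + M) / h"
  have N: "N \<ge> 0" using M m(1) h by (simp add: N_def)
  have Nh: "N * h = m + M" using h by (simp add: N_def)
  have Ne: "N * (\<delta>0 / 2) - M = m" unfolding h_def[symmetric] Nh by (rule add_diff_cancel_right')
  have Nc: "c \<le> N * (\<delta>0 / 2) - M" and NB: "B \<le> N * (\<delta>0 / 2) - M" unfolding Ne by (rule m(2), rule m(3))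
  note ctx = u indep R(3) K \<delta>0 N M c Nc
  let ?g = "glue R1 \<delta>0 N M K u"
  \<comment> \<open>Half of R1 - R, because the smoothing radius and the circle radius, each at most
    \<rho>1, add up.\<close>
  define \<rho>1 where "\<rho>1 = min (\<delta>0 / 4) ((R1 - R) / 2)"
  have \<rho>1: "\<rho>1 > 0" "\<rho>1 \<le> \<delta>0 / 4" "\<rho>1 \<le> (R1 - R) / 2"
  proof -
    have "\<delta>0 / 4 > 0" "(R1 - R) / 2 > 0" using \<delta>0(1) R(2) by simp_all
    then show "\<rho>1 > 0" unfolding \<rho>1_def by (simp only: min_less_iff_conj)
    show "\<rho>1 \<le> \<delta>0 / 4" unfolding \<rho>1_def by (rule min.cobounded1)
    show "\<rho>1 \<le> (R1 - R) / 2" unfolding \<rho>1_def by (rule min.cobounded2)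
  qed
  define \<delta> where "\<delta> = min d \<rho>1"
  have \<delta>: "\<delta> > 0" "\<delta> \<le> d" "\<delta> \<le> \<rho>1" using d \<rho>1 by (auto simp: \<delta>_def)
  have sub: "?g p \<le> cmean (\<lambda>\<zeta>. ?g (p + csc \<zeta> w))" if "fst p \<in> ball 0 (R + \<delta>)" "norm w \<le> \<rho>1" for p w
  proof (rule glue_submean[OF ctx])
    have "cmod (fst p) < R + \<delta>" using that(1) by simp
    moreover have "\<rho>1 + \<rho>1 \<le> R1 - R"
      using add_mono[OF \<rho>1(3) \<rho>1(3)] unfolding field_sum_of_halves .
    ultimately show "cmod (fst p) + norm w \<le> R1" using that(2) \<delta>(3) by linarith
    show "norm w \<le> \<delta>0 / 4" by (rule order_trans[OF that(2) \<rho>1(2)])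
  qed
  obtain U where U: "adp R (\<lambda>\<tau> x. U (\<tau>, cvec x))" "\<And>p. fst p \<in> ball 0 R \<Longrightarrow> ?g p \<le> U p"
    "\<And>p C. (\<forall>q\<in>cball p \<delta>. ?g q \<le> C) \<Longrightarrow> U p \<le> C"
  proof (rule mollification[of ?g \<delta> \<rho>1 R])
    show "?g \<in> borel_measurable borel" by (rule glue_borel[OF ctx])
    show "loc_bounded ?g" by (rule glue_loc_bounded[OF ctx])
    show "0 < \<delta>" "\<delta> \<le> \<rho>1" by (fact \<delta>)+
    show "?g p \<le> cmean (\<lambda>\<zeta>. ?g (p + csc \<zeta> w))" if "fst p \<in> ball 0 (R + \<delta>)" "norm w \<le> \<rho>1" for p w by (rule sub[OF that])
    show "?g (\<tau>, z) = ?g (\<tau>, cvec (\<chi> i. Re (z $ i)))" for \<tau> z by (rule glue_repart[OF ctx])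
    fix U assume U0: "adp R (\<lambda>\<tau> x. U (\<tau>, cvec x))" "\<And>p. fst p \<in> ball 0 R \<Longrightarrow> ?g p \<le> U p"
      and U1: "\<And>p C. (\<And>q. q \<in> cball p \<delta> \<Longrightarrow> ?g q \<le> C) \<Longrightarrow> U p \<le> C"
    have U1': "U p \<le> C" if "\<forall>q\<in>cball p \<delta>. ?g q \<le> C" for p C by (rule U1) (use that in blast)
    show thesis by (rule that[OF U0 U1'])
  qed
  have gmax: "ereal (?g p) = max (u p) (ereal (cone N M K (snd p)))" if "fst p \<in> cball 0 R1" "infdist (repart (snd p)) K \<le> \<delta>0" for p
    by (rule glue_max[OF ctx that])
  have bR: "\<tau> \<in> cball 0 R1" if "\<tau> \<in> ball 0 R" for \<tau> :: complex using that R by simp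
  show thesis
  proof (rule that[of R \<delta> "\<lambda>\<tau> x. U (\<tau>, cvec x)"])
    show "u (\<tau>, cvec x) \<le> ereal (U (\<tau>, cvec x))" if "\<tau> \<in> ball 0 R" "infdist x K \<le> \<delta>0" for \<tau> x
    proof -
      have "fst (\<tau>, cvec x) \<in> cball 0 R1" "infdist (repart (snd (\<tau>, cvec x))) K \<le> \<delta>0"
        using bR[OF that(1)] that(2) by simp_all
      from gmax[OF this] have "u (\<tau>, cvec x) \<le> ereal (?g (\<tau>, cvec x))" by simp
      also have "\<dots> \<le> ereal (U (\<tau>, cvec x))" using U(2)[of "(\<tau>, cvec x)"] that by simp
      finally show ?thesis .
    qed
    show "B \<le> U (\<tau>, cvec x)" if t: "\<tau> \<in> ball 0 R" "infdist x K > \<delta>0" for \<tau> x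
    proof -
      have "h + h = \<delta>0" unfolding h_def by (rule field_sum_of_halves)
      then have "h \<le> infdist x K" using t(2) h by linarith
      then have "N * h \<le> N * infdist x K" by (rule mult_left_mono[OF _ N])
      moreover have "?g (\<tau>, cvec x) = N * infdist x K - M" using bR[OF t(1)] t(2) by (simp add: glue_def cone_def)
      ultimately have "B \<le> ?g (\<tau>, cvec x)" using m(3) unfolding Nh by linarith
      then show ?thesis using U(2)[of "(\<tau>, cvec x)"] t by simp
    qed
    show "U (\<tau>, cvec x) \<le> C" if C: "- M \<le> C" "cball x \<delta> \<subseteq> K" "cball \<tau> \<delta> \<subseteq> ball 0 1" "\<forall>q\<in>cball (\<tau>, cvec x) \<delta>. u q \<le> ereal C" for \<tau> x C
    proof (rule U(3), rule ballI)
      fix q assume q: "q \<in> cball (\<tau>, cvec x) \<delta>"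
      have "dist \<tau> (fst q) \<le> \<delta>" using q dist_fst_le[of "(\<tau>, cvec x)" q] by simp
      then have "fst q \<in> ball 0 1" using C(3) by auto
      then have 1: "fst q \<in> cball 0 R1" using R by simp
      have "dist x (repart (snd q)) \<le> \<delta>"
        using q dist_snd_le[of "(\<tau>, cvec x)" q] dist_repart_le[of "cvec x" "snd q"] by simp
      then have "repart (snd q) \<in> K" using C(2) by auto
      then have 2: "infdist (repart (snd q)) K = 0" by simp
      have 3: "infdist (repart (snd q)) K \<le> \<delta>0" unfolding 2 using \<delta>0(1) by simp
      have "ereal (?g q) = max (u q) (ereal (- M))"
        unfolding gmax[OF 1 3] cone_def 2 by simp
      also have "\<dots> \<le> ereal C" using C(1) bspec[OF C(4) q] by simp
      finally show "?g q \<le> C" by simp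
    qed
  qed (use R(1) \<delta>(1,2) U(1) in simp_all)
qed

text \<open>An affine change of \<tau> maps complex lines to complex lines and preserves circle
  means. For s < r the new disc has radius r / s > 1, which leaves the room that gluing and
  smoothing consume.\<close>

lemma psh_on_scale:
  assumes \<phi>: "psh_on (D \<times> tube V) \<phi>" and V: "open V" and s: "0 < s" and D: "ball a r \<subseteq> D" "r > 0"
  shows "psh_on (ball 0 (r / s) \<times> tube V) (\<lambda>p. \<phi> (a + of_real s * fst p, snd p))"
proof -
  define A where "A p = (a + of_real s * fst p, snd p)" for p :: "complex \<times> (complex^'a)"
  let ?O = "ball 0 (r / s) \<times> tube V"
  have \<phi>': "open (D \<times> tube V)" "\<And>p. p \<in> D \<times> tube V \<Longrightarrow> \<phi> p \<noteq> \<infinity>" "usc_on (D \<times> tube V) \<phi>"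
    "\<And>p w. (\<And>\<zeta>. cmod \<zeta> \<le> 1 \<Longrightarrow> cline p w \<zeta> \<in> D \<times> tube V) \<Longrightarrow> \<phi> p \<le> circle_mean \<phi> p w"
    using \<phi> by (auto simp: psh_on_def)
  have o: "open ?O" using V by (intro open_Times open_ball open_tube)
  have AO: "A p \<in> D \<times> tube V" if "p \<in> ?O" for p
  proof -
    have "cmod (fst p) < r / s" using that by auto
    then have "a + of_real s * fst p \<in> ball a r" using s by (simp add: dist_norm norm_mult pos_less_divide_eq mult.commute)
    then show ?thesis using that D by (auto simp: A_def)
  qed
  have Ac: "continuous_on UNIV A" unfolding A_def by (intro continuous_intros)
  have "usc_on ?O (\<lambda>p. \<phi> (A p))"
    unfolding usc_on_iff_open[OF o]
  proof
    fix c
    have "open {p \<in> D \<times> tube V. \<phi> p < c}" using \<phi>'(3) usc_on_iff_open[OF \<phi>'(1)] by blast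
    then have "open (A -` {p \<in> D \<times> tube V. \<phi> p < c} \<inter> ?O)" using o by (intro open_Int open_vimage Ac)
    also have "A -` {p \<in> D \<times> tube V. \<phi> p < c} \<inter> ?O = {p \<in> ?O. \<phi> (A p) < c}" using AO by blast
    finally show "open {p \<in> ?O. \<phi> (A p) < c}" .
  qed
  moreover have "\<phi> (A p) \<le> circle_mean (\<lambda>p. \<phi> (A p)) p w" if w: "\<And>\<zeta>. cmod \<zeta> \<le> 1 \<Longrightarrow> cline p w \<zeta> \<in> ?O" for p w
  proof -
    define w' where "w' = (of_real s * fst w, snd w)"
    have Al: "A (cline p w \<zeta>) = cline (A p) w' \<zeta>" for \<zeta> by (simp add: A_def cline_def w'_def algebra_simps)
    have "\<phi> (A p) \<le> circle_mean \<phi> (A p) w'" using AO[OF w] unfolding Al by (rule \<phi>'(4))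
    also have "\<dots> = circle_mean (\<lambda>p. \<phi> (A p)) p w" unfolding circle_mean_def Al ..
    finally show ?thesis .
  qed
  ultimately have "psh_on ?O (\<lambda>p. \<phi> (A p))"
    unfolding psh_on_def using o \<phi>'(2)[OF AO] by blast
  then show ?thesis by (simp add: A_def)
qed

section \<open>Measurability of the weight and the approximating weights\<close>

lemma expneg_measurable [measurable]: "expneg \<in> borel_measurable borel"
  unfolding expneg_def[abs_def] by measurable

lemma psh_weight_measurable:
  assumes \<phi>: "psh_on (D \<times> tube V) \<phi>" and V: "open V" and D: "open D"
  shows "(\<lambda>q. expneg (\<phi> (fst q, cvec (snd q))) * indicator (D \<times> V) q) \<in> borel_measurable borel"
proof -
  have [measurable]: "(\<lambda>p. if p \<in> D \<times> tube V then \<phi> p else -\<infinity>) \<in> borel_measurable borel"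
    using \<phi> by (intro usc_borel) (auto simp: psh_on_def)
  have [measurable]: "(\<lambda>q. (fst q, cvec (snd q)) :: complex \<times> (complex^'a)) \<in> borel_measurable borel"
    by (intro continuous_imp_borel continuous_intros)
  have [measurable]: "D \<times> V \<in> sets borel" using open_Times[OF D V] by auto
  have m: "(\<lambda>q. (\<lambda>p. if p \<in> D \<times> tube V then \<phi> p else -\<infinity>) ((\<lambda>q. (fst q, cvec (snd q))) q)) \<in> borel_measurable borel"
    by (rule measurable_compose[rotated]) measurable
  have "(\<lambda>q. expneg (\<phi> (fst q, cvec (snd q))) * indicator (D \<times> V) q)
    = (\<lambda>q. expneg ((\<lambda>p. if p \<in> D \<times> tube V then \<phi> p else -\<infinity>) ((\<lambda>q. (fst q, cvec (snd q))) q)) * indicator (D \<times> V) q)"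
    by (auto simp: fun_eq_iff indicator_def tube_repart)
  also have "\<dots> \<in> borel_measurable borel"
    by (intro borel_measurable_times_ennreal measurable_compose[OF m expneg_measurable]) measurable
  finally show ?thesis .
qed

lemma expneg_antimono: "s \<le> t \<Longrightarrow> t \<noteq> \<infinity> \<Longrightarrow> expneg t \<le> expneg s"
  by (cases s; cases t) (auto simp: expneg_def)

definition sbox :: "real \<Rightarrow> ('a::euclidean_space) set" where "sbox L = {x. \<forall>b\<in>Basis. x \<bullet> b \<in> {-L..L}}"

lemma sbox_cbox: "sbox L = cbox (- L *\<^sub>R One) (L *\<^sub>R One)"
  by (auto simp: sbox_def mem_box)

text \<open>The gluing applied to the points whose closed e-ball lies in the closure of V, with
  level \<open>M\<close> outside. Then exp (- \<psi>) at the centre is bounded by the given weight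
  near K and by exp (-M) on the rest of the box.\<close>

lemma weight_step:
  fixes \<phi> :: "complex \<times> (complex^'n) \<Rightarrow> ereal" and V :: "(real^'n) set"
  assumes V: "open V" "bounded V" "convex V" and psh: "psh_on (D \<times> tube V) \<phi>" and D: "open D" "a \<in> D"
    and indep: "\<And>\<tau> z z'. \<tau> \<in> D \<Longrightarrow> z \<in> tube V \<Longrightarrow> z' \<in> tube V \<Longrightarrow> (\<forall>i. Re (z $ i) = Re (z' $ i)) \<Longrightarrow> \<phi> (\<tau>, z) = \<phi> (\<tau>, z')"
    and r: "ball a r \<subseteq> D" "r > 0" and s: "0 < s" "s < r" and b: "cball b e \<subseteq> V" and e: "e > 0" and M: "M \<ge> 0" and d: "d > 0"
  obtains R \<psi> where "R > 1" "adp R \<psi>"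
    "(\<integral>\<^sup>+x. ennreal (exp (- \<psi> 0 x)) * indicator (sbox L) x \<partial>lborel)
       \<le> (\<integral>\<^sup>+x. expneg (\<phi> (a, cvec x)) * indicator V x \<partial>lborel) + ennreal (exp (- M)) * emeasure lborel (sbox L :: (real^'n) set)"
    "\<And>\<tau> x C. - M \<le> C \<Longrightarrow> cball x (d + e) \<subseteq> V \<Longrightarrow> cball \<tau> d \<subseteq> ball 0 1 \<Longrightarrow>
       (\<forall>q\<in>cball (\<tau>, cvec x) d. \<phi> (a + of_real s * fst q, snd q) \<le> ereal C) \<Longrightarrow> \<psi> \<tau> x \<le> C"
proof -
  \<comment> \<open>An intersection of translates of the closure of V inherits closedness and
    convexity; membership means that the closed e-ball lies in the closure of V.\<close>
  define K where "K = (\<Inter>t\<in>cball 0 e. (\<lambda>x. x + t) -` closure V)"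
  have KI: "x \<in> K" if "cball x e \<subseteq> closure V" for x
    unfolding K_def
  proof (intro INT_I)
    fix t :: "real^'n" assume "t \<in> cball 0 e"
    then have "x + t \<in> cball x e" by (simp add: dist_norm)
    then show "x \<in> (\<lambda>x. x + t) -` closure V" using that by auto
  qed
  have "closed K" unfolding K_def by (intro closed_INT ballI closed_vimage closed_closure continuous_intros)
  moreover have "K \<subseteq> closure V"
  proof
    fix x assume "x \<in> K"
    moreover have "(0::real^'n) \<in> cball 0 e" using e by simp
    ultimately have "x \<in> (\<lambda>x. x + 0) -` closure V" unfolding K_def by blast
    then show "x \<in> closure V" by simp
  qed
  ultimately have Kc: "compact K" using bounded_subset[OF bounded_closure[OF V(2)]] unfolding compact_eq_bounded_closed by simp
  have Kv: "convex K" unfolding K_def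
  proof (intro convex_INT)
    fix t :: "real^'n"
    show "convex ((\<lambda>x. x + t) -` closure V)"
    proof (rule convexI)
      fix x y :: "real^'n" and p q :: real
      assume h: "x \<in> (\<lambda>x. x + t) -` closure V" "y \<in> (\<lambda>x. x + t) -` closure V" "0 \<le> p" "0 \<le> q" "p + q = 1"
      have "p *\<^sub>R (x + t) + q *\<^sub>R (y + t) = (p *\<^sub>R x + q *\<^sub>R y) + (p + q) *\<^sub>R t"
        by (simp add: scaleR_add_right scaleR_add_left)
      moreover have "p *\<^sub>R (x + t) + q *\<^sub>R (y + t) \<in> closure V"
        by (rule convexD[OF convex_closure[OF V(3)]]) (use h in auto)
      ultimately show "p *\<^sub>R x + q *\<^sub>R y \<in> (\<lambda>x. x + t) -` closure V" using h(5) by simp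
    qed
  qed
  have Kn: "K \<noteq> {}" using KI[of b] b closure_subset by blast
  \<comment> \<open>The open e-ball about a point of K lies in the interior of the closure of V,
    which is V itself because V is open and convex.\<close>
  have KV: "{x. infdist x K \<le> e / 2} \<subseteq> V"
  proof
    fix x assume x: "x \<in> {x. infdist x K \<le> e / 2}"
    obtain k where k0: "k \<in> K" "infdist x K = dist x k"
      by (rule infdist_attains_inf[OF compact_imp_closed[OF Kc] Kn])
    then have k: "k \<in> K" "dist x k < e" using x e by auto
    have "ball k e \<subseteq> closure V"
    proof
      fix y assume "y \<in> ball k e"
      then have "y - k \<in> cball 0 e" by (simp add: dist_norm norm_minus_commute)
      then have "k \<in> (\<lambda>x. x + (y - k)) -` closure V" using k(1) unfolding K_def by (rule INT_D[rotated])
      then show "y \<in> closure V" by simp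
    qed
    then have "ball k e \<subseteq> interior (closure V)" by (rule interior_maximal) simp
    then have "ball k e \<subseteq> V" using V(1,3) by (simp add: convex_interior_closure interior_open)
    moreover have "x \<in> ball k e" using k(2) by (simp add: dist_commute)
    ultimately show "x \<in> V" by blast
  qed
  define u where "u p = \<phi> (a + of_real s * fst p, snd p)" for p
  have rs: "r / s > 1" using s by simp
  have pu: "psh_on (ball 0 (r / s) \<times> tube V) u" unfolding u_def by (rule psh_on_scale[OF psh V(1) s(1) r])
  have iu: "u (\<tau>, z) = u (\<tau>, z')" if "\<tau> \<in> ball 0 (r / s)" "z \<in> tube V" "z' \<in> tube V" "repart z = repart z'" for \<tau> z z'
  proof -
    have "cmod \<tau> < r / s" using that(1) by simp
    then have "a + of_real s * \<tau> \<in> ball a r" using s by (simp add: dist_norm norm_mult pos_less_divide_eq mult.commute)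
    then show ?thesis unfolding u_def fst_conv snd_conv using r that by (intro indep) (auto simp: repart_def vec_eq_iff)
  qed
  have e2: "e / 2 > 0" using e by simp
  obtain R \<psi> \<delta> where w: "R > 1" "0 < \<delta>" "\<delta> \<le> d" "adp R \<psi>"
    "\<And>\<tau> x. \<tau> \<in> ball 0 R \<Longrightarrow> infdist x K \<le> e / 2 \<Longrightarrow> u (\<tau>, cvec x) \<le> ereal (\<psi> \<tau> x)"
    "\<And>\<tau> x. \<tau> \<in> ball 0 R \<Longrightarrow> infdist x K > e / 2 \<Longrightarrow> M \<le> \<psi> \<tau> x"
    "\<And>\<tau> x C. - M \<le> C \<Longrightarrow> cball x \<delta> \<subseteq> K \<Longrightarrow> cball \<tau> \<delta> \<subseteq> ball 0 1 \<Longrightarrow> (\<forall>q\<in>cball (\<tau>, cvec x) \<delta>. u q \<le> ereal C) \<Longrightarrow> \<psi> \<tau> x \<le> C"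
    apply (rule glued_weight[where B=M, OF pu rs _ Kv Kc Kn e2 KV M d])
     apply (rule iu; assumption)
    apply (rule that; assumption)
    done
  have [measurable]: "(\<lambda>x. expneg (\<phi> (a, cvec x)) * indicator V x) \<in> borel_measurable borel"
  proof -
    have "(\<lambda>x. (\<lambda>q. expneg (\<phi> (fst q, cvec (snd q))) * indicator (D \<times> V) q) (a, x)) \<in> borel_measurable borel"
      by (rule measurable_compose[OF _ psh_weight_measurable[OF psh V(1) D(1)]]) measurable
    then show ?thesis using D(2) by (simp add: indicator_times)
  qed
  have [measurable]: "sbox L \<in> sets (borel :: (real^'n) measure)" by (simp add: sbox_cbox)
  have i: "(\<integral>\<^sup>+x. ennreal (exp (- \<psi> 0 x)) * indicator (sbox L) x \<partial>lborel)
       \<le> (\<integral>\<^sup>+x. expneg (\<phi> (a, cvec x)) * indicator V x \<partial>lborel) + ennreal (exp (- M)) * emeasure lborel (sbox L :: (real^'n) set)"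
  proof -
    have "(\<integral>\<^sup>+x. ennreal (exp (- \<psi> 0 x)) * indicator (sbox L) x \<partial>lborel)
       \<le> (\<integral>\<^sup>+x. expneg (\<phi> (a, cvec x)) * indicator V x + ennreal (exp (- M)) * indicator (sbox L) x \<partial>lborel)"
    proof (rule nn_integral_mono)
      fix x :: "real^'n"
      show "ennreal (exp (- \<psi> 0 x)) * indicator (sbox L) x \<le> expneg (\<phi> (a, cvec x)) * indicator V x + ennreal (exp (- M)) * indicator (sbox L) x"
      proof (cases "infdist x K \<le> e / 2")
        case True
        then have "x \<in> V" using KV by auto
        have "\<phi> (a, cvec x) \<le> ereal (\<psi> 0 x)" using w(5)[of 0 x] w(1) True by (simp add: u_def)
        then have "expneg (ereal (\<psi> 0 x)) \<le> expneg (\<phi> (a, cvec x))" by (rule expneg_antimono) simp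
        then have "ennreal (exp (- \<psi> 0 x)) \<le> expneg (\<phi> (a, cvec x))" by (simp add: expneg_def)
        then show ?thesis using \<open>x \<in> V\<close> by (auto simp: indicator_def intro: add_increasing2)
      next
        case False
        then have "M \<le> \<psi> 0 x" using w(6)[of 0 x] w(1) by simp
        then show ?thesis by (auto simp: indicator_def intro!: add_increasing ennreal_leI)
      qed
    qed
    also have "\<dots> = (\<integral>\<^sup>+x. expneg (\<phi> (a, cvec x)) * indicator V x \<partial>lborel) + ennreal (exp (- M)) * emeasure lborel (sbox L :: (real^'n) set)"
      by (subst nn_integral_add) (auto simp: nn_integral_cmult_indicator)
    finally show ?thesis .
  qed
  show thesis
  proof (rule that[OF w(1,4) i])
    fix \<tau> x C assume h: "- M \<le> C" "cball x (d + e) \<subseteq> V" "cball \<tau> d \<subseteq> ball 0 1"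
       "\<forall>q\<in>cball (\<tau>, cvec x) d. \<phi> (a + of_real s * fst q, snd q) \<le> ereal C"
    show "\<psi> \<tau> x \<le> C"
    proof (rule w(7)[OF h(1)])
      show "cball x \<delta> \<subseteq> K"
      proof
        fix y assume y: "y \<in> cball x \<delta>"
        have "cball y e \<subseteq> cball x (d + e)"
        proof
          fix z assume "z \<in> cball y e"
          then show "z \<in> cball x (d + e)" using y w(3) dist_triangle[of x z y] by simp
        qed
        then show "y \<in> K" using h(2) closure_subset by (intro KI) blast
      qed
      show "cball \<tau> \<delta> \<subseteq> ball 0 1" using h(3) w(3) by (auto simp: subset_iff)
      show "\<forall>q\<in>cball (\<tau>, cvec x) \<delta>. u q \<le> ereal C"
      proof
        fix q assume "q \<in> cball (\<tau>, cvec x) \<delta>"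
        then have "q \<in> cball (\<tau>, cvec x) d" using w(3) by simp
        then show "u q \<le> ereal C" unfolding u_def using h(4) by blast
      qed
    qed
  qed
qed

section \<open>Passage to the limit\<close>

text \<open>A constant factor of modulus at most 1 makes F^2 real and nonnegative at the centre; the
  mean value property of the real part then bounds |F(w)|^2 by the mean of |F|^2.\<close>

lemma holomorphic_sq_submean:
  assumes F: "F holomorphic_on S" and S: "\<And>\<zeta>. cmod \<zeta> \<le> 1 \<Longrightarrow> w + \<zeta> * v \<in> S"
  shows "(cmod (F w))\<^sup>2 \<le> cmean (\<lambda>\<zeta>. (cmod (F (w + \<zeta> * v)))\<^sup>2)" "cint (\<lambda>\<zeta>. (cmod (F (w + \<zeta> * v)))\<^sup>2)"
proof -
  define c where "c = cnj ((F w)\<^sup>2) / of_real (cmod ((F w)\<^sup>2))"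
  have c: "cmod c \<le> 1" by (cases "F w = 0") (auto simp: c_def norm_divide norm_power)
  have c1: "c * (F w)\<^sup>2 = of_real ((cmod (F w))\<^sup>2)"
  proof (cases "F w = 0")
    case False
    have "cnj ((F w)\<^sup>2) * (F w)\<^sup>2 = of_real ((cmod ((F w)\<^sup>2))\<^sup>2)" by (metis complex_norm_square mult.commute)
    then show ?thesis using False by (simp add: c_def norm_mult power2_eq_square)
  qed (simp add: c_def)
  have Fh: "(\<lambda>\<zeta>. F (w + \<zeta> * v)) holomorphic_on cball 0 1"
    by (rule holomorphic_on_compose_gen[OF _ F, unfolded o_def]) (use S in \<open>auto intro!: holomorphic_intros\<close>)
  define P where "P \<zeta> = c * (F (w + \<zeta> * v))\<^sup>2" for \<zeta>
  have P: "P holomorphic_on cball 0 1" unfolding P_def by (intro holomorphic_intros Fh)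
  have cF: "continuous_on (sphere 0 1) (\<lambda>\<zeta>. F (w + \<zeta> * v))"
    by (rule continuous_on_subset[OF holomorphic_on_imp_continuous_on[OF Fh]]) auto
  show ci: "cint (\<lambda>\<zeta>. (cmod (F (w + \<zeta> * v)))\<^sup>2)" by (intro cint_continuous continuous_intros cF)
  have "(cmod (F w))\<^sup>2 = Re (P 0)" unfolding P_def by (simp add: c1)
  also have "\<dots> = cmean (\<lambda>\<zeta>. Re (P \<zeta>))" by (rule cmean_holomorphic_cball[OF P, symmetric])
  also have "\<dots> \<le> cmean (\<lambda>\<zeta>. (cmod (F (w + \<zeta> * v)))\<^sup>2)"
  proof (rule cmean_mono[OF _ ci])
    show "cint (\<lambda>\<zeta>. Re (P \<zeta>))" unfolding P_def by (intro cint_continuous continuous_intros cF)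
    fix \<zeta> :: complex
    have "Re (P \<zeta>) \<le> cmod (P \<zeta>)" by (rule complex_Re_le_cmod)
    also have "\<dots> \<le> 1 * (cmod (F (w + \<zeta> * v)))\<^sup>2" unfolding P_def norm_mult norm_power by (rule mult_right_mono[OF c]) simp
    finally show "Re (P \<zeta>) \<le> (cmod (F (w + \<zeta> * v)))\<^sup>2" by simp
  qed
  finally show "(cmod (F w))\<^sup>2 \<le> cmean (\<lambda>\<zeta>. (cmod (F (w + \<zeta> * v)))\<^sup>2)" .
qed

text \<open>The circle inequality is integrated over all v in the disc. Multiplication by cis
  \<theta> preserves area, so every \<theta> contributes the same integral, and 2 pi
  cancels.\<close>

lemma holomorphic_L2_bound:
  assumes F: "F holomorphic_on S" and S: "ball w \<rho> \<subseteq> S" and \<rho>: "\<rho> > 0"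
  shows "ennreal (pi * \<rho>\<^sup>2) * ennreal ((cmod (F w))\<^sup>2) \<le> (\<integral>\<^sup>+y. ennreal ((cmod (F y))\<^sup>2) * indicator (ball w \<rho>) y \<partial>lborel)"
proof -
  define g where "g y = ennreal ((cmod (F y))\<^sup>2) * indicator (ball w \<rho>) y" for y
  have cF: "continuous_on (ball w \<rho>) F" using holomorphic_on_imp_continuous_on[OF F] S by (rule continuous_on_subset)
  have "(\<lambda>y. ennreal (indicator (ball w \<rho>) y *\<^sub>R (cmod (F y))\<^sup>2)) \<in> borel_measurable borel"
    by (intro measurable_compose[OF _ measurable_ennreal] borel_measurable_continuous_on_indicator continuous_intros cF) auto
  also have "(\<lambda>y. ennreal (indicator (ball w \<rho>) y *\<^sub>R (cmod (F y))\<^sup>2)) = g" by (auto simp: g_def fun_eq_iff indicator_def)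
  finally have gm[measurable]: "g \<in> borel_measurable borel" .
  have [measurable]: "(\<lambda>q. w + cis (fst q) * snd q) \<in> borel_measurable (lborel \<Otimes>\<^sub>M lborel)"
  proof -
    have "(\<lambda>q. w + cis (fst q) * snd q) \<in> borel_measurable borel" by (intro continuous_imp_borel continuous_intros)
    then show ?thesis by (simp add: lborel_prod)
  qed
  have rot: "(\<integral>\<^sup>+v. g (w + cis \<theta> * v) \<partial>lborel) = (\<integral>\<^sup>+y. g y \<partial>lborel)" for \<theta>
  proof -
    have lin: "linear (\<lambda>v. cis t * v)" for t by (rule linearI) (simp_all add: distrib_left)
    have "(\<integral>\<^sup>+v. (\<lambda>v. g (w + v)) (cis \<theta> * v) \<partial>lborel) = (\<integral>\<^sup>+v. g (w + v) \<partial>lborel)"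
      by (rule nn_integral_lborel_isometry[OF lin[of \<theta>] lin[of "- \<theta>"]])
        (simp add: mult.assoc[symmetric] cis_mult, simp add: norm_mult, measurable)
    also have "\<dots> = (\<integral>\<^sup>+y. g y \<partial>lborel)" by (rule nn_integral_lborel_shift) (rule gm)
    finally show ?thesis by simp
  qed
  have "ennreal (2 * pi) * (ennreal (pi * \<rho>\<^sup>2) * ennreal ((cmod (F w))\<^sup>2)) = (\<integral>\<^sup>+v. ennreal (2 * pi * (cmod (F w))\<^sup>2) * indicator (ball (0::complex) \<rho>) v \<partial>lborel)"
  proof -
    have "emeasure lborel (ball (0::complex) \<rho>) = ennreal (pi * \<rho>\<^sup>2)" using \<rho> by (simp add: emeasure_ball unit_ball_vol_2)
    moreover have "(\<integral>\<^sup>+v. ennreal (2 * pi * (cmod (F w))\<^sup>2) * indicator (ball (0::complex) \<rho>) v \<partial>lborel) = ennreal (2 * pi * (cmod (F w))\<^sup>2) * emeasure lborel (ball (0::complex) \<rho>)"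
      by (rule nn_integral_cmult_indicator) simp
    moreover have "ennreal (2 * pi * (cmod (F w))\<^sup>2) = ennreal (2 * pi) * ennreal ((cmod (F w))\<^sup>2)"
      by (rule ennreal_mult) auto
    ultimately show ?thesis by (simp only: mult_ac)
  qed
  also have "\<dots> \<le> (\<integral>\<^sup>+v. (\<integral>\<^sup>+\<theta>. g (w + cis \<theta> * v) * indicator {0..2*pi} \<theta> \<partial>lborel) \<partial>lborel)"
  proof (rule nn_integral_mono)
    fix v :: complex
    show "ennreal (2 * pi * (cmod (F w))\<^sup>2) * indicator (ball 0 \<rho>) v \<le> (\<integral>\<^sup>+\<theta>. g (w + cis \<theta> * v) * indicator {0..2*pi} \<theta> \<partial>lborel)"
    proof (cases "v \<in> ball 0 \<rho>")
      case True
      have in_b: "w + \<zeta> * v \<in> ball w \<rho>" if "cmod \<zeta> \<le> 1" for \<zeta>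
      proof -
        have "cmod \<zeta> * cmod v \<le> 1 * cmod v" using that by (rule mult_right_mono) simp
        then show ?thesis using True by (simp add: dist_norm norm_mult)
      qed
      then have in_S: "w + \<zeta> * v \<in> S" if "cmod \<zeta> \<le> 1" for \<zeta> using S that by blast
      note sm = holomorphic_sq_submean[OF F in_S]
      have i: "integrable lborel (\<lambda>\<theta>. indicator {0..2*pi} \<theta> * (cmod (F (w + cis \<theta> * v)))\<^sup>2)"
        using sm(2) unfolding cint_def set_integrable_def by simp
      have "2 * pi * (cmod (F w))\<^sup>2 \<le> (\<integral>\<theta>. indicator {0..2*pi} \<theta> * (cmod (F (w + cis \<theta> * v)))\<^sup>2 \<partial>lborel)"
        using sm(1) pi_gt_zero unfolding cmean_def set_lebesgue_integral_def by (simp add: field_simps)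
      then have "ennreal (2 * pi * (cmod (F w))\<^sup>2) \<le> ennreal (\<integral>\<theta>. indicator {0..2*pi} \<theta> * (cmod (F (w + cis \<theta> * v)))\<^sup>2 \<partial>lborel)"
        by (rule ennreal_leI)
      also have "\<dots> = (\<integral>\<^sup>+\<theta>. ennreal (indicator {0..2*pi} \<theta> * (cmod (F (w + cis \<theta> * v)))\<^sup>2) \<partial>lborel)"
        by (rule nn_integral_eq_integral[OF i, symmetric]) simp
      also have "\<dots> = (\<integral>\<^sup>+\<theta>. g (w + cis \<theta> * v) * indicator {0..2*pi} \<theta> \<partial>lborel)"
        by (rule nn_integral_cong) (use in_b[of "cis _"] in \<open>auto simp: g_def indicator_def\<close>)
      finally show ?thesis using True by simp
    qed simp
  qed
  also have "\<dots> = (\<integral>\<^sup>+\<theta>. (\<integral>\<^sup>+v. g (w + cis \<theta> * v) * indicator {0..2*pi} \<theta> \<partial>lborel) \<partial>lborel)"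
    by (rule lborel_pair.Fubini') measurable
  also have "\<dots> = (\<integral>\<^sup>+\<theta>. (\<integral>\<^sup>+y. g y \<partial>lborel) * indicator {0..2*pi} \<theta> \<partial>lborel)"
    by (intro nn_integral_cong, subst nn_integral_multc) (auto simp: rot)
  also have "\<dots> = ennreal (2 * pi) * (\<integral>\<^sup>+y. g y \<partial>lborel)" by (simp add: nn_integral_cmult mult.commute)
  finally have "ennreal (pi * \<rho>\<^sup>2) * ennreal ((cmod (F w))\<^sup>2) \<le> (\<integral>\<^sup>+y. g y \<partial>lborel)"
    using pi_gt_zero by (subst (asm) ennreal_mult_le_mult_iff) (auto simp: ennreal_eq_0_iff not_le)
  then show ?thesis by (simp add: g_def)
qed

text \<open>Upper semicontinuity supplies bounds only for levels C strictly above t. For finite t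
  they pass to the limit; for t = -\<infinity> arbitrarily negative C force \<open>X\<close> to be
  infinite unless \<open>g\<close> is 0.\<close>

lemma expneg_leI:
  assumes "g \<ge> 0" "t \<noteq> \<infinity>" and X: "\<And>C. t < ereal C \<Longrightarrow> ennreal (g * exp (- C)) \<le> X"
  shows "ennreal g * expneg t \<le> X"
proof (cases t)
  case (real t')
  have "(\<lambda>n. ennreal (g * exp (- (t' + inverse (real (Suc n)))))) \<longlonglongrightarrow> ennreal (g * exp (- (t' + 0)))"
    by (intro tendsto_intros tendsto_ennrealI LIMSEQ_inverse_real_of_nat)
  then have "ennreal (g * exp (- (t' + 0))) \<le> X"
    by (rule LIMSEQ_le_const2) (intro exI[of _ 0] allI impI X, simp add: real)
  then show ?thesis using real assms(1) by (simp add: expneg_def ennreal_mult)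
next
  case PInf
  then show ?thesis using assms by simp
next
  case MInf
  show ?thesis
  proof (cases "g = 0 \<or> X = \<infinity>")
    case False
    then have g: "g > 0" using assms(1) by simp
    obtain x where x: "x \<ge> 0" "X = ennreal x" using False by (cases X) auto
    \<comment> \<open>At this level g exp (-C) = x + 1, above the supposedly finite
      \<open>X\<close>.\<close>
    define C where "C = - ln ((x + 1) / g)"
    have "g * exp (- C) = x + 1" using g x by (simp add: C_def)
    then have "ennreal (x + 1) \<le> ennreal x" using X[of C] MInf x by simp
    then show ?thesis using x by (simp add: ennreal_le_iff)
  qed auto
qed

lemma norm_cvec: "norm (cvec x) = norm x" by (simp add: norm_vec_def cvec_def)

lemma dist_cvec: "dist (cvec x) (cvec y) = dist x y"
proof -
  have "cvec x - cvec y = cvec (x - y)" by (simp add: cvec_def vec_eq_iff)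
  then show ?thesis by (simp add: dist_norm norm_cvec)
qed

text \<open>The marginal \<Phi> of the approximating weight is continuous and subharmonic on a disc
  of radius above 1, so the one-dimensional extension applies. Since exp (- \<Phi>) is the fibre
  integral, its estimate is already the one for the weight over the box.\<close>

lemma extension_step:
  fixes \<phi> :: "complex \<times> (complex^'n) \<Rightarrow> ereal" and V :: "(real^'n) set"
  assumes V: "open V" "bounded V" "convex V" and psh: "psh_on (D \<times> tube V) \<phi>" and D: "open D" "a \<in> D"
    and indep: "\<And>\<tau> z z'. \<tau> \<in> D \<Longrightarrow> z \<in> tube V \<Longrightarrow> z' \<in> tube V \<Longrightarrow> (\<forall>i. Re (z $ i) = Re (z' $ i)) \<Longrightarrow> \<phi> (\<tau>, z) = \<phi> (\<tau>, z')"
    and r: "ball a r \<subseteq> D" "r > 0" and s: "0 < s" "s < r" and b: "cball b e \<subseteq> V" and e: "e > 0" and M: "M \<ge> 0" and d: "d > 0"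
    and L: "L > 0" and I: "(\<integral>\<^sup>+x. expneg (\<phi> (a, cvec x)) * indicator V x \<partial>lborel) = ennreal I" "I \<ge> 0"
  shows "\<exists>\<psi> F. continuous_on (ball 0 1 \<times> UNIV) (\<lambda>(\<tau>, x). \<psi> \<tau> x) \<and> F holomorphic_on ball 0 1 \<and> F 0 = 1 \<and>
    (\<integral>\<^sup>+z. ennreal ((cmod (F z))\<^sup>2) * (\<integral>\<^sup>+x. ennreal (exp (- \<psi> z x)) * indicator (sbox L) x \<partial>lborel) * indicator (ball 0 1) z \<partial>lborel)
       \<le> ennreal ((1 + d) * (pi * (I + exp (- M) * measure lborel (sbox L :: (real^'n) set)))) \<and>
    (\<forall>\<tau> x C. - M \<le> C \<longrightarrow> cball x (d + e) \<subseteq> V \<longrightarrow> cball \<tau> d \<subseteq> ball 0 1 \<longrightarrow>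
       (\<forall>q\<in>cball (\<tau>, cvec x) d. \<phi> (a + of_real s * fst q, snd q) \<le> ereal C) \<longrightarrow> \<psi> \<tau> x \<le> C)"
proof -
  obtain R \<psi> where w: "R > 1" "adp R \<psi>"
    "(\<integral>\<^sup>+x. ennreal (exp (- \<psi> 0 x)) * indicator (sbox L) x \<partial>lborel)
       \<le> (\<integral>\<^sup>+x. expneg (\<phi> (a, cvec x)) * indicator V x \<partial>lborel) + ennreal (exp (- M)) * emeasure lborel (sbox L :: (real^'n) set)"
    "\<And>\<tau> x C. - M \<le> C \<Longrightarrow> cball x (d + e) \<subseteq> V \<Longrightarrow> cball \<tau> d \<subseteq> ball 0 1 \<Longrightarrow>
       (\<forall>q\<in>cball (\<tau>, cvec x) d. \<phi> (a + of_real s * fst q, snd q) \<le> ereal C) \<Longrightarrow> \<psi> \<tau> x \<le> C"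
    apply (rule weight_step[where L=L, OF V psh D _ r s b e M d])
     apply (rule indep; assumption)
    apply (rule that; assumption)
    done
  obtain \<Phi> where \<Phi>: "continuous_on (ball 0 R) \<Phi>"
    "\<And>\<tau> \<rho>. 0 < \<rho> \<Longrightarrow> cball \<tau> \<rho> \<subseteq> ball 0 R \<Longrightarrow> \<Phi> \<tau> \<le> cmean (\<lambda>\<zeta>. \<Phi> (\<tau> + of_real \<rho> * \<zeta>))"
    "\<And>\<tau>. \<tau> \<in> ball 0 R \<Longrightarrow> ennreal (exp (- \<Phi> \<tau>)) = (\<integral>\<^sup>+x. ennreal (exp (- \<psi> \<tau> x)) * indicator (sbox L) x \<partial>lborel)"
    using full_marginal[OF w(2) L] unfolding sbox_def by blast
  obtain F where F: "F holomorphic_on ball 0 1" "F 0 = 1"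
    "(\<integral>\<^sup>+z. ennreal ((cmod (F z))\<^sup>2 * exp (- \<Phi> z)) * indicator (ball 0 1) z \<partial>lborel) \<le> ennreal ((1 + d) * (pi * exp (- \<Phi> 0)))"
    using extension_continuous_weight[OF \<Phi>(1) w(1) d \<Phi>(2)] by blast
  define v where "v = measure lborel (sbox L :: (real^'n) set)"
  have ev: "emeasure lborel (sbox L :: (real^'n) set) = ennreal v"
    unfolding v_def sbox_cbox by (intro emeasure_eq_ennreal_measure) (simp add: emeasure_lborel_cbox_eq)
  have v0: "v \<ge> 0" by (simp add: v_def)
  have "ennreal (exp (- \<Phi> 0)) \<le> ennreal I + ennreal (exp (- M)) * ennreal v"
    using w(1,3) \<Phi>(3)[of 0] unfolding I(1) ev by simp
  also have "\<dots> = ennreal (I + exp (- M) * v)"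
    by (simp add: ennreal_plus[symmetric] ennreal_mult[symmetric] I(2) v0 del: ennreal_plus)
  finally have x0: "exp (- \<Phi> 0) \<le> I + exp (- M) * v" using I(2) v0 by (simp add: ennreal_le_iff del: ennreal_plus)
  have "(\<integral>\<^sup>+z. ennreal ((cmod (F z))\<^sup>2) * (\<integral>\<^sup>+x. ennreal (exp (- \<psi> z x)) * indicator (sbox L) x \<partial>lborel) * indicator (ball 0 1) z \<partial>lborel)
      = (\<integral>\<^sup>+z. ennreal ((cmod (F z))\<^sup>2 * exp (- \<Phi> z)) * indicator (ball 0 1) z \<partial>lborel)"
  proof (rule nn_integral_cong)
    fix z
    show "ennreal ((cmod (F z))\<^sup>2) * (\<integral>\<^sup>+x. ennreal (exp (- \<psi> z x)) * indicator (sbox L) x \<partial>lborel) * indicator (ball 0 1) z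
      = ennreal ((cmod (F z))\<^sup>2 * exp (- \<Phi> z)) * indicator (ball 0 1) z"
    proof (cases "z \<in> ball 0 1")
      case True
      then have zR: "z \<in> ball 0 R" using w(1) by simp
      show ?thesis unfolding \<Phi>(3)[OF zR, symmetric] by (simp add: ennreal_mult)
    qed simp
  qed
  also note F(3)
  also have "ennreal ((1 + d) * (pi * exp (- \<Phi> 0))) \<le> ennreal ((1 + d) * (pi * (I + exp (- M) * v)))"
    by (intro ennreal_leI mult_left_mono x0) (use d in auto)
  finally have bound: "(\<integral>\<^sup>+z. ennreal ((cmod (F z))\<^sup>2) * (\<integral>\<^sup>+x. ennreal (exp (- \<psi> z x)) * indicator (sbox L) x \<partial>lborel) * indicator (ball 0 1) z \<partial>lborel)
      \<le> ennreal ((1 + d) * (pi * (I + exp (- M) * v)))" .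
  have c: "continuous_on (ball 0 1 \<times> UNIV) (\<lambda>(\<tau>, x). \<psi> \<tau> x)"
    by (rule continuous_on_subset[of "ball 0 R \<times> UNIV"]) (use w(1,2) in \<open>auto simp: adp_def\<close>)
  show ?thesis
  proof (intro exI[of _ \<psi>] exI[of _ F] conjI allI impI)
    show "\<psi> \<tau> x \<le> C" if "- M \<le> C" "cball x (d + e) \<subseteq> V" "cball \<tau> d \<subseteq> ball 0 1"
      "\<forall>q\<in>cball (\<tau>, cvec x) d. \<phi> (a + of_real s * fst q, snd q) \<le> ereal C" for \<tau> x C
      by (rule w(4)[OF that])
  qed (use c F(1,2) bound in \<open>simp_all add: v_def\<close>)
qed

text \<open>By upper semicontinuity \<phi> < C on a neighbourhood, which for large j contains the
  scaled smoothing balls. This gives the lower bound for exp (- \<psi> j) that serves both local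
  boundedness and Fatou's lemma.\<close>

lemma weights_eventually_le:
  fixes \<phi> :: "complex \<times> (complex^'n) \<Rightarrow> ereal" and V :: "(real^'n) set" and s d e M :: "nat \<Rightarrow> real"
  assumes V: "open V" and D: "open D" and psh: "psh_on (D \<times> tube V) \<phi>" and r: "ball a r \<subseteq> D" "r > 0"
    and lim: "s \<longlonglongrightarrow> r" "d \<longlonglongrightarrow> 0" "e \<longlonglongrightarrow> 0" "filterlim M at_top sequentially"
    and le: "\<And>j \<tau> x C. - M j \<le> C \<Longrightarrow> cball x (d j + e j) \<subseteq> V \<Longrightarrow> cball \<tau> (d j) \<subseteq> ball 0 1 \<Longrightarrow>
       (\<forall>q\<in>cball (\<tau>, cvec x) (d j). \<phi> (a + of_real (s j) * fst q, snd q) \<le> ereal C) \<Longrightarrow> \<psi> j \<tau> x \<le> C"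
    and \<zeta>: "\<zeta> \<in> ball 0 1" and x: "x \<in> V" and C: "\<phi> (a + of_real r * \<zeta>, cvec x) < ereal C"
  obtains \<epsilon> where "\<epsilon> > 0" "ball \<zeta> \<epsilon> \<subseteq> ball 0 1" "ball x \<epsilon> \<subseteq> V"
    "\<forall>\<^sub>F j in sequentially. \<forall>\<zeta>'\<in>ball \<zeta> \<epsilon>. \<forall>x'\<in>ball x \<epsilon>. \<psi> j \<zeta>' x' \<le> C"
proof -
  let ?O = "{p \<in> D \<times> tube V. \<phi> p < ereal C}"
  have "open ?O" using psh usc_on_iff_open[OF open_Times[OF D open_tube[OF V]]] unfolding psh_on_def by blast
  moreover have "(a + of_real r * \<zeta>, cvec x) \<in> ?O"
  proof -
    have "a + of_real r * \<zeta> \<in> ball a r" using \<zeta> r by (simp add: dist_norm norm_mult)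
    then show ?thesis using r x C by (auto simp: tube_repart)
  qed
  ultimately obtain \<epsilon>1 where \<epsilon>1: "\<epsilon>1 > 0" "ball (a + of_real r * \<zeta>, cvec x) \<epsilon>1 \<subseteq> ?O" by (meson open_contains_ball)
  obtain \<epsilon>2 where \<epsilon>2: "\<epsilon>2 > 0" "cball \<zeta> \<epsilon>2 \<subseteq> ball 0 1" using \<zeta> by (meson open_ball open_contains_cball)
  obtain \<epsilon>3 where \<epsilon>3: "\<epsilon>3 > 0" "cball x \<epsilon>3 \<subseteq> V" using x V by (meson open_contains_cball)
  \<comment> \<open>Displacements of \<tau> and x together cost at most 2 (r + 1) \<epsilon> <=
    \<epsilon>1 / 2, leaving \<epsilon>1 / 2 for |s j - r|. The other two terms leave room for d j
    and e j inside the disc and V.\<close>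
  define \<epsilon> where "\<epsilon> = min (\<epsilon>1 / (4 * (r + 1))) (min (\<epsilon>2 / 2) (\<epsilon>3 / 3))"
  have \<epsilon>: "\<epsilon> > 0" "\<epsilon> \<le> \<epsilon>1 / (4 * (r + 1))" "2 * \<epsilon> \<le> \<epsilon>2" "3 * \<epsilon> \<le> \<epsilon>3" using \<epsilon>1 \<epsilon>2 \<epsilon>3 r by (auto simp: \<epsilon>_def)
  have \<epsilon>': "(r + 1) * (2 * \<epsilon>) \<le> \<epsilon>1 / 2" using \<epsilon>(2) r by (simp add: field_simps)
  have "\<forall>\<^sub>F j in sequentially. \<bar>s j - r\<bar> < \<epsilon>1 / 2" using lim(1) \<epsilon>1(1) by (auto dest!: tendstoD[of _ _ _ "\<epsilon>1/2"] simp: dist_real_def)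
  moreover have "\<forall>\<^sub>F j in sequentially. d j < \<epsilon>" "\<forall>\<^sub>F j in sequentially. e j < \<epsilon>" using order_tendstoD(2)[OF lim(2) \<epsilon>(1)] order_tendstoD(2)[OF lim(3) \<epsilon>(1)] .
  moreover have "\<forall>\<^sub>F j in sequentially. - C \<le> M j" using lim(4) by (simp add: filterlim_at_top)
  ultimately have "\<forall>\<^sub>F j in sequentially. \<forall>\<zeta>'\<in>ball \<zeta> \<epsilon>. \<forall>x'\<in>ball x \<epsilon>. \<psi> j \<zeta>' x' \<le> C"
  proof eventually_elim
    case (elim j)
    show ?case
    proof (intro ballI le)
      fix \<zeta>' x' assume z: "\<zeta>' \<in> ball \<zeta> \<epsilon>" and x': "x' \<in> ball x \<epsilon>"
      show "- M j \<le> C" using elim by simp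
      show cV: "cball x' (d j + e j) \<subseteq> V"
      proof
        fix y assume "y \<in> cball x' (d j + e j)"
        then have "dist x y \<le> \<epsilon>3" using x' elim \<epsilon> dist_triangle[of x y x'] by simp
        then show "y \<in> V" using \<epsilon>3 by auto
      qed
      show c1: "cball \<zeta>' (d j) \<subseteq> ball 0 1"
      proof
        fix y assume "y \<in> cball \<zeta>' (d j)"
        then have "dist \<zeta> y \<le> \<epsilon>2" using z elim \<epsilon> dist_triangle[of \<zeta> y \<zeta>'] by simp
        then show "y \<in> ball 0 1" using \<epsilon>2 by auto
      qed
      fix q assume q: "q \<in> cball (\<zeta>', cvec x') (d j)"
      have q1: "dist \<zeta>' (fst q) \<le> d j" using q dist_fst_le[of "(\<zeta>', cvec x')" q] by simp
      have q2: "dist (cvec x') (snd q) \<le> d j" using q dist_snd_le[of "(\<zeta>', cvec x')" q] by simp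
      have n1: "cmod (fst q) \<le> 1" using c1 q1 by (auto simp: subset_iff less_imp_le)
      have d1: "cmod (of_real (s j) * fst q - of_real r * \<zeta>) \<le> \<bar>s j - r\<bar> + r * (2 * \<epsilon>)"
      proof -
        have "of_real (s j) * fst q - of_real r * \<zeta> = of_real (s j - r) * fst q + of_real r * (fst q - \<zeta>)" by (simp add: algebra_simps)
        then have "cmod (of_real (s j) * fst q - of_real r * \<zeta>) \<le> \<bar>s j - r\<bar> * cmod (fst q) + r * cmod (fst q - \<zeta>)"
          using r norm_triangle_ineq[of "of_real (s j - r) * fst q" "of_real r * (fst q - \<zeta>)"] by (simp add: norm_mult del: of_real_diff)
        moreover have "\<bar>s j - r\<bar> * cmod (fst q) \<le> \<bar>s j - r\<bar>" using n1 by (simp add: mult_left_le)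
        moreover have "cmod (fst q - \<zeta>) \<le> 2 * \<epsilon>"
          using q1 z elim dist_triangle[of "fst q" \<zeta> \<zeta>'] by (simp add: dist_norm[symmetric] dist_commute)
        then have "r * cmod (fst q - \<zeta>) \<le> r * (2 * \<epsilon>)" using r by (intro mult_left_mono) auto
        ultimately show ?thesis by linarith
      qed
      have d2: "dist (cvec x) (snd q) \<le> 2 * \<epsilon>"
        using q2 x' elim dist_triangle[of "cvec x" "snd q" "cvec x'"] by (simp add: dist_cvec)
      have "dist (a + of_real r * \<zeta>, cvec x) (a + of_real (s j) * fst q, snd q)
          \<le> dist (a + of_real r * \<zeta>) (a + of_real (s j) * fst q) + dist (cvec x) (snd q)"
        unfolding dist_Pair_Pair by (rule sqrt_sum_squares_le_sum) auto
      also have "dist (a + of_real r * \<zeta>) (a + of_real (s j) * fst q) = cmod (of_real (s j) * fst q - of_real r * \<zeta>)"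
        by (simp add: dist_norm norm_minus_commute)
      also have "\<dots> + dist (cvec x) (snd q) \<le> \<bar>s j - r\<bar> + (r + 1) * (2 * \<epsilon>)" using d1 d2 by (simp add: algebra_simps)
      also have "\<dots> < \<epsilon>1" using elim(1) \<epsilon>' by linarith
      finally have "(a + of_real (s j) * fst q, snd q) \<in> ?O" using \<epsilon>1(2) by auto
      then show "\<phi> (a + of_real (s j) * fst q, snd q) \<le> ereal C" by (auto intro: less_imp_le)
    qed
  qed
  moreover have "ball \<zeta> \<epsilon> \<subseteq> ball 0 1" "ball x \<epsilon> \<subseteq> V" using \<epsilon> \<epsilon>2(2) \<epsilon>3(2) by (auto simp: subset_iff)
  ultimately show thesis using that \<epsilon>(1) by blast
qed

section \<open>Local bounds for the extensions\<close>

lemma cmod_sq_measurable: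
  assumes F: "continuous_on A F" and A: "A \<in> sets borel"
  shows "(\<lambda>y. ennreal ((cmod (F y))\<^sup>2) * indicator A y) \<in> borel_measurable borel"
proof -
  have "(\<lambda>y. ennreal (indicator A y *\<^sub>R (cmod (F y))\<^sup>2)) \<in> borel_measurable borel"
    by (intro measurable_compose[OF _ measurable_ennreal] borel_measurable_continuous_on_indicator continuous_intros F A)
  also have "(\<lambda>y. ennreal (indicator A y *\<^sub>R (cmod (F y))\<^sup>2)) = (\<lambda>y. ennreal ((cmod (F y))\<^sup>2) * indicator A y)"
    by (auto simp: fun_eq_iff indicator_def)
  finally show ?thesis .
qed

text \<open>The area sub-mean value inequality on a ball where the fibre integral \<open>W\<close>
  is at least \<open>m\<close>; finally t <= t^2 + 1 passes from the square to the modulus.\<close>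

lemma locally_bounded_of_L2:
  fixes W :: "complex \<Rightarrow> ennreal"
  assumes F: "F holomorphic_on ball 0 1" and m: "m > 0" and A: "A \<ge> 0"
    and bound: "(\<integral>\<^sup>+z. ennreal ((cmod (F z))\<^sup>2) * W z * indicator (ball 0 1) z \<partial>lborel) \<le> ennreal A"
    and low: "\<And>z. z \<in> ball w \<rho> \<Longrightarrow> ennreal m \<le> W z" and \<rho>: "\<rho> > 0" "ball w \<rho> \<subseteq> ball 0 1"
  shows "cmod (F w) \<le> A / (m * (pi * \<rho>\<^sup>2)) + 1"
proof -
  have cF: "continuous_on (ball w \<rho>) F" using holomorphic_on_imp_continuous_on[OF F] \<rho>(2) by (rule continuous_on_subset)
  have [measurable]: "(\<lambda>y. ennreal ((cmod (F y))\<^sup>2) * indicator (ball w \<rho>) y) \<in> borel_measurable borel"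
    by (rule cmod_sq_measurable[OF cF]) simp
  have "ennreal m * (ennreal (pi * \<rho>\<^sup>2) * ennreal ((cmod (F w))\<^sup>2)) \<le> ennreal m * (\<integral>\<^sup>+y. ennreal ((cmod (F y))\<^sup>2) * indicator (ball w \<rho>) y \<partial>lborel)"
    by (rule mult_left_mono[OF holomorphic_L2_bound[OF F \<rho>(2,1)]]) simp
  also have "\<dots> = (\<integral>\<^sup>+y. ennreal m * (ennreal ((cmod (F y))\<^sup>2) * indicator (ball w \<rho>) y) \<partial>lborel)"
    by (rule nn_integral_cmult[symmetric]) measurable
  also have "\<dots> \<le> (\<integral>\<^sup>+z. ennreal ((cmod (F z))\<^sup>2) * W z * indicator (ball 0 1) z \<partial>lborel)"
  proof (rule nn_integral_mono)
    fix z
    show "ennreal m * (ennreal ((cmod (F z))\<^sup>2) * indicator (ball w \<rho>) z) \<le> ennreal ((cmod (F z))\<^sup>2) * W z * indicator (ball 0 1) z"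
    proof (cases "z \<in> ball w \<rho>")
      case True
      then have "z \<in> ball 0 1" using \<rho>(2) by blast
      then show ?thesis using mult_left_mono[OF low[OF True], of "ennreal ((cmod (F z))\<^sup>2)"] True by (simp add: mult.commute)
    qed simp
  qed
  also note bound
  also have "ennreal m * (ennreal (pi * \<rho>\<^sup>2) * ennreal ((cmod (F w))\<^sup>2)) = ennreal ((m * (pi * \<rho>\<^sup>2)) * (cmod (F w))\<^sup>2)"
    using m by (simp add: ennreal_mult[symmetric] mult.assoc)
  finally have "(m * (pi * \<rho>\<^sup>2)) * (cmod (F w))\<^sup>2 \<le> A" using A by (simp add: ennreal_le_iff)
  moreover have "m * (pi * \<rho>\<^sup>2) > 0" using m \<rho>(1) by simp
  ultimately have "(cmod (F w))\<^sup>2 \<le> A / (m * (pi * \<rho>\<^sup>2))" by (simp add: pos_le_divide_eq mult.commute)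
  moreover have "cmod (F w) \<le> (cmod (F w))\<^sup>2 + 1"
  proof -
    have "cmod (F w) * 1 \<le> cmod (F w) * cmod (F w)" if "cmod (F w) \<ge> 1" by (rule mult_left_mono[OF that]) simp
    then show ?thesis unfolding power2_eq_square using zero_le_square[of "cmod (F w)"] by linarith
  qed
  ultimately show ?thesis by linarith
qed

text \<open>A finite subcover gives one index from which the local bounds hold; the finitely many
  earlier functions are bounded on K by continuity. Montel's theorem asks for a bound on the whole
  family.\<close>

lemma eventually_locally_bounded_imp_bounded:
  fixes F :: "nat \<Rightarrow> 'a::metric_space \<Rightarrow> complex"
  assumes K: "compact K" and c: "\<And>j. continuous_on K (F j)"
    and loc: "\<And>\<zeta>. \<zeta> \<in> K \<Longrightarrow> \<exists>\<epsilon>>0. \<exists>B. \<forall>\<^sub>F j in sequentially. \<forall>w\<in>ball \<zeta> \<epsilon>. cmod (F j w) \<le> B"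
  shows "\<exists>B. \<forall>h\<in>range F. \<forall>z\<in>K. cmod (h z) \<le> B"
proof -
  have "\<forall>\<zeta>\<in>K. \<exists>q. fst q > 0 \<and> (\<forall>\<^sub>F j in sequentially. \<forall>w\<in>ball \<zeta> (fst q). cmod (F j w) \<le> snd q)"
  proof
    fix \<zeta> assume "\<zeta> \<in> K"
    from loc[OF this] obtain \<epsilon> B where "\<epsilon> > 0" "\<forall>\<^sub>F j in sequentially. \<forall>w\<in>ball \<zeta> \<epsilon>. cmod (F j w) \<le> B" by blast
    then show "\<exists>q. fst q > 0 \<and> (\<forall>\<^sub>F j in sequentially. \<forall>w\<in>ball \<zeta> (fst q). cmod (F j w) \<le> snd q)"
      by (intro exI[of _ "(\<epsilon>, B)"]) simp
  qed
  from bchoice[OF this] obtain q where q: "\<And>\<zeta>. \<zeta> \<in> K \<Longrightarrow> fst (q \<zeta>) > 0"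
    "\<And>\<zeta>. \<zeta> \<in> K \<Longrightarrow> \<forall>\<^sub>F j in sequentially. \<forall>w\<in>ball \<zeta> (fst (q \<zeta>)). cmod (F j w) \<le> snd (q \<zeta>)" by blast
  have cov: "K \<subseteq> (\<Union>\<zeta>\<in>K. ball \<zeta> (fst (q \<zeta>)))"
  proof
    fix \<zeta> assume "\<zeta> \<in> K"
    then show "\<zeta> \<in> (\<Union>\<zeta>\<in>K. ball \<zeta> (fst (q \<zeta>)))" using q(1) by (intro UN_I[of \<zeta>]) auto
  qed
  have op: "open (ball \<zeta> (fst (q \<zeta>)))" for \<zeta> by simp
  obtain D where D: "D \<subseteq> K" "finite D" "K \<subseteq> (\<Union>\<zeta>\<in>D. ball \<zeta> (fst (q \<zeta>)))"
    by (rule compactE_image[OF K op cov])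
  have "\<forall>\<^sub>F j in sequentially. \<forall>\<zeta>\<in>D. \<forall>w\<in>ball \<zeta> (fst (q \<zeta>)). cmod (F j w) \<le> snd (q \<zeta>)"
    by (rule eventually_ball_finite[OF D(2)]) (use q(2) D(1) in blast)
  then obtain J where J: "\<And>j \<zeta> w. j \<ge> J \<Longrightarrow> \<zeta> \<in> D \<Longrightarrow> w \<in> ball \<zeta> (fst (q \<zeta>)) \<Longrightarrow> cmod (F j w) \<le> snd (q \<zeta>)"
    unfolding eventually_sequentially by blast
  define B1 where "B1 = Max (insert 0 ((\<lambda>\<zeta>. snd (q \<zeta>)) ` D))"
  have B1: "cmod (F j w) \<le> B1" if jw: "j \<ge> J" "w \<in> K" for j w
  proof -
    obtain \<zeta> where z: "\<zeta> \<in> D" "w \<in> ball \<zeta> (fst (q \<zeta>))" using D(3) jw(2) by blast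
    have "cmod (F j w) \<le> snd (q \<zeta>)" by (rule J[OF jw(1) z])
    also have "\<dots> \<le> B1" unfolding B1_def using D(2) z(1) by (intro Max_ge) auto
    finally show ?thesis .
  qed
  have "bounded (\<Union>j\<in>{..<J}. F j ` K)"
    by (intro bounded_UN finite_lessThan ballI compact_imp_bounded compact_continuous_image c K)
  then obtain B2 where B2: "\<And>y. y \<in> (\<Union>j\<in>{..<J}. F j ` K) \<Longrightarrow> norm y \<le> B2" unfolding bounded_iff by blast
  have "cmod (F j w) \<le> max B1 B2" if "w \<in> K" for j w
  proof (cases "j \<ge> J")
    case True
    then show ?thesis using B1[OF True that] by simp
  next
    case False
    then have "F j w \<in> (\<Union>j\<in>{..<J}. F j ` K)" using that by (intro UN_I[of j]) auto
    then show ?thesis using B2[of "F j w"] by simp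
  qed
  then show ?thesis by blast
qed

section \<open>Montel limit and Fatou's lemma\<close>

theorem theorem1p1:
  fixes D :: "complex set" and V :: "(real^'n) set"
    and \<phi> :: "complex \<times> (complex^'n) \<Rightarrow> ereal" and a :: complex and r :: real
  assumes D_dom: "open D" "connected D" "D \<noteq> {}"
    and V_dom: "open V" "connected V" "V \<noteq> {}" "bounded V" "convex V"
    and psh: "psh_on (D \<times> tube V) \<phi>"
    and indep: "\<And>\<tau> z z'. \<tau> \<in> D \<Longrightarrow> z \<in> tube V \<Longrightarrow> z' \<in> tube V \<Longrightarrow>
                  (\<forall>i. Re (z $ i) = Re (z' $ i)) \<Longrightarrow> \<phi> (\<tau>, z) = \<phi> (\<tau>, z')"
    and aD: "a \<in> D" and rpos: "r > 0"
    and fin: "(\<integral>\<^sup>+ x. expneg (\<phi> (a, cvec x)) * indicator V x \<partial>lborel) < \<infinity>"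
    and disc: "ball a r \<subseteq> D"
  shows "\<exists>f. f holomorphic_on ball a r \<and> f a = 1 \<and>
     (\<integral>\<^sup>+ p. ennreal ((cmod (f (fst p)))\<^sup>2) * expneg (\<phi> (fst p, cvec (snd p)))
               * indicator (ball a r \<times> V) p \<partial>(lborel \<Otimes>\<^sub>M (lborel :: (real^'n) measure)))
     \<le> ennreal (pi * r\<^sup>2) * (\<integral>\<^sup>+ x. expneg (\<phi> (a, cvec x)) * indicator V x \<partial>lborel)"
proof -
  obtain b where b: "b \<in> V" using V_dom(3) by blast
  obtain e0 where e0: "e0 > 0" "cball b e0 \<subseteq> V" using b V_dom(1) by (meson open_contains_cball)
  obtain L where L: "L > 0" "V \<subseteq> sbox L"
  proof -
    obtain L where L: "L > 0" "\<And>x. x \<in> V \<Longrightarrow> norm x \<le> L" using V_dom(4) by (auto simp: bounded_pos)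
    have "x \<in> sbox L" if x: "x \<in> V" for x
      unfolding sbox_def mem_Collect_eq
    proof
      fix c :: "real^'n" assume "c \<in> Basis"
      then have "\<bar>x \<bullet> c\<bar> \<le> norm x" by (rule Basis_le_norm)
      then show "x \<bullet> c \<in> {-L..L}" using L(2)[OF x] by auto
    qed
    then show thesis using that L(1) by blast
  qed
  define I where "I = enn2real (\<integral>\<^sup>+ x. expneg (\<phi> (a, cvec x)) * indicator V x \<partial>lborel)"
  have I: "(\<integral>\<^sup>+ x. expneg (\<phi> (a, cvec x)) * indicator V x \<partial>lborel) = ennreal I" "I \<ge> 0"
    unfolding I_def using fin by (simp_all add: less_top)
  define v where "v = measure lborel (sbox L :: (real^'n) set)"
  have v: "v \<ge> 0" by (simp add: v_def)
  \<comment> \<open>\<open>d j\<close> is both the bound on the smoothing radius and the relative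
    error of the extension; \<open>e j\<close> is the margin inside V, \<open>s j\<close> increases
    to \<open>r\<close>, and the level outside is \<open>j\<close>.\<close>
  define d where "d j = inverse (real (Suc j))" for j
  define e where "e j = e0 * d j" for j
  define s where "s j = r * (1 - d j / 2)" for j
  have d: "0 < d j" "d j \<le> 1" for j by (auto simp: d_def inverse_le_1_iff)
  have e: "0 < e j" "e j \<le> e0" for j using e0 d[of j] by (auto simp: e_def mult_left_le)
  have s: "0 < s j" "s j < r" for j using rpos d[of j] by (auto simp: s_def intro!: mult_pos_pos)
  have dlim: "d \<longlonglongrightarrow> 0" unfolding d_def by (rule LIMSEQ_inverse_real_of_nat)
  have elim: "e \<longlonglongrightarrow> 0" unfolding e_def by (rule tendsto_mult_right_zero[OF dlim])
  have slim: "s \<longlonglongrightarrow> r"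
  proof -
    have "(\<lambda>j. r * (1 - d j / 2)) \<longlonglongrightarrow> r * (1 - 0 / 2)" by (intro tendsto_intros dlim) simp
    then show ?thesis by (simp add: s_def[abs_def])
  qed
  have Mlim: "filterlim (\<lambda>j. real j) at_top sequentially" by (rule filterlim_real_sequentially)
  define Q where "Q j \<psi> F \<longleftrightarrow> continuous_on (ball 0 1 \<times> UNIV) (\<lambda>(\<tau>, x). \<psi> \<tau> x) \<and> F holomorphic_on ball 0 1 \<and> F 0 = 1 \<and>
    (\<integral>\<^sup>+z. ennreal ((cmod (F z))\<^sup>2) * (\<integral>\<^sup>+x. ennreal (exp (- \<psi> z x)) * indicator (sbox L) x \<partial>lborel) * indicator (ball 0 1) z \<partial>lborel)
       \<le> ennreal ((1 + d j) * (pi * (I + exp (- real j) * measure lborel (sbox L :: (real^'n) set)))) \<and>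
    (\<forall>\<tau> x C. - real j \<le> C \<longrightarrow> cball x (d j + e j) \<subseteq> V \<longrightarrow> cball \<tau> (d j) \<subseteq> ball 0 1 \<longrightarrow>
       (\<forall>q\<in>cball (\<tau>, cvec x) (d j). \<phi> (a + of_real (s j) * fst q, snd q) \<le> ereal C) \<longrightarrow> \<psi> \<tau> x \<le> C)"
    for j and \<psi> :: "complex \<Rightarrow> real^'n \<Rightarrow> real" and F
  have "\<exists>\<psi> F. Q j \<psi> F" for j
  proof -
    have "cball b (e j) \<subseteq> V" using e0(2) e(2)[of j] by auto
    then show ?thesis
      unfolding Q_def
      by (intro extension_step[OF V_dom(1,4,5) psh D_dom(1) aD indep disc rpos s _ e(1) _ d(1) L(1) I]) auto
  qed
  then have "\<forall>j. \<exists>q. Q j (fst q) (snd q)" by auto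
  from choice[OF this] obtain q where q: "\<And>j. Q j (fst (q j)) (snd (q j))" by blast
  define \<psi> where "\<psi> j = fst (q j)" for j
  define F where "F j = snd (q j)" for j
  have QQ: "Q j (\<psi> j) (F j)" for j unfolding \<psi>_def F_def by (rule q)
  define A where "A j = (1 + d j) * (pi * (I + exp (- real j) * v))" for j
  have \<psi>c: "continuous_on (ball 0 1 \<times> UNIV) (\<lambda>(\<tau>, x). \<psi> j \<tau> x)" and Fh: "F j holomorphic_on ball 0 1" and F0: "F j 0 = 1"
    and bound: "(\<integral>\<^sup>+z. ennreal ((cmod (F j z))\<^sup>2) * (\<integral>\<^sup>+x. ennreal (exp (- \<psi> j z x)) * indicator (sbox L) x \<partial>lborel) * indicator (ball 0 1) z \<partial>lborel) \<le> ennreal (A j)" for j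
    using QQ[of j] unfolding Q_def A_def v_def by blast+
  have up: "\<psi> j \<tau> x \<le> C" if "- real j \<le> C" "cball x (d j + e j) \<subseteq> V" "cball \<tau> (d j) \<subseteq> ball 0 1"
       "\<forall>q\<in>cball (\<tau>, cvec x) (d j). \<phi> (a + of_real (s j) * fst q, snd q) \<le> ereal C" for j \<tau> x C
    using QQ[of j] that unfolding Q_def by blast
  have Fc: "continuous_on (ball 0 1) (F j)" for j by (rule holomorphic_on_imp_continuous_on[OF Fh])
  have W: "\<exists>\<epsilon>>0. ball \<zeta> \<epsilon> \<subseteq> ball 0 1 \<and> ball x \<epsilon> \<subseteq> V \<and> (\<forall>\<^sub>F j in sequentially. \<forall>\<zeta>'\<in>ball \<zeta> \<epsilon>. \<forall>x'\<in>ball x \<epsilon>. \<psi> j \<zeta>' x' \<le> C)"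
    if h: "\<zeta> \<in> ball 0 1" "x \<in> V" "\<phi> (a + of_real r * \<zeta>, cvec x) < ereal C" for \<zeta> x C
    apply (rule weights_eventually_le[where \<psi>=\<psi>, OF V_dom(1) D_dom(1) psh disc rpos slim dlim elim Mlim _ h])
     apply (rule up; assumption)
    apply blast
    done
  have Alim: "A \<longlonglongrightarrow> pi * I"
  proof -
    have "(\<lambda>j. exp (- real j)) \<longlonglongrightarrow> 0"
      by (rule filterlim_compose[OF exp_at_bot filterlim_uminus_at_top[THEN iffD1, OF filterlim_real_sequentially]])
    then have "(\<lambda>j. (1 + d j) * (pi * (I + exp (- real j) * v))) \<longlonglongrightarrow> (1 + 0) * (pi * (I + 0 * v))"
      by (intro tendsto_intros dlim)
    then show ?thesis by (simp add: A_def[abs_def])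
  qed
  \<comment> \<open>A bound for all \<open>A j\<close>, since d j <= 1 and exp (- j) <= 1.\<close>
  define A0 where "A0 = 2 * (pi * (I + v))"
  have A0: "A0 \<ge> 0" using I(2) v by (simp add: A0_def)
  have AA0: "A j \<le> A0" for j
  proof -
    have "exp (- real j) * v \<le> 1 * v" by (rule mult_right_mono[OF _ v]) simp
    then have "pi * (I + exp (- real j) * v) \<le> pi * (I + v)" by (intro mult_left_mono) auto
    then show ?thesis unfolding A_def A0_def using d[of j] I(2) v by (intro mult_mono) auto
  qed
  have inD: "a + of_real r * \<zeta> \<in> D" if "\<zeta> \<in> ball 0 1" for \<zeta>
  proof -
    have "a + of_real r * \<zeta> \<in> ball a r" using that rpos by (simp add: dist_norm norm_mult)
    then show ?thesis using disc by blast
  qed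
  have nI: "\<phi> (a + of_real r * \<zeta>, cvec x) \<noteq> \<infinity>" if "\<zeta> \<in> ball 0 1" "x \<in> V" for \<zeta> x
    using psh inD[OF that(1)] that(2) unfolding psh_on_def by (auto simp: tube_repart)
  have loc: "\<exists>\<epsilon>>0. \<exists>B. \<forall>\<^sub>F j in sequentially. \<forall>w\<in>ball \<zeta> \<epsilon>. cmod (F j w) \<le> B" if \<zeta>: "\<zeta> \<in> ball 0 1" for \<zeta>
  proof -
    \<comment> \<open>Near \<zeta>, and for points near b, the weights are eventually at most
      \<open>n\<close>. Integrating exp (-n) over a ball about b bounds the fibre integrals below,
      which turns the integral estimate into a pointwise one.\<close>
    obtain n :: nat where n: "\<phi> (a + of_real r * \<zeta>, cvec b) < ereal (real n)"
      using nI[OF \<zeta> b] less_PInf_Ex_of_nat by blast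
    obtain \<epsilon> where \<epsilon>: "\<epsilon> > 0" "ball \<zeta> \<epsilon> \<subseteq> ball 0 1" "ball b \<epsilon> \<subseteq> V"
      "\<forall>\<^sub>F j in sequentially. \<forall>\<zeta>'\<in>ball \<zeta> \<epsilon>. \<forall>x'\<in>ball b \<epsilon>. \<psi> j \<zeta>' x' \<le> real n" using W[OF \<zeta> b n] by blast
    define m where "m = exp (- real n) * measure lborel (ball b \<epsilon>)"
    have m: "m > 0" unfolding m_def by (intro mult_pos_pos exp_gt_zero content_ball_pos \<epsilon>(1))
    have "\<forall>w\<in>ball \<zeta> (\<epsilon>/2). cmod (F j w) \<le> A0 / (m * (pi * (\<epsilon>/2)\<^sup>2)) + 1"
      if j: "\<forall>\<zeta>'\<in>ball \<zeta> \<epsilon>. \<forall>x'\<in>ball b \<epsilon>. \<psi> j \<zeta>' x' \<le> real n" for j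
    proof
      fix w assume w: "w \<in> ball \<zeta> (\<epsilon>/2)"
      have sub: "ball w (\<epsilon>/2) \<subseteq> ball \<zeta> \<epsilon>"
      proof
        fix y assume "y \<in> ball w (\<epsilon>/2)"
        then show "y \<in> ball \<zeta> \<epsilon>" using w dist_triangle[of \<zeta> y w] by simp
      qed
      show "cmod (F j w) \<le> A0 / (m * (pi * (\<epsilon>/2)\<^sup>2)) + 1"
      proof (rule locally_bounded_of_L2[OF Fh m A0 order_trans[OF bound ennreal_leI[OF AA0]]])
        fix z assume "z \<in> ball w (\<epsilon>/2)"
        then have z: "z \<in> ball \<zeta> \<epsilon>" using sub by blast
        have "emeasure lborel (ball b \<epsilon>) = ennreal (measure lborel (ball b \<epsilon>))"
          using emeasure_bounded_finite[of "ball b \<epsilon>"] by (intro emeasure_eq_ennreal_measure) simp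
        then have "ennreal m = ennreal (exp (- real n)) * emeasure lborel (ball b \<epsilon>)" by (simp add: m_def ennreal_mult)
        also have "\<dots> = (\<integral>\<^sup>+x. ennreal (exp (- real n)) * indicator (ball b \<epsilon>) x \<partial>lborel)"
          by (rule nn_integral_cmult_indicator[symmetric]) simp
        also have "\<dots> \<le> (\<integral>\<^sup>+x. ennreal (exp (- \<psi> j z x)) * indicator (sbox L) x \<partial>lborel)"
        proof (rule nn_integral_mono)
          fix x
          show "ennreal (exp (- real n)) * indicator (ball b \<epsilon>) x \<le> ennreal (exp (- \<psi> j z x)) * indicator (sbox L) x"
          proof (cases "x \<in> ball b \<epsilon>")
            case True
            then have "x \<in> sbox L" using \<epsilon>(3) L(2) by blast
            moreover have "\<psi> j z x \<le> real n" using j z True by blast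
            ultimately show ?thesis using True by (simp add: ennreal_leI)
          qed simp
        qed
        finally show "ennreal m \<le> (\<integral>\<^sup>+x. ennreal (exp (- \<psi> j z x)) * indicator (sbox L) x \<partial>lborel)" .
      qed (use \<epsilon> sub in auto)
    qed
    then have "\<forall>\<^sub>F j in sequentially. \<forall>w\<in>ball \<zeta> (\<epsilon>/2). cmod (F j w) \<le> A0 / (m * (pi * (\<epsilon>/2)\<^sup>2)) + 1"
      by (rule eventually_mono[OF \<epsilon>(4)])
    moreover have "\<epsilon>/2 > 0" using \<epsilon>(1) by simp
    ultimately show ?thesis by blast
  qed
  have bdd: "\<exists>B. \<forall>h\<in>range F. \<forall>z\<in>K. cmod (h z) \<le> B" if K: "compact K" "K \<subseteq> ball 0 1" for K
  proof (rule eventually_locally_bounded_imp_bounded[OF K(1)])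
    show "continuous_on K (F j)" for j by (rule continuous_on_subset[OF Fc K(2)])
    show "\<exists>\<epsilon>>0. \<exists>B. \<forall>\<^sub>F j in sequentially. \<forall>w\<in>ball \<zeta> \<epsilon>. cmod (F j w) \<le> B" if "\<zeta> \<in> K" for \<zeta>
      by (rule loc) (use that K(2) in blast)
  qed
  have hol: "h holomorphic_on ball 0 1" if "h \<in> range F" for h using that Fh by blast
  obtain G rr where G: "G holomorphic_on ball 0 1" "strict_mono (rr :: nat \<Rightarrow> nat)"
    and Glim: "\<And>z. z \<in> ball 0 1 \<Longrightarrow> (\<lambda>n. F (rr n) z) \<longlonglongrightarrow> G z"
    by (rule Montel[OF open_ball hol bdd order_refl]) (assumption | blast)+
  have G0: "G 0 = 1"
  proof -
    have "(\<lambda>n. F (rr n) 0) \<longlonglongrightarrow> G 0" by (rule Glim) simp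
    then show ?thesis unfolding F0 by (simp add: LIMSEQ_const_iff)
  qed
  \<comment> \<open>The fibre is cut down from the box to V here: V lies in the box, so the estimate
    survives.\<close>
  define h where "h j p = ennreal ((cmod (F j (fst p)))\<^sup>2 * exp (- \<psi> j (fst p) (snd p))) * indicator (ball 0 1 \<times> V) p" for j p
  have bV: "ball (0::complex) 1 \<times> V \<in> sets borel" by (intro borel_open open_Times open_ball V_dom(1))
  have hm: "h j \<in> borel_measurable borel" for j
  proof -
    have c1: "continuous_on (ball 0 1 \<times> V) (\<lambda>p. F j (fst p))" by (rule continuous_on_compose2[OF Fc]) (auto intro!: continuous_intros)
    have c2: "continuous_on (ball 0 1 \<times> V) (\<lambda>p. \<psi> j (fst p) (snd p))"
      using continuous_on_subset[OF \<psi>c, of "ball 0 1 \<times> V" j] by (auto simp: case_prod_beta')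
    have "(\<lambda>p. ennreal (indicator (ball 0 1 \<times> V) p *\<^sub>R ((cmod (F j (fst p)))\<^sup>2 * exp (- \<psi> j (fst p) (snd p))))) \<in> borel_measurable borel"
      by (intro measurable_compose[OF _ measurable_ennreal] borel_measurable_continuous_on_indicator continuous_intros c1 c2 bV)
    also have "(\<lambda>p. ennreal (indicator (ball 0 1 \<times> V) p *\<^sub>R ((cmod (F j (fst p)))\<^sup>2 * exp (- \<psi> j (fst p) (snd p))))) = h j"
      by (auto simp: fun_eq_iff h_def indicator_def)
    finally show ?thesis .
  qed
  have hm': "h j \<in> borel_measurable (lborel \<Otimes>\<^sub>M lborel)" for j using hm by (simp add: lborel_prod)
  have hA: "(\<integral>\<^sup>+p. h j p \<partial>(lborel \<Otimes>\<^sub>M lborel)) \<le> ennreal (A j)" for j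
  proof -
    have "(\<integral>\<^sup>+p. h j p \<partial>(lborel \<Otimes>\<^sub>M lborel)) = (\<integral>\<^sup>+\<zeta>. (\<integral>\<^sup>+x. h j (\<zeta>, x) \<partial>lborel) \<partial>lborel)"
      by (rule lborel.nn_integral_fst[OF hm', symmetric])
    also have "\<dots> \<le> (\<integral>\<^sup>+z. ennreal ((cmod (F j z))\<^sup>2) * (\<integral>\<^sup>+x. ennreal (exp (- \<psi> j z x)) * indicator (sbox L) x \<partial>lborel) * indicator (ball 0 1) z \<partial>lborel)"
    proof (rule nn_integral_mono)
      fix z
      show "(\<integral>\<^sup>+x. h j (z, x) \<partial>lborel) \<le> ennreal ((cmod (F j z))\<^sup>2) * (\<integral>\<^sup>+x. ennreal (exp (- \<psi> j z x)) * indicator (sbox L) x \<partial>lborel) * indicator (ball 0 1) z"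
      proof (cases "z \<in> ball 0 1")
        case True
        have "continuous_on UNIV (\<lambda>x. case (z, x) of (\<tau>, x) \<Rightarrow> \<psi> j \<tau> x)"
          by (rule continuous_on_compose2[OF \<psi>c]) (use True in \<open>auto intro!: continuous_intros\<close>)
        then have [measurable]: "\<psi> j z \<in> borel_measurable borel" by (intro continuous_imp_borel) simp
        have [measurable]: "sbox L \<in> sets (borel :: (real^'n) measure)" by (simp add: sbox_cbox)
        have "(\<integral>\<^sup>+x. h j (z, x) \<partial>lborel) \<le> (\<integral>\<^sup>+x. ennreal ((cmod (F j z))\<^sup>2) * (ennreal (exp (- \<psi> j z x)) * indicator (sbox L) x) \<partial>lborel)"
        proof (rule nn_integral_mono)
          fix x
          show "h j (z, x) \<le> ennreal ((cmod (F j z))\<^sup>2) * (ennreal (exp (- \<psi> j z x)) * indicator (sbox L) x)"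
          proof (cases "x \<in> V")
            case xV: True
            then have "x \<in> sbox L" using L(2) by blast
            then show ?thesis using xV True by (simp add: h_def ennreal_mult)
          qed (simp add: h_def)
        qed
        also have "\<dots> = ennreal ((cmod (F j z))\<^sup>2) * (\<integral>\<^sup>+x. ennreal (exp (- \<psi> j z x)) * indicator (sbox L) x \<partial>lborel)"
          by (rule nn_integral_cmult) measurable
        finally show ?thesis using True by simp
      next
        case False
        then have "h j (z, x) = 0" for x by (simp add: h_def)
        then show ?thesis by simp
      qed
    qed
    also note bound
    finally show ?thesis .
  qed
  \<comment> \<open>The constants \<open>A j\<close> tend to pi I along the subsequence, as the
    relative error and the contribution exp (- j) v of the box outside both vanish.\<close>
  have fatou: "(\<integral>\<^sup>+\<zeta>. (\<integral>\<^sup>+x. liminf (\<lambda>n. h (rr n) (\<zeta>, x)) \<partial>lborel) \<partial>lborel) \<le> ennreal (pi * I)"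
  proof -
    have m: "(\<lambda>p. liminf (\<lambda>n. h (rr n) p)) \<in> borel_measurable (lborel \<Otimes>\<^sub>M lborel)"
      by (intro borel_measurable_liminf hm')
    have "(\<integral>\<^sup>+\<zeta>. (\<integral>\<^sup>+x. liminf (\<lambda>n. h (rr n) (\<zeta>, x)) \<partial>lborel) \<partial>lborel) = (\<integral>\<^sup>+p. liminf (\<lambda>n. h (rr n) p) \<partial>(lborel \<Otimes>\<^sub>M lborel))"
      by (rule lborel.nn_integral_fst[OF m])
    also have "\<dots> \<le> liminf (\<lambda>n. \<integral>\<^sup>+p. h (rr n) p \<partial>(lborel \<Otimes>\<^sub>M lborel))"
      by (rule nn_integral_liminf) (rule hm')
    also have "\<dots> \<le> liminf (\<lambda>n. ennreal (A (rr n)))"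
      by (rule Liminf_mono) (simp add: hA)
    also have "\<dots> = ennreal (pi * I)"
    proof (rule lim_imp_Liminf)
      show "(\<lambda>n. ennreal (A (rr n))) \<longlonglongrightarrow> ennreal (pi * I)"
        using LIMSEQ_subseq_LIMSEQ[OF Alim G(2)] by (intro tendsto_ennrealI) (simp add: o_def)
    qed simp
    finally show ?thesis .
  qed
  \<comment> \<open>The weights need not converge pointwise. For each C above \<phi> they are
    eventually at most C, which gives the inequality for the lower limit, also where \<phi> is
    -\<infinity>.\<close>
  have point: "ennreal ((cmod (G \<zeta>))\<^sup>2) * expneg (\<phi> (a + of_real r * \<zeta>, cvec x)) \<le> liminf (\<lambda>n. h (rr n) (\<zeta>, x))"
    if z: "\<zeta> \<in> ball 0 1" "x \<in> V" for \<zeta> x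
  proof (rule expneg_leI)
    show "\<phi> (a + of_real r * \<zeta>, cvec x) \<noteq> \<infinity>" by (rule nI[OF z])
    fix C assume C: "\<phi> (a + of_real r * \<zeta>, cvec x) < ereal C"
    obtain \<epsilon> where \<epsilon>: "\<epsilon> > 0" "\<forall>\<^sub>F j in sequentially. \<forall>\<zeta>'\<in>ball \<zeta> \<epsilon>. \<forall>x'\<in>ball x \<epsilon>. \<psi> j \<zeta>' x' \<le> C" using W[OF z C] by blast
    have "\<forall>\<^sub>F j in sequentially. \<psi> j \<zeta> x \<le> C" by (rule eventually_mono[OF \<epsilon>(2)]) (use \<epsilon>(1) in auto)
    then have ev: "\<forall>\<^sub>F n in sequentially. \<psi> (rr n) \<zeta> x \<le> C" by (rule eventually_subseq[OF G(2)])
    have "(\<lambda>n. ennreal ((cmod (F (rr n) \<zeta>))\<^sup>2 * exp (- C))) \<longlonglongrightarrow> ennreal ((cmod (G \<zeta>))\<^sup>2 * exp (- C))"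
      by (intro tendsto_ennrealI tendsto_intros Glim z(1))
    then have "ennreal ((cmod (G \<zeta>))\<^sup>2 * exp (- C)) = liminf (\<lambda>n. ennreal ((cmod (F (rr n) \<zeta>))\<^sup>2 * exp (- C)))"
      by (intro lim_imp_Liminf[symmetric]) auto
    also have "\<dots> \<le> liminf (\<lambda>n. h (rr n) (\<zeta>, x))"
    proof (rule Liminf_mono)
      show "\<forall>\<^sub>F n in sequentially. ennreal ((cmod (F (rr n) \<zeta>))\<^sup>2 * exp (- C)) \<le> h (rr n) (\<zeta>, x)"
        using ev
      proof eventually_elim
        case (elim n)
        have "(cmod (F (rr n) \<zeta>))\<^sup>2 * exp (- C) \<le> (cmod (F (rr n) \<zeta>))\<^sup>2 * exp (- \<psi> (rr n) \<zeta> x)"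
          by (rule mult_left_mono) (use elim in auto)
        from ennreal_leI[OF this] show ?case using z by (simp add: h_def)
      qed
    qed
    finally show "ennreal ((cmod (G \<zeta>))\<^sup>2 * exp (- C)) \<le> liminf (\<lambda>n. h (rr n) (\<zeta>, x))" .
  qed simp
  \<comment> \<open>Transfers the limit from the unit disc to the disc of radius \<open>r\<close>
    about \<open>a\<close>.\<close>
  define f where "f \<tau> = G ((\<tau> - a) / of_real r)" for \<tau>
  have fh: "f holomorphic_on ball a r"
    unfolding f_def
  proof (rule holomorphic_on_compose_gen[OF _ G(1), unfolded o_def])
    show "(\<lambda>\<tau>. (\<tau> - a) / of_real r) holomorphic_on ball a r" using rpos by (intro holomorphic_intros) auto
    show "(\<lambda>\<tau>. (\<tau> - a) / of_real r) ` ball a r \<subseteq> ball 0 1"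
      using rpos by (auto simp: norm_divide dist_norm norm_minus_commute)
  qed
  have fa: "f a = 1" by (simp add: f_def G0)
  define H where "H p = ennreal ((cmod (f (fst p)))\<^sup>2) * expneg (\<phi> (fst p, cvec (snd p))) * indicator (ball a r \<times> V) p" for p
  have Hm: "H \<in> borel_measurable borel"
  proof -
    have "(\<lambda>\<tau>. ennreal ((cmod (f \<tau>))\<^sup>2) * indicator (ball a r) \<tau>) \<in> borel_measurable borel"
      by (rule cmod_sq_measurable[OF holomorphic_on_imp_continuous_on[OF fh]]) simp
    then have m1: "(\<lambda>p :: complex \<times> (real^'n). ennreal ((cmod (f (fst p)))\<^sup>2) * indicator (ball a r) (fst p)) \<in> borel_measurable borel"
      by (rule measurable_compose[rotated]) (intro continuous_imp_borel continuous_intros)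
    have "(\<lambda>p. (ennreal ((cmod (f (fst p)))\<^sup>2) * indicator (ball a r) (fst p)) * (expneg (\<phi> (fst p, cvec (snd p))) * indicator (D \<times> V) p)) \<in> borel_measurable borel"
      by (rule borel_measurable_times_ennreal[OF m1 psh_weight_measurable[OF psh V_dom(1) D_dom(1)]])
    also have "(\<lambda>p. (ennreal ((cmod (f (fst p)))\<^sup>2) * indicator (ball a r) (fst p)) * (expneg (\<phi> (fst p, cvec (snd p))) * indicator (D \<times> V) p)) = H"
    proof (rule ext)
      fix p :: "complex \<times> (real^'n)"
      show "(ennreal ((cmod (f (fst p)))\<^sup>2) * indicator (ball a r) (fst p)) * (expneg (\<phi> (fst p, cvec (snd p))) * indicator (D \<times> V) p) = H p"
      proof (cases "fst p \<in> ball a r")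
        case True
        then have "fst p \<in> D" using disc by blast
        then show ?thesis using True by (cases "snd p \<in> V") (simp_all add: H_def indicator_def mem_Times_iff)
      next
        case False
        then show ?thesis by (simp add: H_def indicator_def mem_Times_iff)
      qed
    qed
    finally show ?thesis .
  qed
  have Hm': "H \<in> borel_measurable (lborel \<Otimes>\<^sub>M lborel)" using Hm by (simp add: lborel_prod)
  have Hle: "H (a + r *\<^sub>R \<zeta>, x) \<le> liminf (\<lambda>n. h (rr n) (\<zeta>, x))" for \<zeta> x
  proof (cases "\<zeta> \<in> ball 0 1 \<and> x \<in> V")
    case True
    have "a + r *\<^sub>R \<zeta> \<in> ball a r" using True rpos by (simp add: dist_norm)
    then have "H (a + r *\<^sub>R \<zeta>, x) = ennreal ((cmod (G \<zeta>))\<^sup>2) * expneg (\<phi> (a + of_real r * \<zeta>, cvec x))"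
      using True rpos by (simp add: H_def f_def scaleR_conv_of_real)
    then show ?thesis using point True by simp
  next
    case False
    have "a + r *\<^sub>R \<zeta> \<notin> ball a r" if "\<zeta> \<notin> ball 0 1" using that rpos by (simp add: dist_norm)
    then have "H (a + r *\<^sub>R \<zeta>, x) = 0" using False by (auto simp: H_def indicator_def)
    then show ?thesis by simp
  qed
  have "(\<integral>\<^sup>+p. H p \<partial>(lborel \<Otimes>\<^sub>M lborel)) = (\<integral>\<^sup>+\<tau>. (\<integral>\<^sup>+x. H (\<tau>, x) \<partial>lborel) \<partial>lborel)"
    by (rule lborel.nn_integral_fst[OF Hm', symmetric])
  \<comment> \<open>The substitution \<tau> = a + r \<zeta> has Jacobian r^2 and completes the
    constant pi r^2.\<close>
  also have "\<dots> = ennreal (r ^ DIM(complex)) * (\<integral>\<^sup>+\<zeta>. (\<integral>\<^sup>+x. H (a + r *\<^sub>R \<zeta>, x) \<partial>lborel) \<partial>lborel)"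
    by (rule nn_integral_lborel_scale[OF _ rpos]) (use lborel.borel_measurable_nn_integral_fst[OF Hm'] in simp)
  also have "\<dots> \<le> ennreal (r ^ DIM(complex)) * (\<integral>\<^sup>+\<zeta>. (\<integral>\<^sup>+x. liminf (\<lambda>n. h (rr n) (\<zeta>, x)) \<partial>lborel) \<partial>lborel)"
    by (intro mult_left_mono nn_integral_mono Hle) simp
  also have "\<dots> \<le> ennreal (r ^ DIM(complex)) * ennreal (pi * I)" by (rule mult_left_mono[OF fatou]) simp
  also have "\<dots> = ennreal (pi * r\<^sup>2) * ennreal I" using I(2) rpos by (simp add: ennreal_mult[symmetric] mult_ac)
  finally have "(\<integral>\<^sup>+p. H p \<partial>(lborel \<Otimes>\<^sub>M lborel)) \<le> ennreal (pi * r\<^sup>2) * (\<integral>\<^sup>+ x. expneg (\<phi> (a, cvec x)) * indicator V x \<partial>lborel)"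
    unfolding I(1) .
  then show ?thesis using fh fa unfolding H_def by blast
qed

end
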